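(* Let $S\subset\mathbb{CP}_4$ be any Segre surface. Let $H\subset\mathbb{CP}_4$ be a hyperplane which does not pass through any singular point of $S$, belongs to the cuspidal locus in $S^*$, and is such that $H|_S$ has a single ordinary cusp as its only singularity (the cuspidal locus in $S^*$ is smooth and 2-dimensional at each such point $H$). Then the dual variety $S^*$ has ordinary cusps along the cuspidal locus at $H$; that is, along the smooth locus in the cuspidal locus formed by such hyperplanes, $S^*$ has ordinary cusps.
   Context: A Segre surface is a non-degenerate irreducible 2-dimensional subvariety $S\subset\mathbb{CP}_4$ of degree four which is neither a cone over a quartic curve in $\mathbb{CP}_3$ nor a projection of a quartic surface in $\mathbb{CP}_5$. (Every Segre surface is a complete intersection of two quadrics, its singularities are finitely many rational double points, and it contains only finitely many straight lines.) $S_{\rm reg}$ denotes the smooth locus. Tangent planes $T_pS$, $p\in S_{\rm reg}$, are regarded as projective 2-planes in $\mathbb{CP}_4$. The incidence variety $I(S)\subset\mathbb{CP}_4\times\mathbb{CP}_4^*$ is the closure of the set of pairs $(p,H)$ with $p\in S_{\rm reg}$ and $H$ a hyperplane containing $T_pS$; $\pi_1:I(S)\to S$ and $\pi_2:I(S)\to\mathbb{CP}_4^*$ are the projections, and the dual variety is $S^*=\pi_2(I(S))$. Let $S^*_{\rm cusp}\subset S^*$ be the image under $\pi_2$ of the closure in $I(S)$ of the set of $(p,H)\in I(S)$ such that $p\in S_{\rm reg}$ and the singularity of $H|_S$ at $p$ is not an ordinary node. The cuspidal locus in $S^*$ is the union of those irreducible components of $S^*_{\rm cusp}$ whose generic point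 corresponds to a hyperplane section having an ordinary cusp at a smooth point of $S$. "$S^*$ has ordinary cusps along a smooth surface $A\subset S^*$ at a point $H\in A$" means: there are local holomorphic coordinates $(z_1,z_2,z_3,z_4)$ on $\mathbb{CP}_4^*$ centered at $H$ such that near $H$ one has $A=\{z_1=z_2=0\}$ and $S^*=\{(z_1,z_2)\in\Gamma\}$, where $\Gamma\subset\mathbb C^2$ is a curve germ with an ordinary cusp ($A_2$-singularity, i.e. analytically equivalent to $y^2=x^3$) at the origin. *)

theory Defs
  imports "HOL-Analysis.Analysis" "HOL-Library.Poly_Mapping"
begin

section \<open>Complex projective space\<close>

definition proj_rel :: "complex ^ 'n::finite \<Rightarrow> complex ^ 'n \<Rightarrow> bool" where
  "proj_rel v w \<longleftrightarrow> v \<noteq> 0 \<and> (\<exists>c. c \<noteq> 0 \<and> w = c *s v)"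

lemma part_equivp_proj_rel: "part_equivp (proj_rel :: complex ^ 'n::finite \<Rightarrow> _)"
proof (rule part_equivpI)
  show "\<exists>x::complex ^ 'n. proj_rel x x"
    by (rule exI[of _ "1"]) (auto simp: proj_rel_def intro!: exI[of _ 1])
  show "symp (proj_rel :: complex ^ 'n \<Rightarrow> _)"
  proof (rule sympI)
    fix x y :: "complex ^ 'n"
    assume "proj_rel x y"
    then obtain c where c: "x \<noteq> 0" "c \<noteq> 0" "y = c *s x" by (auto simp: proj_rel_def)
    have 1: "y \<noteq> 0" unfolding c(3) using c(1,2) by (simp add: vector_mul_eq_0)
    have 2: "x = inverse c *s y" unfolding c(3) using c(2) by (simp add: vector_smult_assoc)
    have 3: "inverse c \<noteq> 0" using c(2) by simp
    show "proj_rel y x" unfolding proj_rel_def using 1 2 3 by blast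
  qed
  show "transp (proj_rel :: complex ^ 'n \<Rightarrow> _)"
  proof (rule transpI)
    fix x y z :: "complex ^ 'n"
    assume "proj_rel x y" "proj_rel y z"
    then obtain c d where cd: "x \<noteq> 0" "c \<noteq> 0" "y = c *s x" "d \<noteq> 0" "z = d *s y"
      unfolding proj_rel_def by blast
    have 1: "z = (d * c) *s x" unfolding cd(5) cd(3) by (simp add: vector_smult_assoc)
    have 2: "d * c \<noteq> 0" using cd by simp
    show "proj_rel x z" unfolding proj_rel_def using 1 2 cd(1) by blast
  qed
qed

text \<open>
  The projective space of dimension \<open>CARD('n) - 1\<close>; thus \<open>5 cproj\<close> is \<open>\<complex>\<pp>\<^sub>4\<close>. The class of
  \<open>0\<close> is a junk value of \<open>abs_cproj\<close>, whereas \<open>rep_cproj p\<close> is always a nonzero vector on the line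
  \<open>p\<close>. The notions below which mention \<open>rep_cproj\<close> do not depend on the chosen representative.
\<close>
quotient_type 'n cproj = "complex ^ ('n::finite)" / partial: proj_rel
  by (rule part_equivp_proj_rel)

text \<open>The quotient topology of the Euclidean topology.\<close>
instantiation cproj :: (finite) topological_space
begin

definition open_cproj :: "'a cproj set \<Rightarrow> bool" where
  "open_cproj U \<longleftrightarrow> open {v. v \<noteq> 0 \<and> abs_cproj v \<in> U}"

instance
proof
  have "{v::complex ^ 'a. v \<noteq> 0 \<and> abs_cproj v \<in> UNIV} = - {0}" by auto
  then show "open (UNIV :: 'a cproj set)"
    unfolding open_cproj_def by (simp add: open_Compl)
next
  fix A B :: "'a cproj set"
  assume "open A" "open B"
  moreover have "{v. v \<noteq> 0 \<and> abs_cproj v \<in> A \<inter> B} =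
      {v. v \<noteq> 0 \<and> abs_cproj v \<in> A} \<inter> {v. v \<noteq> 0 \<and> abs_cproj v \<in> B}" by auto
  ultimately show "open (A \<inter> B)" unfolding open_cproj_def by (simp add: open_Int)
next
  fix K :: "'a cproj set set"
  assume K: "\<forall>A\<in>K. open A"
  have "{v. v \<noteq> 0 \<and> abs_cproj v \<in> \<Union>K} = (\<Union>A\<in>K. {v. v \<noteq> 0 \<and> abs_cproj v \<in> A})" by auto
  then show "open (\<Union>K)" using K unfolding open_cproj_def by (simp add: open_UN)
qed

end

definition pairing :: "complex ^ 'n::finite \<Rightarrow> complex ^ 'n \<Rightarrow> complex" where
  "pairing h v = (\<Sum>i\<in>UNIV. h $ i * v $ i)"

text \<open>
  The dual projective space is given by dual homogeneous coordinates, so that a point \<open>H\<close> of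
  it is again of type \<open>'n cproj\<close>; the corresponding hyperplane is a set of points.
\<close>
definition hyperplane :: "'n::finite cproj \<Rightarrow> 'n cproj set" where
  "hyperplane H = {p. pairing (rep_cproj H) (rep_cproj p) = 0}"


section \<open>Projective varieties\<close>

type_synonym 'x cpoly = "('x \<Rightarrow>\<^sub>0 nat) \<Rightarrow>\<^sub>0 complex"

definition poly_eval :: "'x cpoly \<Rightarrow> ('x \<Rightarrow> complex) \<Rightarrow> complex" where
  "poly_eval F x = (\<Sum>m\<in>Poly_Mapping.keys F.
     Poly_Mapping.lookup F m * (\<Prod>i\<in>Poly_Mapping.keys m. x i ^ Poly_Mapping.lookup m i))"

definition homogeneous :: "'x cpoly \<Rightarrow> bool" where
  "homogeneous F \<longleftrightarrow> (\<exists>d. \<forall>m\<in>Poly_Mapping.keys F.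
     (\<Sum>i\<in>Poly_Mapping.keys m. Poly_Mapping.lookup m i) = d)"

definition zariski_closed :: "'n::finite cproj set \<Rightarrow> bool" where
  "zariski_closed X \<longleftrightarrow> (\<exists>\<F> :: 'n cpoly set. (\<forall>F\<in>\<F>. homogeneous F) \<and>
     X = {p. \<forall>F\<in>\<F>. poly_eval F (($) (rep_cproj p)) = 0})"

definition irreducible_variety :: "'n::finite cproj set \<Rightarrow> bool" where
  "irreducible_variety X \<longleftrightarrow> zariski_closed X \<and> X \<noteq> {} \<and>
     (\<forall>Y Z. zariski_closed Y \<and> zariski_closed Z \<and> X = Y \<union> Z \<longrightarrow> X = Y \<or> X = Z)"

definition irreducible_component :: "'n::finite cproj set \<Rightarrow> 'n cproj set \<Rightarrow> bool" where
  "irreducible_component Z X \<longleftrightarrow> irreducible_variety Z \<and> Z \<subseteq> X \<and>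
     (\<forall>Z'. irreducible_variety Z' \<and> Z \<subseteq> Z' \<and> Z' \<subseteq> X \<longrightarrow> Z' = Z)"

definition has_chain :: "'n::finite cproj set \<Rightarrow> nat \<Rightarrow> bool" where
  "has_chain X k \<longleftrightarrow> (\<exists>Z :: nat \<Rightarrow> 'n cproj set.
     (\<forall>i\<le>k. irreducible_variety (Z i) \<and> Z i \<subseteq> X) \<and> (\<forall>i<k. Z i \<subset> Z (Suc i)))"

definition has_dimension :: "'n::finite cproj set \<Rightarrow> nat \<Rightarrow> bool" where
  "has_dimension X k \<longleftrightarrow> has_chain X k \<and> \<not> has_chain X (Suc k)"

text \<open>
  A \<open>k\<close>-dimensional variety has degree \<open>d\<close> if it meets a general linear subspace of codimension
  \<open>k\<close> in exactly \<open>d\<close> points. The subspace is cut out by the linear forms \<open>A 0, \<dots>, A (k - 1)\<close>, and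
  ``general'' means that some nonzero polynomial in the coefficients of these forms does not vanish.
\<close>
definition has_degree :: "'n::finite cproj set \<Rightarrow> nat \<Rightarrow> nat \<Rightarrow> bool" where
  "has_degree X k d \<longleftrightarrow> (\<exists>F :: (nat \<times> 'n) cpoly. F \<noteq> 0 \<and>
     (\<forall>m\<in>Poly_Mapping.keys F. Poly_Mapping.keys m \<subseteq> {..<k} \<times> UNIV) \<and>
     (\<forall>A :: nat \<Rightarrow> complex ^ 'n. poly_eval F (\<lambda>(j, i). A j $ i) \<noteq> 0 \<longrightarrow>
        finite {p \<in> X. \<forall>j<k. pairing (A j) (rep_cproj p) = 0} \<and>
        card {p \<in> X. \<forall>j<k. pairing (A j) (rep_cproj p) = 0} = d))"

definition nondegenerate :: "'n::finite cproj set \<Rightarrow> bool" where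
  "nondegenerate X \<longleftrightarrow> (\<forall>H. \<not> X \<subseteq> hyperplane H)"

definition variety_of :: "nat \<Rightarrow> nat \<Rightarrow> 'n::finite cproj set \<Rightarrow> bool" where
  "variety_of k d X \<longleftrightarrow> irreducible_variety X \<and> has_dimension X k \<and> has_degree X k d"

text \<open>
  The cone in \<open>\<complex>\<pp>\<^sub>4\<close> over \<open>C \<subseteq> \<complex>\<pp>\<^sub>3\<close>: the space \<open>\<complex>\<pp>\<^sub>3\<close> is embedded as a hyperplane by the
  injective matrix \<open>M\<close>, and the vertex \<open>a\<close> lies outside of this hyperplane.
\<close>
definition is_cone_over :: "5 cproj set \<Rightarrow> 4 cproj set \<Rightarrow> bool" where
  "is_cone_over S C \<longleftrightarrow> (\<exists>(M :: complex ^ 4 ^ 5) (a :: complex ^ 5).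
     inj ((*v) M) \<and> a \<notin> range ((*v) M) \<and>
     S = {abs_cproj (M *v w + c *s a) | w c.
            (w = 0 \<or> abs_cproj w \<in> C) \<and> M *v w + c *s a \<noteq> 0})"

text \<open>
  The surjective matrix \<open>M\<close> induces the linear projection from the point \<open>ker M\<close>, which is not on \<open>Q\<close>.
\<close>
definition is_projection_of :: "5 cproj set \<Rightarrow> 6 cproj set \<Rightarrow> bool" where
  "is_projection_of S Q \<longleftrightarrow> (\<exists>M :: complex ^ 6 ^ 5. surj ((*v) M) \<and>
     (\<forall>q\<in>Q. M *v rep_cproj q \<noteq> 0) \<and> S = (\<lambda>q. abs_cproj (M *v rep_cproj q)) ` Q)"

text \<open>
  A quartic surface ``in \<open>\<complex>\<pp>\<^sub>5\<close>'' has to span \<open>\<complex>\<pp>\<^sub>5\<close>: every surface in \<open>\<complex>\<pp>\<^sub>4\<close> is a projection of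
  a copy of itself in a hyperplane of \<open>\<complex>\<pp>\<^sub>5\<close>.
\<close>
definition segre_surface :: "5 cproj set \<Rightarrow> bool" where
  "segre_surface S \<longleftrightarrow> variety_of 2 4 S \<and> nondegenerate S \<and>
     \<not> (\<exists>C :: 4 cproj set. variety_of 1 4 C \<and> is_cone_over S C) \<and>
     \<not> (\<exists>Q :: 6 cproj set. variety_of 2 4 Q \<and> nondegenerate Q \<and> is_projection_of S Q)"


section \<open>Smooth points, tangent planes and the dual variety\<close>

text \<open>
  The Zariski tangent space of the affine cone over \<open>X\<close>: the common kernel of the differentials of
  all homogeneous polynomials in the ideal of \<open>X\<close>.
\<close>
definition cone_tangent :: "'n::finite cproj set \<Rightarrow> 'n cproj \<Rightarrow> (complex ^ 'n) set" where
  "cone_tangent X p = {w. \<forall>F :: 'n cpoly. homogeneous F \<and>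
       (\<forall>q\<in>X. poly_eval F (($) (rep_cproj q)) = 0) \<longrightarrow>
       deriv (\<lambda>t. poly_eval F (($) (rep_cproj p + t *s w))) 0 = 0}"

definition tangent_plane :: "'n::finite cproj set \<Rightarrow> 'n cproj \<Rightarrow> 'n cproj set" where
  "tangent_plane X p = {q. rep_cproj q \<in> cone_tangent X p}"

text \<open>Jacobian criterion, for a surface \<open>S\<close>; the affine cone over it has dimension \<open>3\<close>.\<close>
definition smooth_locus :: "'n::finite cproj set \<Rightarrow> 'n cproj set" where
  "smooth_locus S = {p \<in> S. vec.dim (cone_tangent S p) = 3}"

text \<open>
  The sets whose (Euclidean) closures are taken here and in \<open>dual_cusp\<close> are constructible, so these
  are also the Zariski closures.
\<close>
definition incidence_variety :: "'n::finite cproj set \<Rightarrow> ('n cproj \<times> 'n cproj) set" where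
  "incidence_variety S =
     closure {(p, H). p \<in> smooth_locus S \<and> tangent_plane S p \<subseteq> hyperplane H}"

definition dual_variety :: "'n::finite cproj set \<Rightarrow> 'n cproj set" where
  "dual_variety S = snd ` incidence_variety S"


section \<open>Holomorphic maps and coordinates\<close>

definition cholomorphic_on :: "(complex ^ 'n::finite \<Rightarrow> complex ^ 'm::finite) \<Rightarrow> (complex ^ 'n) set \<Rightarrow> bool"
  where "cholomorphic_on f U \<longleftrightarrow> open U \<and>
    (\<forall>x\<in>U. \<exists>D. (f has_derivative D) (at x) \<and> (\<forall>c v. D (c *s v) = c *s D v))"

definition biholomorphic_between ::
    "(complex ^ 'n::finite) set \<Rightarrow> (complex ^ 'n) set \<Rightarrow> (complex ^ 'n \<Rightarrow> complex ^ 'n) \<Rightarrow> bool" where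
  "biholomorphic_between U V f \<longleftrightarrow> cholomorphic_on f U \<and> bij_betw f U V \<and>
     cholomorphic_on (inv_into U f) V"

text \<open>
  Local holomorphic coordinates \<open>z\<close> on an open set \<open>N\<close> of projective space, i.e. a biholomorphic map
  from \<open>N\<close> onto an open set. Functions on projective space are holomorphic if they are so on
  the affine cone, maps to projective space are holomorphic if they have local holomorphic lifts.
\<close>
definition holomorphic_coordinates ::
    "'n::finite cproj set \<Rightarrow> ('n cproj \<Rightarrow> complex ^ 'm::finite) \<Rightarrow> bool" where
  "holomorphic_coordinates N z \<longleftrightarrow> open N \<and> open (z ` N) \<and> inj_on z N \<and>
     cholomorphic_on (\<lambda>v. z (abs_cproj v)) {v. v \<noteq> 0 \<and> abs_cproj v \<in> N} \<and>
     (\<forall>p\<in>N. \<exists>W \<psi>. z p \<in> W \<and> W \<subseteq> z ` N \<and> cholomorphic_on \<psi> W \<and>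
        (\<forall>w\<in>W. \<psi> w \<noteq> 0 \<and> abs_cproj (\<psi> w) \<in> N \<and> z (abs_cproj (\<psi> w)) = w))"

text \<open>
  Local holomorphic coordinates on the surface \<open>S\<close> centered at \<open>p\<close>, given by the inverse map
  \<open>W \<rightarrow> S\<close> together with a holomorphic lift \<open>\<phi>\<close> of it. The dimension condition says that the map
  to projective space is an immersion.
\<close>
definition local_parametrization ::
    "'n::finite cproj set \<Rightarrow> 'n cproj \<Rightarrow> (complex ^ 2) set \<Rightarrow> (complex ^ 2 \<Rightarrow> complex ^ 'n) \<Rightarrow> bool" where
  "local_parametrization S p W \<phi> \<longleftrightarrow> 0 \<in> W \<and> cholomorphic_on \<phi> W \<and> (\<forall>w\<in>W. \<phi> w \<noteq> 0) \<and>
     abs_cproj (\<phi> 0) = p \<and>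
     (\<forall>w\<in>W. \<exists>D. (\<phi> has_derivative D) (at w) \<and> vec.dim (insert (\<phi> w) (range D)) = 3) \<and>
     openin (top_of_set S) ((\<lambda>w. abs_cproj (\<phi> w)) ` W) \<and>
     (\<exists>g. homeomorphism W ((\<lambda>w. abs_cproj (\<phi> w)) ` W) (\<lambda>w. abs_cproj (\<phi> w)) g)"


section \<open>Singularities of hyperplane sections and the cuspidal locus\<close>

text \<open>
  The divisor \<open>H|\<^sub>S\<close> has the local equation \<open>g = 0\<close> in suitable local holomorphic coordinates of \<open>S\<close>
  centered at \<open>p\<close>. A unit factor in front of \<open>g\<close> is not needed, as it can be absorbed into the lift.
\<close>
definition section_equation ::
    "'n::finite cproj set \<Rightarrow> 'n cproj \<Rightarrow> 'n cproj \<Rightarrow> (complex ^ 2 \<Rightarrow> complex) \<Rightarrow> bool" where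
  "section_equation S H p g \<longleftrightarrow> (\<exists>W \<phi>. local_parametrization S p W \<phi> \<and>
     (\<forall>w\<in>W. pairing (rep_cproj H) (\<phi> w) = g w))"

definition node_at :: "'n::finite cproj set \<Rightarrow> 'n cproj \<Rightarrow> 'n cproj \<Rightarrow> bool" where
  "node_at S H p \<longleftrightarrow> section_equation S H p (\<lambda>w. w $ 1 * w $ 2)"

definition cusp_at :: "'n::finite cproj set \<Rightarrow> 'n cproj \<Rightarrow> 'n cproj \<Rightarrow> bool" where
  "cusp_at S H p \<longleftrightarrow> section_equation S H p (\<lambda>w. (w $ 2)\<^sup>2 - (w $ 1) ^ 3)"

text \<open>The singular points of \<open>H|\<^sub>S\<close> at which \<open>S\<close> is smooth.\<close>
definition section_singularities :: "'n::finite cproj set \<Rightarrow> 'n cproj \<Rightarrow> 'n cproj set" where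
  "section_singularities S H =
     {p \<in> smooth_locus S \<inter> hyperplane H. tangent_plane S p \<subseteq> hyperplane H}"

definition dual_cusp :: "'n::finite cproj set \<Rightarrow> 'n cproj set" where
  "dual_cusp S = snd ` closure {(p, H) \<in> incidence_variety S. p \<in> smooth_locus S \<and> \<not> node_at S H p}"

text \<open>``Generic'' means outside of a proper Zariski closed subset \<open>Y\<close> of the component \<open>Z\<close>.\<close>
definition cuspidal_locus :: "'n::finite cproj set \<Rightarrow> 'n cproj set" where
  "cuspidal_locus S = \<Union>{Z. irreducible_component Z (dual_cusp S) \<and>
     (\<exists>Y. zariski_closed Y \<and> Y \<subset> Z \<and> (\<forall>H\<in>Z - Y. \<exists>p\<in>smooth_locus S. cusp_at S H p))}"

definition plane_curve_cusp :: "(complex ^ 2) set \<Rightarrow> bool" where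
  "plane_curve_cusp \<Gamma> \<longleftrightarrow> (\<exists>U V \<psi>. 0 \<in> U \<and> \<psi> 0 = 0 \<and> biholomorphic_between U V \<psi> \<and>
     \<psi> ` (\<Gamma> \<inter> U) = {w \<in> V. (w $ 2)\<^sup>2 = (w $ 1) ^ 3})"

text \<open>
  The hypersurface \<open>X\<close> has ordinary cusps along \<open>A\<close> at \<open>H\<close>. In particular \<open>A\<close> is smooth of dimension
  \<open>2\<close> near \<open>H\<close>.
\<close>
definition ordinary_cusps_along :: "5 cproj set \<Rightarrow> 5 cproj set \<Rightarrow> 5 cproj \<Rightarrow> bool" where
  "ordinary_cusps_along X A H \<longleftrightarrow> A \<subseteq> X \<and> (\<exists>N (z :: 5 cproj \<Rightarrow> complex ^ 4) \<Gamma>.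
     H \<in> N \<and> holomorphic_coordinates N z \<and> z H = 0 \<and>
     A \<inter> N = {K \<in> N. z K $ 1 = 0 \<and> z K $ 2 = 0} \<and>
     X \<inter> N = {K \<in> N. vector [z K $ 1, z K $ 2] \<in> \<Gamma>} \<and>
     plane_curve_cusp \<Gamma>)"

end

theory Submission
 imports Defs "HOL-Complex_Analysis.Complex_Analysis" "HOL-Computational_Algebra.Fundamental_Theorem_Algebra"
begin

text \<open>Near the cusp \<open>p\<close> the hyperplanes close to \<open>H\<close> restrict to the sections
\<open>k\<^sub>0 + k\<^sub>1 x + G(k\<^sub>2, d, x, y)\<close> in the coordinates \<open>(x, y)\<close> of a chart of \<open>S\<close>, where \<open>G\<close> has an
\<open>A\<^sub>2\<close> singularity: the constant and the linear terms make this an automatically versal unfolding of the cusp,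
so in suitable coordinates its discriminant is \<open>\<chi>\<^sub>1^2 = \<chi>\<^sub>2^3\<close> and the degenerate critical points lie over
\<open>\<chi>\<^sub>1 = \<chi>\<^sub>2 = 0\<close>. By compactness no other point of \<open>S\<close> contributes to the dual variety near \<open>H\<close>. That the whole
degeneracy locus near \<open>H\<close> belongs to the cuspidal locus follows by elimination: the hyperplanes over which every
limit of incidence points is a cusp in the chart contain the complement of a hypersurface that avoids \<open>H\<close>.\<close>

section \<open>Holomorphic maps of several variables\<close>

text \<open>The discriminant computation is local and analytic, while \<open>cuspidal_locus\<close>
  is defined by whole irreducible components and a Zariski generic point of each; joining the two
  shapes the development. The second and third order data of sections are therefore kept as
  polynomials \<open>N2\<close>, \<open>NH\<close>, \<open>NC\<close> in the point and the
  hyperplane: sufficient conditions for a node or a cusp become algebraic, closed conditions pass to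
  the Euclidean closures in the definitions, and elimination applies. This needs polynomials
  \<open>F\<close>, \<open>G\<close> which cut out the surface on a Zariski open part of a chart and
  not only as germs at the cusp; Krull's intersection theorem supplies the denominator
  \<open>u\<close> for that. Since \<open>dual_cusp\<close> is given as the image of a closure, a
  component through each of its points is found by bounding chains of irreducible varieties through
  the growth of Hilbert functions. Nodes and cusps are defined by parametrizations, so jets have to
  be turned into coordinate changes, and that a point is not both is a topological matter.\<close>

class cvec = euclidean_space +
 fixes cscale :: "complex => 'a => 'a" (infixr "*\<^sub>C" 75)
 assumes cscale_add_right: "c *\<^sub>C (x + y) = c *\<^sub>C x + c *\<^sub>C y"
  and cscale_add_left: "(c + d) *\<^sub>C x = c *\<^sub>C x + d *\<^sub>C x"
  and cscale_assoc: "c *\<^sub>C (d *\<^sub>C x) = (c * d) *\<^sub>C x"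
  and cscale_of_real: "complex_of_real r *\<^sub>C x = r *\<^sub>R x"

instantiation complex :: cvec
begin
definition cscale_complex :: "complex => complex => complex" where "cscale_complex c x = c * x"
instance by standard (auto simp: cscale_complex_def algebra_simps scaleR_conv_of_real)
end

instantiation prod :: (cvec, cvec) cvec
begin
definition cscale_prod :: "complex => 'a * 'b => 'a * 'b" where
 "cscale_prod c x = (c *\<^sub>C fst x, c *\<^sub>C snd x)"
instance
 by standard
  (auto simp: cscale_prod_def cscale_add_right cscale_add_left cscale_assoc cscale_of_real scaleR_prod_def)
end

instantiation vec :: (cvec, finite) cvec
begin
definition cscale_vec :: "complex => 'a ^ 'b => 'a ^ 'b" where
 "cscale_vec c x = (\<chi> i. c *\<^sub>C x $ i)"
instance
 by standard
  (auto simp: cscale_vec_def vec_eq_iff cscale_add_right cscale_add_left cscale_assoc cscale_of_real)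
end

lemma cscale_complex [simp]: "c *\<^sub>C (x::complex) = c * x"
 by (simp add: cscale_complex_def)

lemma cscale_Pair [simp]: "c *\<^sub>C (x, y) = (c *\<^sub>C x, c *\<^sub>C y)"
 by (simp add: cscale_prod_def)

lemma fst_cscale [simp]: "fst (c *\<^sub>C x) = c *\<^sub>C fst x"
 by (simp add: cscale_prod_def)

lemma snd_cscale [simp]: "snd (c *\<^sub>C x) = c *\<^sub>C snd x"
 by (simp add: cscale_prod_def)

lemma cscale_vec_nth [simp]: "(c *\<^sub>C x) $ i = c *\<^sub>C (x $ i)"
 by (simp add: cscale_vec_def)

lemma cscale_eq_smult: "c *\<^sub>C (x :: complex ^ 'n::finite) = c *s x"
 by (simp add: vec_eq_iff)

lemma cscale_one [simp]: "1 *\<^sub>C x = (x::'a::cvec)"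
 using cscale_of_real[of 1 x] by simp

lemma bounded_bilinear_cscale: "bounded_bilinear ((*\<^sub>C) :: complex => 'a::cvec => 'a)"
proof -
 have "bilinear ((*\<^sub>C) :: complex => 'a => 'a)"
  unfolding bilinear_def
 proof (intro conjI allI)
  fix c :: complex
  show "linear ((*\<^sub>C) c :: 'a => 'a)"
   by (rule linearI)
    (auto simp: cscale_add_right cscale_of_real[symmetric] cscale_assoc mult.commute)
 next
  fix y :: 'a
  show "linear (%c. c *\<^sub>C y)"
   by (rule linearI)
    (auto simp: cscale_add_left cscale_of_real[symmetric] cscale_assoc scaleR_conv_of_real)
 qed
 then show ?thesis by (simp add: bilinear_conv_bounded_bilinear)
qed

interpretation cscale: bounded_bilinear "(*\<^sub>C) :: complex => 'a::cvec => 'a"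
 by (rule bounded_bilinear_cscale)

declare cscale.zero_right [simp] cscale.zero_left [simp]

definition clin :: "('a::cvec => 'b::cvec) => bool" where
 "clin D \<longleftrightarrow> (ALL c v. D (c *\<^sub>C v) = c *\<^sub>C D v)"

definition cdiff :: "('a::cvec => 'b::cvec) => 'a => bool" where
 "cdiff f x \<longleftrightarrow> (EX D. (f has_derivative D) (at x) & clin D)"

text \<open>Germs: \<open>f\<close> is holomorphic in some neighbourhood of \<open>x\<close>.\<close>
definition hol_at :: "('a::cvec => 'b::cvec) => 'a => bool" where
 "hol_at f x \<longleftrightarrow> eventually (cdiff f) (nhds x)"

abbreviation fd :: "('a::cvec => 'b::cvec) => 'a => 'a => 'b" where
 "fd f x \<equiv> frechet_derivative f (at x)"

lemma cdiff_has_derivative: "cdiff f x ==> (f has_derivative fd f x) (at x)"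
 unfolding cdiff_def by (auto simp: frechet_derivative_at[symmetric])

lemma cdiff_clin: "cdiff f x ==> clin (fd f x)"
 unfolding cdiff_def by (auto simp: frechet_derivative_at[symmetric])

lemma cdiffI: "(f has_derivative D) (at x) ==> clin D ==> cdiff f x"
 unfolding cdiff_def by blast

lemma fd_eq: "(f has_derivative D) (at x) ==> fd f x v = D v"
 by (simp add: frechet_derivative_at[symmetric])

lemma fd_clin: "cdiff f x ==> fd f x (c *\<^sub>C v) = c *\<^sub>C fd f x v"
 using cdiff_clin unfolding clin_def by blast

lemma fd_linear: "cdiff f x ==> linear (fd f x)"
 using cdiff_has_derivative has_derivative_linear by blast

lemma fd_add: "cdiff f x ==> fd f x (u + v) = fd f x u + fd f x v"
 using fd_linear linear_add by blast

lemma fd_pair: assumes "cdiff f x"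
 shows "fd f x (u, v) = fd f x (u, 0) + fd f x (0, v)"
 using fd_add[OF assms, of "(u,0)" "(0,v)"] by simp

lemma cdiff_continuous: "cdiff f x ==> isCont f x"
 using cdiff_has_derivative has_derivative_continuous by blast

lemmas near_imp = eventually_nhds_x_imp_x

abbreviation near :: "'a::topological_space => ('a => bool) => bool" where "near x P == eventually P (nhds x)"

lemma hol_at_cdiff: "hol_at f x ==> cdiff f x"
 unfolding hol_at_def by (rule near_imp)

lemma hol_at_isCont: "hol_at f x ==> isCont f x"
 by (simp add: hol_at_cdiff cdiff_continuous)

lemma hol_at_eventually: "hol_at f x ==> near x (hol_at f)"
 unfolding hol_at_def by (simp add: eventually_eventually)

lemma open_hol_at: "open {x. hol_at f x}"
proof (subst open_subopen, intro ballI)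
 fix x assume "x : {x. hol_at f x}"
 then have "near x (hol_at f)" using hol_at_eventually by auto
 then show "EX T. open T & x : T & T <= {x. hol_at f x}"
  unfolding eventually_nhds by auto
qed

lemma hol_at_open: "open U ==> (!!x. x : U ==> cdiff f x) ==> x : U ==> hol_at f x"
 unfolding hol_at_def eventually_nhds by blast

lemma eventually_isCont:
 assumes "isCont f x" "near (f x) P"
 shows "near x (%y. P (f y))"
proof -
 have "filterlim f (nhds (f x)) (nhds x)"
  using assms(1) by (simp add: isCont_def tendsto_at_iff_tendsto_nhds)
 then show ?thesis using assms(2) by (rule eventually_compose_filterlim[rotated])
qed

lemma eventually_fst:
 fixes x :: "'a::t2_space" and y :: "'b::t2_space"
 assumes "near x P" shows "near (x, y) (%p. P (fst p))"
 using eventually_isCont[OF continuous_fst[OF continuous_ident, of "(x, y)"], of P] assms by simp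

lemma eventually_snd:
 fixes x :: "'a::t2_space" and y :: "'b::t2_space"
 assumes "near y P" shows "near (x, y) (%p. P (snd p))"
 using eventually_isCont[OF continuous_snd[OF continuous_ident, of "(x, y)"], of P] assms by simp

lemma cdiff_transform:
 assumes "cdiff f x" "near x (%y. f y = g y)"
 shows "cdiff g x" "fd g x = fd f x"
proof -
 obtain D where D: "(f has_derivative D) (at x)" "clin D" using assms(1) unfolding cdiff_def by blast
 have "(g has_derivative D) (at x)"
  by (rule has_derivative_transform_eventually[OF D(1)])
   (use assms(2) in "auto simp: eventually_at_filter dest: near_imp elim: eventually_mono")
 then show "cdiff g x" "fd g x = fd f x" using D
  by (auto simp: cdiff_def frechet_derivative_at[symmetric])
qed

lemma hol_at_transform:
 assumes "hol_at f x" "near x (%y. f y = g y)"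
 shows "hol_at g x"
proof -
 have "near x (%y. near y (%y. f y = g y))"
  using assms(2) by (simp add: eventually_eventually)
 with assms(1) show ?thesis unfolding hol_at_def
  by eventually_elim (rule cdiff_transform)
qed

named_theorems hols

lemma cdiff_const [hols]: "cdiff (%_. c) x"
 by (rule cdiffI[of _ "%_. 0"]) (auto simp: clin_def)

lemma cdiff_ident [hols]: "cdiff (%x. x) x"
 by (rule cdiffI[of _ "%v. v"]) (auto simp: clin_def)

lemma cdiff_compose:
 assumes "cdiff g (f x)" "cdiff f x"
 shows "cdiff (%x. g (f x)) x" "fd (%x. g (f x)) x v = fd g (f x) (fd f x v)"
proof -
 have *: "((%x. g (f x)) has_derivative (%v. fd g (f x) (fd f x v))) (at x)"
  using has_derivative_compose[OF cdiff_has_derivative[OF assms(2)] cdiff_has_derivative[OF assms(1)]] .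
 then show "cdiff (%x. g (f x)) x"
  by (rule cdiffI) (use assms in "simp add: clin_def fd_clin")
 show "fd (%x. g (f x)) x v = fd g (f x) (fd f x v)" by (rule fd_eq[OF *])
qed

lemma cdiff_bounded_linear:
 assumes "bounded_linear L" "clin L"
 shows "cdiff L x" "fd L x v = L v"
 using bounded_linear_imp_has_derivative[OF assms(1)] assms(2) cdiffI fd_eq by blast+

lemma clin_fst: "clin fst" and clin_snd: "clin snd" and clin_nth: "clin (%v. v $ i)"
 by (auto simp: clin_def)

lemma cdiff_linear_compose:
 assumes "bounded_linear L" "clin L" "cdiff f x"
 shows "cdiff (%x. L (f x)) x" "fd (%x. L (f x)) x v = L (fd f x v)"
 using cdiff_compose[of L f x] assms(3) cdiff_bounded_linear[OF assms(1,2)] by auto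

lemmas cdiff_fst [hols] = cdiff_linear_compose(1)[OF bounded_linear_fst clin_fst]
lemmas cdiff_snd [hols] = cdiff_linear_compose(1)[OF bounded_linear_snd clin_snd]
lemmas cdiff_nth [hols] = cdiff_linear_compose(1)[OF bounded_linear_vec_nth clin_nth]
lemmas fd_fst = cdiff_linear_compose(2)[OF bounded_linear_fst clin_fst]
lemmas fd_snd = cdiff_linear_compose(2)[OF bounded_linear_snd clin_snd]
lemmas fd_nth = cdiff_linear_compose(2)[OF bounded_linear_vec_nth clin_nth]

lemma cdiff_Pair:
 assumes "cdiff f x" "cdiff g x"
 shows "cdiff (%x. (f x, g x)) x" "fd (%x. (f x, g x)) x v = (fd f x v, fd g x v)"
proof -
 have *: "((%x. (f x, g x)) has_derivative (%v. (fd f x v, fd g x v))) (at x)"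
  using assms[THEN cdiff_has_derivative] by (rule has_derivative_Pair)
 then show "cdiff (%x. (f x, g x)) x"
  by (rule cdiffI) (use assms in "simp add: clin_def fd_clin")
 show "fd (%x. (f x, g x)) x v = (fd f x v, fd g x v)" by (rule fd_eq[OF *])
qed
lemmas cdiff_Pair(1) [hols]

lemma has_derivative_vec_lambda':
 fixes f :: "'i::finite => 'a::euclidean_space => 'b::euclidean_space"
 assumes "!!i. (f i has_derivative f' i) (at x)"
 shows "((%x. \<chi> i. f i x) has_derivative (%v. \<chi> i. f' i v)) (at x)"
 by (subst has_derivative_componentwise_within)
  (use assms in "auto simp: Basis_vec_def inner_axis intro!: has_derivative_inner_left")

lemma cdiff_vec_lambda:
 fixes f :: "'i::finite => 'a::cvec => 'b::cvec"
 assumes "!!i. cdiff (f i) x"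
 shows "cdiff (%x. \<chi> i. f i x) x" "fd (%x. \<chi> i. f i x) x v = (\<chi> i. fd (f i) x v)"
proof -
 have *: "((%x. \<chi> i. f i x) has_derivative (%v. \<chi> i. fd (f i) x v)) (at x)"
  by (rule has_derivative_vec_lambda') (use assms cdiff_has_derivative in blast)
 then show "cdiff (%x. \<chi> i. f i x) x"
  by (rule cdiffI) (use assms in "simp add: clin_def fd_clin vec_eq_iff")
 show "fd (%x. \<chi> i. f i x) x v = (\<chi> i. fd (f i) x v)" by (rule fd_eq[OF *])
qed
lemmas cdiff_vec_lambda(1) [hols]

lemma cdiff_add:
 assumes "cdiff f x" "cdiff g x"
 shows "cdiff (%x. f x + g x) x" "fd (%x. f x + g x) x v = fd f x v + fd g x v"
proof -
 have *: "((%x. f x + g x) has_derivative (%v. fd f x v + fd g x v)) (at x)"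
  using assms[THEN cdiff_has_derivative] by (rule has_derivative_add)
 then show "cdiff (%x. f x + g x) x"
  by (rule cdiffI) (use assms in "simp add: clin_def fd_clin cscale_add_right")
 show "fd (%x. f x + g x) x v = fd f x v + fd g x v" by (rule fd_eq[OF *])
qed
lemmas cdiff_add(1) [hols]

lemma cdiff_diff:
 assumes "cdiff f x" "cdiff g x"
 shows "cdiff (%x. f x - g x) x" "fd (%x. f x - g x) x v = fd f x v - fd g x v"
proof -
 have *: "((%x. f x - g x) has_derivative (%v. fd f x v - fd g x v)) (at x)"
  using assms[THEN cdiff_has_derivative] by (rule has_derivative_diff)
 then show "cdiff (%x. f x - g x) x"
  by (rule cdiffI) (use assms in "simp add: clin_def fd_clin cscale.diff_right")
 show "fd (%x. f x - g x) x v = fd f x v - fd g x v" by (rule fd_eq[OF *])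
qed
lemmas cdiff_diff(1) [hols]

lemma cdiff_uminus:
 assumes "cdiff f x"
 shows "cdiff (%x. - f x) x" "fd (%x. - f x) x v = - fd f x v"
proof -
 have *: "((%x. - f x) has_derivative (%v. - fd f x v)) (at x)"
  using assms[THEN cdiff_has_derivative] by (rule has_derivative_minus)
 then show "cdiff (%x. - f x) x"
  by (rule cdiffI) (use assms in "simp add: clin_def fd_clin cscale.minus_right")
 show "fd (%x. - f x) x v = - fd f x v" by (rule fd_eq[OF *])
qed
lemmas cdiff_uminus(1) [hols]

lemma cdiff_cscale:
 fixes f :: "'a::cvec => complex" and g :: "'a => 'b::cvec"
 assumes "cdiff f x" "cdiff g x"
 shows "cdiff (%x. f x *\<^sub>C g x) x"
  "fd (%x. f x *\<^sub>C g x) x v = f x *\<^sub>C fd g x v + fd f x v *\<^sub>C g x"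
proof -
 have *: "((%x. f x *\<^sub>C g x) has_derivative (%v. f x *\<^sub>C fd g x v + fd f x v *\<^sub>C g x)) (at x)"
  using assms[THEN cdiff_has_derivative] by (rule cscale.FDERIV)
 then show "cdiff (%x. f x *\<^sub>C g x) x"
  by (rule cdiffI) (use assms in "simp add: clin_def fd_clin cscale_assoc cscale_add_right mult.commute")
 show "fd (%x. f x *\<^sub>C g x) x v = f x *\<^sub>C fd g x v + fd f x v *\<^sub>C g x" by (rule fd_eq[OF *])
qed
lemmas cdiff_cscale(1) [hols]

lemma cdiff_mult:
 fixes f :: "'a::cvec => complex"
 assumes "cdiff f x" "cdiff g x"
 shows "cdiff (%x. f x * g x) x"
  "fd (%x. f x * g x) x v = f x * fd g x v + fd f x v * g x"
 using cdiff_cscale[OF assms] by auto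
lemmas cdiff_mult(1) [hols]

lemma fd_complex:
 fixes f :: "complex => complex"
 assumes "cdiff f z"
 shows "(f has_field_derivative fd f z 1) (at z)"
 unfolding has_field_derivative_def
proof (rule has_derivative_eq_rhs[OF cdiff_has_derivative[OF assms]], rule ext)
 show "fd f z v = fd f z 1 * v" for v using fd_clin[OF assms, of v 1] by (simp add: mult.commute)
qed

lemma cdiff_complex_iff:
 fixes f :: "complex => complex"
 shows "cdiff f z \<longleftrightarrow> f field_differentiable (at z)"
proof
 assume "cdiff f z"
 then show "f field_differentiable (at z)" unfolding field_differentiable_def using fd_complex by blast
next
 assume "f field_differentiable (at z)"
 then obtain d where "(f has_field_derivative d) (at z)" unfolding field_differentiable_def by blast
 then have "(f has_derivative (*) d) (at z)" unfolding has_field_derivative_def by simp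
 then show "cdiff f z" by (rule cdiffI) (auto simp: clin_def)
qed

lemma cdiff_field:
 fixes g :: "complex => complex"
 assumes "(g has_field_derivative d) (at (f x))" "cdiff f x"
 shows "cdiff (%x. g (f x)) x" "fd (%x. g (f x)) x v = d * fd f x v"
proof -
 have *: "(g has_derivative (*) d) (at (f x))" using assms(1) by (simp add: has_field_derivative_def)
 then have "cdiff g (f x)" by (rule cdiffI) (auto simp: clin_def mult.left_commute)
 note g = this
 show "cdiff (%x. g (f x)) x" by (rule cdiff_compose(1)[OF g assms(2)])
 show "fd (%x. g (f x)) x v = d * fd f x v"
  unfolding cdiff_compose(2)[OF g assms(2)] by (rule fd_eq[OF *])
qed

lemma cdiff_inverse [hols]:
 "cdiff f x ==> f x ~= 0 ==> cdiff (%x. inverse (f x) :: complex) x"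
 by (rule cdiff_field[OF DERIV_inverse]) auto

lemma cdiff_divide [hols]:
 "cdiff f x ==> cdiff g x ==> g x ~= 0 ==> cdiff (%x. f x / g x :: complex) x"
 unfolding divide_inverse by (intro hols)

lemma cdiff_power [hols]: "cdiff f x ==> cdiff (%x. f x ^ n :: complex) x"
 by (induction n) (auto intro: hols)

lemma cdiff_sum [hols]:
 "(!!i. i : I ==> cdiff (f i) x) ==> cdiff (%x. \<Sum>i\<in>I. f i x) x"
 by (induction I rule: infinite_finite_induct) (auto intro: hols)

lemma hol_at_const [hols]: "hol_at (%_. c) x"
 unfolding hol_at_def by (rule always_eventually) (simp add: cdiff_const)

lemma hol_at_ident [hols]: "hol_at (%x. x) x"
 unfolding hol_at_def by (rule always_eventually) (simp add: cdiff_ident)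

lemma hol_at_compose:
 assumes "hol_at g (f x)" "hol_at f x"
 shows "hol_at (%x. g (f x)) x"
proof -
 have "near x (%y. cdiff g (f y))"
  using eventually_isCont[OF hol_at_isCont[OF assms(2)]] assms(1) unfolding hol_at_def by blast
 with assms(2) show ?thesis unfolding hol_at_def
  by eventually_elim (rule cdiff_compose)
qed

lemma hol_at_linear_compose:
 "bounded_linear L ==> clin L ==> hol_at f x ==> hol_at (%x. L (f x)) x"
 unfolding hol_at_def by (erule eventually_mono) (rule cdiff_linear_compose)
lemmas hol_at_fst [hols] = hol_at_linear_compose[OF bounded_linear_fst clin_fst]
lemmas hol_at_snd [hols] = hol_at_linear_compose[OF bounded_linear_snd clin_snd]
lemmas hol_at_nth [hols] = hol_at_linear_compose[OF bounded_linear_vec_nth clin_nth]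

lemma hol_at_Pair [hols]: "hol_at f x ==> hol_at g x ==> hol_at (%x. (f x, g x)) x"
 unfolding hol_at_def by (erule (1) eventually_elim2) (auto intro: hols)
lemma hol_at_add [hols]: "hol_at f x ==> hol_at g x ==> hol_at (%x. f x + g x) x"
 unfolding hol_at_def by (erule (1) eventually_elim2) (auto intro: hols)
lemma hol_at_diff [hols]: "hol_at f x ==> hol_at g x ==> hol_at (%x. f x - g x) x"
 unfolding hol_at_def by (erule (1) eventually_elim2) (auto intro: hols)
lemma hol_at_uminus [hols]: "hol_at f x ==> hol_at (%x. - f x) x"
 unfolding hol_at_def by (erule eventually_mono) (auto intro: hols)
lemma hol_at_cscale [hols]: "hol_at f x ==> hol_at g x ==> hol_at (%x. f x *\<^sub>C g x) x"
 unfolding hol_at_def by (erule (1) eventually_elim2) (auto intro: hols)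
lemma hol_at_mult [hols]: "hol_at f x ==> hol_at g x ==> hol_at (%x. f x * g x :: complex) x"
 unfolding hol_at_def by (erule (1) eventually_elim2) (auto intro: hols)
lemma hol_at_power [hols]: "hol_at f x ==> hol_at (%x. f x ^ n :: complex) x"
 unfolding hol_at_def by (erule eventually_mono) (auto intro: hols)
lemma hol_at_vec_lambda [hols]:
 fixes f :: "'i::finite => 'a::cvec => 'b::cvec"
 assumes "!!i. hol_at (f i) x" shows "hol_at (%x. \<chi> i. f i x) x"
proof -
 have "near x (%y. ALL i:UNIV. cdiff (f i) y)"
  using assms unfolding hol_at_def by (intro eventually_ball_finite) auto
 then show ?thesis unfolding hol_at_def by (rule eventually_mono) (auto intro: hols)
qed

lemma hol_at_nonzero:
 "hol_at f x ==> f x ~= 0 ==> near x (%x. f x ~= (0::complex))"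
 using eventually_isCont[OF hol_at_isCont, of f x "%y. y ~= 0"]
 by (simp add: t1_space_nhds)

lemma hol_at_divide [hols]:
 assumes "hol_at f x" "hol_at g x" "g x ~= 0"
 shows "hol_at (%x. f x / g x :: complex) x"
 using assms(1) assms(2) hol_at_nonzero[OF assms(2,3)] unfolding hol_at_def
 by eventually_elim (rule cdiff_divide)

lemma hol_at_analytic:
 assumes "g analytic_on {f x}" "hol_at f x"
 shows "hol_at (%x. g (f x) :: complex) x"
proof (rule hol_at_compose[OF _ assms(2)])
 obtain S where "open S" "f x : S" "g holomorphic_on S"
  using assms(1) analytic_at by metis
 then show "hol_at g (f x)"
  by (intro hol_at_open[of S]) (auto simp: cdiff_complex_iff holomorphic_on_imp_differentiable_at)
qed

lemma cscale_complex_decomp: "c *\<^sub>C v = Re c *\<^sub>R v + Im c *\<^sub>R (\<i> *\<^sub>C v)"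
proof -
 have "c = complex_of_real (Re c) + complex_of_real (Im c) * \<i>" by (simp add: complex_eq mult.commute)
 then have "c *\<^sub>C v = complex_of_real (Re c) *\<^sub>C v + complex_of_real (Im c) *\<^sub>C (\<i> *\<^sub>C v)"
  by (metis cscale_add_left cscale_assoc)
 then show ?thesis by (simp add: cscale_of_real)
qed

lemma clinI:
 assumes "linear D" "!!v. D (\<i> *\<^sub>C v) = \<i> *\<^sub>C D v"
 shows "clin D"
 unfolding clin_def
proof (intro allI)
 fix c v
 have "D (c *\<^sub>C v) = D (Re c *\<^sub>R v + Im c *\<^sub>R (\<i> *\<^sub>C v))" by (metis cscale_complex_decomp)
 also have "\<dots> = Re c *\<^sub>R D v + Im c *\<^sub>R (\<i> *\<^sub>C D v)"
  using assms by (simp add: linear_add linear_scale)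
 also have "\<dots> = c *\<^sub>C D v" by (metis cscale_complex_decomp)
 finally show "D (c *\<^sub>C v) = c *\<^sub>C D v" .
qed

section \<open>Cauchy integrals and the holomorphy of derivatives\<close>

lemma circle_continuous: "continuous_on A (circlepath z r)"
 unfolding circlepath_def part_circlepath_def linepath_def by (intro continuous_intros)

text \<open>Density of dz / (2 \<pi> \<i> z^k) along the circle of radius \<open>r\<close>, so that
  Cauchy's formulas become plain integrals over \<open>{0..1}\<close>. The value
  \<open>k = 2\<close> gives the derivative at the centre, and \<open>k = 0\<close> leaves the
  kernel to the integrand.\<close>

definition circ_weight :: "nat => real => real => complex" where
 "circ_weight k r ta = r * exp (2 * of_real pi * \<i> * ta) / circlepath 0 r ta ^ k"

lemma circ_nonzero: "r > 0 ==> circlepath 0 r ta ~= 0"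
 by (simp add: circlepath)

lemma circ_norm: "r > 0 ==> norm (circlepath 0 r ta) = r"
 by (simp add: circlepath norm_mult)

lemma circ_weight_continuous: "r > 0 ==> continuous_on A (circ_weight k r)"
 unfolding circ_weight_def
 by (intro continuous_intros circle_continuous) (auto simp: circ_nonzero)

text \<open>Cauchy's formula for the function \<open>s \<mapsto> f (y + s *\<^sub>C v)\<close> of
  one variable. The radius is uniform in \<open>y\<close> near \<open>x\<close>, which makes the
  right-hand side usable as a function of \<open>y\<close>.\<close>

lemma cauchy_fd:
 fixes f :: "'a::cvec => complex"
 assumes "hol_at f x"
 obtains r e where "r > 0" "e > 0"
  "!!y ta. y : ball x e ==> hol_at f (y + circlepath 0 r ta *\<^sub>C v)"
  "!!y. y : ball x e ==>
    fd f y v = integral {0..1} (%ta. f (y + circlepath 0 r ta *\<^sub>C v) * circ_weight 2 r ta)"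
proof -
 obtain R where R: "R > 0" "!!y. dist y x < R ==> hol_at f y"
  using hol_at_eventually[OF assms] unfolding eventually_nhds_metric by blast
 obtain K where K: "K > 0" "!!(c::complex) (u::'a). norm (c *\<^sub>C u) <= norm c * norm u * K"
  using cscale.pos_bounded by blast
 \<comment> \<open>For \<open>norm s <= r\<close> the displacement \<open>s *\<^sub>C v\<close> has
   norm at most \<open>r * norm v * K < R / 2\<close>; the summand 1 covers
   \<open>v = 0\<close>.\<close>
 define r where "r = R / (2 * (norm v * K + 1))"
 have pos: "norm v * K + 1 > 0" using K by (simp add: add_nonneg_pos)
 then have r: "r > 0" using R by (simp add: r_def)
 have "r * (norm v * K) < R / 2"
  using pos R(1) K(1) by (simp add: r_def field_simps)
 then have small: "norm (s *\<^sub>C v) < R / 2" if "norm s <= r" for s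
 proof -
  have "norm s * norm v * K <= r * (norm v * K)"
   using that K(1) by (simp add: mult.assoc mult_right_mono)
  then show ?thesis using K(2)[of s v] \<open>r * (norm v * K) < R / 2\<close> by linarith
 qed
 have near: "hol_at f (y + s *\<^sub>C v)" if "y : ball x (R/2)" "norm s <= r" for y s
 proof (rule R(2))
  have "dist (y + s *\<^sub>C v) x <= dist (y + s *\<^sub>C v) y + dist y x" by (rule dist_triangle)
  also have "dist (y + s *\<^sub>C v) y = norm (s *\<^sub>C v)" by (simp add: dist_norm)
  finally show "dist (y + s *\<^sub>C v) x < R" using small[OF that(2)] that(1) by (simp add: dist_commute)
 qed
 show ?thesis
 proof
  show "r > 0" "R/2 > 0" using r R by auto
  show "hol_at f (y + circlepath 0 r ta *\<^sub>C v)" if "y : ball x (R/2)" for y ta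
   using near[OF that] circ_norm[OF r] by simp
  fix y assume y: "y : ball x (R/2)"
  define h where "h = (%s. f (y + s *\<^sub>C v))"
  have h: "cdiff h s" "fd h s c = fd f (y + s *\<^sub>C v) (c *\<^sub>C v)" if "norm s <= r" for s c
  proof -
   have 1: "cdiff (%s. y + s *\<^sub>C v) s" by (intro hols)
   have 2: "fd (%s. y + s *\<^sub>C v) s c = c *\<^sub>C v"
    by (rule fd_eq) (auto intro!: derivative_eq_intros cscale.FDERIV)
   show "cdiff h s" "fd h s c = fd f (y + s *\<^sub>C v) (c *\<^sub>C v)"
    unfolding h_def using cdiff_compose[OF hol_at_cdiff[OF near[OF y that]] 1] by (auto simp: 2)
  qed
  have hol: "h holomorphic_on cball 0 r"
   unfolding holomorphic_on_def
   using h(1) by (auto simp: cdiff_complex_iff intro: field_differentiable_at_within)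
  have "(h has_field_derivative (1 / (2 * of_real pi * \<i>) *
    contour_integral (circlepath 0 r) (%u. h u / (u - 0)^2))) (at 0)"
   by (rule Cauchy_derivative_integral_circlepath(2))
    (use hol r in "auto intro: holomorphic_on_imp_continuous_on holomorphic_on_subset")
  moreover have "(h has_field_derivative fd h 0 1) (at 0)"
   by (rule fd_complex) (use h r in auto)
  ultimately have "fd h 0 1 = 1 / (2 * of_real pi * \<i>) *
    contour_integral (circlepath 0 r) (%u. h u / (u - 0)^2)"
   using DERIV_unique by blast
  also have "\<dots> = integral {0..1} (%ta. h (circlepath 0 r ta) * circ_weight 2 r ta)"
   unfolding contour_integral_integral integral_mult_right[symmetric]
   by (rule integral_cong) (simp add: circ_weight_def vector_derivative_circlepath field_simps)
  finally show "fd f y v = integral {0..1} (%ta. f (y + circlepath 0 r ta *\<^sub>C v) * circ_weight 2 r ta)"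
   using h(2)[of 0 1] r by (simp add: h_def)
 qed
qed

text \<open>\<open>hol_at\<close> only asks for differentiability on a neighbourhood. Continuity of
  the derivative comes from Cauchy's formula, whose integrand depends continuously on
  \<open>y\<close>.\<close>

lemma fd_isCont_complex:
 fixes f :: "'a::cvec => complex"
 assumes "hol_at f x"
 shows "isCont (%y. fd f y v) x"
proof -
 obtain r e where re: "r > 0" "e > 0"
  "!!y ta. y : ball x e ==> hol_at f (y + circlepath 0 r ta *\<^sub>C v)"
  "!!y. y : ball x e ==>
    fd f y v = integral {0..1} (%ta. f (y + circlepath 0 r ta *\<^sub>C v) * circ_weight 2 r ta)"
  by (rule cauchy_fd[OF assms, where v = v]) blast
 have c: "continuous_on {x. hol_at f x} f"
  by (intro continuous_at_imp_continuous_on ballI) (simp add: hol_at_isCont)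
 have "continuous_on (ball x e) (%y. integral (cbox 0 1) (%ta. f (y + circlepath 0 r ta *\<^sub>C v) * circ_weight 2 r ta))"
  by (rule integral_continuous_on_param, unfold split_beta,
    intro continuous_intros continuous_on_compose2[OF c] continuous_on_compose2[OF circle_continuous[of UNIV]]
     continuous_on_compose2[OF circ_weight_continuous[OF re(1), of UNIV]] cscale.continuous_on)
   (use re(3) in auto)
 then have "continuous_on (ball x e) (%y. fd f y v)"
  by (rule continuous_on_eq) (use re(4) in auto)
 then show ?thesis using re(2) continuous_on_eq_continuous_at by (metis centre_in_ball open_ball)
qed

lemma fd_isCont:
 fixes f :: "'a::cvec => 'b::cvec"
 assumes "hol_at f x"
 shows "isCont (%y. fd f y v) x"
 unfolding isCont_def
proof (subst tendsto_componentwise_iff, intro ballI)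
 fix b :: 'b assume b: "b : Basis"
 \<comment> \<open>The complex linear functional whose real part is the coordinate
   \<open>y \<bullet> b\<close>; it reduces the claim to complex valued functions.\<close>
 define Ps where "Ps = (%y. Complex (y \<bullet> b) (- ((\<i> *\<^sub>C y) \<bullet> b)))"
 have lin: "bounded_linear Ps"
  by (rule linear_conv_bounded_linear[THEN iffD1], rule linearI)
   (auto simp: Ps_def complex_eq_iff inner_add_left cscale_add_right cscale.scaleR_right)
 have ii: "\<i> *\<^sub>C (\<i> *\<^sub>C y) = - y" for y :: 'b
  using cscale_of_real[of "-1" y] by (simp add: cscale_assoc)
 have cl: "clin Ps"
  by (rule clinI) (use lin in "auto simp: bounded_linear.linear Ps_def complex_eq_iff ii")
 have h: "hol_at (%x. Ps (f x)) x" by (rule hol_at_linear_compose[OF lin cl assms])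
 have "isCont (%y. Re (fd (%x. Ps (f x)) y v)) x"
  by (rule isCont_o2[OF fd_isCont_complex[OF h]]) (simp add: isCont_def tendsto_Re)
 moreover have "near x (%y. Re (fd (%x. Ps (f x)) y v) = fd f y v \<bullet> b)"
  using assms unfolding hol_at_def
  by (rule eventually_mono) (simp only: cdiff_linear_compose(2)[OF lin cl], simp add: Ps_def)
 ultimately have "isCont (%y. fd f y v \<bullet> b) x" by (subst (asm) isCont_cong)
 then show "((%y. fd f y v \<bullet> b) \<longlongrightarrow> fd f x v \<bullet> b) (at x)" by (simp add: isCont_def)
qed

lemma blinfun_fd: "cdiff f x ==> blinfun_apply (Blinfun (fd f x)) = fd f x"
 by (rule bounded_linear_Blinfun_apply[OF has_derivative_bounded_linear[OF cdiff_has_derivative]])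

text \<open>The Leibniz rule, on a ball of parameters over which \<open>f\<close> is holomorphic
  along the whole compact path. The derivative of the integral is complex linear because that of the
  integrand is.\<close>

lemma hol_at_integral:
 fixes f :: "'a::cvec * complex => complex" and gm w :: "real => complex"
 assumes f: "!!ta. ta : {0..1} ==> hol_at f (x, gm ta)"
  and gm: "continuous_on {0..1} gm" and w: "continuous_on {0..1} w"
 shows "hol_at (%y. integral {0..1} (%ta. f (y, gm ta) * w ta)) x"
proof -
 define O' where "O' = {p. hol_at f p}"
 have "compact ({x} \<times> gm ` {0..1::real})"
  by (intro compact_Times compact_continuous_image gm) auto
 moreover have "{x} \<times> gm ` {0..1} <= O'" using f by (auto simp: O'_def)
 ultimately obtain e where e: "e > 0" "(\<Union>p\<in>{x} \<times> gm ` {0..1}. ball p e) <= O'"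
  using compact_subset_open_imp_ball_epsilon_subset[of _ O'] open_hol_at unfolding O'_def by metis
 define U where "U = ball x e"
 have hf: "hol_at f (y, gm ta)" if "y : U" "ta : {0..1}" for y ta
 proof -
  have "(y, gm ta) : ball (x, gm ta) e" using that by (simp add: U_def dist_Pair_Pair)
  then show ?thesis using e(2) that(2) unfolding O'_def by blast
 qed
 define bl where "bl = (%y ta. Blinfun (%v. fd f (y, gm ta) (v, 0) * w ta))"
 have der: "((%y. f (y, gm ta) * w ta) has_derivative (%v. fd f (y, gm ta) (v, 0) * w ta)) (at y)"
  if "y : U" "ta : {0..1}" for y ta
 proof -
  have "((%y. (y, gm ta)) has_derivative (%v. (v, 0))) (at y)" by (auto intro!: derivative_eq_intros)
  from has_derivative_compose[OF this cdiff_has_derivative[OF hol_at_cdiff[OF hf[OF that]]]]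
  show ?thesis by (rule has_derivative_mult_left)
 qed
 have bl: "blinfun_apply (bl y ta) = (%v. fd f (y, gm ta) (v, 0) * w ta)" if "y : U" "ta : {0..1}" for y ta
  unfolding bl_def using der[OF that] has_derivative_bounded_linear bounded_linear_Blinfun_apply by blast
 have cfd: "continuous_on O' (%p. fd f p v)" for v
  by (intro continuous_at_imp_continuous_on ballI fd_isCont) (simp add: O'_def)
 have cf: "continuous_on O' f"
  by (intro continuous_at_imp_continuous_on ballI) (simp add: O'_def hol_at_isCont)
 have cbl: "continuous_on (U \<times> cbox 0 1) (%(y, ta). bl y ta)"
 proof (rule continuous_on_blinfun_componentwise)
  fix i :: 'a
  have "continuous_on (U \<times> cbox 0 1) (%p. fd f (fst p, gm (snd p)) (i, 0) * w (snd p))"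
   by (intro continuous_intros continuous_on_compose2[OF cfd] continuous_on_compose2[OF gm]
     continuous_on_compose2[OF w]) (auto simp: O'_def hf)
  then show "continuous_on (U \<times> cbox 0 1) (%p. blinfun_apply (case p of (y, ta) => bl y ta) i)"
   by (rule continuous_on_eq) (auto simp: bl)
 qed
 have int: "(%ta. f (y, gm ta) * w ta) integrable_on cbox 0 1" if "y : U" for y
  by (rule integrable_continuous, intro continuous_intros continuous_on_compose2[OF cf])
   (use gm w hf that in "auto simp: O'_def")
 have cint: "bl y integrable_on cbox 0 1" if "y : U" for y
 proof (rule integrable_continuous)
  show "continuous_on (cbox 0 1) (bl y)"
  proof -
   have "continuous_on (cbox 0 1) (%ta. case (y, ta) of (y, ta) => bl y ta)"
    by (rule continuous_on_compose2[OF cbl]) (use that in "auto intro!: continuous_intros")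
   then show ?thesis by simp
  qed
 qed
 have "cdiff (%y. integral {0..1} (%ta. f (y, gm ta) * w ta)) y" if y: "y : U" for y
 proof (rule cdiffI)
  have "((%y. integral (cbox 0 1) (%ta. f (y, gm ta) * w ta)) has_derivative
    integral (cbox 0 1) (bl y)) (at y within U)"
  proof (rule leibniz_rule[OF _ int cbl y])
   show "((%y. f (y, gm ta) * w ta) has_derivative blinfun_apply (bl y ta)) (at y within U)"
    if "y : U" "ta : cbox 0 1" for y ta
    using der[of y ta] bl[of y ta] that by (simp add: has_derivative_at_withinI)
   show "convex U" by (simp add: U_def)
  qed
  then show *: "((%y. integral {0..1} (%ta. f (y, gm ta) * w ta)) has_derivative
    integral (cbox 0 1) (bl y)) (at y)"
   using y by (simp add: U_def at_within_open[OF _ open_ball])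
  show "clin (blinfun_apply (integral (cbox 0 1) (bl y)))"
  proof (rule clinI)
   show "linear (blinfun_apply (integral (cbox 0 1) (bl y)))"
    using blinfun.bounded_linear_right bounded_linear.linear by blast
   fix v
   have "integral (cbox 0 1) (%ta. bl y ta (\<i> *\<^sub>C v)) = integral (cbox 0 1) (%ta. \<i> * bl y ta v)"
   proof (rule integral_cong)
    fix ta :: real assume t: "ta : cbox 0 1"
    have "fd f (y, gm ta) (\<i> *\<^sub>C (v, 0)) = \<i> * fd f (y, gm ta) (v, 0)"
     using fd_clin[OF hol_at_cdiff[OF hf[of y ta]], of \<i> "(v, 0)"] y t by simp
    then show "bl y ta (\<i> *\<^sub>C v) = \<i> * bl y ta v" using bl[of y ta] y t by simp
   qed
   then show "blinfun_apply (integral (cbox 0 1) (bl y)) (\<i> *\<^sub>C v) =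
     \<i> *\<^sub>C blinfun_apply (integral (cbox 0 1) (bl y)) v"
    by (simp add: blinfun_apply_integral[OF cint[OF y, simplified]])
  qed
 qed
 then show ?thesis
  by (rule hol_at_open[of U, rotated]) (use e(1) in "auto simp: U_def")
qed

text \<open>Cauchy's formula writes the derivative as an integral with holomorphic dependence on
  \<open>y\<close>, so \<open>hol_at_integral\<close> applies. Hence germs can be differentiated any
  number of times.\<close>

theorem hol_at_fd:
 fixes f :: "'a::cvec => complex"
 assumes "hol_at f x"
 shows "hol_at (%y. fd f y v) x"
proof -
 obtain r e where re: "r > 0" "e > 0"
  "!!y ta. y : ball x e ==> hol_at f (y + circlepath 0 r ta *\<^sub>C v)"
  "!!y. y : ball x e ==>
    fd f y v = integral {0..1} (%ta. f (y + circlepath 0 r ta *\<^sub>C v) * circ_weight 2 r ta)"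
  by (rule cauchy_fd[OF assms, where v = v]) blast
 have "hol_at (%y. integral {0..1} (%ta. (%p. f (fst p + snd p *\<^sub>C v)) (y, circlepath 0 r ta) * circ_weight 2 r ta)) x"
 proof (rule hol_at_integral)
  show "hol_at (%p. f (fst p + snd p *\<^sub>C v)) (x, circlepath 0 r ta)" for ta
   by (rule hol_at_compose[of f]) (use re(3)[of x] re(2) in "auto intro!: hols")
 qed (auto intro: circle_continuous circ_weight_continuous re)
 then show ?thesis
  by (rule hol_at_transform)
   (use re(2,4) in "auto simp: eventually_nhds_metric dist_commute intro!: exI[of _ e]")
qed

section \<open>Inverse and implicit functions\<close>

lemma clin_inv:
 assumes "bij L" "clin L" shows "clin (inv L)"
 unfolding clin_def
proof (intro allI)
 fix c v
 have "L (c *\<^sub>C inv L v) = c *\<^sub>C v" using assms by (simp add: clin_def bij_is_surj surj_f_inv_f)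
 then show "inv L (c *\<^sub>C v) = c *\<^sub>C inv L v" using assms(1) by (metis bij_inv_eq_iff)
qed

lemma linear_inv:
 assumes "bij L" "linear L" shows "linear (inv L)"
proof (rule linearI)
 have L: "L (inv L v) = v" for v using assms(1) by (simp add: bij_is_surj surj_f_inv_f)
 show "inv L (u + v) = inv L u + inv L v" for u v
  by (rule sym) (simp add: bij_inv_eq_iff[OF assms(1)] linear_add[OF assms(2)] L)
 show "inv L (r *\<^sub>R v) = r *\<^sub>R inv L v" for r v
  by (rule sym) (simp add: bij_inv_eq_iff[OF assms(1)] linear_scale[OF assms(2)] L)
qed

text \<open>The real inverse function theorem asks for a continuous derivative, which
  \<open>fd_isCont\<close> provides. The inverse is holomorphic since the inverse of a complex
  linear bijection is complex linear.\<close>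

theorem hol_inverse_function:
 fixes f :: "'a::cvec => 'b::cvec"
 assumes f: "hol_at f x0" and bij: "bij (fd f x0)"
 obtains g where "hol_at g (f x0)" "g (f x0) = x0"
  "near x0 (%x. g (f x) = x)" "near (f x0) (%y. f (g y) = y)"
proof -
 define L where "L = inv (fd f x0)"
 have linL: "linear L" unfolding L_def
  by (rule linear_inv[OF bij fd_linear[OF hol_at_cdiff[OF f]]])
 then have bL: "bounded_linear L" by (simp add: linear_conv_bounded_linear)
 have cL: "clin L" unfolding L_def by (rule clin_inv[OF bij cdiff_clin[OF hol_at_cdiff[OF f]]])
 have bijL: "bij L" unfolding L_def using bij by (rule bij_imp_bij_inv)
 \<comment> \<open>Composition with the inverse derivative makes source and target equal and the
   derivative at \<open>x0\<close> the identity.\<close>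
 define h where "h = (%x. L (f x))"
 have h: "hol_at h x0" unfolding h_def by (rule hol_at_linear_compose[OF bL cL f])
 have fdh: "fd h x0 v = v" for v
  unfolding h_def cdiff_linear_compose(2)[OF bL cL hol_at_cdiff[OF f]] using bij
  by (simp add: L_def bij_is_inj)
 define U where "U = {x. hol_at h x}"
 have cont: "continuous_on U (%x. Blinfun (fd h x))"
 proof (rule continuous_on_blinfun_componentwise)
  fix i :: 'a
  have "continuous_on U (%x. fd h x i)"
   by (intro continuous_at_imp_continuous_on ballI fd_isCont) (simp add: U_def)
  then show "continuous_on U (%x. blinfun_apply (Blinfun (fd h x)) i)"
   by (rule continuous_on_eq) (simp add: U_def blinfun_fd hol_at_cdiff)
 qed
 have id: "Blinfun (fd h x0) = id_blinfun"
  by (rule blinfun_eqI) (simp add: blinfun_fd hol_at_cdiff h fdh)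
 obtain U' V g g' where g: "open U'" "U' <= U" "x0 : U'" "open V" "h x0 : V" "homeomorphism U' V h g"
  "!!y. y : V ==> (g has_derivative (g' y)) (at y)"
  "!!y. y : V ==> g' y = inv (blinfun_apply (Blinfun (fd h (g y))))"
  "!!y. y : V ==> bij (blinfun_apply (Blinfun (fd h (g y))))"
 proof (rule inverse_function_theorem[of U h "%x. Blinfun (fd h x)" x0 id_blinfun])
  show "open U" unfolding U_def by (rule open_hol_at)
  show "(h has_derivative blinfun_apply (Blinfun (fd h x))) (at x)" if "x : U" for x
   using that by (simp add: U_def blinfun_fd hol_at_cdiff cdiff_has_derivative)
  show "x0 : U" using h by (simp add: U_def)
  show "id_blinfun o\<^sub>L Blinfun (fd h x0) = id_blinfun" by (simp add: id blinfun_eqI)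
 qed (use cont in auto)
 have hg: "h (g y) = y" "g y : U'" if "y : V" for y
  using g(6) that unfolding homeomorphism_def by auto
 have gh: "g (h x) = x" if "x : U'" for x using g(6) that unfolding homeomorphism_def by auto
 have cg: "cdiff g y" if "y : V" for y
 proof (rule cdiffI[OF g(7)[OF that]])
  have "cdiff h (g y)" using hg(2)[OF that] g(2) by (auto simp: U_def hol_at_cdiff)
  then show "clin (g' y)" using g(8,9)[OF that] by (simp add: blinfun_fd clin_inv cdiff_clin)
 qed
 have hg0: "hol_at g (h x0)" by (rule hol_at_open[OF g(4)]) (use cg g(5) in auto)
 have holL: "hol_at L y" for y using hol_at_linear_compose[OF bL cL hol_at_ident] by simp
 show ?thesis
 proof
  show "hol_at (%y. g (L y)) (f x0)"
   by (rule hol_at_compose) (use hg0 holL in "auto simp: h_def")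
  show "g (L (f x0)) = x0" using gh[OF g(3)] by (simp add: h_def)
  show "near x0 (%x. g (L (f x)) = x)"
   using g(1,3) gh unfolding eventually_nhds h_def by blast
  have "near (L (f x0)) (%y. y : V)"
   using g(4,5) unfolding eventually_nhds h_def by blast
  then have "near (f x0) (%y. L y : V)"
   by (rule eventually_isCont[rotated]) (rule hol_at_isCont[OF holL])
  then show "near (f x0) (%y. f (g (L y)) = y)"
   by (rule eventually_mono) (use hg(1) injD[OF bij_is_inj[OF bijL]] in "simp add: h_def")
 qed
qed

theorem hol_implicit_function:
 fixes F :: "'a::cvec * 'b::cvec => 'c::cvec"
 assumes F: "hol_at F (x0, y0)" "F (x0, y0) = 0" and bij: "bij (%v. fd F (x0, y0) (0, v))"
 obtains g where "hol_at g x0" "g x0 = y0"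
  "near (x0, y0) (%p. F p = 0 \<longleftrightarrow> snd p = g (fst p))"
  "near x0 (%x. F (x, g x) = 0)"
proof -
 \<comment> \<open>Carrying the parameter along turns the implicit equation into an invertible map;
   \<open>g x\<close> is the second component of the inverse at \<open>(x, 0)\<close>.\<close>
 define Ph where "Ph = (%p. (fst p, F p))"
 have Ph: "hol_at Ph (x0, y0)" unfolding Ph_def by (intro hols F)
 have cF: "cdiff F (x0, y0)" using F(1) by (rule hol_at_cdiff)
 have fdPh: "fd Ph (x0, y0) = (%p. (fst p, fd F (x0, y0) (fst p, 0) + fd F (x0, y0) (0, snd p)))"
 proof
  fix p :: "'a * 'b"
  have "fd Ph (x0, y0) p = (fst p, fd F (x0, y0) p)" unfolding Ph_def
   by (subst cdiff_Pair(2)) (auto intro!: hols cF fd_eq derivative_eq_intros)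
  then show "fd Ph (x0, y0) p = (fst p, fd F (x0, y0) (fst p, 0) + fd F (x0, y0) (0, snd p))"
   using fd_pair[OF cF, of "fst p" "snd p"] by simp
 qed
 have "bij (fd Ph (x0, y0))" unfolding fdPh
 proof (rule bijI)
  show "inj (%p. (fst p, fd F (x0, y0) (fst p, 0) + fd F (x0, y0) (0, snd p)))"
   using bij by (auto simp: inj_def bij_def)
  show "surj (%p. (fst p, fd F (x0, y0) (fst p, 0) + fd F (x0, y0) (0, snd p)))"
  proof (rule surjI)
   fix q :: "'a * 'c"
   let ?v = "inv (%v. fd F (x0, y0) (0, v)) (snd q - fd F (x0, y0) (fst q, 0))"
   have "fd F (x0, y0) (0, ?v) = snd q - fd F (x0, y0) (fst q, 0)"
    using surj_f_inv_f[OF bij_is_surj[OF bij]] by simp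
   then show "(%p. (fst p, fd F (x0, y0) (fst p, 0) + fd F (x0, y0) (0, snd p))) (fst q, ?v) = q"
    by (simp add: prod_eq_iff)
  qed
 qed
 note bijPh = this
 have Ph0: "Ph (x0, y0) = (x0, 0)" by (simp add: Ph_def F)
 obtain G where G: "hol_at G (x0, 0)" "G (x0, 0) = (x0, y0)"
  "near (x0, y0) (%x. G (Ph x) = x)" "near (x0, 0) (%y. Ph (G y) = y)"
  by (rule hol_inverse_function[OF Ph bijPh, unfolded Ph0]) blast
 define g where "g = (%x. snd (G (x, 0)))"
 have e: "hol_at (%x. (x, 0)) x0" by (intro hols)
 have hg: "hol_at g x0" unfolding g_def
  by (intro hol_at_snd hol_at_compose[where g = G and f = "%x. (x, 0)"] e) (use G in auto)
 have ev: "near x0 (%x. Ph (G (x, 0)) = (x, 0))"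
  using eventually_isCont[OF hol_at_isCont[OF e]] G(4) by blast
 then have ev': "near x0 (%x. F (x, g x) = 0)"
  by (rule eventually_mono) (metis Ph_def fst_conv g_def prod.collapse snd_conv)
 show ?thesis
 proof
  show "hol_at g x0" by fact
  show "g x0 = y0" by (simp add: g_def G)
  show "near x0 (%x. F (x, g x) = 0)" by fact
  have "near (x0, y0) (%p. F (fst p, g (fst p)) = 0)"
   by (rule eventually_fst[OF ev'])
  with G(3) show "near (x0, y0) (%p. F p = 0 \<longleftrightarrow> snd p = g (fst p))"
  proof eventually_elim
   case (elim p)
   show ?case
   proof
    assume "F p = 0"
    then show "snd p = g (fst p)" using elim(1) by (simp add: Ph_def g_def)
   next
    assume "snd p = g (fst p)"
    then have "p = (fst p, g (fst p))" by (simp add: prod_eq_iff)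
    then show "F p = 0" using elim(2) by metis
   qed
  qed
 qed
qed

lemma bij_complex_linear:
 fixes L :: "complex => complex"
 assumes "clin L" "L 1 ~= 0" shows "bij L"
proof -
 have "L c = c * L 1" for c using assms(1) unfolding clin_def by (metis cscale_complex mult.right_neutral)
 then have "L = (%c. c * L 1)" by blast
 moreover have "bij (%c. c * L 1)"
  by (rule bijI) (use assms(2) in \<open>auto simp: inj_def intro!: surjI[of _ "%c. c / L 1"]\<close>)
 ultimately show ?thesis by metis
qed

lemma clin_fd_Pair0: "cdiff F p ==> clin (%v. fd F p (0, v))"
 unfolding clin_def using fd_clin[of F p _ "(0, _)"] by simp

section \<open>Division by a coordinate, roots, even and odd parts\<close>

lemma eventually_segment:
 assumes "near (u0, 0::complex) P"
 shows "near (u0::'a::metric_space, 0) (%p. ALL ta:{0..1}. P (fst p, of_real ta * snd p))"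
proof -
 obtain e where e: "e > 0" "!!p. dist p (u0, 0) < e ==> P p"
  using assms unfolding eventually_nhds_metric by blast
 show ?thesis unfolding eventually_nhds_metric
 proof (intro exI[of _ e] conjI allI impI ballI)
  fix p :: "'a * complex" and ta :: real assume p: "dist p (u0, 0) < e" and ta: "ta : {0..1}"
  have "norm (of_real ta * snd p) <= norm (snd p)" using ta by (simp add: norm_mult mult_left_le_one_le)
  then have "dist (fst p, of_real ta * snd p) (u0, 0) <= dist p (u0, 0)"
   by (auto simp: dist_prod_def)
  then show "P (fst p, of_real ta * snd p)" using p by (intro e(2)) simp
 qed (rule e(1))
qed

text \<open>The quotient is \<open>q (u, t) = \<integral>\<^sub>0\<^sup>1 ta\<^sup>j b (u, ta t) dta\<close>.\<close>
lemma hol_antiderivative: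
 fixes h b :: "'a::cvec * complex => complex"
 assumes h: "hol_at h (u0, 0)" and zero: "near u0 (%u. h (u, 0) = 0)"
  and b: "hol_at b (u0, 0)"
  and der: "near (u0, 0) (%p. fd h p (0, 1) = snd p ^ j * b p)"
 obtains q where "hol_at q (u0, 0)" "near (u0, 0) (%p. h p = snd p ^ Suc j * q p)"
  "!!u. q (u, 0) = b (u, 0) / of_nat (Suc j)"
proof -
 define f where "f = (%p::('a * complex) \<times> complex. b (fst (fst p), snd p * snd (fst p)))"
 define q where "q = (%p. integral {0..1} (%ta. f (p, of_real ta) * of_real ta ^ j))"
 have hq: "hol_at q (u0, 0)" unfolding q_def
 proof (rule hol_at_integral)
  show "hol_at f ((u0, 0), of_real ta)" for ta
   unfolding f_def by (rule hol_at_compose[of b]) (auto intro!: hols b)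
 qed (auto intro!: continuous_intros)
 have "near (u0, 0::complex) (%p. h (fst p, 0) = 0)"
  by (rule eventually_fst[OF zero])
 moreover have "near (u0, 0) (%p. ALL ta:{0..1}. cdiff h (fst p, of_real ta * snd p))"
  using eventually_segment[of "cdiff h"] h unfolding hol_at_def by blast
 moreover note eventually_segment[OF der]
 ultimately have "near (u0, 0) (%p. h p = snd p ^ Suc j * q p)"
 proof eventually_elim
  case (elim p)
  define k where "k = (%ta::real. h (fst p, of_real ta * snd p))"
  have "(k has_vector_derivative snd p ^ Suc j * (f (p, of_real ta) * of_real ta ^ j)) (at ta within {0..1})"
   if ta: "ta : {0..1}" for ta
  proof -
   have 1: "((%ta::real. (fst p, of_real ta * snd p)) has_derivative (%v. (0, of_real v * snd p))) (at ta)"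
    by (auto intro!: derivative_eq_intros)
   have c: "cdiff h (fst p, of_real ta * snd p)" using elim(2) ta by blast
   have d: "fd h (fst p, of_real ta * snd p) (0, 1) = (of_real ta * snd p) ^ j * f (p, of_real ta)"
    using bspec[OF elim(3) ta] by (simp add: f_def)
   have "(k has_derivative (%v. fd h (fst p, of_real ta * snd p) (0, of_real v * snd p))) (at ta)"
    unfolding k_def using has_derivative_compose[OF 1 cdiff_has_derivative[OF c]] .
   moreover have "fd h (fst p, of_real ta * snd p) (0, of_real v * snd p) =
     v *\<^sub>R (snd p ^ Suc j * (f (p, of_real ta) * of_real ta ^ j))" for v
   proof -
    have "fd h (fst p, of_real ta * snd p) (0, of_real v * snd p) =
      of_real v * snd p * fd h (fst p, of_real ta * snd p) (0, 1)"
     using fd_clin[OF c, of "of_real v * snd p" "(0, 1)"] by simp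
    then show ?thesis unfolding d by (simp add: scaleR_conv_of_real power_mult_distrib)
   qed
   ultimately have "(k has_vector_derivative snd p ^ Suc j * (f (p, of_real ta) * of_real ta ^ j)) (at ta)"
    unfolding has_vector_derivative_def by simp
   then show ?thesis by (rule has_vector_derivative_at_within)
  qed
  then have "((%ta. snd p ^ Suc j * (f (p, of_real ta) * of_real ta ^ j)) has_integral k 1 - k 0) {0..1}"
   by (intro fundamental_theorem_of_calculus) auto
  then have "integral {0..1} (%ta. snd p ^ Suc j * (f (p, of_real ta) * of_real ta ^ j)) = k 1 - k 0"
   by (rule integral_unique)
  then show ?case using elim(1) unfolding integral_mult_right by (simp add: q_def k_def)
 qed
 moreover have "q (u, 0) = b (u, 0) / of_nat (Suc j)" for u
 proof -
  have der: "((%ta::real. of_real ta ^ Suc j / of_nat (Suc j) :: complex) has_vector_derivative of_real ta ^ j)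
   (at ta within {0..1})" for ta
  proof -
   have "((%z::complex. z ^ Suc j / of_nat (Suc j)) has_field_derivative of_real ta ^ j) (at (of_real ta))"
    by (rule derivative_eq_intros refl | simp add: field_simps del: of_nat_Suc)+
   then show ?thesis using has_vector_derivative_real_field by blast
  qed
  have "((%ta. of_real ta ^ j :: complex) has_integral
    (of_real 1 ^ Suc j / of_nat (Suc j) - of_real 0 ^ Suc j / of_nat (Suc j))) {0..1}"
   by (rule fundamental_theorem_of_calculus[OF _ der]) simp
  then have "integral {0..1} (%ta. of_real ta ^ j :: complex) = 1 / of_nat (Suc j)"
   by (simp add: integral_unique)
  then show ?thesis by (simp add: q_def f_def)
 qed
 ultimately show ?thesis using that hq by blast
qed

lemma hol_divide_snd:
 fixes h :: "'a::cvec * complex => complex"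
 assumes h: "hol_at h (u0, 0)" and zero: "near u0 (%u. h (u, 0) = 0)"
 obtains q where "hol_at q (u0, 0)" "near (u0, 0) (%p. h p = snd p * q p)"
  "!!u. q (u, 0) = fd h (u, 0) (0, 1)"
proof -
 have "near (u0, 0) (%p. fd h p (0, 1) = snd p ^ 0 * fd h p (0, 1))" by simp
 then obtain q where "hol_at q (u0, 0)" "near (u0, 0) (%p. h p = snd p ^ Suc 0 * q p)"
  "!!u. q (u, 0) = fd h (u, 0) (0, 1) / of_nat (Suc 0)"
  by (rule hol_antiderivative[OF h zero hol_at_fd[OF h]]) blast
 then show ?thesis by (intro that[of q]) auto
qed

lemma hol_root:
 fixes m :: "'a::cvec => complex"
 assumes m: "hol_at m x" "m x ~= 0" and j: "j > 0"
 obtains rh where "hol_at rh x" "rh x ~= 0" "near x (%y. rh y ^ j = m y)"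
proof -
 define c where "c = exp (Ln (m x) / of_nat j)"
 \<comment> \<open>Dividing by \<open>m x\<close> moves the argument of \<open>Ln\<close> to 1, away
   from the branch cut; the constant \<open>c\<close> restores the factor.\<close>
 define rh where "rh = (%y. c * exp (Ln (m y / m x) / of_nat j))"
 have pw: "exp (z / of_nat j) ^ j = exp z" for z :: complex
  using j by (simp add: exp_of_nat_mult[symmetric])
 have an: "(%z. Ln z) analytic_on {m x / m x}"
  unfolding analytic_at
  by (rule exI[of _ "- \<real>\<^sub>\<le>\<^sub>0"]) (use m(2) in "auto intro!: holomorphic_on_Ln simp: open_Compl")
 have h: "hol_at (%y. exp (Ln (m y / m x) / of_nat j)) x"
  by (rule hol_at_analytic[of exp], unfold analytic_at, rule exI[of _ UNIV])
   (auto intro: holomorphic_on_exp intro!: hols hol_at_analytic[of Ln] m j simp: m gr_implies_not0[OF j] intro: an)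
 have "hol_at rh x" unfolding rh_def by (intro hols h)
 moreover have "rh x ~= 0" by (simp add: rh_def c_def)
 moreover have "near x (%y. rh y ^ j = m y)"
  using hol_at_nonzero[OF m]
  by (rule eventually_mono) (use m(2) in "simp add: rh_def c_def power_mult_distrib pw")
 ultimately show ?thesis using that by blast
qed

text \<open>The even and odd parts are the Cauchy integrals of \<open>s N (u, s) / (s\<^sup>2 - z)\<close> and \<open>N (u, s) / (s\<^sup>2 - z)\<close>.\<close>
lemma hol_even_odd:
 fixes N :: "'a::cvec * complex => complex"
 assumes N: "hol_at N (u0, 0)"
 obtains e o' where "hol_at e (u0, 0)" "hol_at o' (u0, 0)"
  "near (u0, 0) (%p. N p = e (fst p, snd p ^ 2) + snd p * o' (fst p, snd p ^ 2))"
proof -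
 obtain R where R: "R > 0" "!!p. dist p (u0, 0) < R ==> hol_at N p"
  using hol_at_eventually[OF N] unfolding eventually_nhds_metric by blast
 define r where "r = R / 2"
 have r: "r > 0" using R by (simp add: r_def)
 define f where "f = (%p::('a * complex) \<times> complex. N (fst (fst p), snd p) / ((snd p)\<^sup>2 - snd (fst p)))"
 have hf: "hol_at f ((u0, 0), circlepath 0 r ta)" for ta
 proof -
  have "dist (u0, circlepath 0 r ta) (u0, 0) < R"
   using circ_norm[OF r, of ta] R(1) by (simp add: dist_Pair_Pair r_def)
  then have "hol_at (%p::('a * complex) \<times> complex. N (fst (fst p), snd p)) ((u0, 0), circlepath 0 r ta)"
   by (intro hol_at_compose[where g = N and f = "%p. (fst (fst p), snd p)"] hols) (simp add: R)
  then show ?thesis unfolding f_def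
   by (intro hols) (use circ_nonzero[OF r] in auto)
 qed
 define e where "e = (%p. integral {0..1} (%ta. (%p. f p * snd p) (p, circlepath 0 r ta) * circ_weight 0 r ta))"
 define o' where "o' = (%p. integral {0..1} (%ta. f (p, circlepath 0 r ta) * circ_weight 0 r ta))"
 have "hol_at e (u0, 0)" unfolding e_def
  by (rule hol_at_integral) (auto intro!: circle_continuous circ_weight_continuous r hols hf)
 moreover have "hol_at o' (u0, 0)" unfolding o'_def
  by (rule hol_at_integral) (auto intro!: circle_continuous circ_weight_continuous r hf)
 moreover have "near (u0, 0) (%p. N p = e (fst p, snd p ^ 2) + snd p * o' (fst p, snd p ^ 2))"
  unfolding eventually_nhds_metric
 proof (intro exI[of _ r] conjI allI impI r)
  fix p :: "'a * complex" assume p: "dist p (u0, 0) < r"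
  obtain u s where us: "p = (u, s)" by (cases p)
  have d: "dist u u0 < r" "norm s < r"
   using p dist_fst_le[of p "(u0, 0)"] dist_snd_le[of p "(u0, 0)"] by (auto simp: us)
  have hN: "hol_at N (u, t)" if "norm t <= r" for t
  proof (rule R(2))
   have "dist (u, t) (u0, 0) <= dist u u0 + norm t"
    using sqrt_sum_squares_le_sum[of "dist u u0" "norm t"] by (simp add: dist_Pair_Pair)
   then show "dist (u, t) (u0, 0) < R" using d(1) that by (simp add: r_def)
  qed
  define h where "h = (%t. N (u, t))"
  have "cdiff h t" if "norm t <= r" for t
   unfolding h_def by (rule cdiff_compose[of N]) (use hN[OF that] hol_at_cdiff in "auto intro!: hols")
  then have hol: "h holomorphic_on cball 0 r"
   unfolding holomorphic_on_def by (auto simp: cdiff_complex_iff intro: field_differentiable_at_within)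
  have ci: "((%t. h t / (t - s)) has_contour_integral 2 * of_real pi * \<i> * h s) (circlepath 0 r)"
   by (rule Cauchy_integral_circlepath_simple[OF hol]) (use d in simp)
  let ?c = "circlepath 0 r"
  have ne: "?c ta ^ 2 - s ^ 2 ~= 0" "?c ta - s ~= 0" for ta
   using circ_norm[OF r, of ta] d(2) by (auto simp: power2_eq_iff)
  have cont: "continuous_on {0..1} (%ta. h (?c ta) / ((?c ta)^2 - s^2))"
   by (intro continuous_intros continuous_on_compose2[OF holomorphic_on_imp_continuous_on[OF hol]] circle_continuous)
    (use ne circ_norm[OF r] in auto)
  have int: "(%ta. h (?c ta) / ((?c ta)^2 - s^2) * ?c ta * circ_weight 0 r ta) integrable_on {0..1}"
   "(%ta. s * (h (?c ta) / ((?c ta)^2 - s^2) * circ_weight 0 r ta)) integrable_on {0..1}"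
   by (intro integrable_continuous_real continuous_intros cont circle_continuous circ_weight_continuous r)+
  \<comment> \<open>The decomposition 1/(c - s) = c/(c^2 - s^2) + s/(c^2 - s^2) of the Cauchy kernel
    into its even and odd part in \<open>s\<close>, multiplied by the numerator.\<close>
  have alg: "A * c * W + s * (A * W) = B * W" if "A * (c + s) = B" for A c B W
   using that[symmetric] by (simp add: algebra_simps)
  have "e (u, s^2) + s * o' (u, s^2) =
   integral {0..1} (%ta. h (?c ta) / ((?c ta)^2 - s^2) * ?c ta * circ_weight 0 r ta) +
   integral {0..1} (%ta. s * (h (?c ta) / ((?c ta)^2 - s^2) * circ_weight 0 r ta))"
   unfolding integral_mult_right by (simp add: e_def o'_def f_def h_def)
  also have "\<dots> = integral {0..1} (%ta. h (?c ta) / ((?c ta)^2 - s^2) * ?c ta * circ_weight 0 r ta +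
    s * (h (?c ta) / ((?c ta)^2 - s^2) * circ_weight 0 r ta))"
   by (rule integral_add[symmetric, OF int])
  also have "\<dots> = integral {0..1} (%ta. 1 / (2 * of_real pi * \<i>) *
    (h (?c ta) / (?c ta - s) * vector_derivative ?c (at ta)))"
  proof (rule integral_cong)
   fix ta :: real
   have "h (?c ta) / ((?c ta)^2 - s^2) * (?c ta + s) = h (?c ta) / (?c ta - s)"
    using ne[of ta] by (simp add: field_simps power2_eq_square)
   then have "h (?c ta) / ((?c ta)^2 - s^2) * ?c ta * W + s * (h (?c ta) / ((?c ta)^2 - s^2) * W) =
    h (?c ta) / (?c ta - s) * W" for W
    by (rule alg)
   note eq = this
   then show "h (?c ta) / ((?c ta)^2 - s^2) * ?c ta * circ_weight 0 r ta +
    s * (h (?c ta) / ((?c ta)^2 - s^2) * circ_weight 0 r ta) =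
    1 / (2 * of_real pi * \<i>) * (h (?c ta) / (?c ta - s) * vector_derivative ?c (at ta))"
    unfolding eq by (simp add: vector_derivative_circlepath circ_weight_def field_simps)
  qed
  also have "\<dots> = 1 / (2 * of_real pi * \<i>) * contour_integral ?c (%t. h t / (t - s))"
   unfolding contour_integral_integral by (rule integral_mult_right)
  also have "\<dots> = h s" using contour_integral_unique[OF ci] by simp
  finally show "N p = e (fst p, snd p ^ 2) + snd p * o' (fst p, snd p ^ 2)"
   by (simp add: us h_def)
 qed
 ultimately show ?thesis using that by blast
qed

lemma eventually_hol:
 "hol_at f x ==> f x = y ==> near y P ==> near x (%z. P (f z))"
 using eventually_isCont hol_at_isCont by blast

lemma fd_eventually_eq:
 assumes "near x (%y. f y = g y)" "hol_at f x"
 shows "near x (%y. fd f y = fd g y)"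
proof -
 have "near x (%y. near y (%y. f y = g y))"
  using assms(1) by (simp add: eventually_eventually)
 with assms(2) show ?thesis unfolding hol_at_def
  by eventually_elim (rule cdiff_transform(2)[symmetric])
qed

section \<open>Singularities of type \<open>A\<^sub>1\<close> and \<open>A\<^sub>2\<close> and the unfolding of the latter\<close>

abbreviation ex :: "'u::cvec * complex * complex" where "ex \<equiv> (0, 1, 0)"
abbreviation ey :: "'u::cvec * complex * complex" where "ey \<equiv> (0, 0, 1)"

text \<open>Both orders of the mixed derivative occur, in the form in which the chain rule of
  \<open>reduce_variable\<close> produces them.\<close>

definition hess :: "('a::cvec => complex) => 'a => 'a => 'a => complex" where
 "hess f a b p = fd (%q. fd f q a) p a * fd (%q. fd f q b) p b - fd (%q. fd f q a) p b * fd (%q. fd f q b) p a"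

text \<open>
 The derivative of the Hessian determinant along the curve \<open>\<partial>f/\<partial>b = 0\<close>. It decides whether a degenerate
 critical point with \<open>\<partial>\<^sup>2f/\<partial>b\<^sup>2 ~= 0\<close> has type \<open>A\<^sub>2\<close>.
\<close>
definition cub :: "('a::cvec => complex) => 'a => 'a => 'a => complex" where
 "cub f a b p = fd (%q. fd f q b) p b * fd (hess f a b) p a - fd (%q. fd f q b) p a * fd (hess f a b) p b"

lemma hol_at_hess: "hol_at f p ==> hol_at (hess f a b) p"
 unfolding hess_def[abs_def] by (intro hols hol_at_fd)

lemma fd_fst_id: "fd (fst :: 'a::cvec * 'b::cvec => 'a) p v = fst v"
 and fd_snd_id: "fd (snd :: 'a::cvec * 'b::cvec => 'b) p v = snd v"
 by (rule fd_eq[OF bounded_linear_imp_has_derivative], rule bounded_linear_fst bounded_linear_snd)+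

lemma cdiff_fst_id: "cdiff (fst :: 'a::cvec * 'b::cvec => 'a) p"
 and cdiff_snd_id: "cdiff (snd :: 'a::cvec * 'b::cvec => 'b) p"
 by (intro cdiff_fst cdiff_snd cdiff_ident)+

lemma fd_triple:
 fixes f :: "'u::cvec * complex * complex => complex"
 assumes "cdiff f p"
 shows "fd f p (0, a, b) = a * fd f p ex + b * fd f p ey"
proof -
 have "(0, a, b) = a *\<^sub>C (0, 1, 0) + b *\<^sub>C ((0::'u), 0, 1)" by simp
 then show ?thesis using assms by (simp only: fd_add fd_clin) simp
qed

text \<open>The variable \<open>y\<close> is eliminated through the equation \<open>G_y = 0\<close>,
  solved by \<open>om\<close>. Implicit differentiation gives the derivatives of the restriction
  \<open>F\<close>: up to powers of \<open>G_yy\<close>, its second derivative is the Hessian and,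
  where that vanishes, its third is \<open>cub\<close>.\<close>

lemma reduce_variable:
 fixes G :: "'u::cvec * complex * complex => complex"
 assumes G: "hol_at G (u0, 0, 0)" and Gy: "fd G (u0, 0, 0) ey = 0"
  and Gyy: "fd (%p. fd G p ey) (u0, 0, 0) ey ~= 0"
 obtains om F where "hol_at om (u0, 0)" "om (u0, 0) = 0" "hol_at F (u0, 0)"
  "!!q. F q = G (fst q, snd q, om q)"
  "near (u0, 0, 0) (%p. fd G p ey = 0 \<longleftrightarrow> snd (snd p) = om (fst p, fst (snd p)))"
  "near (u0, 0) (%q. fd G (fst q, snd q, om q) ey = 0)"
  "near (u0, 0) (%q. fd F q (0, 1) = fd G (fst q, snd q, om q) ex)"
  "near (u0, 0) (%q. fd (%q. fd F q (0, 1)) q (0, 1) = hess G ex ey (fst q, snd q, om q) /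
    fd (%p. fd G p ey) (fst q, snd q, om q) ey)"
  "hess G ex ey (u0, 0, 0) = 0 ==> fd (%q. fd (%q. fd F q (0, 1)) q (0, 1)) (u0, 0) (0, 1) =
    cub G ex ey (u0, 0, 0) / (fd (%p. fd G p ey) (u0, 0, 0) ey)\<^sup>2"
proof -
 let ?Gx = "%p. fd G p ex" and ?Gy = "%p. fd G p ey"
 define F0 where "F0 = (%p::('u * complex) \<times> complex. ?Gy (fst (fst p), snd (fst p), snd p))"
 have a: "hol_at (%p::('u * complex) \<times> complex. (fst (fst p), snd (fst p), snd p)) p" for p
  by (intro hols)
 have hGx: "hol_at ?Gx (u0, 0, 0)" and hGy: "hol_at ?Gy (u0, 0, 0)" using G by (auto intro: hol_at_fd)
 have hF0: "hol_at F0 ((u0, 0), 0)" unfolding F0_def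
  by (rule hol_at_compose[OF _ a]) (simp add: hGy)
 have fda: "fd (%p::('u * complex) \<times> complex. (fst (fst p), snd (fst p), snd p)) p v =
   (fst (fst v), snd (fst v), snd v)" for p v
  by (rule fd_eq) (auto intro!: derivative_eq_intros)
 have fdF0: "fd F0 ((u0, 0), 0) (0, v) = fd ?Gy (u0, 0, 0) (0, 0, v)" for v
  unfolding F0_def using cdiff_compose(2)[OF _ hol_at_cdiff[OF a], of ?Gy "((u0, 0), 0)" "(0, v)"] hol_at_cdiff[OF hGy]
  by (simp add: fda)
 have "bij (%v. fd F0 ((u0, 0), 0) (0, v))"
  by (rule bij_complex_linear) (use Gyy hF0 in "auto simp: fdF0[symmetric] intro!: clin_fd_Pair0 hol_at_cdiff")
 then obtain om where om: "hol_at om (u0, 0)" "om (u0, 0) = 0"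
  "near ((u0, 0), 0) (%p. F0 p = 0 \<longleftrightarrow> snd p = om (fst p))"
  "near (u0, 0) (%x. F0 (x, om x) = 0)"
  using hol_implicit_function[OF hF0, of thesis] Gy by (auto simp: F0_def)
 define ka where "ka = (%q. (fst q, snd q, om q))"
 have ka: "hol_at ka (u0, 0)" "ka (u0, 0) = (u0, 0, 0)" unfolding ka_def by (auto intro!: hols om)
 define F where "F = (%q. G (ka q))"
 have hF: "hol_at F (u0, 0)" unfolding F_def by (rule hol_at_compose) (use ka G in auto)
 have ev1: "near (u0, 0, 0) (%p. ?Gy p = 0 \<longleftrightarrow> snd (snd p) = om (fst p, fst (snd p)))"
  using eventually_hol[of "%p. ((fst p, fst (snd p)), snd (snd p))" "(u0, 0, 0)", OF _ _ om(3)]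
  by (simp add: F0_def hols)
 have ev2: "near (u0, 0) (%q. ?Gy (ka q) = 0)"
  using om(4) by (simp add: F0_def ka_def)
 define omx where "omx = (%q. fd om q (0, 1))"
 have fdka: "fd ka q (0, 1) = (0, 1, omx q)" if "cdiff om q" for q
  unfolding ka_def using that
  by (simp add: cdiff_Pair(2) hols fd_fst fd_snd omx_def fd_eq[OF has_derivative_ident])
 have chain: "fd (%q. K (ka q)) q (0, 1) = fd K (ka q) ex + omx q * fd K (ka q) ey"
  if "cdiff K (ka q)" "cdiff om q" for K :: "'u * complex * complex => complex" and q
 proof -
  have "cdiff ka q" unfolding ka_def by (intro hols that)
  then show ?thesis using cdiff_compose(2)[where g = K and f = ka, OF that(1)] fd_triple[OF that(1), of 1 "omx q"]
   by (simp add: fdka[OF that(2)])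
 qed
 have com: "near (u0, 0) (cdiff om)" using om(1) unfolding hol_at_def .
 have lift: "near (u0, 0) (%q. cdiff K (ka q))" if "hol_at K (u0, 0, 0)" for K :: "'u * complex * complex => complex"
  by (rule eventually_hol[OF ka]) (use that in "simp add: hol_at_def")
 have Gyy': "near (u0, 0) (%q. fd ?Gy (ka q) ey ~= 0)"
  by (rule eventually_hol[OF ka], rule hol_at_nonzero[OF hol_at_fd[OF hGy] Gyy])
 have Fx: "near (u0, 0) (%q. fd F q (0, 1) = ?Gx (ka q))"
  using lift[OF G] com ev2
  by eventually_elim (simp add: F_def chain)
 have hGka: "hol_at (%q. K (ka q)) (u0, 0)" if "hol_at K (u0, 0, 0)" for K :: "'u * complex * complex => complex"
  by (rule hol_at_compose) (use ka that in auto)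
 \<comment> \<open>Derivative of the identity \<open>G_y (ka q) = 0\<close>; it determines the slope
   \<open>omx\<close> of the critical curve.\<close>
 have omx: "near (u0, 0) (%q. fd ?Gy (ka q) ex + omx q * fd ?Gy (ka q) ey = 0)"
 proof -
  have "near (u0, 0) (%q. fd (%q. ?Gy (ka q)) q = fd (%_. 0) q)"
   by (rule fd_eventually_eq[OF ev2 hGka[OF hGy]])
  then show ?thesis using lift[OF hGy] com
  proof eventually_elim
   case (elim q)
   have "fd (%_. 0::complex) q (0, 1) = 0" by (rule fd_eq[OF has_derivative_const])
   then show ?case using elim(1) chain[OF elim(2,3)] by simp
  qed
 qed
 have Fxx: "near (u0, 0) (%q. fd (%q. fd F q (0, 1)) q (0, 1) = hess G ex ey (ka q) / fd ?Gy (ka q) ey)"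
 proof -
  have "near (u0, 0) (%q. fd (%q. fd F q (0, 1)) q = fd (%q. ?Gx (ka q)) q)"
   by (rule fd_eventually_eq[OF Fx hol_at_fd[OF hF]])
  then show ?thesis using lift[OF hGx] com omx Gyy'
  proof eventually_elim
   case (elim q)
   have w: "omx q = - fd ?Gy (ka q) ex / fd ?Gy (ka q) ey"
    using elim(4,5) by (simp add: field_simps eq_neg_iff_add_eq_0)
   show ?case unfolding elim(1) chain[OF elim(2,3)] hess_def w using elim(5) by (simp add: field_simps)
  qed
 qed
 have Fxxx: "fd (%q. fd (%q. fd F q (0, 1)) q (0, 1)) (u0, 0) (0, 1) =
    cub G ex ey (u0, 0, 0) / (fd ?Gy (u0, 0, 0) ey)\<^sup>2" if h0: "hess G ex ey (u0, 0, 0) = 0"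
 proof -
  \<comment> \<open>In the product rule for \<open>?k\<close> the term with the derivative of the
    inverse drops out, because \<open>hess\<close> vanishes at the base point.\<close>
  let ?k = "%q. hess G ex ey (ka q) * inverse (fd ?Gy (ka q) ey)"
  have hh: "hol_at (hess G ex ey) (u0, 0, 0)" by (rule hol_at_hess[OF G])
  have c1: "cdiff (%q. hess G ex ey (ka q)) (u0, 0)" using hGka[OF hh] by (rule hol_at_cdiff)
  have c2: "cdiff (%q. inverse (fd ?Gy (ka q) ey)) (u0, 0)"
   by (intro cdiff_inverse hol_at_cdiff hGka hol_at_fd hGy) (use Gyy ka(2) in auto)
  have "near (u0, 0) (%q. fd (%q. fd F q (0, 1)) q (0, 1) = ?k q)"
   using Fxx by (simp add: divide_inverse)
  then have "near (u0, 0) (%q. fd (%q. fd (%q. fd F q (0, 1)) q (0, 1)) q = fd ?k q)"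
   by (rule fd_eventually_eq) (intro hol_at_fd hF)
  then have "fd (%q. fd (%q. fd F q (0, 1)) q (0, 1)) (u0, 0) (0, 1) = fd ?k (u0, 0) (0, 1)"
   by (drule_tac near_imp) simp
  also have "\<dots> = fd (%q. hess G ex ey (ka q)) (u0, 0) (0, 1) * inverse (fd ?Gy (u0, 0, 0) ey)"
   using cdiff_mult(2)[OF c1 c2] h0 ka(2) by simp
  also have "fd (%q. hess G ex ey (ka q)) (u0, 0) (0, 1) =
    fd (hess G ex ey) (u0, 0, 0) ex + omx (u0, 0) * fd (hess G ex ey) (u0, 0, 0) ey"
   using chain[of "hess G ex ey" "(u0, 0)"] hol_at_cdiff[OF hh] hol_at_cdiff[OF om(1)] ka(2) by simp
  finally have *: "fd (%q. fd (%q. fd F q (0, 1)) q (0, 1)) (u0, 0) (0, 1) =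
   (fd (hess G ex ey) (u0, 0, 0) ex + omx (u0, 0) * fd (hess G ex ey) (u0, 0, 0) ey) * inverse (fd ?Gy (u0, 0, 0) ey)" .
  have w: "omx (u0, 0) = - fd ?Gy (u0, 0, 0) ex / fd ?Gy (u0, 0, 0) ey"
   using near_imp[OF omx] Gyy ka(2) by (simp add: field_simps eq_neg_iff_add_eq_0)
  show ?thesis unfolding * w cub_def using Gyy by (simp add: field_simps power2_eq_square)
 qed
 show ?thesis
  by (rule that[of om F]) (use om(1,2) hF ev1 ev2 Fx Fxx Fxxx in "simp_all add: F_def ka_def")
qed

lemma bij_fdI:
 fixes f :: "'a::cvec => 'a"
 assumes "cdiff f p" "!!v. fd f p v = 0 ==> v = 0"
 shows "bij (fd f p)"
proof -
 have l: "linear (fd f p)" using assms(1) by (rule fd_linear)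
 then have "inj (fd f p)" using assms(2) linear_injective_0 by blast
 then show ?thesis using linear_injective_imp_surjective[OF l] by (simp add: bij_def)
qed

text \<open>\<open>T\<close> has the constant derivative \<open>L\<close>, as affine maps do, so
  iterated derivatives pull back without correction terms from higher derivatives of
  \<open>T\<close>.\<close>

lemma fd_pull:
 fixes T :: "'a::cvec => 'b::cvec" and g :: "'b => complex"
 assumes T: "!!p. cdiff T p" "!!p v. fd T p v = L v" and g: "hol_at g (T p)"
 shows "fd (%p. g (T p)) p a = fd g (T p) (L a)"
  "fd (%q. fd (%p. g (T p)) q a) p b = fd (%q. fd g q (L a)) (T p) (L b)"
  "hess (%p. g (T p)) a b p = hess g (L a) (L b) (T p)"
  "cub (%p. g (T p)) a b p = cub g (L a) (L b) (T p)"
proof -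
 have 1: "fd (%p. g (T p)) p a = fd g (T p) (L a)" if "hol_at g (T p)" for g :: "'b => complex" and p a
  using cdiff_compose(2)[OF hol_at_cdiff[OF that] T(1)] T(2) by simp
 have hT: "hol_at T p" for p unfolding hol_at_def using T(1) by (simp add: always_eventually)
 have ev: "near p (%p. hol_at g (T p))" if "hol_at g (T p)" for g :: "'b => complex" and p
  using eventually_hol[OF hT refl] hol_at_eventually[OF that] by blast
 have tr: "fd f p b = fd g (T p) (L b)" if "near p (%q. f q = g (T q))" "hol_at g (T p)"
  for f and g :: "'b => complex" and p b
 proof -
  have "cdiff (%p. g (T p)) p" using cdiff_compose(1)[OF hol_at_cdiff[OF that(2)] T(1)] .
  then have "fd f p = fd (%p. g (T p)) p"
   using cdiff_transform(2)[of "%p. g (T p)" p f] that(1) by (simp add: eq_commute)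
  then show ?thesis using 1[OF that(2)] by simp
 qed
 have 2: "fd (%q. fd (%p. g (T p)) q a) p b = fd (%q. fd g q (L a)) (T p) (L b)" if "hol_at g (T p)" for p a b
  by (rule tr[OF eventually_mono[OF ev[OF that]]]) (auto simp: 1 intro: hol_at_fd that)
 have 3: "hess (%p. g (T p)) a b p = hess g (L a) (L b) (T p)" if "hol_at g (T p)" for p
  unfolding hess_def using 2[OF that] by simp
 show "fd (%p. g (T p)) p a = fd g (T p) (L a)"
  "fd (%q. fd (%p. g (T p)) q a) p b = fd (%q. fd g q (L a)) (T p) (L b)"
  "hess (%p. g (T p)) a b p = hess g (L a) (L b) (T p)"
  using 1 2 3 g by auto
 have "fd (hess (%p. g (T p)) a b) p c = fd (hess g (L a) (L b)) (T p) (L c)" for c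
  by (rule tr[OF eventually_mono[OF ev[OF g]]]) (auto simp: 3 intro: hol_at_hess g)
 then show "cub (%p. g (T p)) a b p = cub g (L a) (L b) (T p)"
  unfolding cub_def using 2[OF g] by simp
qed

text \<open>On the curve where \<open>g_y = 0\<close>, the function \<open>g\<close> restricts to
  \<open>x^j\<close> times a unit, with \<open>j\<close> read off from the Hessian and from
  \<open>cub\<close>. The remainder vanishes to second order on that curve and is hence the square
  of a function \<open>B\<close>, a root of the unit factor being absorbed.\<close>

lemma splitting:
 fixes g :: "complex * complex => complex"
 assumes g: "hol_at g (0, 0)" "g (0, 0) = 0" "fd g (0, 0) (1, 0) = 0" "fd g (0, 0) (0, 1) = 0"
  and gyy: "fd (%p. fd g p (0, 1)) (0, 0) (0, 1) ~= 0"
  and j: "(hess g (1, 0) (0, 1) (0, 0) ~= 0 & j = 2) |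
   (hess g (1, 0) (0, 1) (0, 0) = 0 & cub g (1, 0) (0, 1) (0, 0) ~= 0 & j = 3)"
 obtains B r where "hol_at B (0, 0)" "B (0, 0) = 0" "fd B (0, 0) (0, 1) ~= 0"
  "hol_at r (0, 0)" "r (0, 0) ~= 0"
  "near (0, 0) (%w. g w = B w ^ 2 + fst w ^ j * r w)"
proof -
 \<comment> \<open>A dummy parameter, to fit the format of \<open>reduce_variable\<close>.\<close>
 define G where "G = (%p::complex * complex * complex. g (snd p))"
 have T: "cdiff (snd :: complex * complex * complex => _) p" "fd snd p v = snd v"
  for p v :: "complex * complex * complex"
  by (simp_all add: cdiff_fst_id cdiff_snd_id fd_fst_id fd_snd_id)
 have hG: "hol_at G p" if "hol_at g (snd p)" for p
  unfolding G_def by (rule hol_at_compose[where f = snd, OF that]) (intro hols)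
 note pull = fd_pull[where g = g, OF T, folded G_def]
 have p0: "hol_at g (snd (u, 0, 0))" for u :: complex using g by simp
 obtain om F where r: "hol_at om (0, 0)" "om (0, 0) = 0" "hol_at F (0, 0)"
  "!!q. F q = G (fst q, snd q, om q)"
  "near (0, 0, 0) (%p. fd G p ey = 0 \<longleftrightarrow> snd (snd p) = om (fst p, fst (snd p)))"
  "near (0, 0) (%q. fd G (fst q, snd q, om q) ey = 0)"
  "near (0, 0) (%q. fd F q (0, 1) = fd G (fst q, snd q, om q) ex)"
  "near (0, 0) (%q. fd (%q. fd F q (0, 1)) q (0, 1) = hess G ex ey (fst q, snd q, om q) /
    fd (%p. fd G p ey) (fst q, snd q, om q) ey)"
  "hess G ex ey (0, 0, 0) = 0 ==> fd (%q. fd (%q. fd F q (0, 1)) q (0, 1)) (0, 0) (0, 1) =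
    cub G ex ey (0, 0, 0) / (fd (%p. fd G p ey) (0, 0, 0) ey)\<^sup>2"
 proof (rule reduce_variable[of G 0])
  show "hol_at G (0, 0, 0)" using hG g by simp
  show "fd G (0, 0, 0) ey = 0" using pull(1)[OF p0[of 0]] g by simp
  show "fd (%p. fd G p ey) (0, 0, 0) ey ~= 0" using pull(2)[OF p0[of 0]] gyy by simp
 qed blast
 let ?Fx = "%q. fd F q (0, 1)" and ?Fxx = "%q. fd (%q. fd F q (0, 1)) q (0, 1)"
 have line: "hol_at (%u::complex. (u, 0::complex)) 0" by (intro hols)
 have line3: "hol_at (%u::complex. (u, 0::complex, 0::complex)) 0" by (intro hols)
 have om0: "near 0 (%u. om (u, 0) = 0)"
  using eventually_hol[OF line3 refl r(5)] pull(1)[OF p0] g by (auto elim!: eventually_mono)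
 have F0: "near 0 (%u. F (u, 0) = 0)"
  using om0 by (rule eventually_mono) (simp add: r(4) G_def g)
 have Fx0: "near 0 (%u. ?Fx (u, 0) = 0)"
  using eventually_hol[OF line refl r(7)] om0
  by eventually_elim (simp add: pull(1)[OF p0] g)
 have Fxx0: "near 0 (%u. ?Fxx (u, 0) = hess g (1, 0) (0, 1) (0, 0) / fd (%p. fd g p (0, 1)) (0, 0) (0, 1))"
  using eventually_hol[OF line refl r(8)] om0
  by eventually_elim (simp add: pull(2,3)[OF p0])
 have hFx: "hol_at ?Fx (0, 0)" and hFxx: "hol_at ?Fxx (0, 0)" by (intro hol_at_fd r)+
 obtain r0 where r0: "hol_at r0 (0, 0)" "r0 (0, 0) ~= 0" "near (0, 0) (%p. F p = snd p ^ j * r0 p)"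
 proof (cases "j = 2")
  case True
  with j have h: "hess g (1, 0) (0, 1) (0, 0) ~= 0" by auto
  obtain b where b: "hol_at b (0, 0)" "near (0, 0) (%p. ?Fx p = snd p * b p)"
   "!!u. b (u, 0) = ?Fxx (u, 0)"
   using hol_divide_snd[OF hFx Fx0] by blast
  have "near (0, 0) (%p. ?Fx p = snd p ^ 1 * b p)" using b(2) by simp
  from hol_antiderivative[OF r(3) F0 b(1) this]
  obtain q where q: "hol_at q (0, 0)" "near (0, 0) (%p. F p = snd p ^ Suc 1 * q p)"
   "!!u. q (u, 0) = b (u, 0) / of_nat (Suc 1)" by blast
  have "q (0, 0) ~= 0" using q(3)[of 0] b(3)[of 0] near_imp[OF Fxx0] h gyy by simp
  then show ?thesis using that[of q] q True by (simp add: numeral_2_eq_2)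
 next
  case False
  with j have h: "hess g (1, 0) (0, 1) (0, 0) = 0" "cub g (1, 0) (0, 1) (0, 0) ~= 0" "j = 3" by auto
  have "near 0 (%u. ?Fxx (u, 0) = 0)" using Fxx0 h by simp
  from hol_divide_snd[OF hFxx this]
  obtain b where b: "hol_at b (0, 0)" "near (0, 0) (%p. ?Fxx p = snd p * b p)"
   "!!u. b (u, 0) = fd ?Fxx (u, 0) (0, 1)" by blast
  have "b (0, 0) ~= 0"
   using r(9) b(3)[of 0] pull(2,3,4)[OF p0[of 0]] h gyy by simp
  moreover have "near (0, 0) (%p. ?Fxx p = snd p ^ 1 * b p)" using b(2) by simp
  from hol_antiderivative[OF hFx Fx0 b(1) this]
  obtain q where q: "hol_at q (0, 0)" "near (0, 0) (%p. ?Fx p = snd p ^ Suc 1 * q p)"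
   "!!u. q (u, 0) = b (u, 0) / of_nat (Suc 1)" by blast
  from hol_antiderivative[OF r(3) F0 q(1,2)]
  obtain q' where q': "hol_at q' (0, 0)" "near (0, 0) (%p. F p = snd p ^ Suc (Suc 1) * q' p)"
   "!!u. q' (u, 0) = q (u, 0) / of_nat (Suc (Suc 1))" by blast
  ultimately have "q' (0, 0) ~= 0" unfolding q'(3) q(3) by simp
  then show ?thesis using that[of q'] q' h(3) by (simp add: numeral_3_eq_3)
 qed
 have line2: "hol_at (%p::complex * complex. (0::complex, fst p)) (0, 0)" by (intro hols)
 define w where "w = (%p::complex * complex. om (0, fst p))"
 have hw: "hol_at w (0, 0)" unfolding w_def by (rule hol_at_compose[OF _ line2]) (simp add: r)
 have w0: "w (0, y) = 0" for y by (simp add: w_def r)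
 have hf: "hol_at (%p. F (0, fst p)) (0, 0::complex)" by (rule hol_at_compose[OF _ line2]) (simp add: r(3))
 \<comment> \<open>Shear which straightens the critical curve to \<open>snd p = 0\<close>; there
   \<open>h\<close> and its derivative \<open>k\<close> in the second direction both vanish.\<close>
 define S where "S = (%p. (fst p, w p + snd p))"
 have hS: "hol_at S (0, 0)" "S (0, 0) = (0, 0)" unfolding S_def by (auto intro!: hols hw simp: w0)
 define h where "h = (%p. g (S p) - F (0, fst p))"
 define k where "k = (%p. fd g (S p) (0, 1))"
 have hh: "hol_at h (0, 0)" unfolding h_def
  by (intro hols hf hol_at_compose[where g = g and f = S]) (use hS g in auto)
 have hk: "hol_at k (0, 0)" unfolding k_def
  by (rule hol_at_compose[where f = S]) (use hS g in "auto intro: hol_at_fd")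
 have h0: "near 0 (%u. h (u, 0) = 0)"
  by (simp add: h_def S_def r(4) G_def w_def)
 have k0: "near 0 (%u. k (u, 0) = 0)"
 proof -
  have "hol_at (%u::complex. (0::complex, u)) 0" by (intro hols)
  from eventually_hol[OF this refl r(6)]
  have "near 0 (%u. fd G (0, u, om (0, u)) ey = 0)" by simp
  moreover have "hol_at (%u. S (u, 0)) 0"
   by (rule hol_at_compose[where f = "%u. (u, 0)"]) (use hS in "auto intro!: hols")
  from eventually_hol[OF this hS(2) hol_at_eventually[OF g(1)]]
  have "near 0 (%u. hol_at g (S (u, 0)))" .
  ultimately show ?thesis
   by eventually_elim (simp add: k_def S_def w_def pull(1))
 qed
 have fdS: "fd S p (0, 1) = (0, 1)" if "cdiff w p" "fd w p (0, 1) = 0" for p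
  unfolding S_def using that
  by (simp add: cdiff_Pair(2) cdiff_add(2) hols fd_fst fd_snd fd_eq[OF has_derivative_ident])
 have fdw: "near (0, 0) (%p. cdiff w p & fd w p (0, 1) = 0)"
 proof -
  have "hol_at (%x. om (0, x)) 0"
   by (rule hol_at_compose[where f = "%x. (0, x)"]) (use r(1,2,3) in "auto intro!: hols")
  then have "near 0 (cdiff (%x. om (0, x)))" by (simp add: hol_at_def)
  then have "near (0, 0::complex) (%p. cdiff (%x. om (0, x)) (fst p))" by (rule eventually_fst)
  then show ?thesis
  proof eventually_elim
   case (elim p)
   have f: "cdiff fst p" "fd fst p (0, 1) = (0::complex)" for p :: "complex * complex"
    by (simp_all add: cdiff_fst_id cdiff_snd_id fd_fst_id fd_snd_id)
   have "fd (%p. (%x. om (0, x)) (fst p)) p (0, 1) = fd (%x. om (0, x)) (fst p) 0"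
    using cdiff_compose(2)[OF elim f(1)] f(2) by simp
   also have "\<dots> = 0" using linear_0[OF fd_linear[OF elim]] .
   finally show ?case using cdiff_compose(1)[OF elim f(1)] by (simp add: w_def)
  qed
 qed
 have hk1: "near (0, 0) (%p. fd h p (0, 1) = k p)"
 proof -
  have cgS: "near (0, 0) (%p. cdiff g (S p))"
   by (rule eventually_hol[OF hS]) (use g in "simp add: hol_at_def")
  have cS: "near (0, 0) (cdiff S)" using hS(1) by (simp add: hol_at_def)
  have "near (0, 0::complex) (%p. cdiff (%x. F (0, x)) (fst p))"
  proof (rule eventually_fst)
   have "hol_at (%x. F (0, x)) 0"
    by (rule hol_at_compose[where f = "%x. (0, x)"]) (use r(1,2,3) in "auto intro!: hols")
   then show "near 0 (cdiff (%x. F (0, x)))" by (simp add: hol_at_def)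
  qed
  with cgS cS fdw show ?thesis
  proof eventually_elim
   case (elim p)
   have f: "cdiff fst p" "fd fst p (0, 1) = (0::complex)" for p :: "complex * complex"
    by (simp_all add: cdiff_fst_id cdiff_snd_id fd_fst_id fd_snd_id)
   have "fd (%p. (%x. F (0, x)) (fst p)) p (0, 1) = fd (%x. F (0, x)) (fst p) 0"
    using cdiff_compose(2)[OF elim(4) f(1)] f(2) by simp
   also have "\<dots> = 0" using linear_0[OF fd_linear[OF elim(4)]] .
   finally have 1: "fd (%p. F (0, fst p)) p (0, 1) = 0" .
   have 2: "fd (%p. g (S p)) p (0, 1) = k p"
    using cdiff_compose(2)[OF elim(1,2)] fdS elim(3) by (simp add: k_def)
   show ?case unfolding h_def
    by (subst cdiff_diff(2)) (use 1 2 cdiff_compose(1)[OF elim(1,2)] cdiff_compose(1)[OF elim(4) f(1)] in auto)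
  qed
 qed
 obtain b where b: "hol_at b (0, 0)" "near (0, 0) (%p. k p = snd p * b p)"
   "!!u. b (u, 0) = fd k (u, 0) (0, 1)"
  using hol_divide_snd[OF hk k0] by blast
 have "near (0, 0) (%p. fd h p (0, 1) = snd p ^ 1 * b p)"
  using hk1 b(2) by eventually_elim simp
 from hol_antiderivative[OF hh h0 b(1) this]
 obtain q where q: "hol_at q (0, 0)" "near (0, 0) (%p. h p = snd p ^ Suc 1 * q p)"
  "!!u. q (u, 0) = b (u, 0) / of_nat (Suc 1)" by blast
 have "fd k (0, 0) (0, 1) = fd (%p. fd g p (0, 1)) (0, 0) (0, 1)"
  unfolding k_def using cdiff_compose(2)[OF hol_at_cdiff[OF hol_at_fd[of g "S (0,0)" "(0,1)"]] hol_at_cdiff[OF hS(1)], of "(0, 1)"]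
   g hS(2) fdS[of "(0,0)"] near_imp[OF fdw] by simp
 then have "q (0, 0) ~= 0" unfolding q(3) b(3) using gyy by simp
 from hol_root[OF q(1) this, of 2]
 obtain rh where rh: "hol_at rh (0, 0)" "rh (0, 0) ~= 0" "near (0, 0) (%y. rh y ^ 2 = q y)"
  by auto
 define S' where "S' = (%p. (fst p, snd p - w p))"
 have hS': "hol_at S' (0, 0)" "S' (0, 0) = (0, 0)" unfolding S'_def by (auto intro!: hols hw simp: w0)
 have hrhS: "hol_at (%p. rh (S' p)) (0, 0)" by (rule hol_at_compose[where f = S']) (use hS' rh in auto)
 define B where "B = (%p. (snd p - w p) * rh (S' p))"
 have hB: "hol_at B (0, 0)" unfolding B_def by (intro hols hw hrhS)
 show ?thesis
 proof (rule that[of B "%p. r0 (0, fst p)"])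
  show "hol_at B (0, 0)" "B (0, 0) = 0" by (use hB in "auto simp: B_def w0")
  have c: "cdiff (%p. snd p - w p) (0, 0)" by (intro hols hol_at_cdiff[OF hw])
  have "fd (%p. snd p - w p) (0, 0) (0, 1) = 1"
   by (subst cdiff_diff(2)) (use near_imp[OF fdw] in
     "auto intro!: hols hol_at_cdiff[OF hw] simp: fd_snd hols fd_eq[OF has_derivative_ident]")
  then show "fd B (0, 0) (0, 1) ~= 0"
   unfolding B_def using cdiff_mult(2)[OF c hol_at_cdiff[OF hrhS]] rh(2) hS'(2) by (simp add: w0)
  show "hol_at (%p. r0 (0, fst p)) (0, 0::complex)"
   by (rule hol_at_compose[where g = r0 and f = "%p. (0, fst p)"]) (simp_all add: r0 line2)
  show "r0 (0, fst (0, 0)) ~= 0" using r0 by simp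
  have "near (0, 0::complex) (%p. F (0, fst p) = fst p ^ j * r0 (0, fst p))"
   using eventually_hol[OF line2 _ r0(3)] by simp
  then show "near (0, 0) (%p. g p = B p ^ 2 + fst p ^ j * r0 (0, fst p))"
   using eventually_hol[OF hS' rh(3)] eventually_hol[OF hS' q(2)]
  proof eventually_elim
   case (elim p)
   have "S (S' p) = p" by (simp add: S_def S'_def w_def)
   then have "h (S' p) = g p - F (0, fst p)" by (simp add: h_def S'_def)
   moreover have "h (S' p) = (snd p - w p)^2 * rh (S' p)^2"
    using elim(2,3) by (simp add: S'_def power2_eq_square)
   ultimately have "g p = F (0, fst p) + (snd p - w p)^2 * rh (S' p)^2" by (simp add: algebra_simps)
   then show ?case using elim(1) by (simp add: B_def power_mult_distrib)
  qed
 qed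
qed

text \<open>With a square root \<open>sg\<close> of \<open>- r\<close> the result of
  \<open>splitting\<close> is a difference of squares \<open>B^2 - A^2\<close>, whose factors are
  the new coordinates.\<close>

lemma node_normal_form:
 fixes g :: "complex * complex => complex"
 assumes g: "hol_at g (0, 0)" "g (0, 0) = 0" "fd g (0, 0) (1, 0) = 0" "fd g (0, 0) (0, 1) = 0"
  and gyy: "fd (%p. fd g p (0, 1)) (0, 0) (0, 1) ~= 0"
  and h: "hess g (1, 0) (0, 1) (0, 0) ~= 0"
 obtains ka where "hol_at ka (0, 0)" "ka (0, 0) = (0, 0)" "bij (fd ka (0, 0))"
  "near (0, 0) (%w. g w = fst (ka w) * snd (ka w))"
proof -
 obtain B r where B: "hol_at B (0, 0)" "B (0, 0) = 0" "fd B (0, 0) (0, 1) ~= 0"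
  "hol_at r (0, 0)" "r (0, 0) ~= 0"
  "near (0, 0) (%w. g w = B w ^ 2 + fst w ^ 2 * r w)"
  using splitting[OF g gyy, of 2] h by blast
 obtain sg where sg: "hol_at sg (0, 0)" "sg (0, 0) ~= 0" "near (0, 0) (%y. sg y ^ 2 = - r y)"
  using hol_root[OF hol_at_uminus[OF B(4)], of 2] B(5) by auto
 define A where "A = (%w. fst w * sg w)"
 have A: "hol_at A (0, 0)" "fd A (0, 0) (a, b) = a * sg (0, 0)" "A (0, 0) = 0" for a b
 proof -
  show "hol_at A (0, 0)" unfolding A_def by (intro hols sg)
  show "fd A (0, 0) (a, b) = a * sg (0, 0)" unfolding A_def
   by (subst cdiff_mult(2)) (auto intro!: hols hol_at_cdiff[OF sg(1)] simp: fd_fst hols fd_eq[OF has_derivative_ident])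
 qed (simp add: A_def)
 define ka where "ka = (%w. (B w - A w, B w + A w))"
 have hka: "hol_at ka (0, 0)" unfolding ka_def by (intro hols A B)
 note c = hol_at_cdiff[OF A(1)] hol_at_cdiff[OF B(1)]
 have fdka: "fd ka (0, 0) v = (fd B (0, 0) v - fd A (0, 0) v, fd B (0, 0) v + fd A (0, 0) v)" for v
  unfolding ka_def by (simp add: cdiff_Pair(2) cdiff_add cdiff_diff c)
 have "bij (fd ka (0, 0))"
 proof (rule bij_fdI[OF hol_at_cdiff[OF hka]])
  fix v assume v: "fd ka (0, 0) v = 0"
  obtain a b where ab: "v = (a, b)" by (cases v)
  have "fd A (0, 0) v = 0" "fd B (0, 0) v = 0" using v by (auto simp: fdka prod_eq_iff eq_neg_iff_add_eq_0)
  then have "a = 0" using A(2) sg(2) ab by simp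
  moreover have "fd B (0, 0) (0, b) = b * fd B (0, 0) (0, 1)" using fd_clin[OF c(2), of b "(0, 1)"] by simp
  ultimately show "v = 0" using \<open>fd B (0, 0) v = 0\<close> B(3) ab by (simp add: zero_prod_def)
 qed
 moreover have "near (0, 0) (%w. g w = fst (ka w) * snd (ka w))"
  using B(6) sg(3)
 proof eventually_elim
  case (elim w)
  have "A w ^ 2 = - (fst w ^ 2 * r w)" by (simp add: A_def power_mult_distrib elim(2))
  then have "g w = B w ^ 2 - A w ^ 2" using elim(1) by simp
  then show ?case by (simp add: ka_def algebra_simps power2_eq_square)
 qed
 ultimately show ?thesis using that hka A B by (simp add: ka_def)
qed

text \<open>As for the node, with a cube root of \<open>- r\<close>, so that
  \<open>x^3 r = - A^3\<close>.\<close>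

lemma cusp_normal_form:
 fixes g :: "complex * complex => complex"
 assumes g: "hol_at g (0, 0)" "g (0, 0) = 0" "fd g (0, 0) (1, 0) = 0" "fd g (0, 0) (0, 1) = 0"
  and gyy: "fd (%p. fd g p (0, 1)) (0, 0) (0, 1) ~= 0"
  and h: "hess g (1, 0) (0, 1) (0, 0) = 0" "cub g (1, 0) (0, 1) (0, 0) ~= 0"
 obtains ka where "hol_at ka (0, 0)" "ka (0, 0) = (0, 0)" "bij (fd ka (0, 0))"
  "near (0, 0) (%w. g w = snd (ka w) ^ 2 - fst (ka w) ^ 3)"
proof -
 obtain B r where B: "hol_at B (0, 0)" "B (0, 0) = 0" "fd B (0, 0) (0, 1) ~= 0"
  "hol_at r (0, 0)" "r (0, 0) ~= 0"
  "near (0, 0) (%w. g w = B w ^ 2 + fst w ^ 3 * r w)"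
  using splitting[OF g gyy, of 3] h by blast
 obtain sg where sg: "hol_at sg (0, 0)" "sg (0, 0) ~= 0" "near (0, 0) (%y. sg y ^ 3 = - r y)"
  using hol_root[OF hol_at_uminus[OF B(4)], of 3] B(5) by auto
 define A where "A = (%w. fst w * sg w)"
 have A: "hol_at A (0, 0)" "fd A (0, 0) (a, b) = a * sg (0, 0)" "A (0, 0) = 0" for a b
 proof -
  show "hol_at A (0, 0)" unfolding A_def by (intro hols sg)
  show "fd A (0, 0) (a, b) = a * sg (0, 0)" unfolding A_def
   by (subst cdiff_mult(2)) (auto intro!: hols hol_at_cdiff[OF sg(1)] simp: fd_fst hols fd_eq[OF has_derivative_ident])
 qed (simp add: A_def)
 define ka where "ka = (%w. (A w, B w))"
 have hka: "hol_at ka (0, 0)" unfolding ka_def by (intro hols A B)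
 note c = hol_at_cdiff[OF A(1)] hol_at_cdiff[OF B(1)]
 have fdka: "fd ka (0, 0) v = (fd A (0, 0) v, fd B (0, 0) v)" for v
  unfolding ka_def by (simp add: cdiff_Pair(2) c)
 have "bij (fd ka (0, 0))"
 proof (rule bij_fdI[OF hol_at_cdiff[OF hka]])
  fix v assume v: "fd ka (0, 0) v = 0"
  obtain a b where ab: "v = (a, b)" by (cases v)
  have "fd A (0, 0) v = 0" "fd B (0, 0) v = 0" using v by (auto simp: fdka prod_eq_iff)
  then have "a = 0" using A(2) sg(2) ab by simp
  moreover have "fd B (0, 0) (0, b) = b * fd B (0, 0) (0, 1)" using fd_clin[OF c(2), of b "(0, 1)"] by simp
  ultimately show "v = 0" using \<open>fd B (0, 0) v = 0\<close> B(3) ab by (simp add: zero_prod_def)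
 qed
 moreover have "near (0, 0) (%w. g w = snd (ka w) ^ 2 - fst (ka w) ^ 3)"
  using B(6) sg(3)
 proof eventually_elim
  case (elim w)
  have "A w ^ 3 = - (fst w ^ 3 * r w)" by (simp add: A_def power_mult_distrib elim(2))
  then show ?case using elim(1) by (simp add: ka_def)
 qed
 ultimately show ?thesis using that hka A B by (simp add: ka_def)
qed

text \<open>
 The functions \<open>k\<^sub>0 + k\<^sub>1 x + G (u, x, y)\<close> with parameters \<open>k = (k\<^sub>0, k\<^sub>1, u)\<close> are a versal unfolding of
 the singularity of \<open>G (0, x, y)\<close>, if the latter has type \<open>A\<^sub>2\<close>.
\<close>
definition unf_crit :: "('u::cvec * complex * complex => complex) => complex * complex * 'u => complex * complex => bool" where
 "unf_crit G k w \<longleftrightarrow> fst k + fst (snd k) * fst w + G (snd (snd k), w) = 0 &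
   fst (snd k) + fd G (snd (snd k), w) ex = 0 & fd G (snd (snd k), w) ey = 0"

text \<open>After \<open>y\<close> is eliminated, \<open>k\<close> is critical at \<open>x\<close>
  when the line with intercept \<open>- k0\<close> and slope \<open>- k1\<close> is tangent at
  \<open>x\<close> to the graph of \<open>F (u, \<cdot>)\<close>. Measured from the inflection point
  \<open>xx u\<close>, slope and height of the tangent have order 2 and 3 in the distance
  \<open>t\<close>; suitable coordinates make them exactly \<open>s^2\<close> and
  \<open>s^3\<close>.\<close>

lemma unfolding_discriminant:
 fixes G :: "'u::cvec * complex * complex => complex"
 assumes G: "hol_at G (0, 0, 0)" and G0: "G (0, 0, 0) = 0" "fd G (0, 0, 0) ex = 0" "fd G (0, 0, 0) ey = 0"
  and Gyy: "fd (%p. fd G p ey) (0, 0, 0) ey ~= 0"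
  and h: "hess G ex ey (0, 0, 0) = 0" "cub G ex ey (0, 0, 0) ~= 0"
 obtains chx1 chx2 :: "complex * complex * 'u => complex" where
  "hol_at chx1 0" "hol_at chx2 0" "chx1 0 = 0" "chx2 0 = 0"
  "bij (fd (%k. (chx1 k, chx2 k, snd (snd k))) 0)"
  "near (0, 0) (%(k, w). unf_crit G k w --> chx1 k ^ 2 = chx2 k ^ 3 &
    (hess G ex ey (snd (snd k), w) = 0 \<longleftrightarrow> chx1 k = 0 & chx2 k = 0))"
  "!!P. near (0, 0) P ==>
    near 0 (%k. chx1 k ^ 2 = chx2 k ^ 3 --> (EX w. P w & unf_crit G k w))"
proof -
 obtain om F where r: "hol_at om (0, 0)" "om (0, 0) = 0" "hol_at F (0, 0)"
  "!!q. F q = G (fst q, snd q, om q)"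
  "near (0, 0, 0) (%p. fd G p ey = 0 \<longleftrightarrow> snd (snd p) = om (fst p, fst (snd p)))"
  "near (0, 0) (%q. fd G (fst q, snd q, om q) ey = 0)"
  "near (0, 0) (%q. fd F q (0, 1) = fd G (fst q, snd q, om q) ex)"
  "near (0, 0) (%q. fd (%q. fd F q (0, 1)) q (0, 1) = hess G ex ey (fst q, snd q, om q) /
    fd (%p. fd G p ey) (fst q, snd q, om q) ey)"
  "hess G ex ey (0, 0, 0) = 0 ==> fd (%q. fd (%q. fd F q (0, 1)) q (0, 1)) (0, 0) (0, 1) =
    cub G ex ey (0, 0, 0) / (fd (%p. fd G p ey) (0, 0, 0) ey)\<^sup>2"
  by (rule reduce_variable[OF G G0(3) Gyy]) blast
 define Fx where "Fx = (%q. fd F q (0, 1))"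
 define Fxx where "Fxx = (%q. fd Fx q (0, 1))"
 have hFx: "hol_at Fx (0, 0)" and hFxx: "hol_at Fxx (0, 0)" unfolding Fx_def Fxx_def by (intro hol_at_fd r)+
 have F00: "F (0, 0) = 0" "Fx (0, 0) = 0" "Fxx (0, 0) = 0" "fd Fxx (0, 0) (0, 1) ~= 0"
  using r(4)[of "(0,0)"] near_imp[OF r(7)] near_imp[OF r(8)] r(9) r(2) G0 h Gyy
  by (auto simp: Fx_def Fxx_def)
 \<comment> \<open>The third derivative is nonzero, so for each small \<open>u\<close> there is
   exactly one inflection point \<open>xx u\<close> near 0.\<close>
 have "bij (%v. fd Fxx (0, 0) (0, v))"
  by (rule bij_complex_linear) (use F00 hFxx in "auto intro: clin_fd_Pair0 hol_at_cdiff")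
 then obtain xx where xx: "hol_at xx 0" "xx 0 = 0"
  "near (0, 0) (%p. Fxx p = 0 \<longleftrightarrow> snd p = xx (fst p))"
  "near 0 (%x. Fxx (x, xx x) = 0)"
  by (rule hol_implicit_function[OF hFxx F00(3)]) blast
 have xx': "hol_at (%p. xx (fst p)) (0, 0::complex)" by (rule hol_at_compose[where f = fst]) (use xx in "auto intro!: hols")
 define T where "T = (%p. (fst p, xx (fst p) + snd p))"
 define T0 where "T0 = (%u. (u, xx u))"
 have hT: "hol_at T (0, 0)" "T (0, 0) = (0, 0)" unfolding T_def by (auto intro!: hols xx' xx)
 have hT0: "hol_at T0 0" "T0 0 = (0, 0)" unfolding T0_def by (auto intro!: hols xx)
 have fdT: "fd T p (0, 1) = (0, 1)" if "cdiff xx (fst p)" for p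
 proof -
  have f: "cdiff (fst::'u * complex => _) p" "fd (fst::'u * complex => _) p (0, 1) = 0"
   by (simp_all add: cdiff_fst_id cdiff_snd_id fd_fst_id fd_snd_id)
  have "fd (%p. xx (fst p)) p (0, 1) = 0"
   using cdiff_compose(2)[where g = xx and f = fst, OF that f(1)] f(2) linear_0[OF fd_linear[OF that]] by simp
  then show ?thesis unfolding T_def
   using cdiff_compose(1)[where g = xx and f = fst, OF that f(1)]
   by (simp add: cdiff_Pair(2) cdiff_add(2) hols fd_fst fd_snd fd_eq[OF has_derivative_ident])
 qed
 have cxx: "near (0, 0::complex) (%p. cdiff xx (fst p))"
  using xx(1) unfolding hol_at_def by (rule eventually_fst)
 have hT0': "hol_at (%p. T0 (fst p)) (0, 0::complex)"
  by (rule hol_at_compose[where f = fst]) (use hT0 in "auto intro!: hols")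
 have hKT: "hol_at (%p. K (T p)) (0, 0)" "hol_at (%p. K (T0 (fst p))) (0, 0::complex)"
  "hol_at (%u. K (T0 u)) 0"
  if "hol_at K (0, 0)" for K :: "'u * complex => complex"
  by (rule hol_at_compose[where f = T] hol_at_compose[where f = "%p. T0 (fst p)"] hol_at_compose[where f = T0];
    use hT hT0 hT0' that in simp)+
 have dT: "near (0, 0) (%p. fd (%p. K (T p)) p (0, 1) = fd K (T p) (0, 1) & cdiff (%p. K (T p)) p)"
  if "hol_at K (0, 0)" for K :: "'u * complex => complex"
 proof -
  have "near (0, 0) (%p. cdiff K (T p))"
   by (rule eventually_hol[OF hT]) (use that in "simp add: hol_at_def")
  moreover have "near (0, 0) (cdiff T)" using hT(1) by (simp add: hol_at_def)
  ultimately show ?thesis using cxx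
   by eventually_elim (simp add: cdiff_compose[where g = K and f = T] fdT)
 qed
 have dT0: "near (0, 0::complex) (%p. fd (%p. K (T0 (fst p))) p (0, 1) = 0 & cdiff (%p. K (T0 (fst p))) p)"
  if "hol_at K (0, 0)" for K :: "'u * complex => complex"
 proof -
  have "near 0 (cdiff (%u. K (T0 u)))" using hKT(3)[OF that] by (simp add: hol_at_def)
  from eventually_fst[OF this, of "0::complex"] show ?thesis
  proof eventually_elim
   case (elim p)
   have f: "cdiff (fst::'u * complex => _) p" "fd (fst::'u * complex => _) p (0, 1) = 0"
    by (simp_all add: cdiff_fst_id cdiff_snd_id fd_fst_id fd_snd_id)
   show ?case
    using cdiff_compose[where g = "%u. K (T0 u)" and f = fst, OF elim f(1)] f(2) linear_0[OF fd_linear[OF elim]] by simp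
  qed
 qed
 have T0T: "T (u, 0) = T0 u" for u by (simp add: T_def T0_def)

 have hc: "hol_at (%p. Fxx (T p)) (0, 0)" by (rule hKT(1)[OF hFxx])
 have "near 0 (%u. Fxx (T (u, 0)) = 0)" using xx(4) by (simp add: T_def)
 from hol_divide_snd[OF hc this]
 obtain b where b: "hol_at b (0, 0)" "near (0, 0) (%p. Fxx (T p) = snd p * b p)"
  "!!u. b (u, 0) = fd (%p. Fxx (T p)) (u, 0) (0, 1)" by blast
 have b0: "b (0, 0) ~= 0"
  using b(3)[of 0] near_imp[OF dT[OF hFxx]] F00(4) hT(2) by simp

 define h1 where "h1 = (%p. Fx (T p) - Fx (T0 (fst p)))"
 have hh1: "hol_at h1 (0, 0)" unfolding h1_def by (intro hols hKT hFx)
 have der: "near (0, 0) (%p. fd h1 p (0, 1) = snd p ^ 1 * b p)"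
  using dT[OF hFx] dT0[OF hFx] b(2)
  by eventually_elim (simp add: h1_def cdiff_diff(2) Fxx_def)
 have zero: "near 0 (%u. h1 (u, 0) = 0)" by (simp add: h1_def T0T)
 obtain q2 where q2: "hol_at q2 (0, 0)" "near (0, 0) (%p. h1 p = snd p ^ Suc 1 * q2 p)"
  "!!u. q2 (u, 0) = b (u, 0) / of_nat (Suc 1)"
  by (rule hol_antiderivative[OF hh1 zero b(1) der]) blast

 \<comment> \<open>Vertical distance, at the inflection abscissa, between the graph and its tangent
   at distance \<open>t\<close>. Its derivative in \<open>t\<close> is
   \<open>t * Fxx = t^2 * b\<close>, hence the order 3.\<close>
 define a where "a = (%p. snd p * Fx (T p) - F (T p) + F (T0 (fst p)))"
 have ha: "hol_at a (0, 0)" unfolding a_def by (intro hols hKT hFx r)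
 have der: "near (0, 0) (%p. fd a p (0, 1) = snd p ^ 2 * b p)"
  using dT[OF hFx] dT[OF r(3)] dT0[OF r(3)] b(2)
 proof eventually_elim
  case (elim p)
  have s: "cdiff (snd::'u * complex => _) p" "fd (snd::'u * complex => _) p (0, 1) = 1"
   by (simp_all add: cdiff_fst_id cdiff_snd_id fd_fst_id fd_snd_id)
  have "fd a p (0, 1) = snd p * Fxx (T p)" unfolding a_def
   using elim s by (simp add: cdiff_add cdiff_diff cdiff_mult Fxx_def) (simp add: Fx_def)
  then show ?case using elim(4) by (simp add: power2_eq_square)
 qed
 have zero: "near 0 (%u. a (u, 0) = 0)" by (simp add: a_def T0T)
 obtain q3 where q3: "hol_at q3 (0, 0)" "near (0, 0) (%p. a p = snd p ^ Suc 2 * q3 p)"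
  "!!u. q3 (u, 0) = b (u, 0) / of_nat (Suc 2)"
  by (rule hol_antiderivative[OF ha zero b(1) der]) blast

 have q20: "q2 (0, 0) ~= 0" "q3 (0, 0) ~= 0" unfolding q2(3) q3(3) using b0 by (auto simp del: of_nat_Suc)
 obtain rh where rh: "hol_at rh (0, 0)" "rh (0, 0) ~= 0" "near (0, 0) (%p. rh p ^ 2 = - q2 p)"
  using hol_root[OF hol_at_uminus[OF q2(1)], of 2] q20 by auto
 \<comment> \<open>The second component \<open>s = t * rh\<close> is a uniformizing parameter with
   \<open>h1 = - s^2\<close>.\<close>
 define \<Sigma> where "\<Sigma> = (%p. (fst p, snd p * rh p))"
 have h\<Sigma>: "hol_at \<Sigma> (0, 0)" "\<Sigma> (0, 0) = (0, 0)" unfolding \<Sigma>_def by (auto intro!: hols rh)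
 have "bij (fd \<Sigma> (0, 0))"
 proof (rule bij_fdI[OF hol_at_cdiff[OF h\<Sigma>(1)]])
  fix v assume v: "fd \<Sigma> (0, 0) v = 0"
  have "fd \<Sigma> (0, 0) v = (fst v, snd v * rh (0, 0))" unfolding \<Sigma>_def
   by (simp add: cdiff_Pair(2) cdiff_mult hols hol_at_cdiff[OF rh(1)] fd_fst fd_snd fd_eq[OF has_derivative_ident])
  then show "v = 0" using v rh(2) by (simp add: prod_eq_iff)
 qed
 from hol_inverse_function[OF h\<Sigma>(1) this]
 obtain \<Lambda> where \<Lambda>: "hol_at \<Lambda> (0, 0)" "\<Lambda> (0, 0) = (0, 0)"
  "near (0, 0) (%p. \<Lambda> (\<Sigma> p) = p)" "near (0, 0) (%p. \<Sigma> (\<Lambda> p) = p)"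
  unfolding h\<Sigma>(2) by blast
 define N where "N = (%p. q3 (\<Lambda> p) / rh (\<Lambda> p) ^ 3)"
 have hN: "hol_at N (0, 0)" unfolding N_def
  by (intro hols hol_at_compose[where f = \<Lambda> and g = q3] hol_at_compose[where f = \<Lambda> and g = rh])
   (use \<Lambda> rh q3 in auto)
 obtain e o' where eo: "hol_at e (0, 0)" "hol_at o' (0, 0)"
  "near (0, 0) (%p. N p = e (fst p, snd p ^ 2) + snd p * o' (fst p, snd p ^ 2))"
  using hol_even_odd[OF hN] by blast
 have e0: "e (0, 0) ~= 0"
 proof -
  have "e (0, 0) = q3 (0, 0) / rh (0, 0) ^ 3"
   using near_imp[OF eo(3)] \<Lambda>(2) by (simp add: N_def)
  then show ?thesis using q20 rh(2) by simp
 qed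

 define uu where "uu = (%k::complex * complex * 'u. snd (snd k))"
 have huu: "hol_at uu k" for k unfolding uu_def by (intro hols)
 have uu0: "uu 0 = 0" by (simp add: uu_def)
 define chx2 where "chx2 = (%k. fst (snd k) + Fx (T0 (uu k)))"
 define al where "al = (%k. fst k + xx (uu k) * fst (snd k) + F (T0 (uu k)))"
 \<comment> \<open>At critical parameters \<open>chx2 = s^2\<close> and
   \<open>al = s^3 * e (u, s^2) + s^4 * o' (u, s^2)\<close>. The second summand is
   \<open>chx2^2 * o' (u, chx2)\<close>, a function of \<open>k\<close>; removing it and dividing by
   \<open>e\<close> leaves \<open>s^3\<close>.\<close>
 define chx1 where "chx1 = (%k. (al k - chx2 k ^ 2 * o' (uu k, chx2 k)) / e (uu k, chx2 k))"
 have cu: "hol_at (%k. K (uu k)) 0" "fd (%k. K (uu k)) 0 (x, y, 0) = 0" if "hol_at K 0" for K :: "'u => complex" and x y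
 proof -
  show "hol_at (%k. K (uu k)) 0" by (rule hol_at_compose[where f = uu]) (use that huu uu0 in auto)
  have "fd uu 0 v = snd (snd v)" for v unfolding uu_def by (rule fd_eq) (auto intro!: derivative_eq_intros)
  then show "fd (%k. K (uu k)) 0 (x, y, 0) = 0"
   using cdiff_compose(2)[where f = uu and g = K and x = 0 and v = "(x, y, 0)"] hol_at_cdiff[OF that] hol_at_cdiff[OF huu] uu0
   by (simp add: linear_0[OF fd_linear])
 qed
 note hK = cu[OF hKT(3)[OF hFx]] cu[OF hKT(3)[OF r(3)]] cu[OF xx(1)]
 have hchx2: "hol_at chx2 0" unfolding chx2_def by (intro hols hK)
 have chx20: "chx2 0 = 0" by (simp add: chx2_def uu0 hT0 F00)
 have hp: "hol_at (%k. (uu k, chx2 k)) 0" by (intro hols huu hchx2)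
 have hae: "hol_at (%k. e (uu k, chx2 k)) 0" "hol_at (%k. o' (uu k, chx2 k)) 0"
  by (rule hol_at_compose[OF _ hp], simp add: uu0 chx20 eo)+
 have hal: "hol_at al 0" unfolding al_def by (intro hols hK)
 have al0: "al 0 = 0" by (simp add: al_def uu0 hT0 F00)
 have hchx1: "hol_at chx1 0" unfolding chx1_def by (intro hols hae hal hchx2) (simp add: uu0 chx20 e0)
 have chx10: "chx1 0 = 0" by (simp add: chx1_def chx20 al0)
 have fdp: "fd (fst :: complex * complex * 'u => _) p v = fst v"
   "fd (%k::complex * complex * 'u. fst (snd k)) p v = fst (snd v)" for p v
  by (rule fd_eq, auto intro!: derivative_eq_intros)+
 have cp: "cdiff (fst :: complex * complex * 'u => _) p"
   "cdiff (%k::complex * complex * 'u. fst (snd k)) p" for p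
  by (intro hols)+
 have d2: "fd chx2 0 (x, y, 0) = y" for x y
  unfolding chx2_def by (subst cdiff_add(2)) (auto simp: fdp cp hK hol_at_cdiff)
 have dal: "fd al 0 (x, y, 0) = x" for x y
 proof -
  have c1: "cdiff (%k. xx (uu k) * fst (snd k)) 0" by (intro hols hol_at_cdiff hK)
  have "fd (%k. xx (uu k) * fst (snd k)) 0 (x, y, 0) = 0"
   by (subst cdiff_mult(2)) (auto simp: cp hol_at_cdiff hK uu0 xx)
  moreover have "fd al 0 (x, y, 0) = fd fst 0 (x, y, 0::'u) + fd (%k. xx (uu k) * fst (snd k)) 0 (x, y, 0) + fd (%k. F (T0 (uu k))) 0 (x, y, 0)"
   unfolding al_def
   using cdiff_add[OF cdiff_add(1)[OF cp(1) c1] hol_at_cdiff[OF hK(3)]] cdiff_add(2)[OF cp(1) c1] by simp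
  ultimately show ?thesis by (simp add: fdp hK)
 qed
 have d1: "fd chx1 0 (x, 0, 0) * e (0, 0) = x" for x
 proof -
  have "near 0 (%k. chx1 k * e (uu k, chx2 k) + chx2 k * (chx2 k * o' (uu k, chx2 k)) = al k)"
  proof -
   have "near 0 (%k. e (uu k, chx2 k) ~= 0)"
    by (rule hol_at_nonzero[OF hae(1)]) (simp add: uu0 chx20 e0)
   then show ?thesis by (rule eventually_mono) (simp add: chx1_def power2_eq_square)
  qed
  moreover have c: "cdiff (%k. chx1 k * e (uu k, chx2 k)) 0" "cdiff (%k. chx2 k * o' (uu k, chx2 k)) 0"
   "cdiff (%k. chx2 k * (chx2 k * o' (uu k, chx2 k))) 0"
   by (intro hols hol_at_cdiff hchx1 hchx2 hae)+
  ultimately have "fd al 0 = fd (%k. chx1 k * e (uu k, chx2 k) + chx2 k * (chx2 k * o' (uu k, chx2 k))) 0"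
   by (intro cdiff_transform(2)) (auto intro: hols)
  then have "x = fd (%k. chx1 k * e (uu k, chx2 k) + chx2 k * (chx2 k * o' (uu k, chx2 k))) 0 (x, 0, 0)"
   using dal[of x 0] by simp
  also have "\<dots> = fd (%k. chx1 k * e (uu k, chx2 k)) 0 (x, 0, 0) + fd (%k. chx2 k * (chx2 k * o' (uu k, chx2 k))) 0 (x, 0, 0)"
   by (rule cdiff_add(2)[OF c(1,3)])
  also have "fd (%k. chx1 k * e (uu k, chx2 k)) 0 (x, 0, 0) = fd chx1 0 (x, 0, 0) * e (0, 0)"
   by (subst cdiff_mult(2)) (auto simp: hol_at_cdiff hchx1 hae chx10 uu0 chx20)
  also have "fd (%k. chx2 k * (chx2 k * o' (uu k, chx2 k))) 0 (x, 0, 0) = 0"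
   by (subst cdiff_mult(2)) (auto simp: hol_at_cdiff hchx2 c chx20)
  finally show ?thesis by simp
 qed
 have bij: "bij (fd (%k. (chx1 k, chx2 k, snd (snd k))) 0)"
 proof (rule bij_fdI)
  show c: "cdiff (%k. (chx1 k, chx2 k, snd (snd k))) 0" by (intro hols hol_at_cdiff hchx1 hchx2)
  fix v assume v: "fd (%k. (chx1 k, chx2 k, snd (snd k))) 0 v = 0"
  have "fd (%k. (chx1 k, chx2 k, snd (snd k))) 0 v = (fd chx1 0 v, fd chx2 0 v, snd (snd v))"
   by (simp add: cdiff_Pair hol_at_cdiff hchx1 hchx2 hols fd_snd fd_eq[OF has_derivative_ident])
  then have *: "fd chx1 0 v = 0" "fd chx2 0 v = 0" "snd (snd v) = 0" using v by (auto simp: prod_eq_iff)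
  then obtain x y where xy: "v = (x, y, 0)" by (cases v) auto
  then have "y = 0" using * d2 by simp
  then show "v = 0" using d1[of x] * xy by (simp add: zero_prod_def)
 qed

 have E1: "near (0, 0) (%(k, w). unf_crit G k w --> chx1 k ^ 2 = chx2 k ^ 3 &
    (hess G ex ey (snd (snd k), w) = 0 \<longleftrightarrow> chx1 k = 0 & chx2 k = 0))"
 proof -
  define A1 where "A1 = (%p::(complex * complex * 'u) \<times> complex * complex. (uu (fst p), snd p))"
  define A2 where "A2 = (%p::(complex * complex * 'u) \<times> complex * complex. (uu (fst p), fst (snd p)))"
  define A3 where "A3 = (%p::(complex * complex * 'u) \<times> complex * complex. (uu (fst p), fst (snd p) - xx (uu (fst p))))"
  have z: "(0, 0) = (0::(complex * complex * 'u) \<times> complex * complex)" by (simp add: zero_prod_def)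
  have huu': "hol_at (%p::(complex * complex * 'u) \<times> complex * complex. uu (fst p)) 0" unfolding uu_def by (intro hols)
  have hxx': "hol_at (%p::(complex * complex * 'u) \<times> complex * complex. xx (uu (fst p))) 0"
   by (rule hol_at_compose[OF _ huu']) (simp add: uu0 xx)
  have A1: "hol_at A1 0" "A1 0 = (0, 0, 0)"
   by (unfold A1_def, intro hols huu') (simp add: uu0, simp add: zero_prod_def)
  have A2: "hol_at A2 0" "A2 0 = (0, 0)" unfolding A2_def by (auto intro!: hols huu' simp: uu0)
  have A3: "hol_at A3 0" "A3 0 = (0, 0)" unfolding A3_def by (auto intro!: hols huu' hxx' simp: uu0 xx)
  define A4 where "A4 = (%p. \<Sigma> (A3 p))"
  have A4: "hol_at A4 0" "A4 0 = (0, 0)" unfolding A4_def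
   using hol_at_compose[where f = A3 and g = \<Sigma> and x = 0] A3 h\<Sigma> by auto
  have A1': "hol_at (%p. fd (%p. fd G p ey) (A1 p) ey) 0"
   by (rule hol_at_compose[OF _ A1(1)]) (simp add: A1(2) hol_at_fd G)
  have "near 0 (%p. fd (%p. fd G p ey) (A1 p) ey ~= 0)"
   by (rule hol_at_nonzero[OF A1']) (simp add: A1(2) Gyy)
  moreover have "near 0 (%p. rh (A3 p) ~= 0)"
   by (rule eventually_hol[OF A3 hol_at_nonzero[OF rh(1,2)]])
  moreover have "near (0, 0) (%p::(complex * complex * 'u) \<times> complex * complex. e (uu (fst p), chx2 (fst p)) ~= 0)"
   by (rule eventually_fst[OF hol_at_nonzero[OF hae(1)]]) (simp add: uu0 chx20 e0)
  ultimately show ?thesis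
   using eventually_hol[OF A1 r(5)] eventually_hol[OF A2 r(7)] eventually_hol[OF A2 r(8)] eventually_hol[OF A2 xx(3)]
    eventually_hol[OF A3 q2(2)] eventually_hol[OF A3 q3(2)] eventually_hol[OF A3 rh(3)]
    eventually_hol[OF A3 \<Lambda>(3)] eventually_hol[OF A4 eo(3)]
   unfolding zero_prod_def[symmetric]
  proof eventually_elim
   case (elim p)
   obtain k w where p: "p = (k, w)" by (cases p)
   define u where "u = uu k"
   define x where "x = fst w"
   define t where "t = x - xx u"
   define s where "s = t * rh (u, t)"
   have A: "A1 p = (u, w)" "A2 p = (u, x)" "A3 p = (u, t)" "A4 p = (u, s)"
    by (auto simp: p A1_def A2_def A3_def A4_def u_def x_def t_def s_def \<Sigma>_def)
   show ?case unfolding p split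
   proof
    assume crit: "unf_crit G k w"
    have u': "snd (snd k) = u" by (simp add: u_def uu_def)
    have y: "snd w = om (u, x)" using elim(4) crit by (simp add: A unf_crit_def u' x_def)
    then have w: "w = (x, om (u, x))" by (simp add: x_def prod_eq_iff)
    have Tt: "T (u, t) = (u, x)" "T0 u = (u, xx u)" by (simp_all add: T_def T0_def t_def)
    have k1: "fst (snd k) = - Fx (u, x)" using elim(5) crit
     by (simp add: A unf_crit_def u' w Fx_def eq_neg_iff_add_eq_0)
    have k0: "fst k = - (fst (snd k) * x) - F (u, x)" using crit
     by (simp add: unf_crit_def u' w r(4) algebra_simps eq_neg_iff_add_eq_0)
    have "h1 (u, t) = t ^ 2 * q2 (u, t)" using elim(8) by (simp add: A power2_eq_square)
    moreover have "chx2 k = - h1 (u, t)" by (simp add: chx2_def k1 h1_def Tt u_def[symmetric])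
    moreover have "s ^ 2 = - (t ^ 2 * q2 (u, t))" using elim(10) by (simp add: A s_def power_mult_distrib)
    ultimately have c2: "chx2 k = s ^ 2" by simp
    have "al k = a (u, t)"
     by (simp add: al_def u_def[symmetric] k0 k1 a_def Tt, simp add: t_def algebra_simps)
    also have "\<dots> = t ^ 3 * q3 (u, t)" using elim(9) by (simp add: A numeral_3_eq_3)
    also have "\<dots> = s ^ 3 * N (u, s)"
    proof -
     have "\<Lambda> (u, s) = (u, t)" using elim(11) by (simp add: A \<Sigma>_def s_def)
     then show ?thesis using elim(2) by (simp add: N_def s_def A power_mult_distrib)
    qed
    also have "N (u, s) = e (u, chx2 k) + s * o' (u, chx2 k)" using elim(12) by (simp add: A c2)
    finally have "al k - chx2 k ^ 2 * o' (u, chx2 k) = s ^ 3 * e (u, chx2 k)"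
     by (simp add: c2 algebra_simps power2_eq_square power3_eq_cube)
    then have c1: "chx1 k = s ^ 3" using elim(3) by (simp add: chx1_def p u_def)
    have "hess G ex ey (u, w) = 0 \<longleftrightarrow> Fxx (u, x) = 0"
     using elim(6) elim(1) by (simp add: A w Fxx_def Fx_def[abs_def])
    also have "\<dots> \<longleftrightarrow> s = 0" using elim(7) elim(2) by (simp add: A s_def t_def)
    finally show "chx1 k ^ 2 = chx2 k ^ 3 & (hess G ex ey (snd (snd k), w) = 0 \<longleftrightarrow> chx1 k = 0 & chx2 k = 0)"
     by (simp add: c1 c2 u' power_mult[symmetric])
   qed
  qed
 qed

 have E2: "near 0 (%k. chx1 k ^ 2 = chx2 k ^ 3 --> (EX w. P w & unf_crit G k w))"
  if P: "near (0, 0) P" for P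
 proof -
  \<comment> \<open>\<open>B1\<close> and \<open>B2\<close> send \<open>(u, s)\<close> to
    \<open>(u, x)\<close> and to the critical point \<open>(x, y)\<close> with this value of the
    uniformizing parameter.\<close>
  define B1 where "B1 = (%p. T (\<Lambda> p))"
  define B2 where "B2 = (%p. (snd (B1 p), om (B1 p)))"
  have B1: "hol_at B1 (0, 0)" "B1 (0, 0) = (0, 0)" unfolding B1_def
   using hol_at_compose[where f = \<Lambda> and g = T and x = "(0,0)"] \<Lambda> hT by auto
  have homB: "hol_at (%p. om (B1 p)) (0, 0)" by (rule hol_at_compose[OF _ B1(1)]) (simp add: B1 r)
  have B2: "hol_at B2 (0, 0)" "B2 (0, 0) = (0, 0)" unfolding B2_def
   by (auto intro!: hols homB B1(1) simp: B1 r)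
  define Q where "Q = (%p. P (B2 p) & fd G (fst (B1 p), B2 p) ey = 0 & Fx (B1 p) = fd G (fst (B1 p), B2 p) ex
   & h1 (\<Lambda> p) = snd (\<Lambda> p) ^ 2 * q2 (\<Lambda> p) & a (\<Lambda> p) = snd (\<Lambda> p) ^ 3 * q3 (\<Lambda> p) & rh (\<Lambda> p) ^ 2 = - q2 (\<Lambda> p)
   & \<Sigma> (\<Lambda> p) = p & N p = e (fst p, snd p ^ 2) + snd p * o' (fst p, snd p ^ 2) & rh (\<Lambda> p) ~= 0)"
  have "near (0, 0) Q"
   using eventually_hol[OF B2 P] eventually_hol[OF B1 r(6)] eventually_hol[OF B1 r(7)]
    eventually_hol[OF \<Lambda>(1,2) q2(2)] eventually_hol[OF \<Lambda>(1,2) q3(2)] eventually_hol[OF \<Lambda>(1,2) rh(3)] \<Lambda>(4) eo(3)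
    eventually_hol[OF \<Lambda>(1,2) hol_at_nonzero[OF rh(1,2)]]
   by eventually_elim (simp add: Q_def B2_def Fx_def numeral_2_eq_2 numeral_3_eq_3)
  then obtain d where d: "d > 0" "!!p. dist p (0, 0) < d ==> Q p" unfolding eventually_nhds_metric by blast
  have "near 0 (%k. dist (uu k) 0 < d / 2)"
   by (rule eventually_hol[OF huu uu0]) (use d in \<open>auto simp: eventually_nhds_metric intro!: exI[of _ "d / 2"]\<close>)
  moreover have "near 0 (%k. dist (chx2 k) 0 < (d / 2)\<^sup>2)"
   by (rule eventually_hol[OF hchx2 chx20]) (use d in \<open>auto simp: eventually_nhds_metric intro!: exI[of _ "(d / 2)\<^sup>2"]\<close>)
  moreover have "near 0 (%k. e (uu k, chx2 k) ~= 0)"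
   by (rule hol_at_nonzero[OF hae(1)]) (simp add: uu0 chx20 e0)
  ultimately show ?thesis
  proof eventually_elim
   case (elim k)
   show ?case
   proof
    assume k: "chx1 k ^ 2 = chx2 k ^ 3"
    \<comment> \<open>If \<open>chx2 k = 0\<close>, then also \<open>chx1 k = 0\<close>, and
      division by zero yields \<open>s = 0\<close>, as it should.\<close>
    define s where "s = chx1 k / chx2 k"
    have s: "chx2 k = s ^ 2" "chx1 k = s ^ 3"
    proof -
     have "s ^ 2 = chx2 k ^ 3 / chx2 k ^ 2" by (simp add: s_def power_divide k)
     then show "chx2 k = s ^ 2" by (simp add: power3_eq_cube power2_eq_square)
     have "s ^ 3 = chx1 k ^ 3 / chx1 k ^ 2" by (simp add: s_def power_divide k)
     then show "chx1 k = s ^ 3" by (simp add: power3_eq_cube power2_eq_square)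
    qed
    define u where "u = uu k"
    have "norm s ^ 2 < (d / 2)\<^sup>2" using elim(2) by (simp add: s(1) norm_power)
    then have "norm s < d / 2" by (rule power2_less_imp_less) (use d(1) in simp)
    moreover have "dist (u, s) (0, 0) <= dist u 0 + norm s"
     using sqrt_sum_squares_le_sum[of "dist u 0" "norm s"] by (simp add: dist_Pair_Pair)
    ultimately have "dist (u, s) (0, 0) < d" using elim(1) by (simp add: u_def)
    then have Q: "Q (u, s)" by (rule d(2))
    obtain u1 t where ut: "\<Lambda> (u, s) = (u1, t)" by (cases "\<Lambda> (u, s)")
    have u1: "u1 = u" "s = t * rh (u, t)" using Q by (auto simp: Q_def ut \<Sigma>_def)
    define x where "x = xx u + t"
    have B: "B1 (u, s) = (u, x)" "B2 (u, s) = (x, om (u, x))" by (simp_all add: B1_def B2_def ut u1(1) T_def x_def)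
    have Tt: "T (u, t) = (u, x)" "T0 u = (u, xx u)" by (simp_all add: T_def T0_def x_def)
    have u': "snd (snd k) = u" by (simp add: u_def uu_def)
    have Qh: "h1 (u, t) = t ^ 2 * q2 (u, t)" "a (u, t) = t ^ 3 * q3 (u, t)"
     "rh (u, t) ^ 2 = - q2 (u, t)" "rh (u, t) ~= 0"
     using Q unfolding Q_def by (simp_all add: ut u1(1))
    have QN: "N (u, s) = e (u, s ^ 2) + s * o' (u, s ^ 2)" using Q unfolding Q_def by simp
    have "chx2 k = (t * rh (u, t)) ^ 2" using s(1) u1(2) by simp
    then have "chx2 k = - h1 (u, t)" by (simp add: power_mult_distrib Qh)
    then have k1: "fst (snd k) = - Fx (u, x)" by (simp add: chx2_def h1_def Tt u_def[symmetric] algebra_simps eq_neg_iff_add_eq_0)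
    have "al k = chx1 k * e (u, chx2 k) + chx2 k ^ 2 * o' (u, chx2 k)"
     using elim(3) by (simp add: chx1_def u_def)
    also have "\<dots> = s ^ 3 * N (u, s)" unfolding QN s
     by (simp add: algebra_simps power2_eq_square power3_eq_cube)
    also have "s ^ 3 = t ^ 3 * rh (u, t) ^ 3" using u1(2) by (simp add: power_mult_distrib)
    also have "t ^ 3 * rh (u, t) ^ 3 * N (u, s) = a (u, t)"
     using Qh(4) by (simp add: Qh(2) ut u1(1) N_def)
    finally have "fst k = - (fst (snd k) * x) - F (u, x)"
     by (simp add: al_def u_def[symmetric] k1 a_def Tt) (simp add: x_def algebra_simps)
    then have "unf_crit G k (B2 (u, s))"
     using Q unfolding Q_def by (simp add: unf_crit_def u' B k1 r(4))
    then show "EX w. P w & unf_crit G k w" using Q unfolding Q_def by blast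
   qed
  qed
 qed
 show ?thesis using that[OF hchx1 hchx2 chx10 chx20 bij E1 E2] .
qed

section \<open>Algebras of polynomial functions\<close>

text \<open>An algebra of functions rather than of formal polynomials: elements are evaluated by
  application, and relations between the generators hold automatically. Degrees are recovered from
  the behaviour under scaling.\<close>

inductive_set polys :: "('a => complex) set => ('a => complex) set" for X where
 const: "(%_. c) : polys X"
| gen: "f : X ==> f : polys X"
| add: "f : polys X ==> g : polys X ==> (%z. f z + g z) : polys X"
| mult: "f : polys X ==> g : polys X ==> (%z. f z * g z) : polys X"

lemma polys_uminus: "f : polys X ==> (%z. - f z) : polys X"
 using polys.mult[OF polys.const[of "-1"]] by simp

lemma polys_diff: "f : polys X ==> g : polys X ==> (%z. f z - g z) : polys X"
 using polys.add[OF _ polys_uminus] by simp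

lemma polys_sum: "(!!i. i : I ==> f i : polys X) ==> (%z. \<Sum>i\<in>I. f i z) : polys X"
 by (induction I rule: infinite_finite_induct) (auto intro: polys.intros)

lemma polys_prod: "(!!i. i : I ==> f i : polys X) ==> (%z. \<Prod>i\<in>I. f i z) : polys X"
 by (induction I rule: infinite_finite_induct) (auto intro: polys.intros)

lemma polys_power: "f : polys X ==> (%z. f z ^ n) : polys X"
 by (induction n) (auto intro: polys.intros)

lemmas polys_intros = polys.const polys.add polys.mult polys_uminus polys_diff polys_sum polys_prod polys_power

lemma polys_compose:
 assumes "P : polys X" "!!f. f : X ==> (%z. f (T z)) : polys Y"
 shows "(%z. P (T z)) : polys Y"
 using assms(1) by induction (auto intro: polys.intros assms(2))

lemma polys_mono: "X <= polys Y ==> polys X <= polys Y"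
 using polys_compose[of _ X "%z. z" Y] by auto

definition xmonom :: "('i::finite => 'a => complex) => ('i => nat) => 'a => complex" where
 "xmonom xs e z = (\<Prod>i\<in>UNIV. xs i z ^ e i)"

lemma xmonom_add: "xmonom xs (%i. e i + e' i) z = xmonom xs e z * xmonom xs e' z"
 by (simp add: xmonom_def power_add prod.distrib)

lemma xmonom_zero [simp]: "xmonom xs (%_. 0) z = 1" by (simp add: xmonom_def)

lemma xmonom_unit: "xmonom xs (%j. if j = i then n else 0) z = xs i z ^ n"
proof -
 have "xmonom xs (%j. if j = i then n else 0) z = (\<Prod>j\<in>UNIV. if j = i then xs i z ^ n else 1)"
  unfolding xmonom_def by (rule prod.cong) auto
 then show ?thesis by simp
qed

lemma xmonom_polys: "xmonom xs e : polys (range xs)"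
 unfolding xmonom_def[abs_def] by (intro polys_intros polys.gen) auto

definition normal_form :: "('a => complex) set => ('i::finite => 'a => complex) => ('a => complex) set" where
 "normal_form R xs = {P. EX A c. finite A & (ALL e. c e : polys R) & P = (%z. \<Sum>e\<in>A. c e z * xmonom xs e z)}"

lemma normal_form_term: "r : polys R ==> (%z. r z * xmonom xs e z) : normal_form R xs"
 unfolding normal_form_def by (intro CollectI exI[of _ "{e}"] exI[of _ "%_. r"]) auto

lemma normal_form_add:
 assumes "P : normal_form R xs" "Q : normal_form R xs"
 shows "(%z. P z + Q z) : normal_form R xs"
proof -
 obtain A c where 1: "finite A" "!!e. c e : polys R" "P = (%z. \<Sum>e\<in>A. c e z * xmonom xs e z)"
  using assms(1) unfolding normal_form_def by blast
 obtain B d where 2: "finite B" "!!e. d e : polys R" "Q = (%z. \<Sum>e\<in>B. d e z * xmonom xs e z)"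
  using assms(2) unfolding normal_form_def by blast
 define c' where "c' = (%e z. (if e : A then c e z else 0) + (if e : B then d e z else 0))"
 have "c' e : polys R" for e unfolding c'_def
  using 1(2) 2(2) by (cases "e : A"; cases "e : B") (auto intro: polys.intros)
 moreover have "P z + Q z = (\<Sum>e\<in>A Un B. c' e z * xmonom xs e z)" for z
 proof -
  have "P z = (\<Sum>e\<in>A Un B. (if e : A then c e z else 0) * xmonom xs e z)"
   unfolding 1(3) by (rule sum.mono_neutral_cong_left) (use 1 2 in auto)
  moreover have "Q z = (\<Sum>e\<in>A Un B. (if e : B then d e z else 0) * xmonom xs e z)"
   unfolding 2(3) by (rule sum.mono_neutral_cong_left) (use 1 2 in auto)
  ultimately show ?thesis by (simp add: c'_def sum.distrib distrib_right)
 qed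
 ultimately show ?thesis unfolding normal_form_def
  using 1(1) 2(1) by (intro CollectI exI[of _ "A Un B"] exI[of _ c']) auto
qed

lemma normal_form_sum:
 "(!!i. i : I ==> f i : normal_form R xs) ==> (%z. \<Sum>i\<in>I. f i z) : normal_form R xs"
proof (induction I rule: infinite_finite_induct)
 case (insert i I)
 then show ?case using normal_form_add[of "f i" R xs "%z. \<Sum>i\<in>I. f i z"] by auto
qed (use normal_form_term[where R = R and xs = xs, OF polys.const[of 0]] in auto)

lemma normal_form_mult_term:
 assumes "P : normal_form R xs" "r : polys R"
 shows "(%z. (r z * xmonom xs e z) * P z) : normal_form R xs"
proof -
 obtain A c where 1: "finite A" "!!e. c e : polys R" "P = (%z. \<Sum>e\<in>A. c e z * xmonom xs e z)"
  using assms(1) unfolding normal_form_def by blast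
 have "(r z * xmonom xs e z) * P z = (\<Sum>e'\<in>A. (r z * c e' z) * xmonom xs (%i. e i + e' i) z)" for z
  by (simp add: 1 sum_distrib_left xmonom_add mult_ac)
 moreover have "(%z. \<Sum>e'\<in>A. (r z * c e' z) * xmonom xs (%i. e i + e' i) z) : normal_form R xs"
  by (intro normal_form_sum normal_form_term polys.mult assms 1)
 ultimately show ?thesis by simp
qed

lemma polys_normal_form:
 assumes "P : polys (R Un range xs)"
 shows "P : normal_form R xs"
 using assms
proof induction
 case (const c)
 then show ?case using normal_form_term[where R = R and xs = xs and e = "%_. 0", OF polys.const[of c]] by simp
next
 case (gen f)
 then show ?case
 proof
  assume "f : R"
  then show ?thesis using normal_form_term[where R = R and xs = xs and e = "%_. 0" and r = f, OF polys.gen] by simp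
 next
  assume "f : range xs"
  then obtain i where "f = xs i" by blast
  then show ?thesis using normal_form_term[where R = R and xs = xs and e = "%j. if j = i then 1 else 0", OF polys.const[of 1]]
   by (simp add: xmonom_unit)
 qed
next
 case (mult f g)
 obtain A c where 1: "finite A" "!!e. c e : polys R" "f = (%z. \<Sum>e\<in>A. c e z * xmonom xs e z)"
  using mult.IH(1) unfolding normal_form_def by blast
 have "(%z. \<Sum>e\<in>A. (c e z * xmonom xs e z) * g z) : normal_form R xs"
  by (intro normal_form_sum normal_form_mult_term mult.IH 1)
 then show ?case by (simp add: 1 sum_distrib_right)
qed (rule normal_form_add)

text \<open>Both sides are polynomials in the scaling parameter \<open>t\<close>, so coefficients
  can be compared. Multiplication by \<open>t\<close> extends the identity to
  \<open>t = 0\<close>.\<close>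

lemma graded_coefficients:
 fixes a :: "'e => complex"
 assumes A: "finite A" and eq: "!!t. t ~= 0 ==> (\<Sum>e\<in>A. a e * t ^ dg e) = t ^ d * p"
 shows "(\<Sum>e | e : A & dg e = k. a e) = (if k = d then p else 0)"
proof -
 define N where "N = Max (insert k (insert d (dg ` A)))"
 define b where "b k = (\<Sum>e | e : A & dg e = k. a e) - (if k = d then p else 0)" for k
 have N: "dg e <= N" if "e : A" for e unfolding N_def by (rule Max_ge) (use A that in auto)
 have dN: "d <= N" "k <= N" unfolding N_def by (rule Max_ge; use A in simp)+
 have "(\<Sum>k\<le>N. b k * t ^ k) = 0" if "t ~= 0" for t
 proof -
  have "(\<Sum>k\<le>N. (\<Sum>e | e : A & dg e = k. a e) * t ^ k) = (\<Sum>k\<le>N. \<Sum>e | e : A & dg e = k. a e * t ^ dg e)"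
   by (simp add: sum_distrib_right)
  also have "\<dots> = (\<Sum>e\<in>A. a e * t ^ dg e)"
   by (rule sum.group) (use A N in auto)
  also have "\<dots> = (\<Sum>k\<le>N. (if k = d then p else 0) * t ^ k)"
  proof -
   have "(\<Sum>k\<le>N. (if k = d then p else 0) * t ^ k) = (\<Sum>k\<le>N. if k = d then p * t ^ d else 0)"
    by (rule sum.cong) auto
   then show ?thesis using dN eq[OF that] by simp
  qed
  finally show ?thesis by (simp add: b_def left_diff_distrib sum_subtractf)
 qed
 then have z: "(\<Sum>k\<le>N. b k * t ^ k) * t = 0" for t by (cases "t = 0") auto
 have "ALL t. (\<Sum>k\<le>Suc N. (if k = 0 then 0 else b (k - 1)) * t ^ k) = 0"
 proof
  fix t
  have "(\<Sum>k\<le>Suc N. (if k = 0 then 0 else b (k - 1)) * t ^ k) = (\<Sum>k\<le>N. b k * t ^ k) * t"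
   by (subst sum.atMost_Suc_shift) (simp add: sum_distrib_right sum_distrib_left mult_ac)
  then show "(\<Sum>k\<le>Suc N. (if k = 0 then 0 else b (k - 1)) * t ^ k) = 0" using z by simp
 qed
 then have "ALL k<=Suc N. (if k = 0 then 0 else b (k - 1)) = 0"
  unfolding polyfun_eq_0 .
 then have "b k = 0" using dN(2) by (metis Suc_le_mono diff_Suc_1 nat.distinct(1))
 then show ?thesis by (simp add: b_def)
qed

definition coords :: "'n::finite => complex ^ 'n => complex" where "coords i v = v $ i"

lemma coords_scale [simp]: "coords i (c *s v) = c * coords i v" by (simp add: coords_def)

lemma xmonom_scale: "(!!i. xs i (T z) = c * xs i z) ==> xmonom xs e (T z) = c ^ (\<Sum>i\<in>UNIV. e i) * xmonom xs e z"
 by (simp add: xmonom_def power_mult_distrib prod.distrib power_sum)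

text \<open>\<open>T c\<close> scales the variables \<open>xs\<close>, and leaves the coefficients from \<open>R\<close> unchanged.\<close>
lemma homogeneous_normal_form:
 fixes xs :: "'i::finite => 'a => complex"
 assumes P: "P : polys (R Un range xs)"
  and T: "!!c i z. xs i (T c z) = c * xs i z" "!!f c z. f : R ==> f (T c z) = f z"
  and hom: "!!c z. c ~= 0 ==> P (T c z) = c ^ d * P z"
 obtains A c where "finite A" "!!e. e : A ==> (\<Sum>i\<in>UNIV. e i) = d" "!!e. c e : polys R"
  "!!z. P z = (\<Sum>e\<in>A. c e z * xmonom xs e z)"
proof -
 obtain A c where 1: "finite A" "!!e. c e : polys R" "P = (%z. \<Sum>e\<in>A. c e z * xmonom xs e z)"
  using polys_normal_form[OF P] unfolding normal_form_def by blast
 have inv: "f (T t z) = f z" if "f : polys R" for f t z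
  using that by induction (auto simp: T(2))
 have "P z = (\<Sum>e | e : A & (\<Sum>i\<in>UNIV. e i) = d. c e z * xmonom xs e z)" for z
 proof -
  have "(\<Sum>e\<in>A. (c e z * xmonom xs e z) * t ^ (\<Sum>i\<in>UNIV. e i)) = t ^ d * P z" if "t ~= 0" for t
  proof -
   have sc: "xmonom xs e (T t z) = t ^ (\<Sum>i\<in>UNIV. e i) * xmonom xs e z" for e
    by (rule xmonom_scale) (rule T(1))
   have "t ^ d * P z = P (T t z)" using hom[OF that] by simp
   also have "\<dots> = (\<Sum>e\<in>A. c e z * (t ^ (\<Sum>i\<in>UNIV. e i) * xmonom xs e z))"
    unfolding 1(3) by (rule sum.cong) (simp_all add: inv 1 sc)
   finally show ?thesis by (simp add: mult_ac)
  qed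
  from graded_coefficients[OF 1(1) this, of d] show ?thesis by simp
 qed
 note eq = this
 show ?thesis
 proof (rule that[of "{e : A. (\<Sum>i\<in>UNIV. e i) = d}" c])
  show "P z = (\<Sum>e | e : A & (\<Sum>i\<in>UNIV. e i) = d. c e z * xmonom xs e z)" for z by (rule eq)
 qed (use 1(1,2) in auto)
qed

text \<open>Homogenization with respect to the form \<open>l\<close>, which is equal to \<open>1\<close> on the chart \<open>io ` D\<close>.\<close>
lemma homogenization:
 assumes f: "f : polys X"
  and l: "l : polys Y" "!!c z. l (T c z) = c * l z" "!!x. x : D ==> l (io x) = 1"
  and gen: "!!f. f : X ==> EX N. EX P:polys Y. (ALL c z. P (T c z) = c ^ N * P z) & (ALL x:D. P (io x) = f x)"
 shows "EX N. EX P:polys Y. (ALL c z. P (T c z) = c ^ N * P z) & (ALL x:D. P (io x) = f x)"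
 using f
proof induction
 case (const c)
 show ?case by (rule exI[of _ 0], rule bexI[of _ "%_. c"]) (auto intro: polys.intros)
next
 case (add f g)
 then obtain N P M Q where "P : polys Y" "Q : polys Y"
  "ALL c z. P (T c z) = c ^ N * P z" "ALL c z. Q (T c z) = c ^ M * Q z"
  "ALL x:D. P (io x) = f x" "ALL x:D. Q (io x) = g x" by blast
 then show ?case
  by (intro exI[of _ "N + M"] bexI[of _ "%z. l z ^ M * P z + l z ^ N * Q z"])
   (auto intro!: polys_intros l simp: l power_mult_distrib power_add algebra_simps)
next
 case (mult f g)
 then obtain N P M Q where "P : polys Y" "Q : polys Y"
  "ALL c z. P (T c z) = c ^ N * P z" "ALL c z. Q (T c z) = c ^ M * Q z"
  "ALL x:D. P (io x) = f x" "ALL x:D. Q (io x) = g x" by blast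
 then show ?case
  by (intro exI[of _ "N + M"] bexI[of _ "%z. P z * Q z"])
   (auto intro!: polys_intros simp: power_add algebra_simps)
qed (rule gen)

lemma poly_eval_polys: "(%v. poly_eval F (($) v)) : polys (range coords)"
 unfolding poly_eval_def
 by (intro polys_intros polys.gen) (auto simp: coords_def[abs_def])

text \<open>The way back to the formal polynomials of \<open>zariski_closed\<close>: scaling selects
  the monomials of degree \<open>d\<close>, and their coefficients, lying in
  \<open>polys {}\<close>, are constants.\<close>

lemma polys_homogeneous_poly_eval:
 fixes P :: "complex ^ 'n::finite => complex"
 assumes P: "P : polys (range coords)" and hom: "!!c v. c ~= 0 ==> P (c *s v) = c ^ d * P v"
 obtains F :: "'n cpoly" where "homogeneous F" "!!v. poly_eval F (($) v) = P v"
proof -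
 obtain A c where A: "finite A" "!!e. e : A ==> (\<Sum>i\<in>UNIV. e i) = d" "!!e. c e : polys {}"
  "!!z. P z = (\<Sum>e\<in>A. c e z * xmonom coords e z)"
  by (rule homogeneous_normal_form[of P "{}" coords "%c z. c *s z" d]) (use P hom in auto)
 have "EX k. f = (%_. k)" if "f : polys {}" for f :: "complex ^ 'n => complex"
  using that by induction auto
 then have "ALL e. EX k. c e = (%_. k)" using A(3) by blast
 then obtain k where k: "!!e. c e = (%_. k e)" by metis
 have lk: "Poly_Mapping.lookup (Abs_poly_mapping e) = e" for e :: "'n => nat"
  by (rule lookup_Abs_poly_mapping) simp
 define F :: "'n cpoly" where "F = Abs_poly_mapping (%m. if Poly_Mapping.lookup m : A then k (Poly_Mapping.lookup m) else 0)"
 have fin: "finite (Abs_poly_mapping ` A :: ('n \<Rightarrow>\<^sub>0 nat) set)" using A(1) by simp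
 have sub: "{m. Poly_Mapping.lookup m : A} <= (Abs_poly_mapping ` A :: ('n \<Rightarrow>\<^sub>0 nat) set)"
  by (auto intro!: image_eqI[of _ _ "Poly_Mapping.lookup _"])
 have "finite {m :: 'n \<Rightarrow>\<^sub>0 nat. (if Poly_Mapping.lookup m : A then k (Poly_Mapping.lookup m) else 0) ~= 0}"
  by (rule finite_subset[OF _ finite_subset[OF sub fin]]) auto
 then have lF: "Poly_Mapping.lookup F m = (if Poly_Mapping.lookup m : A then k (Poly_Mapping.lookup m) else 0)" for m
  unfolding F_def by (subst lookup_Abs_poly_mapping) auto
 have keys: "m : Poly_Mapping.keys F ==> Poly_Mapping.lookup m : A" for m
  by (auto simp: in_keys_iff lF split: if_splits)
 have expo: "(\<Sum>i\<in>Poly_Mapping.keys m. Poly_Mapping.lookup m i) = (\<Sum>i\<in>UNIV. Poly_Mapping.lookup m i)" for m :: "'n \<Rightarrow>\<^sub>0 nat"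
  by (rule sum.mono_neutral_left) (auto simp: in_keys_iff)
 have "homogeneous F" unfolding homogeneous_def using keys A(2) by (auto simp: expo)
 moreover have "poly_eval F (($) v) = P v" for v
 proof -
  have 1: "(\<Prod>i\<in>Poly_Mapping.keys m. v $ i ^ Poly_Mapping.lookup m i) = xmonom coords (Poly_Mapping.lookup m) v" for m :: "'n \<Rightarrow>\<^sub>0 nat"
   unfolding xmonom_def coords_def by (rule prod.mono_neutral_left) (auto simp: in_keys_iff)
  have "poly_eval F (($) v) = (\<Sum>m\<in>Poly_Mapping.keys F. Poly_Mapping.lookup F m * xmonom coords (Poly_Mapping.lookup m) v)"
   unfolding poly_eval_def 1 ..
  also have "\<dots> = (\<Sum>m\<in>Abs_poly_mapping ` A. Poly_Mapping.lookup F m * xmonom coords (Poly_Mapping.lookup m) v)"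
   by (rule sum.mono_neutral_left) (use fin sub keys in "auto simp: in_keys_iff")
  also have "\<dots> = (\<Sum>e\<in>A. k e * xmonom coords e v)"
   by (subst sum.reindex) (auto simp: inj_on_def lk lF dest: arg_cong[of _ _ Poly_Mapping.lookup] intro!: sum.cong)
  finally show ?thesis by (simp add: A k)
 qed
 ultimately show ?thesis using that by blast
qed

lemma poly_eval_homogeneous:
 assumes "homogeneous F"
 obtains d where "!!c v. poly_eval F (($) (c *s v)) = c ^ d * poly_eval F (($) v)"
proof -
 obtain d where d: "ALL m:Poly_Mapping.keys F. (\<Sum>i\<in>Poly_Mapping.keys m. Poly_Mapping.lookup m i) = d"
  using assms unfolding homogeneous_def by blast
 have "poly_eval F (($) (c *s v)) = c ^ d * poly_eval F (($) v)" for c v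
  unfolding poly_eval_def sum_distrib_left
 proof (rule sum.cong[OF refl])
  fix m assume "m : Poly_Mapping.keys F"
  then show "Poly_Mapping.lookup F m * (\<Prod>i\<in>Poly_Mapping.keys m. (c *s v) $ i ^ Poly_Mapping.lookup m i) =
   c ^ d * (Poly_Mapping.lookup F m * (\<Prod>i\<in>Poly_Mapping.keys m. v $ i ^ Poly_Mapping.lookup m i))"
   using d by (auto simp: power_mult_distrib prod.distrib power_sum[symmetric] mult_ac)
 qed
 then show ?thesis using that by blast
qed

subsection \<open>Ideals and the basis theorem\<close>

definition fideal :: "('a => complex) set => ('a => complex) set => bool" where
 "fideal R I \<longleftrightarrow> I <= R & (%_. 0) : I & (ALL f:I. ALL g:I. (%z. f z + g z) : I) &
   (ALL r:R. ALL f:I. (%z. r z * f z) : I)"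

lemma fidealD:
 assumes "fideal R I"
 shows "f : I ==> f : R" "(%_. 0) : I" "f : I ==> g : I ==> (%z. f z + g z) : I"
  "r : R ==> f : I ==> (%z. r z * f z) : I"
 using assms unfolding fideal_def by blast+

lemma fideal_diff: "fideal (polys X) I ==> f : I ==> g : I ==> (%z. f z - g z) : I"
 using fidealD(3)[of _ I f "%z. - 1 * g z"] fidealD(4)[of _ I "%_. -1" g] polys.const by fastforce

inductive_set ideal_gen :: "('a => complex) set => ('a => complex) set => ('a => complex) set" for R B where
 zero: "(%_. 0) : ideal_gen R B"
| step: "f : ideal_gen R B ==> r : R ==> b : B ==> (%z. r z * b z + f z) : ideal_gen R B"

lemma ideal_gen_least:
 assumes "fideal R I" "B <= I" shows "ideal_gen R B <= I"
proof
 fix f assume "f : ideal_gen R B"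
 then show "f : I" by induction (use assms fidealD[OF assms(1)] in auto)
qed

lemma ideal_gen_base: "b : B ==> b : ideal_gen (polys X) B"
 using ideal_gen.step[OF ideal_gen.zero polys.const[of 1], of b B X] by simp

lemma ideal_gen_fideal:
 assumes "B <= polys X" shows "fideal (polys X) (ideal_gen (polys X) B)"
 unfolding fideal_def
proof (intro conjI ballI)
 show "ideal_gen (polys X) B <= polys X"
 proof
  fix f assume "f : ideal_gen (polys X) B"
  then show "f : polys X" by induction (auto intro!: polys.const polys.add polys.mult dest: subsetD[OF assms])
 qed
 show "(%_. 0) : ideal_gen (polys X) B" by (rule ideal_gen.zero)
 show "(%z. f z + g z) : ideal_gen (polys X) B"
  if "f : ideal_gen (polys X) B" "g : ideal_gen (polys X) B" for f g
  using that(1)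
 proof induction
  case (step f r b)
  from ideal_gen.step[OF step.IH step.hyps(2,3)] show ?case by (simp add: add.assoc)
 qed (use that(2) in simp)
 show "(%z. r z * f z) : ideal_gen (polys X) B"
  if "r : polys X" "f : ideal_gen (polys X) B" for f r
  using that(2)
 proof induction
  case zero show ?case using ideal_gen.zero by simp
 next
  case (step f r' b)
  from ideal_gen.step[OF step.IH polys.mult[OF that(1) step.hyps(2)] step.hyps(3)]
  show ?case by (simp add: algebra_simps)
 qed
qed

definition noeth :: "('a => complex) set => bool" where
 "noeth R \<longleftrightarrow> (ALL I. fideal R I --> (EX B. finite B & B <= I & I <= ideal_gen R B))"

lemma chain_finite_subset:
 assumes "finite B" "B <= (\<Union>n::nat. I n)" "!!n. I n <= I (Suc n)"
 obtains n where "B <= I n"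
proof -
 have mono: "I m <= I n" if "m <= n" for m n using lift_Suc_mono_le[of I, OF assms(3) that] .
 have "EX n. B <= I n" using assms(1,2)
 proof induction
  case (insert b B)
  then obtain n m where "B <= I n" "b : I m" by blast
  then have "insert b B <= I (max n m)" using mono[of n "max n m"] mono[of m "max n m"] by auto
  then show ?case by blast
 qed simp
 then show ?thesis using that by blast
qed

lemma fideal_chain_union:
 assumes "!!n::nat. fideal R (I n)" "!!n. I n <= I (Suc n)"
 shows "fideal R (\<Union>n. I n)"
proof -
 have mono: "I m <= I n" if "m <= n" for m n using lift_Suc_mono_le[of I, OF assms(2) that] .
 show ?thesis unfolding fideal_def
 proof (intro conjI ballI)
  show "(\<Union>n. I n) <= R" "(%_. 0) : (\<Union>n. I n)"
   using fidealD(1,2)[OF assms(1)] by blast+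
  show "(%z. r z * f z) : (\<Union>n. I n)" if "r : R" "f : (\<Union>n. I n)" for r f
   using fidealD(4)[OF assms(1) that(1)] that(2) by blast
  fix f g assume "f : (\<Union>n. I n)" "g : (\<Union>n. I n)"
  then obtain m n where "f : I m" "g : I n" by blast
  then have "f : I (max m n)" "g : I (max m n)" using mono[of m "max m n"] mono[of n "max m n"] by auto
  from fidealD(3)[OF assms(1) this] show "(%z. f z + g z) : (\<Union>n. I n)" by blast
 qed
qed

lemma noeth_chain:
 assumes "noeth R" "!!n::nat. fideal R (I n)" "!!n. I n <= I (Suc n)"
 obtains n where "!!m. I m <= I n"
proof -
 obtain B where B: "finite B" "B <= (\<Union>n. I n)" "(\<Union>n. I n) <= ideal_gen R B"
  using assms(1) fideal_chain_union[of R I, OF assms(2,3)] unfolding noeth_def by blast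
 obtain n where "B <= I n" using chain_finite_subset[where I = I, OF B(1,2) assms(3)] .
 then have "ideal_gen R B <= I n" by (rule ideal_gen_least[OF assms(2)])
 then show ?thesis using B(3) that by blast
qed

lemma noeth_polys_empty: "noeth (polys {})"
 unfolding noeth_def
proof (intro allI impI)
 fix I :: "('a => complex) set" assume I: "fideal (polys {}) I"
 have c: "EX k. f = (%_. k)" if "f : polys {}" for f :: "'a => complex"
  using that by induction auto
 show "EX B. finite B & B <= I & I <= ideal_gen (polys {}) B"
 proof (cases "I <= {%_. 0}")
  case True
  then show ?thesis using ideal_gen.zero by (intro exI[of _ "{}"]) auto
 next
  case False
  then obtain f where f: "f : I" "f ~= (%_. 0)" by blast
  then obtain k where k: "f = (%_. k)" using c fidealD(1)[OF I] by blast
  then have k0: "k ~= 0" using f by auto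
  have "I <= ideal_gen (polys {}) {f}"
  proof
   fix g assume "g : I"
   then obtain l where "g = (%_. l)" using c fidealD(1)[OF I] by blast
   then have "g = (%z. (%_. l / k) z * f z + (%_. 0) z)" using k k0 by auto
   then show "g : ideal_gen (polys {}) {f}"
    using ideal_gen.step[OF ideal_gen.zero polys.const[of "l / k"], of f "{f}"] by simp
  qed
  then show ?thesis using f by blast
 qed
qed

text \<open>Polynomials in \<open>x\<close> of degree less than \<open>n\<close>; the function \<open>x\<close> need not be transcendental over \<open>R\<close>.\<close>
inductive_set pdeg :: "('a => complex) set => ('a => complex) => (nat \<times> ('a => complex)) set" for R x where
 zero: "(0, %_. 0) : pdeg R x"
| Suc: "(n, f) : pdeg R x ==> r : R ==> (Suc n, %z. r z * x z ^ n + f z) : pdeg R x"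

inductive_cases pdeg_0E: "(0, f) : pdeg R x"
inductive_cases pdeg_SucE: "(Suc n, f) : pdeg R x"

lemma pdeg_Suc: "(n, f) : pdeg (polys X) x ==> (Suc n, f) : pdeg (polys X) x"
 using pdeg.Suc[OF _ polys.const[of 0], of n f X x] by simp

lemma pdeg_le: "(n, f) : pdeg (polys X) x ==> n <= m ==> (m, f) : pdeg (polys X) x"
 by (induction m) (auto simp: le_Suc_eq intro: pdeg_Suc)

lemma pdeg_zero: "(n, %_. 0) : pdeg (polys X) x"
 by (rule pdeg_le[OF pdeg.zero]) simp

lemma pdeg_add:
 "(n, f) : pdeg (polys X) x ==> (n, g) : pdeg (polys X) x ==> (n, %z. f z + g z) : pdeg (polys X) x"
proof (induction n arbitrary: f g)
 case 0
 then show ?case by (auto elim!: pdeg_0E intro: pdeg.zero)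
next
 case (Suc n)
 obtain r f' s g' where 1: "f = (%z. r z * x z ^ n + f' z)" "(n, f') : pdeg (polys X) x" "r : polys X"
  "g = (%z. s z * x z ^ n + g' z)" "(n, g') : pdeg (polys X) x" "s : polys X"
  using Suc.prems by (auto elim!: pdeg_SucE)
 from pdeg.Suc[OF Suc.IH[OF 1(2,5)] polys.add[OF 1(3,6)]]
 show ?case unfolding 1(1,4) by (simp add: algebra_simps)
qed

lemma pdeg_smult:
 "(n, f) : pdeg (polys X) x ==> r : polys X ==> (n, %z. r z * f z) : pdeg (polys X) x"
proof (induction n arbitrary: f)
 case 0
 then show ?case by (auto elim!: pdeg_0E intro: pdeg.zero)
next
 case (Suc n)
 obtain s f' where 1: "f = (%z. s z * x z ^ n + f' z)" "(n, f') : pdeg (polys X) x" "s : polys X"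
  using Suc.prems by (auto elim!: pdeg_SucE)
 from pdeg.Suc[OF Suc.IH[OF 1(2) Suc.prems(2)] polys.mult[OF Suc.prems(2) 1(3)]]
 show ?case unfolding 1 by (simp add: algebra_simps)
qed

lemma pdeg_shift: "(n, f) : pdeg (polys X) x ==> (n + k, %z. x z ^ k * f z) : pdeg (polys X) x"
proof (induction n arbitrary: f)
 case 0
 then show ?case by (auto elim!: pdeg_0E intro: pdeg_zero)
next
 case (Suc n)
 obtain s f' where 1: "f = (%z. s z * x z ^ n + f' z)" "(n, f') : pdeg (polys X) x" "s : polys X"
  using Suc.prems by (auto elim!: pdeg_SucE)
 from pdeg.Suc[OF Suc.IH[OF 1(2)] 1(3)]
 show ?case unfolding 1 by (simp add: algebra_simps power_add)
qed

lemma pdeg_mult: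
 "(n, f) : pdeg (polys X) x ==> (m, g) : pdeg (polys X) x ==> (n + m, %z. f z * g z) : pdeg (polys X) x"
proof (induction n arbitrary: f)
 case 0
 then show ?case by (auto elim!: pdeg_0E intro: pdeg_zero)
next
 case (Suc n)
 obtain s f' where 1: "f = (%z. s z * x z ^ n + f' z)" "(n, f') : pdeg (polys X) x" "s : polys X"
  using Suc.prems(1) by (auto elim!: pdeg_SucE)
 have a: "(Suc n + m, %z. f' z * g z) : pdeg (polys X) x"
  using pdeg_le[OF Suc.IH[OF 1(2) Suc.prems(2)], of "Suc n + m"] by simp
 have b: "(Suc n + m, %z. s z * (x z ^ n * g z)) : pdeg (polys X) x"
  using pdeg_le[OF pdeg_smult[OF pdeg_shift[OF Suc.prems(2), of n] 1(3)], of "Suc n + m"] by simp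
 from pdeg_add[OF b a] show ?case unfolding 1 by (simp add: algebra_simps)
qed

lemma polys_insert_pdeg: "f : polys (insert x X) ==> EX n. (n, f) : pdeg (polys X) x"
proof (induction rule: polys.induct)
 case (const c)
 show ?case using pdeg.Suc[OF pdeg.zero polys.const[of c X]] by auto
next
 case (gen f)
 have "(2, x) : pdeg (polys X) x"
  using pdeg.Suc[OF pdeg_zero[of 1] polys.const[of 1 X], of x] by (simp add: numeral_2_eq_2)
 then show ?case using gen pdeg.Suc[OF pdeg.zero polys.gen[of f X]] by auto
next
 case (add f g)
 then obtain n m where "(n, f) : pdeg (polys X) x" "(m, g) : pdeg (polys X) x" by blast
 then have "(max n m, f) : pdeg (polys X) x" "(max n m, g) : pdeg (polys X) x" by (auto intro: pdeg_le)
 then show ?case using pdeg_add by blast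
next
 case (mult f g)
 then show ?case using pdeg_mult by blast
qed

text \<open>Hilbert's basis theorem. As \<open>x\<close> may satisfy relations over the
  coefficients, leading coefficients belong to a representation with top exponent \<open>n\<close>
  rather than to a function; the ideals \<open>L n\<close> which they form still increase with
  \<open>n\<close>.\<close>

theorem noeth_insert:
 assumes R: "noeth (polys X)"
 shows "noeth (polys (insert x X))"
 unfolding noeth_def
proof (intro allI impI)
 let ?R = "polys X" and ?S = "polys (insert x X)"
 fix I assume I: "fideal ?S I"
 have RS: "r : ?S" if "r : ?R" for r using that polys_mono[of X "insert x X"] by (auto intro: polys.gen)
 have xS: "(%z. x z ^ k) : ?S" for k by (intro polys_power polys.gen) simp
 define L where "L n = {r : ?R. EX g. (n, g) : pdeg ?R x & (%z. r z * x z ^ n + g z) : I}" for n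
 have idL: "fideal ?R (L n)" for n
  unfolding fideal_def
 proof (intro conjI ballI)
  show "L n <= ?R" by (auto simp: L_def)
  show "(%_. 0) : L n" using pdeg_zero fidealD(2)[OF I]
   by (auto simp: L_def intro!: polys.intros exI[of _ "%_. 0"])
  fix r s assume "r : L n" "s : L n"
  then obtain g h where 1: "r : ?R" "s : ?R" "(n, g) : pdeg ?R x" "(n, h) : pdeg ?R x"
   "(%z. r z * x z ^ n + g z) : I" "(%z. s z * x z ^ n + h z) : I" by (auto simp: L_def)
  have "(%z. (r z + s z) * x z ^ n + (g z + h z)) : I"
   using fidealD(3)[OF I 1(5,6)] by (simp add: algebra_simps)
  then show "(%z. r z + s z) : L n" using pdeg_add[OF 1(3,4)] polys.add[OF 1(1,2)] unfolding L_def by blast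
 next
  fix r s assume r: "r : ?R" and "s : L n"
  then obtain h where 1: "s : ?R" "(n, h) : pdeg ?R x" "(%z. s z * x z ^ n + h z) : I" by (auto simp: L_def)
  have "(%z. (r z * s z) * x z ^ n + r z * h z) : I"
   using fidealD(4)[OF I RS[OF r] 1(3)] by (simp add: algebra_simps)
  then show "(%z. r z * s z) : L n" using pdeg_smult[OF 1(2) r] polys.mult[OF r 1(1)] unfolding L_def by blast
 qed
 have monoL: "L n <= L (Suc n)" for n
 proof
  fix r assume "r : L n"
  then obtain g where 1: "r : ?R" "(n, g) : pdeg ?R x" "(%z. r z * x z ^ n + g z) : I" by (auto simp: L_def)
  have "(%z. r z * x z ^ Suc n + x z * g z) : I"
   using fidealD(4)[OF I xS[of 1] 1(3)] by (simp add: algebra_simps)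
  moreover have "(Suc n, %z. x z * g z) : pdeg ?R x" using pdeg_shift[OF 1(2), of 1] by simp
  ultimately show "r : L (Suc n)" using 1(1) unfolding L_def by blast
 qed
 obtain n0 where n0: "!!m. L m <= L n0" using noeth_chain[where I = L, OF R idL monoL] by blast
 have "EX B. finite B & B <= L n & L n <= ideal_gen ?R B" for n
  using R idL unfolding noeth_def by blast
 note exB = this
 define B where "B n = (SOME B. finite B & B <= L n & L n <= ideal_gen ?R B)" for n
 have B: "finite (B n)" "B n <= L n" "L n <= ideal_gen ?R (B n)" for n
  using someI_ex[OF exB[of n], folded B_def] by auto
 have "EX g. (n, g) : pdeg ?R x & (%z. b z * x z ^ n + g z) : I" if "b : B n" for n b
  using B(2)[of n] that by (auto simp: L_def)
 note ex = this
 define g where "g n b = (SOME g. (n, g) : pdeg ?R x & (%z. b z * x z ^ n + g z) : I)" for n b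
 have g: "(n, g n b) : pdeg ?R x & (%z. b z * x z ^ n + g n b z) : I" if "b : B n" for n b
  unfolding g_def by (rule someI_ex[OF ex[OF that]])
 define C where "C = (\<Union>n\<le>n0. (%b z. b z * x z ^ n + g n b z) ` B n)"
 have C: "finite C" "C <= I" using B(1) g by (auto simp: C_def)
 have CS: "fideal ?S (ideal_gen ?S C)"
  by (rule ideal_gen_fideal) (use C(2) fidealD(1)[OF I] in blast)
 have CI: "ideal_gen ?S C <= I" by (rule ideal_gen_least[OF I C(2)])
 \<comment> \<open>From index \<open>n0\<close> on the ideals \<open>L n\<close> are constant, so
   the leading coefficient is produced by generators of index \<open>m = min n n0\<close>,
   multiplied by \<open>x^(n - m)\<close>.\<close>
 have lead: "EX h:ideal_gen ?S C. (n, %z. h z - r z * x z ^ n) : pdeg ?R x" if r: "r : L n" for r n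
 proof -
  define m where "m = min n n0"
  have "r : L m" using r n0 by (auto simp: m_def min_def)
  then have "r : ideal_gen ?R (B m)" using B(3) by blast
  then show ?thesis
  proof induction
   case zero
   then show ?case using ideal_gen.zero pdeg_zero by (intro bexI[of _ "%_. 0"]) auto
  next
   case (step f r b)
   then obtain h where h: "h : ideal_gen ?S C" "(n, %z. h z - f z * x z ^ n) : pdeg ?R x" by blast
   define k where "k = (%z. b z * x z ^ m + g m b z)"
   have k: "k : C" using step(3) by (auto simp: C_def k_def m_def)
   have nm: "x z ^ n = x z ^ (n - m) * x z ^ m" for z by (simp add: m_def power_add[symmetric])
   have "(%z. (r z * x z ^ (n - m)) * k z + h z) : ideal_gen ?S C"
    by (rule ideal_gen.step[OF h(1) polys.mult[OF RS[OF step(2)] xS] k])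
   moreover have "(n, %z. (r z * x z ^ (n - m)) * k z + h z - (r z * b z + f z) * x z ^ n) : pdeg ?R x"
   proof -
    have "(m + (n - m), %z. r z * (x z ^ (n - m) * g m b z)) : pdeg ?R x"
     using g[OF step(3)] by (intro pdeg_smult pdeg_shift step(2)) auto
    from pdeg_add[OF this[simplified, unfolded m_def, simplified], folded m_def] h(2)
    have "(n, %z. r z * (x z ^ (n - m) * g m b z) + (h z - f z * x z ^ n)) : pdeg ?R x"
     by (simp add: m_def)
    then show ?thesis by (simp add: k_def nm algebra_simps)
   qed
   ultimately show ?case by (intro bexI[of _ "%z. (r z * x z ^ (n - m)) * k z + h z"])
  qed
 qed
 have "f : ideal_gen ?S C" if "(n, f) : pdeg ?R x" "f : I" for n f
  using that
 proof (induction n arbitrary: f)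
  case 0
  then show ?case by (auto elim!: pdeg_0E intro: ideal_gen.zero)
 next
  case (Suc n)
  obtain r f' where 1: "f = (%z. r z * x z ^ n + f' z)" "(n, f') : pdeg ?R x" "r : ?R"
   using Suc.prems(1) by (auto elim!: pdeg_SucE)
  then have "r : L n" using Suc.prems(2) unfolding L_def by blast
  then obtain h where h: "h : ideal_gen ?S C" "(n, %z. h z - r z * x z ^ n) : pdeg ?R x"
   using lead by blast
  have "(n, %z. f' z + (-1) * (h z - r z * x z ^ n)) : pdeg ?R x"
   by (rule pdeg_add[OF 1(2) pdeg_smult[OF h(2) polys.const]])
  then have "(n, %z. f z - h z) : pdeg ?R x" by (simp add: 1 algebra_simps)
  moreover have "(%z. f z - h z) : I" using fideal_diff[OF I Suc.prems(2)] CI h(1) by blast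
  ultimately have "(%z. f z - h z) : ideal_gen ?S C" by (rule Suc.IH)
  from fidealD(3)[OF CS this h(1)] show ?case by simp
 qed
 then have "I <= ideal_gen ?S C" using polys_insert_pdeg fidealD(1)[OF I] by blast
 then show "EX B. finite B & B <= I & I <= ideal_gen ?S B" using C by blast
qed

corollary noeth_polys: "finite X ==> noeth (polys X)"
 by (induction X rule: finite_induct) (auto intro: noeth_polys_empty noeth_insert)

text \<open>Zorn's lemma. With \<open>Z = {%_. 1}\<close> it gives maximal ideals; in the
  intersection theorem \<open>Z\<close> is a difference of two ideals.\<close>

lemma maximal_disjoint_ideal:
 assumes I: "fideal R I" "I Int Z = {}"
 obtains L where "fideal R L" "I <= L" "L Int Z = {}"
  "!!L'. fideal R L' ==> L <= L' ==> L' Int Z = {} ==> L' = L"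
proof -
 let ?A = "{L. fideal R L & I <= L & L Int Z = {}}"
 have "EX M:?A. ALL X:?A. M <= X --> X = M"
 proof (rule subset_Zorn_nonempty)
  show "?A ~= {}" using I by blast
  fix C assume C: "C ~= {}" "subset.chain ?A C"
  have "fideal R (\<Union>C)" unfolding fideal_def
  proof (intro conjI ballI)
   show "\<Union>C <= R" "(%_. 0) : \<Union>C" using C by (auto simp: subset_chain_def fideal_def)
   show "(%z. f z + g z) : \<Union>C" if "f : \<Union>C" "g : \<Union>C" for f g
   proof -
    obtain A B where AB: "A : C" "B : C" "f : A" "g : B" using \<open>f : \<Union>C\<close> \<open>g : \<Union>C\<close> by blast
    obtain D where D: "D : C" "f : D" "g : D"
    proof -
     have "A <= B | B <= A" using C(2) AB(1,2) unfolding subset_chain_def by blast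
     then show ?thesis using that[of A] that[of B] AB by blast
    qed
    then have "fideal R D" using C(2) by (auto simp: subset_chain_def)
    then show ?thesis using D fidealD(3) by blast
   qed
   show "(%z. r z * f z) : \<Union>C" if "r : R" "f : \<Union>C" for r f
   proof -
    obtain A where A: "A : C" "f : A" using \<open>f : \<Union>C\<close> by blast
    then have "fideal R A" using C(2) by (auto simp: subset_chain_def)
    then show ?thesis using fidealD(4) that(1) A by blast
   qed
  qed
  then show "\<Union>C : ?A" using C by (auto simp: subset_chain_def)
 qed
 then obtain M where M: "M : ?A" and max: "ALL X:?A. M <= X --> X = M" by blast
 show ?thesis
 proof (rule that[of M])
  fix L' assume L': "fideal R L'" "M <= L'" "L' Int Z = {}"
  then have "L' : ?A" using M by auto
  then show "L' = M" using max L'(2) by blast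
 qed (use M in auto)
qed

subsection \<open>The intersection theorem of Krull\<close>

text \<open>Powers of the ideal generated by \<open>X\<close>. For the coordinates \<open>Xc\<close>
  of a chart, \<open>mpow Xc k\<close> consists of the polynomials of order at least
  \<open>k\<close> at the origin.\<close>

primrec mpow :: "('a => complex) set => nat => ('a => complex) set" where
 "mpow X 0 = polys X"
| "mpow X (Suc k) = ideal_gen (polys X) {%z. x z * f z | x f. x : X & f : mpow X k}"

declare mpow.simps(2) [simp del]

lemma fideal_polys: "fideal (polys X) (polys X)"
 unfolding fideal_def by (auto intro!: polys.const polys.add polys.mult)

lemma mpow_fideal: "fideal (polys X) (mpow X k)"
proof (induction k)
 case (Suc k)
 then show ?case unfolding mpow.simps
  by (intro ideal_gen_fideal) (auto intro!: polys.mult intro: polys.gen fidealD(1)[OF Suc])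
qed (simp add: fideal_polys)

lemma mpow_SucI: "x : X ==> f : mpow X k ==> (%z. x z * f z) : mpow X (Suc k)"
 unfolding mpow.simps by (rule ideal_gen_base) blast

lemma mpow_Suc_induct [consumes 1, case_names zero step]:
 assumes "f : mpow X (Suc k)" "Q (%_. 0)"
  "!!r x g f. r : polys X ==> x : X ==> g : mpow X k ==> f : mpow X (Suc k) ==> Q f ==> Q (%z. r z * (x z * g z) + f z)"
 shows "Q f"
 using assms(1) unfolding mpow.simps
proof induction
 case (step f r b)
 then obtain x g where "b = (%z. x z * g z)" "x : X" "g : mpow X k" by blast
 moreover have "f : mpow X (Suc k)" using step.hyps(1) by (simp add: mpow.simps(2))
 ultimately show ?case using assms(3)[of r x g f] step by simp
qed (rule assms(2))

lemma mpow_Suc_subset: "mpow X (Suc k) <= mpow X k"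
proof
 fix f assume "f : mpow X (Suc k)"
 then show "f : mpow X k"
 proof (induction rule: mpow_Suc_induct)
  case (step r x g f)
  have "(%z. (r z * x z) * g z) : mpow X k"
   by (rule fidealD(4)[OF mpow_fideal polys.mult[OF step(1) polys.gen[OF step(2)]] step(3)])
  from fidealD(3)[OF mpow_fideal this step(5)] show ?case by (simp add: mult.assoc)
 qed (rule fidealD(2)[OF mpow_fideal])
qed

lemma mpow_antimono: "k <= l ==> mpow X l <= mpow X k"
 by (induction l) (auto simp: le_Suc_eq dest: subsetD[OF mpow_Suc_subset])

lemma mpow_mult: "f : mpow X k ==> g : mpow X l ==> (%z. f z * g z) : mpow X (k + l)"
proof (induction k arbitrary: f)
 case 0
 then show ?case using fidealD(4)[OF mpow_fideal] by auto
next
 case (Suc k)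
 from Suc.prems(1) show ?case
 proof (induction rule: mpow_Suc_induct)
  case zero
  then show ?case using fidealD(2)[OF mpow_fideal] by simp
 next
  case (step r x h f)
  have "(%z. r z * (x z * (h z * g z))) : mpow X (Suc k + l)"
   using fidealD(4)[OF mpow_fideal step(1) mpow_SucI[OF step(2) Suc.IH[OF step(3) Suc.prems(2)]]] by simp
  from fidealD(3)[OF mpow_fideal this step(5)] show ?case by (simp add: algebra_simps)
 qed
qed

text \<open>Pigeonhole principle: a long product of generators contains one of them to a high power.
  The generators are added one by one, with \<open>n + k\<close> as the new exponent.\<close>

lemma mpow_subset_ideal:
 assumes "finite Y" "Y <= X" "fideal (polys X) L" "!!x. x : Y ==> EX k. (%z. x z ^ k) : L"
 shows "EX n. mpow Y n <= L"
 using assms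
proof (induction Y)
 case empty
 have "f = (%_. 0)" if "f : mpow {} 1" for f :: "'a => complex"
  using that unfolding One_nat_def by (induction rule: mpow_Suc_induct) auto
 then show ?case using fidealD(2)[OF empty.prems(2)] by (intro exI[of _ 1]) auto
next
 case (insert x Y)
 have "EX n. mpow Y n <= L" by (rule insert.IH) (use insert.prems in auto)
 then obtain n where n: "mpow Y n <= L" by blast
 obtain k where k: "(%z. x z ^ k) : L" using insert.prems(3)[of x] by auto
 note L = fidealD[OF insert.prems(2)]
 have sub: "polys Z <= polys X" if "Z <= X" for Z using polys_mono[of Z X] that by (auto intro: polys.gen)
 \<comment> \<open>The factors of \<open>f\<close> are sorted one at a time into powers of
   \<open>x\<close>, counted by \<open>i\<close>, and products from \<open>Y\<close>, counted by
   \<open>b\<close>. When \<open>c = 0\<close>, either \<open>b >= n\<close> or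
   \<open>i >= k\<close>.\<close>
 have "(%z. x z ^ i * g z * f z) : L"
  if "f : mpow (insert x Y) c" "g : mpow Y b" "b + i + c >= n + k" for b c i f g
  using that
 proof (induction c arbitrary: b i f g)
  case 0
  have gX: "g : polys X" using 0(2) fidealD(1)[OF mpow_fideal] sub insert.prems(1) by blast
  have fX: "f : polys X" using 0(1) sub[of "insert x Y"] insert.prems(1) by auto
  have xX: "(%z. x z ^ j) : polys X" for j by (intro polys_power polys.gen) (use insert.prems(1) in simp)
  show ?case
  proof (cases "b >= n")
   case True
   then have "g : L" using 0(2) mpow_antimono[OF True] n by blast
   from L(4)[OF polys.mult[OF xX[of i] fX] this] show ?thesis by (simp add: mult_ac)
  next
   case False
   then have "i >= k" using 0(3) by simp
   then have "x z ^ i = x z ^ (i - k) * x z ^ k" for z by (simp add: power_add[symmetric])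
   with L(4)[OF polys.mult[OF polys.mult[OF xX[of "i - k"] gX] fX] k] show ?thesis by (simp add: mult_ac)
  qed
 next
  case (Suc c)
  from Suc.prems(1) show ?case
  proof (induction rule: mpow_Suc_induct)
   case zero
   then show ?case using L(2) by simp
  next
   case (step r y h f)
   have "(%z. x z ^ i * g z * (y z * h z)) : L"
   proof (cases "y = x")
    case True
    have "(%z. x z ^ Suc i * g z * h z) : L"
     by (rule Suc.IH[OF step(3) Suc.prems(2)]) (use Suc.prems(3) in simp)
    then show ?thesis by (simp add: True mult_ac)
   next
    case False
    then have "(%z. y z * g z) : mpow Y (Suc b)" using step(2) by (intro mpow_SucI Suc.prems(2)) auto
    then have "(%z. x z ^ i * (y z * g z) * h z) : L"
     by (rule Suc.IH[OF step(3)]) (use Suc.prems(3) in simp)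
    then show ?thesis by (simp add: mult_ac)
   qed
   moreover have "r : polys X" using step(1) sub insert.prems(1) by blast
   ultimately have "(%z. r z * (x z ^ i * g z * (y z * h z))) : L" using L(4) by blast
   from L(3)[OF this step(5)] show ?case by (simp add: algebra_simps)
  qed
 qed
 from this[of _ "n + k" "%_. 1" 0 0] show ?case
  by (intro exI[of _ "n + k"]) (auto intro: polys.const)
qed

text \<open>
 A maximal ideal \<open>L\<close> which contains \<open>m E + J\<close> and whose intersection with \<open>R E + J\<close> is not
 larger contains a power of \<open>m\<close>, and hence \<open>E\<close>.
\<close>
theorem krull_intersection:
 assumes X: "finite X" and J: "fideal (polys X) J" and E: "E : polys X"
  and inter: "!!k. EX j:J. (%z. E z - j z) : mpow X k"
 obtains e where "e : mpow X 1" "(%z. (1 - e z) * E z) : J"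
proof -
 let ?R = "polys X"
 note Jd = fidealD[OF J]
 have plus: "fideal ?R {%z. r z * E z + j z | r j. r : M & j : J}" if M: "fideal ?R M" for M
  unfolding fideal_def
 proof (intro conjI ballI)
  show "{%z. r z * E z + j z | r j. r : M & j : J} <= ?R"
   using E fidealD(1)[OF M] Jd(1) by (auto intro!: polys.const polys.add polys.mult)
  show "(%_. 0) : {%z. r z * E z + j z | r j. r : M & j : J}"
   using fidealD(2)[OF M] Jd(2) by (intro CollectI exI[of _ "%_. 0"]) auto
  fix f g assume "f : {%z. r z * E z + j z | r j. r : M & j : J}" "g : {%z. r z * E z + j z | r j. r : M & j : J}"
  then obtain r j r' j' where 1: "f = (%z. r z * E z + j z)" "g = (%z. r' z * E z + j' z)" "r : M" "r' : M" "j : J" "j' : J"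
   by blast
  show "(%z. f z + g z) : {%z. r z * E z + j z | r j. r : M & j : J}"
   using fidealD(3)[OF M 1(3,4)] Jd(3)[OF 1(5,6)]
   by (intro CollectI exI[of _ "%z. r z + r' z"] exI[of _ "%z. j z + j' z"]) (auto simp: 1 algebra_simps)
 next
  fix s f assume s: "s : ?R" and "f : {%z. r z * E z + j z | r j. r : M & j : J}"
  then obtain r j where 1: "f = (%z. r z * E z + j z)" "r : M" "j : J" by blast
  show "(%z. s z * f z) : {%z. r z * E z + j z | r j. r : M & j : J}"
   using fidealD(4)[OF M s 1(2)] Jd(4)[OF s 1(3)]
   by (intro CollectI exI[of _ "%z. s z * r z"] exI[of _ "%z. s z * j z"]) (auto simp: 1 algebra_simps)
 qed
 \<comment> \<open>The ideals \<open>R E + J\<close> and \<open>m E + J\<close>, where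
   \<open>m\<close> is generated by \<open>X\<close>; the claim amounts to \<open>E\<close> lying in
   the second one.\<close>
 define N0 where "N0 = {%z. r z * E z + j z | r j. r : ?R & j : J}"
 define T0 where "T0 = {%z. r z * E z + j z | r j. r : mpow X 1 & j : J}"
 have N0: "fideal ?R N0" unfolding N0_def by (rule plus[OF fideal_polys])
 have T0: "fideal ?R T0" unfolding T0_def by (rule plus[OF mpow_fideal])
 obtain L where L: "fideal ?R L" "T0 <= L" "L Int (N0 - T0) = {}"
  "!!L'. fideal ?R L' ==> L <= L' ==> L' Int (N0 - T0) = {} ==> L' = L"
  using maximal_disjoint_ideal[OF T0, of "N0 - T0"] by blast
 note Ld = fidealD[OF L(1)]
 have pw: "EX k. (%z. x z ^ k) : L" if x: "x : X" for x
 proof -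
  have xR: "(%z. x z ^ k) : ?R" "x : ?R" for k using x by (auto intro: polys_power polys.gen)
  \<comment> \<open>The quotients \<open>(L : x^k)\<close> become stationary. From then on
    \<open>L + x^k R\<close> meets \<open>N0\<close> only inside \<open>T0\<close>: \<open>x\<close>
    times an element of \<open>N0\<close> lies in \<open>T0\<close> and thus in \<open>L\<close>, so
    the summand from \<open>x^k R\<close> lies in \<open>L\<close> by stationarity. Maximality then
    gives \<open>x^k \<in> L\<close>.\<close>
  define Q where "Q k = {r : ?R. (%z. x z ^ k * r z) : L}" for k
  have Q: "fideal ?R (Q k)" for k
   unfolding fideal_def
  proof (intro conjI ballI)
   show "Q k <= ?R" by (auto simp: Q_def)
   show "(%_. 0) : Q k" using Ld(2) by (auto simp: Q_def intro!: polys.const polys.add polys.mult)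
   show "(%z. f z + g z) : Q k" if "f : Q k" "g : Q k" for f g
    using that Ld(3)[of "%z. x z ^ k * f z" "%z. x z ^ k * g z"]
    by (auto simp: Q_def distrib_left intro!: polys.const polys.add polys.mult)
   show "(%z. r z * f z) : Q k" if "r : ?R" "f : Q k" for r f
    using that Ld(4)[of r "%z. x z ^ k * f z"] by (auto simp: Q_def mult.left_commute intro!: polys.const polys.add polys.mult)
  qed
  have "Q k <= Q (Suc k)" for k
   using Ld(4)[OF xR(2)] by (auto simp: Q_def mult.assoc)
  then obtain k where k: "!!m. Q m <= Q k" using noeth_chain[where I = Q, OF noeth_polys[OF X] Q] by blast
  let ?L' = "{%z. l z + x z ^ k * r z | l r. l : L & r : ?R}"
  have "fideal ?R ?L'" unfolding fideal_def
  proof (intro conjI ballI)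
   show "?L' <= ?R" using Ld(1) xR by (auto intro!: polys.const polys.add polys.mult)
   show "(%_. 0) : ?L'" using Ld(2) by (intro CollectI exI[of _ "%_. 0"]) (auto intro!: polys.const polys.add polys.mult)
   fix f g assume "f : ?L'" "g : ?L'"
   then obtain l r l' r' where 1: "f = (%z. l z + x z ^ k * r z)" "g = (%z. l' z + x z ^ k * r' z)"
    "l : L" "r : ?R" "l' : L" "r' : ?R" by blast
   show "(%z. f z + g z) : ?L'" using Ld(3)[OF 1(3,5)] polys.add[OF 1(4,6)]
    by (intro CollectI exI[of _ "%z. l z + l' z"] exI[of _ "%z. r z + r' z"]) (auto simp: 1 algebra_simps)
  next
   fix s f assume s: "s : ?R" and "f : ?L'"
   then obtain l r where 1: "f = (%z. l z + x z ^ k * r z)" "l : L" "r : ?R" by blast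
   show "(%z. s z * f z) : ?L'" using Ld(4)[OF s 1(2)] polys.mult[OF s 1(3)]
    by (intro CollectI exI[of _ "%z. s z * l z"] exI[of _ "%z. s z * r z"]) (auto simp: 1 algebra_simps)
  qed
  moreover have "L <= ?L'"
  proof
   fix l assume "l : L"
   then show "l : ?L'" by (intro CollectI exI[of _ l] exI[of _ "%_. 0"]) (auto intro!: polys.const polys.add polys.mult)
  qed
  moreover have "?L' Int (N0 - T0) = {}"
  proof (rule ccontr)
   assume "?L' Int (N0 - T0) ~= {}"
   then obtain l r where lr: "l : L" "r : ?R" "(%z. l z + x z ^ k * r z) : N0" "(%z. l z + x z ^ k * r z) ~: T0"
    by blast
   obtain s j where sj: "(%z. l z + x z ^ k * r z) = (%z. s z * E z + j z)" "s : ?R" "j : J"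
    using lr(3) unfolding N0_def by blast
   have "(%z. x z * s z) : mpow X 1" using mpow_SucI[OF x, of s 0] sj(2) by simp
   then have "(%z. (x z * s z) * E z + x z * j z) : T0" unfolding T0_def
    by (intro CollectI exI[of _ "%z. x z * s z"] exI[of _ "%z. x z * j z"]) (use Jd(4)[OF xR(2) sj(3)] in auto)
   moreover have "(x z * s z) * E z + x z * j z = x z * (l z + x z ^ k * r z)" for z
    using fun_cong[OF sj(1), of z] by (simp add: algebra_simps)
   ultimately have "(%z. x z * (l z + x z ^ k * r z)) : L" using L(2) by auto
   from fideal_diff[OF L(1) this Ld(4)[OF xR(2) lr(1)]]
   have "r : Q (Suc k)" using lr(2) by (simp add: Q_def algebra_simps)
   then have "r : Q k" using k[of "Suc k"] by blast
   then have "(%z. x z ^ k * r z) : L" by (simp add: Q_def)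
   from Ld(3)[OF lr(1) this] show False using L(3) lr(3,4) by blast
  qed
  ultimately have "?L' = L" by (rule L(4))
  moreover have "(%z. x z ^ k) : ?L'"
   using Ld(2) by (intro CollectI exI[of _ "%_. 0"] exI[of _ "%_. 1"]) (auto intro!: polys.const polys.add polys.mult)
  ultimately show ?thesis by blast
 qed
 obtain n where n: "mpow X n <= L" using mpow_subset_ideal[OF X subset_refl L(1) pw] by blast
 obtain j where j: "j : J" "(%z. E z - j z) : mpow X n" using inter by blast
 have "j : T0" unfolding T0_def using j(1) fidealD(2)[OF mpow_fideal, of X 1]
  by (intro CollectI exI[of _ "%_. 0"] exI[of _ j]) auto
 then have "E : L" using Ld(3)[of j "%z. E z - j z"] j(2) n L(2) by auto
 moreover have "E : N0" unfolding N0_def using Jd(2)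
  by (intro CollectI exI[of _ "%_. 1"] exI[of _ "%_. 0"]) (auto intro!: polys.const polys.add polys.mult)
 ultimately have "E : T0" using L(3) by blast
 then obtain e j where e: "E = (%z. e z * E z + j z)" "e : mpow X 1" "j : J" unfolding T0_def by blast
 have "(1 - e z) * E z = j z" for z using fun_cong[OF e(1), of z] by (simp add: algebra_simps)
 then have "(%z. (1 - e z) * E z) = j" by blast
 then show ?thesis using that e by simp
qed

section \<open>The Nullstellensatz and elimination\<close>

text \<open>One unknown is eliminated at a time. The lemma serves two counting arguments with
  polynomials of bounded degree.\<close>

lemma underdetermined_system:
 fixes A :: "'i => 'j => complex"
 assumes "finite I" "finite J" "card I < card J"
 shows "EX c. (EX j:J. c j ~= 0) & (ALL i:I. (\<Sum>j\<in>J. A i j * c j) = 0)"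
 using assms
proof (induction I arbitrary: J A rule: finite_induct)
 case empty
 then obtain j where "j : J" by (metis card.empty less_nat_zero_code ex_in_conv)
 then show ?case by (intro exI[of _ "%_. 1"]) auto
next
 case (insert i I)
 show ?case
 proof (cases "ALL j:J. A i j = 0")
  case True
  have "card I < card J" using insert by simp
  from insert.IH[OF insert.prems(1) this, of A] show ?thesis using True by auto
 next
  case False
  then obtain j0 where j0: "j0 : J" "A i j0 ~= 0" by blast
  define J' where "J' = J - {j0}"
  have J': "finite J'" "J = insert j0 J'" "j0 ~: J'" using insert.prems j0 by (auto simp: J'_def)
  have "card I < card J'" using insert J' by simp
  from insert.IH[OF J'(1) this, of "%i' j. A i' j - A i' j0 * A i j / A i j0"]
  obtain c where c: "EX j:J'. c j ~= 0" "ALL i':I. (\<Sum>j\<in>J'. (A i' j - A i' j0 * A i j / A i j0) * c j) = 0"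
   by blast
  define t where "t = - (\<Sum>j\<in>J'. A i j * c j) / A i j0"
  define d where "d = c(j0 := t)"
  have sum: "(\<Sum>j\<in>J. A i' j * d j) = A i' j0 * t + (\<Sum>j\<in>J'. A i' j * c j)" for i'
  proof -
   have "(\<Sum>j\<in>J'. A i' j * d j) = (\<Sum>j\<in>J'. A i' j * c j)"
    by (rule sum.cong) (use J' in "auto simp: d_def")
   then show ?thesis using J' by (simp add: d_def)
  qed
  have "(\<Sum>j\<in>J. A i j * d j) = 0" unfolding sum using j0 by (simp add: t_def)
  moreover have "(\<Sum>j\<in>J. A i' j * d j) = 0" if "i' : I" for i'
  proof -
   have "(\<Sum>j\<in>J'. A i' j * c j) = (\<Sum>j\<in>J'. A i' j0 * A i j / A i j0 * c j)"
    using c(2) that by (simp add: left_diff_distrib sum_subtractf)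
   also have "\<dots> = A i' j0 / A i j0 * (\<Sum>j\<in>J'. A i j * c j)"
    by (simp add: sum_distrib_left mult_ac)
   finally show ?thesis unfolding sum by (simp add: t_def)
  qed
  moreover have "EX j:J. d j ~= 0" using c(1) J' by (auto simp: d_def)
  ultimately show ?thesis by (intro exI[of _ d]) auto
 qed
qed

definition ebox :: "nat => ('i::finite => nat) set" where "ebox D = {e. ALL i. e i <= D}"

lemma ebox_eq: "ebox D = (UNIV :: 'i::finite set) \<rightarrow>\<^sub>E {..D}"
 by (auto simp: ebox_def PiE_def extensional_def Pi_def)

lemma finite_ebox: "finite (ebox D :: ('i::finite => nat) set)"
 unfolding ebox_eq by (rule finite_PiE) auto

lemma card_ebox: "card (ebox D :: ('i::finite => nat) set) = Suc D ^ CARD('i)"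
 unfolding ebox_eq by (simp add: card_PiE)

lemma polys_empty: "f : polys {} ==> EX k. f = (%_. k)"
 by (induction rule: polys.induct) auto

lemma polys_ebox:
 fixes xs :: "'i::finite => 'a => complex"
 assumes "P : polys (range xs)"
 obtains D k where "!!z. P z = (\<Sum>e\<in>ebox D. k e * xmonom xs e z)"
proof -
 have "P : normal_form {} xs" using polys_normal_form[of P "{}" xs] assms by simp
 then obtain A c where A: "finite A" "!!e. c e : polys {}" "P = (%z. \<Sum>e\<in>A. c e z * xmonom xs e z)"
  unfolding normal_form_def by blast
 obtain k where k: "!!e. c e = (%_. k e)" using polys_empty[OF A(2)] by metis
 define D where "D = Max ((%(e, i). e i) ` (A \<times> UNIV))"
 have "e i <= D" if "e : A" for e i
  unfolding D_def by (rule Max_ge) (use A(1) that in \<open>auto intro!: image_eqI[of _ _ "(e, i)"]\<close>)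
 then have sub: "A <= ebox D" by (auto simp: ebox_def)
 have "P z = (\<Sum>e\<in>ebox D. (if e : A then k e else 0) * xmonom xs e z)" for z
  unfolding A(3) k by (rule sum.mono_neutral_cong_left) (use sub in "auto simp: finite_ebox")
 then show ?thesis by (rule that[of "%e. if e : A then k e else 0" D])
qed

text \<open>The quotient by a maximal ideal is a field: \<open>M\<close> and \<open>f\<close>
  together generate an ideal that contains 1.\<close>

lemma maximal_ideal_inverse:
 assumes M: "fideal (polys X) M" "!!L. fideal (polys X) L ==> M <= L ==> L Int {%_. 1} = {} ==> L = M"
  and f: "f : polys X" "f ~: M"
 obtains r where "r : polys X" "(%z. 1 - r z * f z) : M"
proof -
 note Md = fidealD[OF M(1)]
 define L where "L = {%z. m z + r z * f z | m r. m : M & r : polys X}"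
 have "fideal (polys X) L" unfolding fideal_def
 proof (intro conjI ballI)
  show "L <= polys X" unfolding L_def using Md(1) f by (auto intro!: polys.add polys.mult)
  show "(%_. 0) : L" unfolding L_def using Md(2)
   by (intro CollectI exI[of _ "%_. 0"]) (auto intro: polys.const)
  fix g h assume "g : L" "h : L"
  then obtain m r m' r' where 1: "g = (%z. m z + r z * f z)" "h = (%z. m' z + r' z * f z)"
   "m : M" "r : polys X" "m' : M" "r' : polys X" unfolding L_def by blast
  show "(%z. g z + h z) : L" unfolding L_def using Md(3)[OF 1(3,5)] polys.add[OF 1(4,6)]
   by (intro CollectI exI[of _ "%z. m z + m' z"] exI[of _ "%z. r z + r' z"]) (auto simp: 1 algebra_simps)
 next
  fix s g assume s: "s : polys X" and "g : L"
  then obtain m r where 1: "g = (%z. m z + r z * f z)" "m : M" "r : polys X" unfolding L_def by blast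
  show "(%z. s z * g z) : L" unfolding L_def using Md(4)[OF s 1(2)] polys.mult[OF s 1(3)]
   by (intro CollectI exI[of _ "%z. s z * m z"] exI[of _ "%z. s z * r z"]) (auto simp: 1 algebra_simps)
 qed
 moreover have "M <= L"
 proof
  fix m assume "m : M"
  then show "m : L" unfolding L_def
   by (intro CollectI exI[of _ m] exI[of _ "%_. 0"]) (auto intro: polys.const)
 qed
 moreover have "f : L" unfolding L_def using Md(2)
  by (intro CollectI exI[of _ "%_. 0"] exI[of _ "%_. 1"]) (auto intro: polys.const)
 ultimately have "(%_. 1) : L" using M(2)[of L] f(2) by auto
 then obtain m r where mr: "(%_. 1) = (%z. m z + r z * f z)" "m : M" "r : polys X" unfolding L_def by blast
 have "(%z. 1 - r z * f z) = m"
 proof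
  fix z show "1 - r z * f z = m z" using fun_cong[OF mr(1), of z] by (simp add: algebra_simps)
 qed
 then show ?thesis using that mr by blast
qed

text \<open>
 Modulo a maximal ideal \<open>M\<close> every coordinate is a constant: otherwise the inverses of the
 uncountably many functions \<open>x\<^sub>i - a\<close> would be linearly independent, whereas polynomials form a space of
 countable dimension.
\<close>
lemma maximal_ideal_coordinate:
 fixes M :: "(complex ^ 'n::finite => complex) set"
 defines "R \<equiv> polys (range coords)"
 assumes M: "fideal R M" "!!L. fideal R L ==> M <= L ==> L Int {%_. 1} = {} ==> L = M" "(%_. 1) ~: M"
 shows "EX a. (%v. v $ i - a) : M"
proof (rule ccontr)
 assume "\<nexists>a. (%v. v $ i - a) : M"
 then have no: "(%v. v $ i - a) ~: M" for a by blast
 note Md = fidealD[OF M(1)]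
 have xi: "(%v. v $ i - a) : R" for a unfolding R_def
  by (intro polys_diff polys.const polys.gen) (auto simp: coords_def[abs_def])
 have "EX r. r : R & (%v. 1 - r v * (v $ i - a)) : M" for a
  using maximal_ideal_inverse[OF M(1)[unfolded R_def] M(2)[unfolded R_def] xi[unfolded R_def] no]
  unfolding R_def by blast
 then obtain r where r: "!!a. r a : R" "!!a. (%v. 1 - r a v * (v $ i - a)) : M" by metis
 have "EX D k. ALL z. r a z = (\<Sum>e\<in>ebox D. k e * xmonom coords e z)" for a
  using polys_ebox[of "r a" coords] r(1)[of a] unfolding R_def by metis
 then obtain Df kf where Dk: "!!a z. r a z = (\<Sum>e\<in>ebox (Df a). kf a e * xmonom coords e z)" by metis
 \<comment> \<open>Uncountably many values \<open>a\<close> are distributed over countably many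
   degree bounds.\<close>
 have "EX D. infinite (Df -` {D})"
 proof (rule ccontr)
  assume "\<nexists>D. infinite (Df -` {D})"
  then have "countable (\<Union>D. Df -` {D})" by (intro countable_UN) (auto intro: countable_finite)
  moreover have "(\<Union>D. Df -` {D}) = (UNIV :: complex set)" by auto
  ultimately show False using uncountable_UNIV_complex by simp
 qed
 then obtain D where "infinite (Df -` {D})" by blast
 then obtain A where A: "A <= Df -` {D}" "finite A" "card A = Suc (card (ebox D :: ('n => nat) set))"
  using infinite_arbitrarily_large by metis
 obtain c where c: "EX a:A. c a ~= 0" "ALL e:(ebox D :: ('n => nat) set). (\<Sum>a\<in>A. kf a e * c a) = 0"
  using underdetermined_system[of "ebox D :: ('n => nat) set" A "%e a. kf a e"] A finite_ebox by auto
 have dep: "(\<Sum>a\<in>A. c a * r a v) = 0" for v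
 proof -
  have "(\<Sum>a\<in>A. c a * r a v) = (\<Sum>a\<in>A. \<Sum>e\<in>ebox D. kf a e * c a * xmonom coords e v)"
  proof (rule sum.cong[OF refl])
   fix a assume "a : A"
   then have "Df a = D" using A by auto
   then show "c a * r a v = (\<Sum>e\<in>ebox D. kf a e * c a * xmonom coords e v)"
    unfolding Dk by (simp add: sum_distrib_left mult_ac)
  qed
  also have "\<dots> = (\<Sum>e\<in>ebox D. (\<Sum>a\<in>A. kf a e * c a) * xmonom coords e v)"
   by (subst sum.swap) (simp add: sum_distrib_right)
  finally show ?thesis using c(2) by simp
 qed
 \<comment> \<open>The relation \<open>dep\<close> multiplied by all \<open>x_i - b\<close>: modulo
   \<open>M\<close>, where \<open>r a\<close> inverts \<open>x_i - a\<close>, it becomes a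
   polynomial relation for the single coordinate \<open>x_i\<close>.\<close>
 define p where "p = (\<Sum>a\<in>A. smult (c a) (\<Prod>b\<in>A - {a}. [:- b, 1:]))"
 have p: "poly p t = (\<Sum>a\<in>A. c a * (\<Prod>b\<in>A - {a}. t - b))" for t
  by (simp add: p_def poly_sum poly_prod algebra_simps)
 have pM: "(%v. poly p (v $ i)) : M"
 proof -
  have eq: "poly p (v $ i) = (\<Sum>a\<in>A. (c a * (\<Prod>b\<in>A - {a}. v $ i - b)) * (1 - r a v * (v $ i - a)))" for v
  proof -
   have "(\<Sum>a\<in>A. (c a * (\<Prod>b\<in>A - {a}. v $ i - b)) * (r a v * (v $ i - a))) =
    (\<Sum>a\<in>A. (\<Prod>b\<in>A. v $ i - b) * (c a * r a v))"
    by (rule sum.cong) (use A(2) in "auto simp: prod.remove[of A] mult_ac")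
   also have "\<dots> = 0" using dep[of v] by (simp flip: sum_distrib_left)
   finally show ?thesis unfolding p by (simp add: right_diff_distrib sum_subtractf)
  qed
  have "(%v. \<Sum>a\<in>A'. (c a * (\<Prod>b\<in>A - {a}. v $ i - b)) * (1 - r a v * (v $ i - a))) : M"
   if "finite A'" for A'
   using that
  proof induction
   case empty then show ?case using Md(2) by simp
  next
   case (insert a A')
   have "(%v. c a * (\<Prod>b\<in>A - {a}. v $ i - b)) : R" unfolding R_def
    by (intro polys.mult polys.const polys_prod xi[unfolded R_def])
   from Md(3)[OF Md(4)[OF this r(2)[of a]] insert.IH] show ?case using insert.hyps by simp
  qed
  then show ?thesis unfolding eq using A(2) .
 qed
 obtain a0 where a0: "a0 : A" "c a0 ~= 0" using c(1) by blast
 have "poly p a0 = c a0 * (\<Prod>b\<in>A - {a0}. a0 - b)"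
 proof -
  have "(\<Sum>a\<in>A - {a0}. c a * (\<Prod>b\<in>A - {a}. a0 - b)) = 0"
  proof (rule sum.neutral, rule ballI)
   fix a assume "a : A - {a0}"
   then have "(\<Prod>b\<in>A - {a}. a0 - b) = 0" using A(2) a0 by (intro prod_zero) auto
   then show "c a * (\<Prod>b\<in>A - {a}. a0 - b) = 0" by simp
  qed
  then show ?thesis unfolding p using A(2) a0 by (simp add: sum.remove[of A a0])
 qed
 then have "p ~= 0" using a0 A(2) by auto
 then show False using pM
 \<comment> \<open>Root by root the linear factors of \<open>p\<close> are inverted modulo
   \<open>M\<close>, until a nonzero constant lies in \<open>M\<close>.\<close>
 proof (induction "degree p" arbitrary: p rule: less_induct)
  case less
  show ?case
  proof (cases "degree p = 0")
   case True
   then obtain k where k: "p = [:k:]" using degree_eq_zeroE by blast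
   have "(%_. 1 / k) : R" unfolding R_def by (rule polys.const)
   from Md(4)[OF this less.prems(2)] have "(%v. 1 / k * poly p (v $ i)) : M" .
   moreover have "1 / k * poly p t = 1" for t using k less.prems(1) by simp
   ultimately show False using M(3) by simp
  next
   case False
   then have "\<not> constant (poly p)" by (simp add: constant_degree)
   then obtain rh where "poly p rh = 0" using fundamental_theorem_of_algebra by blast
   then obtain q where q: "p = [:- rh, 1:] * q" unfolding poly_eq_0_iff_dvd dvd_def by blast
   have q0: "q ~= 0" using q less.prems(1) by auto
   have "degree q < degree p" unfolding q using q0 by (subst degree_mult_eq) auto
   moreover have "(%v. poly q (v $ i)) : M"
   proof -
    have qR: "(%v. poly q (v $ i)) : R" unfolding poly_altdef R_def
     by (intro polys_intros polys.gen) (auto simp: coords_def[abs_def])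
    have "(%v. poly q (v $ i) * (1 - r rh v * (v $ i - rh)) + r rh v * poly p (v $ i)) : M"
     using Md(3)[OF Md(4)[OF qR r(2)[of rh]] Md(4)[OF r(1)[of rh] less.prems(2)]] by simp
    moreover have "poly q (v $ i) * (1 - r rh v * (v $ i - rh)) + r rh v * poly p (v $ i) = poly q (v $ i)" for v
     unfolding q by (simp add: algebra_simps)
    ultimately show ?thesis by simp
   qed
   ultimately show False using less.hyps q0 by blast
  qed
 qed
qed

text \<open>A maximal ideal above the generated one contains all \<open>x_i - a_i\<close>, by
  \<open>maximal_ideal_coordinate\<close>. Modulo it each function is congruent to its value at the
  point \<open>a\<close>, which would be a common zero of \<open>B\<close>.\<close>

theorem weak_nullstellensatz:
 fixes B :: "(complex ^ 'n::finite => complex) set"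
 assumes B: "B <= polys (range coords)" and zeros: "!!v. EX f:B. f v ~= 0"
 shows "(%_. 1) : ideal_gen (polys (range coords)) B"
proof (rule ccontr)
 let ?R = "polys (range coords) :: (complex ^ 'n => complex) set"
 let ?I = "ideal_gen ?R B"
 assume "(%_. 1) ~: ?I"
 then obtain M where M: "fideal ?R M" "?I <= M" "M Int {%_. 1} = {}"
  "!!L'. fideal ?R L' ==> M <= L' ==> L' Int {%_. 1} = {} ==> L' = M"
  using maximal_disjoint_ideal[OF ideal_gen_fideal[OF B], of "{%_. 1}"] by blast
 note Md = fidealD[OF M(1)]
 have one: "(%_. 1) ~: M" using M(3) by blast
 have "ALL i. EX a. (%v. v $ i - a) : M" using maximal_ideal_coordinate[OF M(1) M(4) one] by blast
 then obtain a where a: "!!i. (%v. v $ i - a i) : M" by metis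
 define v0 where "v0 = (\<chi> i. a i)"
 have ev: "(%v. f v - f v0) : M" if "f : ?R" for f
  using that
 proof induction
  case (const c) then show ?case using Md(2) by simp
 next
  case (gen f)
  then obtain i where "f = coords i" by blast
  then show ?case using a[of i] by (simp add: coords_def v0_def)
 next
  case (add f g)
  from Md(3)[OF add.IH] show ?case by (simp add: algebra_simps)
 next
  case (mult f g)
  from Md(3)[OF Md(4)[OF mult.hyps(2) mult.IH(1)] Md(4)[OF polys.const[of "f v0"] mult.IH(2)]]
  show ?case by (simp add: algebra_simps)
 qed
 obtain f where f: "f : B" "f v0 ~= 0" using zeros by blast
 have fM: "f : M" using M(2) ideal_gen_base[OF f(1), of "range coords"] by blast
 have "(%v. f v - (f v - f v0)) : M"
  by (rule fideal_diff[OF M(1) fM ev]) (use f(1) B in blast)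
 then have "(%v. f v0) : M" by simp
 from Md(4)[OF polys.const[of "1 / f v0"] this] show False using one f(2) by simp
qed

subsection \<open>Bihomogeneous forms\<close>

definition jv :: "'n::finite => (complex ^ 'n) \<times> (complex ^ 'm::finite) => complex" where "jv i p = fst p $ i"
definition jk :: "'m::finite => (complex ^ 'n::finite) \<times> (complex ^ 'm) => complex" where "jk i p = snd p $ i"

definition joint :: "((complex ^ 'n::finite) \<times> (complex ^ 'm::finite) => complex) set" where
 "joint = polys (range jv Un range jk)"

lemma coords_fst: "(%z. coords i (fst z)) = jv i" by (simp add: coords_def jv_def[abs_def])

lemma joint_jv: "jv i : joint" and joint_jk: "jk j : joint"
 unfolding joint_def by (auto intro: polys.gen)

lemma joint_intros: "(%_. c) : joint" "f : joint ==> g : joint ==> (%z. f z + g z) : joint"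
 "f : joint ==> g : joint ==> (%z. f z * g z) : joint" "f : joint ==> (%z. f z ^ n) : joint"
 "f : joint ==> g : joint ==> (%z. f z - g z) : joint"
 unfolding joint_def by (auto intro: polys.add polys.mult polys.const polys_power polys_diff)

definition bihom :: "((complex ^ 'n::finite) \<times> (complex ^ 'm::finite) => complex) => nat => nat => bool" where
 "bihom P d e \<longleftrightarrow> (ALL c v K. c ~= 0 --> P (c *s v, K) = c ^ d * P (v, K) & P (v, c *s K) = c ^ e * P (v, K))"

lemma bihom_mult: "bihom P d e ==> bihom Q d' e' ==> bihom (%z. P z * Q z) (d + d') (e + e')"
 unfolding bihom_def by (simp add: power_add)

lemma bihom_add: "bihom P d e ==> bihom Q d e ==> bihom (%z. P z + Q z) d e"
 unfolding bihom_def by (simp add: distrib_left)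

lemma bihom_jv_power: "bihom (%z. jv i z ^ n) n 0"
 unfolding bihom_def jv_def by (simp add: power_mult_distrib)

lemma bihom_jk_power: "bihom (%z. (jk i z / h) ^ n) 0 n"
 unfolding bihom_def jk_def by (simp add: power_mult_distrib power_divide)

definition exps :: "nat => ('i::finite => nat) set" where "exps D = {e. (\<Sum>i\<in>UNIV. e i) = D}"

lemma finite_exps: "finite (exps D :: ('i::finite => nat) set)"
proof (rule finite_subset[OF _ finite_ebox[of D]])
 show "exps D <= (ebox D :: ('i => nat) set)"
  by (auto simp: exps_def ebox_def intro!: member_le_sum)
qed

text \<open>Grading once in \<open>v\<close> and once in \<open>K\<close>. The coefficients in
  \<open>v\<close> are forms in \<open>K\<close>, so that a bihomogeneous form becomes a row of a
  matrix depending on \<open>K\<close>.\<close>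

lemma bihom_expand:
 fixes P :: "(complex ^ 'n::finite) \<times> (complex ^ 'm::finite) => complex"
 assumes P: "P : joint" "bihom P D e"
 obtains c where "!!g. c g : polys (range coords)" "!!g t K. c g (t *s K) = t ^ e * c g K"
  "!!v K. P (v, K) = (\<Sum>g\<in>exps D. c g K * xmonom coords g v)"
proof -
 define xs where "xs = (%s::'n + 'm. case s of Inl i => jv i | Inr j => jk j)"
 have rng: "range jv Un range jk = range xs"
 proof -
  have "range xs = xs ` (range Inl Un range Inr)" by (simp add: UNIV_sum)
  then show ?thesis by (auto simp: xs_def image_Un image_image)
 qed
 obtain N k where k: "!!z. P z = (\<Sum>s\<in>ebox N. k s * xmonom xs s z)"
  using polys_ebox[of P xs] P(1) unfolding joint_def rng by blast
 have xm: "xmonom xs s (v, K) = xmonom coords (s \<circ> Inl) v * xmonom coords (s \<circ> Inr) K" for s v K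
 proof -
  have "xmonom xs s (v, K) = (\<Prod>i\<in>range Inl Un range Inr. xs i (v, K) ^ s i)"
   unfolding xmonom_def UNIV_sum ..
  also have "\<dots> = (\<Prod>i\<in>range Inl. xs i (v, K) ^ s i) * (\<Prod>i\<in>range Inr. xs i (v, K) ^ s i)"
   by (rule prod.union_disjoint) auto
  finally show ?thesis
   by (simp add: prod.reindex xmonom_def xs_def jv_def jk_def coords_def)
 qed
 let ?dv = "%s::'n + 'm => nat. \<Sum>i\<in>UNIV. s (Inl i)" and ?dk = "%s::'n + 'm => nat. \<Sum>i\<in>UNIV. s (Inr i)"
 have sv: "xmonom coords (s \<circ> Inl) (t *s v) = t ^ ?dv s * xmonom coords (s \<circ> Inl) v" for s :: "'n + 'm => nat" and t v
  using xmonom_scale[of coords "%v. t *s v" v t "s \<circ> Inl"] by simp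
 have sk: "xmonom coords (s \<circ> Inr) (t *s v) = t ^ ?dk s * xmonom coords (s \<circ> Inr) v" for s :: "'n + 'm => nat" and t v
  using xmonom_scale[of coords "%v. t *s v" v t "s \<circ> Inr"] by simp
 define A where "A = {s : ebox N. ?dv s = D}"
 define B where "B = {s : A. ?dk s = e}"
 have fin: "finite A" "finite B" using finite_ebox[of N] by (auto simp: A_def B_def)
 have 1: "P (v, K) = (\<Sum>s\<in>A. k s * xmonom xs s (v, K))" for v K
 proof -
  have "(\<Sum>s\<in>ebox N. (k s * xmonom xs s (v, K)) * t ^ ?dv s) = t ^ D * P (v, K)" if "t ~= 0" for t
  proof -
   have "t ^ D * P (v, K) = P (t *s v, K)" using P(2) that by (simp add: bihom_def)
   then show ?thesis unfolding k by (simp add: xm sv mult_ac)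
  qed
  from graded_coefficients[OF finite_ebox this, of D] show ?thesis by (simp add: A_def)
 qed
 have 2: "P (v, K) = (\<Sum>s\<in>B. k s * xmonom xs s (v, K))" for v K
 proof -
  have "(\<Sum>s\<in>A. (k s * xmonom xs s (v, K)) * t ^ ?dk s) = t ^ e * P (v, K)" if "t ~= 0" for t
  proof -
   have "t ^ e * P (v, K) = P (v, t *s K)" using P(2) that by (simp add: bihom_def)
   then show ?thesis unfolding 1 by (simp add: xm sk mult_ac)
  qed
  from graded_coefficients[OF fin(1) this, of e] show ?thesis by (simp add: B_def)
 qed
 define c where "c g K = (\<Sum>s | s : B & s \<circ> Inl = g. k s * xmonom coords (s \<circ> Inr) K)" for g :: "'n => nat" and K :: "complex ^ 'm"
 show ?thesis
 proof (rule that[of c])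
  show "c g : polys (range coords)" for g
   unfolding c_def[abs_def] by (intro polys_sum polys.mult polys.const xmonom_polys)
  show "c g (t *s K) = t ^ e * c g K" for g t K
   unfolding c_def sum_distrib_left by (rule sum.cong) (auto simp: sk B_def)
  fix v K
  have "(\<Sum>g\<in>exps D. c g K * xmonom coords g v) =
   (\<Sum>g\<in>exps D. \<Sum>s | s : B & s \<circ> Inl = g. k s * xmonom xs s (v, K))"
   unfolding c_def sum_distrib_right by (intro sum.cong) (auto simp: xm)
  also have "\<dots> = (\<Sum>s\<in>B. k s * xmonom xs s (v, K))"
   by (rule sum.group[OF fin(2) finite_exps]) (auto simp: exps_def B_def A_def)
  finally show "P (v, K) = (\<Sum>g\<in>exps D. c g K * xmonom coords g v)" using 2 by simp
 qed
qed

text \<open>Gaussian elimination without divisions.\<close>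
lemma generic_nonsingular:
 fixes M :: "'i => 'i => complex ^ 'm::finite => complex"
 assumes "finite I"
  "!!i j. i : I ==> j : I ==> M i j : polys (range coords)"
  "!!i j t K. i : I ==> j : I ==> M i j (t *s K) = t ^ e * M i j K"
  "!!i j. i : I ==> j : I ==> M i j H = (if i = j then 1 else 0)"
 shows "EX G d. G : polys (range coords) & (ALL t K. G (t *s K) = t ^ d * G K) & G H = 1 &
  (ALL K x. G K ~= 0 --> (ALL i:I. (\<Sum>j\<in>I. M i j K * x j) = 0) --> (ALL j:I. x j = 0))"
 using assms
proof (induction I arbitrary: M e rule: finite_induct)
 case empty
 show ?case by (rule exI[of _ "%_. 1"], rule exI[of _ 0]) (auto intro: polys.const)
next
 case (insert k I)
 define M' where "M' i j K = M k k K * M i j K - M i k K * M k j K" for i j K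
 have "EX G d. G : polys (range coords) & (ALL t K. G (t *s K) = t ^ d * G K) & G H = 1 &
  (ALL K x. G K ~= 0 --> (ALL i:I. (\<Sum>j\<in>I. M' i j K * x j) = 0) --> (ALL j:I. x j = 0))"
 proof (rule insert.IH[of M' "e + e"])
  show "M' i j : polys (range coords)" if "i : I" "j : I" for i j
   unfolding M'_def[abs_def] using that by (intro polys_diff polys.mult insert.prems) auto
  show "M' i j (t *s K) = t ^ (e + e) * M' i j K" if "i : I" "j : I" for i j t K
   unfolding M'_def using that by (simp add: insert.prems(2) power_add algebra_simps)
  show "M' i j H = (if i = j then 1 else 0)" if "i : I" "j : I" for i j
   using that insert.hyps by (auto simp: M'_def insert.prems(3))
 qed
 then obtain G d where G: "G : polys (range coords)" "!!t K. G (t *s K) = t ^ d * G K" "G H = 1"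
  "!!K x. G K ~= 0 ==> (ALL i:I. (\<Sum>j\<in>I. M' i j K * x j) = 0) ==> (ALL j:I. x j = 0)" by blast
 show ?case
 proof (intro exI[of _ "%K. M k k K * G K"] exI[of _ "e + d"] conjI allI impI)
  show "(%K. M k k K * G K) : polys (range coords)" by (intro polys.mult G insert.prems) auto
  show "M k k (t *s K) * G (t *s K) = t ^ (e + d) * (M k k K * G K)" for t K
   by (simp add: insert.prems(2) G power_add)
  show "M k k H * G H = 1" by (simp add: insert.prems(3) G)
  fix K x assume nz: "M k k K * G K ~= 0" and sys: "ALL i:insert k I. (\<Sum>j\<in>insert k I. M i j K * x j) = 0"
  have s: "M i k K * x k + (\<Sum>j\<in>I. M i j K * x j) = 0" if "i : insert k I" for i
   using bspec[OF sys that] insert.hyps by simp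
  have "(\<Sum>j\<in>I. M' i j K * x j) = 0" if "i : I" for i
  proof -
   have "(\<Sum>j\<in>I. M' i j K * x j) = M k k K * (\<Sum>j\<in>I. M i j K * x j) - M i k K * (\<Sum>j\<in>I. M k j K * x j)"
    by (simp add: M'_def sum_distrib_left sum_subtractf left_diff_distrib right_diff_distrib mult_ac)
   also have "(\<Sum>j\<in>I. M i j K * x j) = - (M i k K * x k)" using s[of i] that by (simp add: eq_neg_iff_add_eq_0 add.commute)
   also have "(\<Sum>j\<in>I. M k j K * x j) = - (M k k K * x k)" using s[of k] by (simp add: eq_neg_iff_add_eq_0 add.commute)
   finally show ?thesis by simp
  qed
  then have I: "ALL j:I. x j = 0" by (intro G(4)[of K x]) (use nz in auto)
  then show "ALL j:insert k I. x j = 0" using s[of k] nz by simp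
 qed
qed

text \<open>Over \<open>H\<close> there is no common zero, so by the Nullstellensatz high powers of
  the coordinates are combinations of the equations. In a large degree \<open>D\<close> all
  monomials are, which gives a square matrix \<open>M\<close> equal to the identity at
  \<open>H\<close>. Where \<open>G\<close> shows it to be nonsingular, a common zero would
  annihilate all monomials of degree \<open>D\<close>.\<close>

theorem elimination:
 fixes \<F> :: "((complex ^ 'n::finite) \<times> (complex ^ 'm::finite) => complex) set" and H :: "complex ^ 'm"
 assumes \<F>: "\<F> <= joint" "!!P. P : \<F> ==> EX d e. bihom P d e"
  and H: "H ~= 0" "!!v. v ~= 0 ==> EX P:\<F>. P (v, H) ~= 0"
 obtains G d where "G : polys (range coords)" "!!t K. G (t *s K) = t ^ d * G K" "G H ~= 0"
  "!!K v. G K ~= 0 ==> v ~= 0 ==> EX P:\<F>. P (v, K) ~= 0"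
proof -
 let ?R = "polys (range coords) :: (complex ^ 'n => complex) set"
 obtain j0 where j0: "H $ j0 ~= 0" using H(1) by (auto simp: vec_eq_iff)
 \<comment> \<open>A form of degree 1 in \<open>K\<close> with value 1 at \<open>H\<close>; its
   powers equalize degrees in \<open>K\<close> without changing values over
   \<open>H\<close>.\<close>
 define l where "l = (%z::(complex ^ 'n) \<times> (complex ^ 'm). jk j0 z / H $ j0)"
 have lH: "l (v, H) = 1" for v using j0 by (simp add: l_def jk_def)
 have lj: "(%z. l z ^ n) : joint" for n
  unfolding l_def divide_inverse by (intro joint_intros joint_jk)
 have lb: "bihom (%z. l z ^ n) 0 n" for n unfolding l_def by (rule bihom_jk_power)
 have step1: "EX N e Ph. Ph : joint & bihom Ph N e & (ALL v K. (ALL P:\<F>. P (v, K) = 0) --> Ph (v, K) = 0) &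
   (ALL v. v $ i = 1 --> Ph (v, H) = 1)" for i
 proof -
  define B where "B = insert (%v. coords i v - 1) ((%P v. P (v, H)) ` \<F>)"
  have BR: "B <= ?R"
  proof -
   have "(%v. P (v, H)) : ?R" if "P : \<F>" for P
   proof (rule polys_compose[of P "range jv Un range jk"])
    show "P : polys (range jv Un range jk)" using that \<F> by (auto simp: joint_def)
    fix f :: "(complex ^ 'n) \<times> (complex ^ 'm) => complex" assume "f : range jv Un range jk"
    then consider i where "f = jv i" | j where "f = jk j" by blast
    then show "(%v. f (v, H)) : ?R"
    proof cases
     case 1
     then have "(%v. f (v, H)) = coords i" by (auto simp: jv_def coords_def)
     then show ?thesis by (simp add: polys.gen)
    next
     case 2
     then show ?thesis by (simp add: jk_def polys.const)
    qed
   qed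
   moreover have "(%v. coords i v - 1) : ?R" by (intro polys_diff polys.const polys.gen) auto
   ultimately show ?thesis by (auto simp: B_def)
  qed
  have "EX f:B. f v ~= 0" for v
  proof (cases "v $ i = 1")
   case True
   then have "v ~= 0" by auto
   then show ?thesis using H(2)[of v] by (auto simp: B_def)
  next
   case False
   then show ?thesis by (auto simp: B_def coords_def)
  qed
  then have one: "(%_. 1) : ideal_gen ?R B" by (rule weak_nullstellensatz[OF BR])
  have "EX N e Ph. Ph : joint & bihom Ph N e & (ALL v K. (ALL P:\<F>. P (v, K) = 0) --> Ph (v, K) = 0) &
   (ALL v. v $ i = 1 --> Ph (v, H) = f v)" if "f : ideal_gen ?R B" for f
   using that
  proof induction
   case zero
   show ?case by (rule exI[of _ 0], rule exI[of _ 0], rule exI[of _ "%_. 0"]) (auto simp: joint_intros bihom_def)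
  next
   case (step f r b)
   obtain Nf ef Phf where Phf: "Phf : joint" "bihom Phf Nf ef" "!!v K. (ALL P:\<F>. P (v, K) = 0) ==> Phf (v, K) = 0"
    "!!v. v $ i = 1 ==> Phf (v, H) = f v" using step.IH by blast
   have "EX N e Ph. Ph : joint & bihom Ph N e & (ALL v K. (ALL P:\<F>. P (v, K) = 0) --> Ph (v, K) = 0) &
    (ALL v. v $ i = 1 --> Ph (v, H) = b v)"
   proof (cases "b = (%v. coords i v - 1)")
    case True
    then show ?thesis
     by (intro exI[of _ 0] exI[of _ "%_. 0"]) (auto simp: joint_intros bihom_def coords_def)
   next
    case False
    then obtain P where P: "P : \<F>" "b = (%v. P (v, H))" using step.hyps(3) by (auto simp: B_def)
    then obtain d e where "bihom P d e" using \<F>(2) by blast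
    then show ?thesis using P \<F>(1) by (intro exI[of _ d] exI[of _ e] exI[of _ P]) auto
   qed
   then obtain Nb eb Phb where Phb: "Phb : joint" "bihom Phb Nb eb" "!!v K. (ALL P:\<F>. P (v, K) = 0) ==> Phb (v, K) = 0"
    "!!v. v $ i = 1 ==> Phb (v, H) = b v" by blast
   have "EX N. EX P:?R. (ALL c v. P (c *s v) = c ^ N * P v) & (ALL v:{v. v $ i = 1}. P v = r v)"
   proof (rule homogenization[where io = "%v. v" and T = "%c v. c *s v" and l = "coords i", OF step.hyps(2)])
    show "coords i : ?R" by (rule polys.gen) auto
    show "EX N. EX P:?R. (ALL c v. P (c *s v) = c ^ N * P v) & (ALL v:{v. v $ i = 1}. P v = f v)"
     if "f : range coords" for f
     using that by (intro exI[of _ 1] bexI[of _ f]) (auto intro: polys.gen)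
   qed (auto simp: coords_def)
   then obtain Nr R where R: "R : ?R" "!!c v. R (c *s v) = c ^ Nr * R v" "!!v. v $ i = 1 ==> R v = r v" by auto
   define Rj where "Rj = (%z::(complex ^ 'n) \<times> (complex ^ 'm). R (fst z))"
   have Rj: "Rj : joint" "bihom Rj Nr 0"
   proof -
    show "Rj : joint" unfolding Rj_def joint_def
     by (rule polys_compose[OF R(1)]) (auto simp: coords_fst intro!: polys.gen)
    show "bihom Rj Nr 0" by (simp add: bihom_def Rj_def R)
   qed
   define Ph where "Ph = (%z. (Rj z * Phb z) * (jv i z ^ Nf * l z ^ ef) + Phf z * (jv i z ^ (Nr + Nb) * l z ^ eb))"
   have "Ph : joint" unfolding Ph_def by (intro joint_intros Rj Phb Phf joint_jv lj)
   moreover have "bihom Ph (Nr + Nb + Nf) (ef + eb)"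
   proof -
    have 1: "bihom (%z. (Rj z * Phb z) * (jv i z ^ Nf * l z ^ ef)) (Nr + Nb + (Nf + 0)) (0 + eb + (0 + ef))"
     by (intro bihom_mult Rj Phb bihom_jv_power lb)
    have 2: "bihom (%z. Phf z * (jv i z ^ (Nr + Nb) * l z ^ eb)) (Nf + (Nr + Nb + 0)) (ef + (0 + eb))"
     by (intro bihom_mult Phf bihom_jv_power lb)
    show ?thesis unfolding Ph_def by (rule bihom_add) (use 1 2 in "simp_all add: ac_simps")
   qed
   moreover have "Ph (v, K) = 0" if "ALL P:\<F>. P (v, K) = 0" for v K
    using Phb(3) Phf(3) that by (simp add: Ph_def)
   moreover have "Ph (v, H) = r v * b v + f v" if "v $ i = 1" for v
    using that by (simp add: Ph_def Rj_def R Phb Phf lH jv_def)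
   ultimately show ?case by blast
  qed
  from this[OF one] show ?thesis by blast
 qed
 have "ALL i. EX t. (snd (snd t)) : joint & bihom (snd (snd t)) (fst t) (fst (snd t)) &
   (ALL v K. (ALL P:\<F>. P (v, K) = 0) --> snd (snd t) (v, K) = 0) & (ALL v. v $ i = 1 --> snd (snd t) (v, H) = 1)"
 proof
  fix i
  obtain N e Ph where "Ph : joint & bihom Ph N e & (ALL v K. (ALL P:\<F>. P (v, K) = 0) --> Ph (v, K) = 0) &
   (ALL v. v $ i = 1 --> Ph (v, H) = 1)" using step1[of i] by blast
  then show "EX t. (snd (snd t)) : joint & bihom (snd (snd t)) (fst t) (fst (snd t)) &
   (ALL v K. (ALL P:\<F>. P (v, K) = 0) --> snd (snd t) (v, K) = 0) & (ALL v. v $ i = 1 --> snd (snd t) (v, H) = 1)"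
   by (intro exI[of _ "(N, e, Ph)"]) simp
 qed
 from choice[OF this] obtain tt where tt: "!!i. (snd (snd (tt i))) : joint & bihom (snd (snd (tt i))) (fst (tt i)) (fst (snd (tt i))) &
   (ALL v K. (ALL P:\<F>. P (v, K) = 0) --> snd (snd (tt i)) (v, K) = 0) & (ALL v. v $ i = 1 --> snd (snd (tt i)) (v, H) = 1)"
  by blast
 define Nf where "Nf i = fst (tt i)" for i :: 'n
 define ef where "ef i = fst (snd (tt i))" for i :: 'n
 define Ph where "Ph i = snd (snd (tt i))" for i :: 'n
 have Ph: "Ph i : joint" "bihom (Ph i) (Nf i) (ef i)" "!!v K. (ALL P:\<F>. P (v, K) = 0) ==> Ph i (v, K) = 0"
  "!!v. v $ i = 1 ==> Ph i (v, H) = 1" for i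
  using tt[of i] by (auto simp: Ph_def Nf_def ef_def)
 define N where "N = (\<Sum>i\<in>UNIV. Nf i + 1)"
 define e where "e = (\<Sum>i\<in>UNIV. ef i)"
 have N: "Nf i + 1 <= N" "ef i <= e" for i unfolding N_def e_def by (auto intro!: member_le_sum)
 have N0: "N > 0" using N(1)[of undefined] by simp
 define Ps where "Ps i = (%z. Ph i z * (jv i z ^ (N - Nf i) * l z ^ (e - ef i)))" for i
 have Ps: "Ps i : joint" "bihom (Ps i) N e" "!!v K. (ALL P:\<F>. P (v, K) = 0) ==> Ps i (v, K) = 0" for i
 proof -
  show "Ps i : joint" unfolding Ps_def by (intro joint_intros Ph joint_jv lj)
  have "bihom (Ps i) (Nf i + (N - Nf i + 0)) (ef i + (0 + (e - ef i)))"
   unfolding Ps_def by (intro bihom_mult Ph bihom_jv_power lb)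
  then show "bihom (Ps i) N e" using N[of i] by simp
  show "Ps i (v, K) = 0" if "ALL P:\<F>. P (v, K) = 0" for v K using Ph(3)[OF that] by (simp add: Ps_def)
 qed
 have PsH: "Ps i (v, H) = (v $ i) ^ N" for i v
 proof (cases "v $ i = 0")
  case True
  have "N - Nf i > 0" using N(1)[of i] by simp
  then show ?thesis using True N0 by (simp add: Ps_def jv_def zero_power)
 next
  case False
  define u where "u = inverse (v $ i) *s v"
  have u: "u $ i = 1" "v = (v $ i) *s u" using False by (auto simp: u_def vec_eq_iff)
  have "Ph i ((v $ i) *s u, H) = (v $ i) ^ Nf i * Ph i (u, H)"
   using Ph(2)[of i] False unfolding bihom_def by blast
  then have "Ph i (v, H) = (v $ i) ^ Nf i" using u Ph(4)[OF u(1)] by simp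
  then show ?thesis using N(1)[of i] by (simp add: Ps_def lH jv_def power_add[symmetric])
 qed

 \<comment> \<open>In this degree every monomial is divisible by the \<open>N\<close>-th power of
   some coordinate.\<close>
 define D where "D = CARD('n) * N"
 have D0: "D > 0" using N0 by (simp add: D_def)
 have "EX i. N <= g i" if "g : exps D" for g :: "'n => nat"
 proof (rule ccontr)
  assume "\<nexists>i. N <= g i"
  then have "(\<Sum>i\<in>UNIV. g i) < (\<Sum>i\<in>(UNIV::'n set). N)" by (intro sum_strict_mono) (auto simp: not_le)
  then show False using that by (simp add: exps_def D_def)
 qed
 note ex = this
 define io where "io g = (SOME i. N <= g i)" for g :: "'n => nat"
 have io: "N <= g (io g)" if "g : exps D" for g unfolding io_def by (rule someI_ex[OF ex[OF that]])
 define sub where "sub g = (%i. g i - (if i = io g then N else 0))" for g :: "'n => nat"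
 define row where "row g = (%z::(complex ^ 'n) \<times> (complex ^ 'm). xmonom coords (sub g) (fst z) * Ps (io g) z)" for g
 have sub: "g = (%i. sub g i + (if i = io g then N else 0))" if "g : exps D" for g
  using io[OF that] by (auto simp: sub_def)
 have row: "row g : joint" "bihom (row g) D e" "row g (v, H) = xmonom coords g v" if g: "g : exps D" for g v
 proof -
  have "(%z. xmonom coords (sub g) (fst z)) : joint" unfolding joint_def
   by (rule polys_compose[OF xmonom_polys]) (auto simp: coords_fst intro!: polys.gen)
  then show "row g : joint" unfolding row_def by (intro joint_intros Ps)
  have s: "xmonom coords (sub g) (c *s v) = c ^ (\<Sum>i\<in>UNIV. sub g i) * xmonom coords (sub g) v" for c v
   by (rule xmonom_scale) simp
  have "D = (\<Sum>i\<in>UNIV. g i)" using g by (simp add: exps_def)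
  also have "\<dots> = (\<Sum>i\<in>UNIV. sub g i + (if i = io g then N else 0))"
   by (rule arg_cong[where f = "%h. sum h UNIV", OF sub[OF g]])
  finally have D: "D = (\<Sum>i\<in>UNIV. sub g i) + N" by (simp add: sum.distrib)
  have "bihom (%z::(complex ^ 'n) \<times> (complex ^ 'm). xmonom coords (sub g) (fst z)) (\<Sum>i\<in>UNIV. sub g i) 0"
   by (simp add: bihom_def s)
  from bihom_mult[OF this Ps(2)[of "io g"]] show "bihom (row g) D e" by (simp add: row_def D)
  have "xmonom coords g v = xmonom coords (%i. sub g i + (if i = io g then N else 0)) v"
   by (rule arg_cong[where f = "%h. xmonom coords h v", OF sub[OF g]])
  also have "\<dots> = xmonom coords (sub g) v * (v $ io g) ^ N"
   by (simp add: xmonom_add xmonom_unit coords_def)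
  finally show "row g (v, H) = xmonom coords g v" by (simp add: row_def PsH)
 qed
 have "ALL g:exps D. EX c. (ALL g'. c g' : polys (range coords)) & (ALL g' t K. c g' (t *s K) = t ^ e * c g' K) &
  (ALL v K. row g (v, K) = (\<Sum>g'\<in>exps D. c g' K * xmonom coords g' v))"
 proof
  fix g :: "'n => nat" assume g: "g : exps D"
  show "EX c. (ALL g'. c g' : polys (range coords)) & (ALL g' t K. c g' (t *s K) = t ^ e * c g' K) &
   (ALL v K. row g (v, K) = (\<Sum>g'\<in>exps D. c g' K * xmonom coords g' v))"
   by (rule bihom_expand[OF row(1,2)[OF g]]) blast
 qed
 from bchoice[OF this] obtain c where c: "!!g g'. g : exps D ==> c g g' : polys (range coords)"
  "!!g g' t K. g : exps D ==> c g g' (t *s K) = t ^ e * c g g' K"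
  "!!g v K. g : exps D ==> row g (v, K) = (\<Sum>g'\<in>exps D. c g g' K * xmonom coords g' v)" by blast
 define l' where "l' K = (K $ j0 / H $ j0) ^ e" for K :: "complex ^ 'm"
 \<comment> \<open>The correction by \<open>l'\<close> makes \<open>M\<close> the identity at
   \<open>H\<close>. Relations are unaffected: applied to the monomials of \<open>v\<close>, the
   correction in row \<open>g\<close> gives
   \<open>xmonom coords g v - row g (v, H) = 0\<close>.\<close>
 define M where "M g g' K = c g g' K + l' K * ((if g = g' then 1 else 0) - c g g' H)" for g g' K
 have l'p: "l' : polys (range coords)" unfolding l'_def[abs_def] divide_inverse
  by (intro polys_power polys.mult polys.const polys.gen) (auto simp: coords_def[abs_def])
 have l's: "l' (t *s K) = t ^ e * l' K" for t K by (simp add: l'_def power_mult_distrib power_divide)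
 have "EX G d. G : polys (range coords) & (ALL t K. G (t *s K) = t ^ d * G K) & G H = 1 &
  (ALL K x. G K ~= 0 --> (ALL g:exps D. (\<Sum>g'\<in>exps D. M g g' K * x g') = 0) --> (ALL g':exps D. x g' = 0))"
 proof (rule generic_nonsingular[OF finite_exps])
  show "M g g' : polys (range coords)" if "g : exps D" for g g'
   unfolding M_def[abs_def] by (intro polys.add polys.mult polys.const l'p c that)
  show "M g g' (t *s K) = t ^ e * M g g' K" if "g : exps D" for g g' t K
   unfolding M_def by (simp add: c that l's algebra_simps)
  show "M g g' H = (if g = g' then 1 else 0)" for g g' using j0 by (simp add: M_def l'_def)
 qed
 then obtain G d where G: "G : polys (range coords)" "!!t K. G (t *s K) = t ^ d * G K" "G H = 1"
  "!!K x. G K ~= 0 ==> (!!g. g : exps D ==> (\<Sum>g'\<in>exps D. M g g' K * x g') = 0) ==> (ALL g':exps D. x g' = 0)" by blast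
 have "EX P:\<F>. P (v, K) ~= 0" if K: "G K ~= 0" and v: "v ~= 0" for K v
 proof (rule ccontr)
  assume "\<not> (EX P:\<F>. P (v, K) ~= 0)"
  then have "Ps i (v, K) = 0" for i using Ps(3) by blast
  then have r0: "row g (v, K) = 0" for g by (simp add: row_def)
  have "(\<Sum>g'\<in>exps D. M g g' K * xmonom coords g' v) = 0" if g: "g : exps D" for g
  proof -
   have "(\<Sum>g'\<in>exps D. M g g' K * xmonom coords g' v) = (\<Sum>g'\<in>exps D. c g g' K * xmonom coords g' v) +
     l' K * ((\<Sum>g'\<in>exps D. (if g = g' then 1 else 0) * xmonom coords g' v) - (\<Sum>g'\<in>exps D. c g g' H * xmonom coords g' v))"
    by (simp add: M_def sum.distrib sum_subtractf sum_distrib_left algebra_simps)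
   also have "(\<Sum>g'\<in>exps D. (if g = g' then 1 else 0) * xmonom coords g' v) = xmonom coords g v"
   proof -
    have "(\<Sum>g'\<in>exps D. (if g = g' then 1 else 0) * xmonom coords g' v) =
     (\<Sum>g'\<in>exps D. if g = g' then xmonom coords g' v else 0)" by (rule sum.cong) auto
    also have "\<dots> = (if g : exps D then xmonom coords g v else 0)" by (rule sum.delta'[OF finite_exps])
    finally show ?thesis using g by simp
   qed
   finally show ?thesis using c(3)[OF g, symmetric] r0 row(3)[OF g] by simp
  qed
  then have "ALL g':exps D. xmonom coords g' v = 0" by (rule G(4)[OF K])
  moreover have "(%j. if j = i then D else 0) : exps D" for i :: 'n by (simp add: exps_def)
  ultimately have "coords i v ^ D = 0" for i using xmonom_unit[of coords i D v] by metis
  then have "v $ i = 0" for i using D0 by (simp add: coords_def)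
  then show False using v by (simp add: vec_eq_iff)
 qed
 then show ?thesis using that[OF G(1,2)] G(3) by simp
qed

no_notation fps_nth (infixl \<open>$\<close> 75)

section \<open>Irreducible components\<close>

lemma rep_cproj_nonzero: "rep_cproj p ~= 0"
 using Quotient3_rep_reflp[OF Quotient3_cproj, of p] by (simp add: proj_rel_def)

lemma abs_rep_cproj [simp]: "abs_cproj (rep_cproj p) = p"
 by (rule Quotient3_abs_rep[OF Quotient3_cproj])

lemma abs_cproj_eq_iff:
 assumes "v ~= 0" "w ~= 0"
 shows "abs_cproj v = abs_cproj w \<longleftrightarrow> (EX c. c ~= 0 & w = c *s v)"
proof -
 have r: "proj_rel v v" if "v ~= 0" for v :: "complex ^ 'a"
  using that unfolding proj_rel_def by (intro conjI exI[of _ 1]) auto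
 show ?thesis
  using Quotient3_rel[OF Quotient3_cproj, of v w] r[OF assms(1)] r[OF assms(2)] assms(1)
  by (auto simp: proj_rel_def)
qed

lemma abs_cproj_scale: "v ~= 0 ==> c ~= 0 ==> abs_cproj (c *s v) = abs_cproj v"
 using abs_cproj_eq_iff[of v "c *s v"] by (auto simp: vector_mul_eq_0)

lemma rep_abs_cproj:
 assumes "v ~= 0" obtains c where "c ~= 0" "rep_cproj (abs_cproj v) = c *s v"
 using abs_cproj_eq_iff[OF assms rep_cproj_nonzero[of "abs_cproj v"]] by auto

definition form :: "nat => (complex ^ 'n::finite => complex) => bool" where
 "form d P \<longleftrightarrow> P : polys (range coords) & (ALL c v. P (c *s v) = c ^ d * P v)"

lemma form_coords: "form 1 (coords i)"
 by (auto simp: form_def intro: polys.gen)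

lemma form_mult: "form d P ==> form e Q ==> form (d + e) (%v. P v * Q v)"
 by (auto simp: form_def power_add intro: polys.mult)

lemma form_power: "form d P ==> form (d * m) (%v. P v ^ m)"
 by (auto simp: form_def power_mult_distrib power_mult intro: polys_power)

lemma form_sum: "(!!i. i : I ==> form d (f i)) ==> form d (%v. \<Sum>i\<in>I. c i * f i v)"
 by (auto simp: form_def sum_distrib_left mult_ac intro!: polys_sum polys.mult polys.const)

lemma form_abs_cproj: "form d P ==> v ~= 0 ==> P (rep_cproj (abs_cproj v)) = 0 \<longleftrightarrow> P v = 0"
 by (rule rep_abs_cproj[of v]) (auto simp: form_def)

lemma form_poly_eval:
 assumes "homogeneous F" obtains d where "form d (%v. poly_eval F (($) v))"
 by (rule poly_eval_homogeneous[OF assms]) (auto simp: form_def poly_eval_polys intro: that)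

lemma form_cpoly:
 assumes "form d P" obtains F where "homogeneous F" "!!v. poly_eval F (($) v) = P v"
 by (rule polys_homogeneous_poly_eval[of P d]) (use assms in "auto simp: form_def intro: that")

lemma zariski_closed_iff:
 "zariski_closed X \<longleftrightarrow> (\<exists>\<P>. (ALL P:\<P>. EX d. form d P) & X = {p. ALL P:\<P>. P (rep_cproj p) = 0})"
proof
 assume "zariski_closed X"
 then obtain \<F> where F: "ALL F:\<F>. homogeneous F" "X = {p. ALL F:\<F>. poly_eval F (($) (rep_cproj p)) = 0}"
  unfolding zariski_closed_def by blast
 have "EX d. form d (%v. poly_eval F (($) v))" if "F : \<F>" for F
  using form_poly_eval F(1) that by metis
 then show "\<exists>\<P>. (ALL P:\<P>. EX d. form d P) & X = {p. ALL P:\<P>. P (rep_cproj p) = 0}"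
  by (intro exI[of _ "(%F v. poly_eval F (($) v)) ` \<F>"]) (auto simp: F(2))
next
 assume "\<exists>\<P>. (ALL P:\<P>. EX d. form d P) & X = {p. ALL P:\<P>. P (rep_cproj p) = 0}"
 then obtain \<P> where P: "!!P. P : \<P> ==> EX d. form d P" "X = {p. ALL P:\<P>. P (rep_cproj p) = 0}" by blast
 have "EX F. homogeneous F & (ALL v. poly_eval F (($) v) = P v)" if "P : \<P>" for P
  using P(1)[OF that] form_cpoly by metis
 then have "ALL P:\<P>. EX F. homogeneous F & (ALL v. poly_eval F (($) v) = P v)" by blast
 from bchoice[OF this] obtain G where G: "!!P. P : \<P> ==> homogeneous (G P) & (ALL v. poly_eval (G P) (($) v) = P v)"
  by blast
 then have "X = {p. ALL F:G ` \<P>. poly_eval F (($) (rep_cproj p)) = 0}" using P(2) by auto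
 then show "zariski_closed X" unfolding zariski_closed_def using G by blast
qed

lemma zariski_closedE:
 assumes "zariski_closed X"
 obtains \<P> where "!!P. P : \<P> ==> EX d. form d P" "!!p. p : X \<longleftrightarrow> (ALL P:\<P>. P (rep_cproj p) = 0)"
proof -
 obtain \<P> where P: "ALL P:\<P>. EX d. form d P" "X = {p. ALL P:\<P>. P (rep_cproj p) = 0}"
  using assms unfolding zariski_closed_iff by (elim exE conjE)
 show ?thesis by (rule that[of \<P>]) (use P in auto)
qed

lemma zariski_closed_hypersurface: "form d P ==> zariski_closed {p. P (rep_cproj p) = 0}"
 unfolding zariski_closed_iff by (intro exI[of _ "{P}"]) auto

lemma zariski_closed_Int:
 assumes "zariski_closed X" "zariski_closed Y" shows "zariski_closed (X Int Y)"
proof -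
 obtain \<P> \<Q> where "ALL P:\<P>. EX d. form d P" "X = {p. ALL P:\<P>. P (rep_cproj p) = 0}"
  "ALL P:\<Q>. EX d. form d P" "Y = {p. ALL P:\<Q>. P (rep_cproj p) = 0}"
  using assms unfolding zariski_closed_iff by blast
 then show ?thesis unfolding zariski_closed_iff by (intro exI[of _ "\<P> Un \<Q>"]) auto
qed

text \<open>The 2 by 2 minors formed from \<open>rep_cproj p\<close> and the variable vector cut out
  the point.\<close>

lemma irreducible_point: "irreducible_variety {p}"
proof -
 let ?k = "rep_cproj p"
 let ?P = "%i j v. ?k $ j * coords i v - ?k $ i * coords j v"
 have f: "form 1 (?P i j)" for i j
  unfolding form_def
  by (rule conjI, intro polys_diff polys.mult polys.const polys.gen) (auto simp: algebra_simps)
 have eqp: "q = p" if "ALL i j. ?P i j (rep_cproj q) = 0" for q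
 proof -
  obtain j where j: "?k $ j ~= 0" using rep_cproj_nonzero[of p] by (auto simp: vec_eq_iff)
  define c where "c = rep_cproj q $ j / ?k $ j"
  have eq: "rep_cproj q $ i = c * ?k $ i" for i
  proof -
   have "?k $ j * rep_cproj q $ i = ?k $ i * rep_cproj q $ j" using that[rule_format, of i j] by (simp add: coords_def)
   then show ?thesis using j by (simp add: c_def field_simps)
  qed
  then have e: "rep_cproj q = c *s ?k" by (simp add: vec_eq_iff)
  then have "c ~= 0" using rep_cproj_nonzero[of q] by auto
  then have "abs_cproj (rep_cproj q) = abs_cproj ?k" unfolding e by (rule abs_cproj_scale[OF rep_cproj_nonzero])
  then show ?thesis by simp
 qed
 have "{p} = {q. ALL P:range (%(i, j). ?P i j). P (rep_cproj q) = 0}" (is "_ = ?R")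
 proof (intro equalityI subsetI)
  fix q assume "q : {p}"
  then show "q : ?R" by (auto simp: coords_def)
 next
  fix q assume "q : ?R"
  then have "ALL i j. ?P i j (rep_cproj q) = 0" by auto
  then show "q : {p}" using eqp by simp
 qed
 moreover have "ALL P:range (%(i, j). ?P i j). EX d. form d P" by (auto intro: f)
 ultimately have "zariski_closed {p}" unfolding zariski_closed_iff by blast
 then show ?thesis unfolding irreducible_variety_def by blast
qed

text \<open>\<open>Z\<close> is the union of its intersections with the two hypersurfaces, so one of
  these is all of \<open>Z\<close>; forms on an irreducible variety have no zero divisors.\<close>

lemma irreducible_form_mult:
 assumes Z: "irreducible_variety Z" and P: "form d P" and Q: "form e Q"
  and z: "!!p. p : Z ==> P (rep_cproj p) * Q (rep_cproj p) = 0"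
  and nz: "EX p:Z. P (rep_cproj p) ~= 0"
 shows "p : Z ==> Q (rep_cproj p) = 0"
proof -
 let ?A = "Z Int {p. P (rep_cproj p) = 0}" and ?B = "Z Int {p. Q (rep_cproj p) = 0}"
 have zc: "zariski_closed ?A" "zariski_closed ?B"
  using Z zariski_closed_Int zariski_closed_hypersurface[OF P] zariski_closed_hypersurface[OF Q]
  unfolding irreducible_variety_def by blast+
 have "Z = ?A Un ?B" using z by auto
 then have "Z = ?A | Z = ?B" using Z zc unfolding irreducible_variety_def by blast
 then show "p : Z ==> Q (rep_cproj p) = 0" using nz by blast
qed

text \<open>There are at least \<open>m\<close> linearly independent forms of degree \<open>d\<close> on \<open>Z\<close>.\<close>
definition indep_forms :: "'n::finite cproj set => nat => nat => bool" where
 "indep_forms Z d m \<longleftrightarrow> (EX f. (ALL i<m. form d (f i)) &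
   (ALL c. (ALL p:Z. (\<Sum>i<m. c i * f i (rep_cproj p)) = 0) --> (ALL i<m. c i = 0)))"

text \<open>Independent forms on \<open>Z\<close> are supplemented by multiples of \<open>f\<close>,
  which vanish on \<open>Z\<close>: restricting a relation to \<open>Z\<close> kills the first
  coefficients, and then \<open>f\<close> is cancelled on \<open>Z'\<close>. For Hilbert functions
  this is H(Z', d + e) \<ge> H(Z, d + e) + H(Z', d).\<close>

lemma indep_forms_mono:
 assumes "irreducible_variety Z'" "Z <= Z'" "form e f" "!!p. p : Z ==> f (rep_cproj p) = 0"
  "EX p:Z'. f (rep_cproj p) ~= 0" "indep_forms Z (d + e) m" "indep_forms Z' d m'"
 shows "indep_forms Z' (d + e) (m + m')"
proof -
 obtain g where g: "!!i. i < m ==> form (d + e) (g i)"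
  "!!c. (ALL p:Z. (\<Sum>i<m. c i * g i (rep_cproj p)) = 0) ==> (ALL i<m. c i = 0)"
  using assms(6) unfolding indep_forms_def by blast
 obtain h where h: "!!i. i < m' ==> form d (h i)"
  "!!c. (ALL p:Z'. (\<Sum>i<m'. c i * h i (rep_cproj p)) = 0) ==> (ALL i<m'. c i = 0)"
  using assms(7) unfolding indep_forms_def by blast
 define k where "k i = (if i < m then g i else (%v. h (i - m) v * f v))" for i
 have split: "(\<Sum>i<m + m'. c i * k i v) = (\<Sum>i<m. c i * g i v) + f v * (\<Sum>i<m'. c (m + i) * h i v)" for c v
 proof -
  have "(\<Sum>i<m + m'. c i * k i v) = (\<Sum>i<m. c i * k i v) + (\<Sum>i<m'. c (m + i) * k (m + i) v)"
   by (induction m') (auto simp: add.assoc)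
  then show ?thesis by (simp add: k_def sum_distrib_left mult_ac)
 qed
 show ?thesis unfolding indep_forms_def
 proof (intro exI[of _ k] conjI allI impI)
  fix i assume "i < m + m'"
  then show "form (d + e) (k i)" using g(1)[of i] form_mult[OF h(1)[of "i - m"] assms(3)] by (auto simp: k_def)
 next
  fix c i assume c: "ALL p:Z'. (\<Sum>i<m + m'. c i * k i (rep_cproj p)) = 0" and i: "i < m + m'"
  have "ALL p:Z. (\<Sum>i<m. c i * g i (rep_cproj p)) = 0"
  proof
   fix p assume "p : Z"
   then show "(\<Sum>i<m. c i * g i (rep_cproj p)) = 0"
    using bspec[OF c, of p] assms(2) assms(4)[of p] unfolding split by auto
  qed
  then have c1: "ALL i<m. c i = 0" by (rule g(2))
  have fs: "form d (%v. \<Sum>i\<in>{..<m'}. c (m + i) * h i v)" by (rule form_sum) (use h(1) in auto)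
  have "f (rep_cproj p) * (\<Sum>i<m'. c (m + i) * h i (rep_cproj p)) = 0" if "p : Z'" for p
   using bspec[OF c that] c1 unfolding split by simp
  from irreducible_form_mult[OF assms(1,3) fs this assms(5)]
  have "ALL i<m'. c (m + i) = 0" by (intro h(2)) blast
  then show "c i = 0" using c1 i by (metis add_diff_inverse_nat nat_add_left_cancel_less)
 qed
qed

lemma irreducible_coordinate:
 assumes "irreducible_variety Z"
 obtains i where "EX p:Z. coords i (rep_cproj p) ~= 0"
proof -
 obtain p where p: "p : Z" using assms unfolding irreducible_variety_def by blast
 obtain i where "rep_cproj p $ i ~= 0" using rep_cproj_nonzero[of p] by (auto simp: vec_eq_iff)
 then show ?thesis using that p by (auto simp: coords_def)
qed

lemma indep_forms_pad:
 assumes Z: "irreducible_variety Z" and "indep_forms Z d m"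
 shows "indep_forms Z (d + k) m"
proof -
 obtain g where g: "!!i. i < m ==> form d (g i)"
  "!!c. (ALL p:Z. (\<Sum>i<m. c i * g i (rep_cproj p)) = 0) ==> (ALL i<m. c i = 0)"
  using assms(2) unfolding indep_forms_def by blast
 obtain j where j: "EX p:Z. coords j (rep_cproj p) ~= 0" using irreducible_coordinate[OF Z] .
 have fj: "form k (%v. coords j v ^ k)" using form_power[OF form_coords[of j], of k] by simp
 show ?thesis unfolding indep_forms_def
 proof (intro exI[of _ "%i v. g i v * coords j v ^ k"] conjI allI impI)
  show "form (d + k) (%v. g i v * coords j v ^ k)" if "i < m" for i by (rule form_mult[OF g(1)[OF that] fj])
  fix c i assume c: "ALL p:Z. (\<Sum>i<m. c i * (g i (rep_cproj p) * coords j (rep_cproj p) ^ k)) = 0" and "i < m"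
  have fs: "form d (%v. \<Sum>i\<in>{..<m}. c i * g i v)" by (rule form_sum) (use g(1) in auto)
  have "coords j (rep_cproj p) ^ k * (\<Sum>i<m. c i * g i (rep_cproj p)) = 0" if "p : Z" for p
   using bspec[OF c that] by (simp add: sum_distrib_left mult_ac)
  from irreducible_form_mult[OF Z fj fs this] j
  have "ALL i<m. c i = 0" by (intro g(2)) auto
  then show "c i = 0" using \<open>i < m\<close> by blast
 qed
qed

text \<open>Each step of the chain raises the growth of the Hilbert function by one power of
  \<open>m\<close>; Pascal's rule turns the inequality of \<open>indep_forms_mono\<close> into
  binomial coefficients.\<close>

lemma chain_indep_forms:
 assumes Z: "!!i. i <= k ==> irreducible_variety (Z i)" "!!i. i < k ==> Z i \<subset> Z (Suc i)"
 shows "EX E. ALL m. indep_forms (Z k) (m * E) ((m + k) choose k)"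
 using assms
proof (induction k)
 case 0
 obtain j where j: "EX p:Z 0. coords j (rep_cproj p) ~= 0" using irreducible_coordinate[of "Z 0"] 0 by auto
 have "indep_forms (Z 0) (m * 1) ((m + 0) choose 0)" for m
  unfolding indep_forms_def
 proof (intro exI[of _ "%_ v. coords j v ^ m"] conjI allI impI)
  show "form (m * 1) (%v. coords j v ^ m)" using form_power[OF form_coords[of j], of m] by simp
 qed (use j in auto)
 then show ?case by blast
next
 case (Suc k)
 have "EX E. ALL m. indep_forms (Z k) (m * E) ((m + k) choose k)" by (rule Suc.IH) (use Suc.prems in auto)
 then obtain E where E: "!!m. indep_forms (Z k) (m * E) ((m + k) choose k)" by blast
 have irr: "irreducible_variety (Z k)" "irreducible_variety (Z (Suc k))" "Z k \<subset> Z (Suc k)" using Suc.prems by auto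
 have "zariski_closed (Z k)" using irr(1) by (simp add: irreducible_variety_def)
 then obtain \<P> where P: "!!P. P : \<P> ==> EX d. form d P" "!!p. p : Z k \<longleftrightarrow> (ALL P:\<P>. P (rep_cproj p) = 0)"
  by (rule zariski_closedE) blast
 obtain q where q: "q : Z (Suc k)" "q ~: Z k" using irr(3) by blast
 then obtain f e where f: "form e f" "f (rep_cproj q) ~= 0" "!!p. p : Z k ==> f (rep_cproj p) = 0"
  using P by blast
 obtain j where j: "EX p:Z (Suc k). coords j (rep_cproj p) ~= 0" using irreducible_coordinate[OF irr(2)] .
 have fj: "form E (%v. coords j v ^ E)" using form_power[OF form_coords[of j], of E] by simp
 \<comment> \<open>The factor \<open>coords j v ^ E\<close> brings the degree to
   \<open>E + e\<close>, the step width for the longer chain; the degrees on \<open>Z k\<close> are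
   padded to match.\<close>
 define f' where "f' = (%v. coords j v ^ E * f v)"
 have f': "form (E + e) f'" unfolding f'_def by (rule form_mult[OF fj f(1)])
 have f'0: "f' (rep_cproj p) = 0" if "p : Z k" for p using f(3)[OF that] by (simp add: f'_def)
 have f'1: "EX p:Z (Suc k). f' (rep_cproj p) ~= 0"
 proof (rule ccontr)
  assume "\<not> ?thesis"
  then have "coords j (rep_cproj p) ^ E * f (rep_cproj p) = 0" if "p : Z (Suc k)" for p using that by (auto simp: f'_def)
  from irreducible_form_mult[OF irr(2) fj f(1) this _ q(1)] show False using j f(2) by auto
 qed
 have "indep_forms (Z (Suc k)) (m * (E + e)) ((m + Suc k) choose Suc k)" for m
 proof (induction m)
  case 0
  obtain j where j: "EX p:Z (Suc k). coords j (rep_cproj p) ~= 0" using irreducible_coordinate[OF irr(2)] .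
  show ?case unfolding indep_forms_def
   by (intro exI[of _ "%_ _. 1"]) (use q in "auto simp: form_def intro: polys.const")
 next
  case (Suc m)
  have 1: "indep_forms (Z k) (m * (E + e) + (E + e)) ((Suc m + k) choose k)"
   using indep_forms_pad[OF irr(1) E[of "Suc m"], of "Suc m * e"] by (simp add: algebra_simps)
  from indep_forms_mono[OF irr(2) _ f' f'0 f'1 1 Suc.IH] irr(3)
  show ?case by (simp add: algebra_simps)
 qed
 then show ?case by blast
qed

lemma indep_forms_bound:
 fixes Z :: "'n::finite cproj set"
 assumes "indep_forms Z d m"
 shows "m <= Suc d ^ CARD('n)"
proof (rule ccontr)
 assume "\<not> ?thesis"
 then have m: "m > Suc d ^ CARD('n)" by simp
 obtain g where g: "!!i. i < m ==> form d (g i)"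
  "!!c. (ALL p:Z. (\<Sum>i<m. c i * g i (rep_cproj p)) = 0) ==> (ALL i<m. c i = 0)"
  using assms unfolding indep_forms_def by blast
 have "EX k. ALL v. g i v = (\<Sum>e\<in>exps d. k e * xmonom coords e v)" if im: "i < m" for i
 proof -
  obtain A c where A: "finite A" "!!e. e : A ==> (\<Sum>i\<in>UNIV. e i) = d" "!!e. c e : polys {}"
   "!!z. g i z = (\<Sum>e\<in>A. c e z * xmonom coords e z)"
   by (rule homogeneous_normal_form[of "g i" "{}" coords "%c z. c *s z" d]) (use g(1)[OF im] in "auto simp: form_def")
  obtain k where k: "!!e. c e = (%_. k e)" using polys_empty[OF A(3)] by metis
  have "g i v = (\<Sum>e\<in>exps d. (if e : A then k e else 0) * xmonom coords e v)" for v
   unfolding A(4) k by (rule sum.mono_neutral_cong_left[OF finite_exps]) (use A(2) in "auto simp: exps_def")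
  then show ?thesis by (intro exI[of _ "%e. if e : A then k e else 0"]) blast
 qed
 then have "ALL i:{..<m}. EX k. ALL v. g i v = (\<Sum>e\<in>exps d. k e * xmonom coords e v)" by blast
 from bchoice[OF this] obtain k where k: "!!i v. i < m ==> g i v = (\<Sum>e\<in>exps d. k i e * xmonom coords e v)"
  by blast
 have "card (exps d :: ('n => nat) set) <= card (ebox d :: ('n => nat) set)"
  by (rule card_mono[OF finite_ebox]) (auto simp: exps_def ebox_def intro!: member_le_sum)
 then have "card (exps d :: ('n => nat) set) < card {..<m}" using m by (simp add: card_ebox)
 from underdetermined_system[OF finite_exps _ this, of "%e i. k i e"]
 obtain c where c: "EX i:{..<m}. c i ~= 0" "ALL e:(exps d :: ('n => nat) set). (\<Sum>i<m. k i e * c i) = 0" by auto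
 have "(\<Sum>i<m. c i * g i v) = 0" for v
 proof -
  have "(\<Sum>i<m. c i * g i v) = (\<Sum>i<m. \<Sum>e\<in>exps d. k i e * c i * xmonom coords e v)"
   by (rule sum.cong) (auto simp: k sum_distrib_left mult_ac)
  also have "\<dots> = (\<Sum>e\<in>exps d. (\<Sum>i<m. k i e * c i) * xmonom coords e v)"
   by (subst sum.swap) (simp add: sum_distrib_right)
  finally show ?thesis using c(2) by simp
 qed
 then show False using g(2)[of c] c(1) by auto
qed

text \<open>With \<open>n = CARD('n)\<close>, a chain with \<open>n + 1\<close> steps would force
  growth of order \<open>n + 1\<close>, against the bound of order \<open>n\<close> obtained by
  counting monomials in \<open>n\<close> variables.\<close>

lemma no_long_chain:
 fixes Z :: "nat => 'n::finite cproj set"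
 assumes Z: "!!i. irreducible_variety (Z i)" "!!i. Z i \<subset> Z (Suc i)"
 shows False
proof -
 define n where "n = CARD('n)"
 define k where "k = Suc n"
 obtain E where E: "!!m. indep_forms (Z k) (m * E) ((m + k) choose k)"
  using chain_indep_forms[of k Z] Z by blast
 define m where "m = Suc (k ^ k * Suc E ^ n)"
 have "(m + k) choose k <= Suc (m * E) ^ n" using indep_forms_bound[OF E[of m]] by (simp add: n_def)
 also have "\<dots> <= (m * Suc E) ^ n" by (rule power_mono) (auto simp: m_def)
 finally have 1: "real ((m + k) choose k) <= real m ^ n * real (Suc E) ^ n"
  by (metis of_nat_le_iff of_nat_mult of_nat_power power_mult_distrib)
 have "(real m / real k) ^ k <= (real (m + k) / real k) ^ k"
  by (intro power_mono divide_right_mono) auto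
 also have "\<dots> <= real ((m + k) choose k)" by (rule binomial_ge_n_over_k_pow_k) simp
 finally have "real m ^ k / real k ^ k <= real m ^ n * real (Suc E) ^ n" using 1 by (simp add: power_divide)
 then have "real m ^ k <= real m ^ n * real (Suc E) ^ n * real k ^ k"
  by (simp add: k_def divide_le_eq)
 then have "real m ^ n * real m <= real m ^ n * (real (Suc E) ^ n * real k ^ k)" by (simp add: k_def algebra_simps)
 moreover have "real m ^ n > 0" by (simp add: m_def del: of_nat_Suc)
 ultimately have "real m <= real (Suc E) ^ n * real k ^ k" by (meson mult_le_cancel_left_pos)
 moreover have "real m = real k ^ k * real (Suc E) ^ n + 1"
  by (simp add: m_def del: of_nat_Suc) (simp add: of_nat_Suc)
 ultimately show False by (simp add: mult.commute)
qed

text \<open>Otherwise \<open>{K}\<close> could be enlarged forever inside \<open>X\<close>, against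
  \<open>no_long_chain\<close>.\<close>

theorem irreducible_component_exists:
 assumes "K : X" obtains Z where "irreducible_component Z X" "K : Z"
proof -
 define \<A> where "\<A> = {Z. irreducible_variety Z & K : Z & Z <= X}"
 have "EX Z:\<A>. ALL Z':\<A>. Z <= Z' --> Z' = Z"
 proof (rule ccontr)
  assume "\<not> ?thesis"
  then have ex: "EX Z'. Z' : \<A> & Z \<subset> Z'" if "Z : \<A>" for Z using that by blast
  define F where "F = rec_nat {K} (%_ Z. SOME Z'. Z' : \<A> & Z \<subset> Z')"
  have F: "F i : \<A>" for i
  proof (induction i)
   case 0
   show ?case using assms irreducible_point[of K] by (simp add: F_def \<A>_def)
  next
   case (Suc i)
   then show ?case using someI_ex[OF ex[OF Suc]] by (simp add: F_def)
  qed
  have "F i \<subset> F (Suc i)" for i using someI_ex[OF ex[OF F[of i]]] by (simp add: F_def)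
  then show False using no_long_chain[of F] F by (auto simp: \<A>_def)
 qed
 then obtain Z where Z: "Z : \<A>" "!!Z'. Z' : \<A> ==> Z <= Z' ==> Z' = Z" by blast
 have "irreducible_component Z X" unfolding irreducible_component_def
 proof (intro conjI allI impI)
  fix Z' assume "irreducible_variety Z' & Z <= Z' & Z' <= X"
  then show "Z' = Z" using Z(1) by (intro Z(2)) (auto simp: \<A>_def)
 qed (use Z in \<open>auto simp: \<A>_def\<close>)
 then show ?thesis using that Z(1) by (auto simp: \<A>_def)
qed

section \<open>Topology of the projective space\<close>

lemma continuous_smult: "continuous_on A (%v::complex ^ 'n::finite. c *s v)"
 unfolding cscale_eq_smult[symmetric] by (intro cscale.continuous_on continuous_intros)

lemma open_smult_image:
 assumes "open (U :: (complex ^ 'n::finite) set)" "c ~= 0" shows "open ((*s) c ` U)"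
proof -
 have "(*s) c ` U = (*s) (inverse c) -` U"
  using assms(2) by (auto simp: vector_smult_assoc intro!: image_eqI[of _ _ "inverse c *s _"])
 then show ?thesis using open_vimage[OF assms(1) continuous_smult] by simp
qed

text \<open>The preimage of the image is the union of all nonzero multiples of
  \<open>U\<close>.\<close>

lemma open_abs_cproj_image:
 assumes U: "open U" "0 ~: U" shows "open (abs_cproj ` U)"
proof -
 have "{v. v ~= 0 & abs_cproj v : abs_cproj ` U} = (\<Union>c\<in>-{0}. (*s) c ` U)"
 proof (intro set_eqI iffI)
  fix v assume "v : {v. v ~= 0 & abs_cproj v : abs_cproj ` U}"
  then obtain w where "w : U" "abs_cproj w = abs_cproj v" "v ~= 0" by auto
  moreover then have "w ~= 0" using U(2) by auto
  ultimately show "v : (\<Union>c\<in>-{0}. (*s) c ` U)" using abs_cproj_eq_iff[of w v] by auto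
 next
  fix v assume "v : (\<Union>c\<in>-{0}. (*s) c ` U)"
  then obtain c w where "c ~= 0" "w : U" "v = c *s w" by auto
  moreover then have "w ~= 0" using U(2) by auto
  ultimately show "v : {v. v ~= 0 & abs_cproj v : abs_cproj ` U}"
   by (auto simp: abs_cproj_scale vector_mul_eq_0)
 qed
 then show ?thesis unfolding open_cproj_def using open_smult_image[OF U(1)] by (auto intro!: open_UN)
qed

lemma open_cproj_preimage: "open N ==> open {v. v ~= 0 & abs_cproj v : N}"
 by (simp add: open_cproj_def)

lemma continuous_on_abs_cproj:
 assumes "0 ~: A" shows "continuous_on A abs_cproj"
proof (rule continuous_on_subset)
 show "continuous_on (- {0}) (abs_cproj :: complex ^ 'n::finite => _)"
  by (subst continuous_on_open_vimage)
   (auto simp: open_cproj_def vimage_def Int_def conj_commute open_Compl)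
qed (use assms in auto)

lemma continuous_on_cproj:
 fixes h :: "'n::finite cproj => 'b::topological_space"
 assumes N: "open N" and h: "continuous_on {v. v ~= 0 & abs_cproj v : N} (%v. h (abs_cproj v))"
 shows "continuous_on N h"
proof (subst continuous_on_open_vimage[OF N], intro allI impI)
 fix B :: "'b set" assume "open B"
 then have "open ((%v. h (abs_cproj v)) -` B Int {v. v ~= 0 & abs_cproj v : N})"
  using h continuous_on_open_vimage[OF open_cproj_preimage[OF N]] by blast
 moreover have "(%v. h (abs_cproj v)) -` B Int {v. v ~= 0 & abs_cproj v : N} = {v. v ~= 0 & abs_cproj v : h -` B Int N}"
  by auto
 ultimately show "open (h -` B Int N)" by (simp add: open_cproj_def)
qed

text \<open>The quotient map is open, so neighbourhoods of lifts project to neighbourhoods. This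
  moves Euclidean closures to the affine cones, where polynomials are evaluated.\<close>

lemma closure_cproj_lift:
 fixes A :: "('n::finite cproj \<times> 'm::finite cproj) set"
 assumes "(abs_cproj v0, abs_cproj k0) : closure A" "v0 ~= 0" "k0 ~= 0" "open U" "(v0, k0) : U"
 obtains v k where "(v, k) : U" "v ~= 0" "k ~= 0" "(abs_cproj v, abs_cproj k) : A"
proof -
 obtain V W where VW: "open V" "open W" "(v0, k0) : V \<times> W" "V \<times> W <= U"
  using open_prod_elim[OF assms(4,5)] by blast
 define V' W' where "V' = V - {0}" and "W' = W - {0}"
 have o: "open (abs_cproj ` V' \<times> abs_cproj ` W')"
  by (intro open_Times open_abs_cproj_image) (use VW in "auto simp: V'_def W'_def")
 have "(abs_cproj v0, abs_cproj k0) : abs_cproj ` V' \<times> abs_cproj ` W'"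
  using VW assms by (auto simp: V'_def W'_def)
 then obtain v k where "v : V'" "k : W'" "(abs_cproj v, abs_cproj k) : A"
  using o assms(1) unfolding closure_iff_nhds_not_empty by blast
 then show ?thesis using that VW(4) by (auto simp: V'_def W'_def)
qed

lemma continuous_on_polys:
 fixes f :: "'a::topological_space => complex"
 assumes "f : polys X" "!!x. x : X ==> continuous_on UNIV x"
 shows "continuous_on UNIV f"
 using assms(1) by induction (auto intro: continuous_on_add continuous_on_mult continuous_on_const assms(2))

lemma joint_continuous: "f : joint ==> continuous_on UNIV f"
 unfolding joint_def
 by (erule continuous_on_polys) (auto simp: jv_def[abs_def] jk_def[abs_def] intro!: continuous_intros)

text \<open>Points of \<open>\<complex>\<pp>\<^sub>4\<close> and of its dual at which bihomogeneous equations hold form a closed set.\<close>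
lemma closure_bihom:
 fixes P :: "(complex ^ 'n::finite) \<times> (complex ^ 'm::finite) => complex"
 assumes P: "P : joint" "bihom P d e"
  and A: "!!v k. v ~= 0 ==> k ~= 0 ==> (abs_cproj v, abs_cproj k) : A ==> P (v, k) = 0"
  and vk: "(abs_cproj v, abs_cproj k) : closure A" "v ~= 0" "k ~= 0"
 shows "P (v, k) = 0"
proof (rule ccontr)
 assume nz: "P (v, k) ~= 0"
 have "open (P -` (- {0}))" by (rule open_vimage) (use joint_continuous[OF P(1)] in auto)
 then obtain v' k' where "(v', k') : P -` (- {0})" "v' ~= 0" "k' ~= 0" "(abs_cproj v', abs_cproj k') : A"
  using closure_cproj_lift[OF vk, of "P -` (- {0})"] nz by auto
 then show False using A by auto
qed

section \<open>Affine charts\<close>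

lemma pairing_linear:
 "pairing k (v + w) = pairing k v + pairing k w" "pairing k (c *s v) = c * pairing k v"
 "pairing (k + l) v = pairing k v + pairing l v" "pairing (c *s k) v = c * pairing k v"
 "pairing k (v - w) = pairing k v - pairing k w" "pairing k 0 = 0" "pairing 0 v = 0"
 by (simp_all add: pairing_def sum.distrib sum_distrib_left sum_subtractf algebra_simps)

lemma pairing_cscale: "pairing k (c *\<^sub>C v) = c * pairing k v"
 by (simp add: cscale_eq_smult pairing_linear)

lemma bounded_linear_pairing: "bounded_linear (pairing k)"
 unfolding pairing_def[abs_def]
 by (intro bounded_linear_sum bounded_linear_const_mult bounded_linear_vec_nth)

lemma clin_pairing: "clin (pairing k)" by (simp add: clin_def pairing_cscale)

lemma cdiff_pairing: "cdiff f x ==> cdiff (%x. pairing k (f x)) x"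
 and fd_pairing: "cdiff f x ==> fd (%x. pairing k (f x)) x v = pairing k (fd f x v)"
 by (rule cdiff_linear_compose[OF bounded_linear_pairing clin_pairing], assumption)+

lemma hol_at_pairing: "hol_at f x ==> hol_at (%x. pairing k (f x)) x"
 by (rule hol_at_linear_compose[OF bounded_linear_pairing clin_pairing])

type_synonym chart = "complex * complex * complex * complex"

text \<open>Coordinates of an affine chart of projective 4-space. The first two will be normal to
  the surface, and the last two parametrize it.\<close>

definition Xc :: "(chart => complex) set" where
 "Xc = {fst, %x. fst (snd x), %x. fst (snd (snd x)), %x. snd (snd (snd x))}"

lemma cdiff_Xc: "f : Xc ==> cdiff f x"
 unfolding Xc_def by (auto intro!: hols)

lemma cdiff_polys_Xc: "f : polys Xc ==> cdiff f x"
 by (induction rule: polys.induct) (auto intro: hols cdiff_Xc)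

lemma hol_at_polys_Xc: "f : polys Xc ==> hol_at f x"
 unfolding hol_at_def by (simp add: cdiff_polys_Xc always_eventually)

lemma fd_const: "fd (%_. c) x v = 0"
 by (rule fd_eq[OF has_derivative_const])

lemma fd_Xc: "f : Xc ==> fd f x v = f v"
proof -
 have "bounded_linear f & clin f" if "f : Xc" for f
  using that unfolding Xc_def
  by (auto simp: clin_def intro!: bounded_linear_intros)
 then show "f : Xc ==> fd f x v = f v" using cdiff_bounded_linear(2) by blast
qed

text \<open>Polynomials on the chart with coefficients which depend polynomially on a dual vector \<open>k\<close>.\<close>
definition XK :: "(chart \<times> (complex ^ 'm::finite) => complex) set" where
 "XK = (%f z. f (fst z)) ` Xc Un range (%i z. snd z $ i)"

lemma XK_fst: "f : polys Xc ==> (%z. f (fst z)) : polys XK"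
 by (rule polys_compose) (auto simp: XK_def intro: polys.gen)

lemma XK_slice: "P : polys XK ==> (%x. P (x, k)) : polys Xc"
 by (rule polys_compose) (auto simp: XK_def intro: polys.gen polys.const)

lemma XK_fd: "P : polys XK ==> (%z. fd (%x. P (x, snd z)) (fst z) v) : polys XK"
proof (induction rule: polys.induct)
 case (const c)
 then show ?case by (simp add: fd_const polys.const)
next
 case (gen f)
 then consider g where "g : Xc" "f = (%z. g (fst z))" | i where "f = (%z. snd z $ i)" by (auto simp: XK_def)
 then show ?case by cases (simp_all add: fd_Xc fd_const polys.const)
next
 case (add f g)
 have "fd (%x. f (x, k) + g (x, k)) x v = fd (%x. f (x, k)) x v + fd (%x. g (x, k)) x v" for x k
  by (rule cdiff_add(2)) (intro cdiff_polys_Xc XK_slice add)+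
 then show ?case using polys.add[OF add.IH] by simp
next
 case (mult f g)
 have "fd (%x. f (x, k) * g (x, k)) x v = f (x, k) * fd (%x. g (x, k)) x v + fd (%x. f (x, k)) x v * g (x, k)" for x k
  by (rule cdiff_mult(2)) (intro cdiff_polys_Xc XK_slice mult)+
 then show ?case using polys.add[OF polys.mult[OF mult.hyps(1) mult.IH(2)] polys.mult[OF mult.IH(1) mult.hyps(2)]] by simp
qed

lemma polys_Xc_fd: "f : polys Xc ==> (%x. fd f x v) : polys Xc"
 using XK_slice[OF XK_fd[OF XK_fst, of f v]] by simp

lemma fd_chart_expand:
 assumes "cdiff f (x::chart)"
 shows "fd f x (a, b, c, d) = a * fd f x (1, 0, 0, 0) + b * fd f x (0, 1, 0, 0) +
  c * fd f x (0, 0, 1, 0) + d * fd f x (0, 0, 0, 1 :: complex)"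
proof -
 have "(a, b, c, d) = a *\<^sub>C (1, 0, 0, 0) + b *\<^sub>C (0, 1, 0, 0) + c *\<^sub>C (0, 0, 1, 0) + d *\<^sub>C ((0, 0, 0, 1) :: chart)"
  by simp
 then have "fd f x (a, b, c, d) = fd f x (a *\<^sub>C (1, 0, 0, 0) + b *\<^sub>C (0, 1, 0, 0) + c *\<^sub>C (0, 0, 1, 0) + d *\<^sub>C ((0, 0, 0, 1) :: chart))"
  by simp
 also have "\<dots> = a * fd f x (1, 0, 0, 0) + b * fd f x (0, 1, 0, 0) + c * fd f x (0, 0, 1, 0) + d * fd f x (0, 0, 0, 1)"
  unfolding fd_add[OF assms] fd_clin[OF assms] by simp
 finally show ?thesis .
qed

text \<open>In the application \<open>el\<close> is a lift of the cusp, \<open>e1\<close> and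
  \<open>e2\<close> span the tangent plane together with it, \<open>es\<close> and \<open>et\<close>
  are transversal to it, and \<open>ks\<close> represents \<open>H\<close>. The affine chart is
  given by \<open>kl = 1\<close>.\<close>

locale frame =
 fixes es et el e1 e2 ks kt kl k1 k2 :: "complex ^ 5"
 assumes dual [simp]:
  "pairing ks es = 1" "pairing ks et = 0" "pairing ks el = 0" "pairing ks e1 = 0" "pairing ks e2 = 0"
  "pairing kt es = 0" "pairing kt et = 1" "pairing kt el = 0" "pairing kt e1 = 0" "pairing kt e2 = 0"
  "pairing kl es = 0" "pairing kl et = 0" "pairing kl el = 1" "pairing kl e1 = 0" "pairing kl e2 = 0"
  "pairing k1 es = 0" "pairing k1 et = 0" "pairing k1 el = 0" "pairing k1 e1 = 1" "pairing k1 e2 = 0"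
  "pairing k2 es = 0" "pairing k2 et = 0" "pairing k2 el = 0" "pairing k2 e1 = 0" "pairing k2 e2 = 1"
  and expand: "v = pairing ks v *s es + pairing kt v *s et + pairing kl v *s el + pairing k1 v *s e1 + pairing k2 v *s e2"
  and expand_dual: "k = pairing k es *s ks + pairing k et *s kt + pairing k el *s kl + pairing k e1 *s k1 + pairing k e2 *s k2"
begin

definition tang :: "chart => complex ^ 5" where
 "tang x = fst x *s es + fst (snd x) *s et + fst (snd (snd x)) *s e1 + snd (snd (snd x)) *s e2"

definition Lc :: "chart => complex ^ 5" where "Lc x = el + tang x"

definition co :: "complex ^ 5 => chart" where
 "co v = (pairing ks v, pairing kt v, pairing k1 v, pairing k2 v)"

lemma pairing_tang [simp]: "pairing kl (tang x) = 0" "pairing ks (tang x) = fst x" "pairing kt (tang x) = fst (snd x)"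
 "pairing k1 (tang x) = fst (snd (snd x))" "pairing k2 (tang x) = snd (snd (snd x))"
 by (simp_all add: tang_def pairing_linear)

lemma kl_Lc [simp]: "pairing kl (Lc x) = 1" by (simp add: Lc_def pairing_linear)

lemma co_Lc [simp]: "co (Lc x) = x" by (simp add: co_def Lc_def pairing_linear)

lemma co_tang [simp]: "co (tang x) = x" by (simp add: co_def)

lemma tang_co: "tang (co v) = v - pairing kl v *s el"
 by (subst (2) expand) (simp add: tang_def co_def algebra_simps)

lemma tang_cscale: "tang (c *\<^sub>C x) = c *s tang x"
 by (simp add: tang_def vector_smult_assoc vector_add_ldistrib)

lemma co_smult: "co (c *s v) = c *\<^sub>C co v" by (simp add: co_def pairing_linear)

lemma Lc_nonzero [simp]: "Lc x ~= 0"
proof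
 assume "Lc x = 0"
 then have "pairing kl (Lc x) = 0" by (simp add: pairing_linear)
 then show False by simp
qed

definition chi :: "complex ^ 5 => chart" where "chi v = inverse (pairing kl v) *\<^sub>C co v"

lemma Lc_chi: "pairing kl v ~= 0 ==> v = pairing kl v *s Lc (chi v)"
 by (simp add: Lc_def chi_def tang_cscale tang_co vector_add_ldistrib vector_smult_assoc vector_sub_rdistrib vec_eq_iff)

lemma chi_Lc [simp]: "chi (Lc x) = x" by (simp add: chi_def)

lemma chi_smult: "c ~= 0 ==> chi (c *s v) = chi v"
 by (simp add: chi_def co_smult pairing_linear cscale_assoc field_simps)

lemma bounded_linear_tang: "bounded_linear tang"
proof (rule linear_conv_bounded_linear[THEN iffD1], rule linearI)
 show "tang (x + y) = tang x + tang y" for x y by (simp add: tang_def vec_eq_iff algebra_simps)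
 show "tang (r *\<^sub>R x) = r *\<^sub>R tang x" for r x
  using tang_cscale[of "of_real r" x] by (simp add: cscale_of_real cscale_eq_smult[symmetric])
qed

lemma clin_tang: "clin tang" by (simp add: clin_def tang_cscale cscale_eq_smult)

lemma cdiff_Lc: "cdiff Lc x" and fd_Lc: "fd Lc x v = tang v"
 unfolding Lc_def[abs_def]
 using cdiff_add[OF cdiff_const cdiff_bounded_linear(1)[OF bounded_linear_tang clin_tang]]
  cdiff_bounded_linear(2)[OF bounded_linear_tang clin_tang] by (simp_all add: fd_const)

lemma hol_at_Lc: "hol_at Lc x"
 unfolding hol_at_def by (simp add: cdiff_Lc always_eventually)

lemma coords_Lc: "(%x. coords i (Lc x)) : polys Xc"
proof -
 have "(%x. coords i (Lc x)) = (%x. el $ i + fst x * es $ i + fst (snd x) * et $ i +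
   fst (snd (snd x)) * e1 $ i + snd (snd (snd x)) * e2 $ i)"
  by (auto simp: coords_def Lc_def tang_def)
 moreover have "\<dots> : polys Xc" by (intro polys.add polys.mult polys.const polys.gen) (auto simp: Xc_def)
 ultimately show ?thesis by simp
qed

lemma polys_Lc: "P : polys (range coords) ==> (%x. P (Lc x)) : polys Xc"
 by (rule polys_compose) (auto intro: coords_Lc)

lemma pairing_polys: "pairing k : polys (range coords)"
 unfolding pairing_def[abs_def]
 by (intro polys_sum polys.mult polys.const polys.gen) (auto simp: coords_def[abs_def])

lemma homogenize:
 assumes "P : polys (XK :: (chart \<times> (complex ^ 'm::finite) => complex) set)"
 obtains Q d where "Q : joint" "!!c v k. Q (c *s v, k) = c ^ d * Q (v, k)" "!!x k. Q (Lc x, k) = P (x, k)"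
proof -
 have jp: "(%z. pairing k (fst z)) : (joint :: ((complex ^ 5) \<times> (complex ^ 'm) => complex) set)" for k
  unfolding joint_def
  by (rule polys_compose[OF pairing_polys]) (auto simp: coords_fst intro!: polys.gen)
 have "EX N. EX Q:polys (range jv Un range jk). (ALL c z. Q (c *s fst z, snd z) = c ^ N * Q z) &
  (ALL z:UNIV. Q (Lc (fst z), snd z :: complex ^ 'm) = P z)"
 proof (rule homogenization[where T = "%c z. (c *s fst z, snd z)" and io = "%z. (Lc (fst z), snd z)" and l = "%z. pairing kl (fst z)", OF assms])
  show "(%z. pairing kl (fst z)) : polys (range jv Un range (jk :: 'm => _))"
   using jp[of kl] by (simp add: joint_def)
  fix f :: "chart \<times> (complex ^ 'm) => complex" assume "f : XK"
  then consider g where "g : Xc" "f = (%z. g (fst z))" | i where "f = (%z. snd z $ i)" by (auto simp: XK_def)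
  then show "EX N. EX Q:polys (range jv Un range jk). (ALL c z. Q (c *s fst z, snd z) = c ^ N * Q z) &
   (ALL z:UNIV. Q (Lc (fst z), snd z) = f z)"
  proof cases
   case 1
   then have "EX k:{ks, kt, k1, k2}. g = (%x. pairing k (tang x))" by (auto simp: Xc_def)
   then obtain k where "k : {ks, kt, k1, k2}" "g = (%x. pairing k (tang x))" by blast
   then have k: "!!x. g x = pairing k (tang x)" "pairing k el = 0" by auto
   show ?thesis using jp[of k] 1 k
    by (intro exI[of _ 1] bexI[of _ "%z. pairing k (fst z)"]) (auto simp: joint_def Lc_def pairing_linear)
  next
   case 2
   then show ?thesis
    by (intro exI[of _ 0] bexI[of _ "jk i"]) (auto simp: jk_def intro: polys.gen)
  qed
 qed (auto simp: pairing_linear)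
 then obtain d Q where "Q : joint" "!!c v k. Q (c *s v, k) = c ^ d * Q (v, k)" "!!x k. Q (Lc x, k) = P (x, k)"
  unfolding joint_def by (metis (no_types, lifting) UNIV_I fst_conv snd_conv)
 then show ?thesis using that by blast
qed

end

text \<open>Outside \<open>u = 0\<close> the surface is \<open>F = G = 0\<close> in the chart. The
  function \<open>u\<close> is a common denominator: it arises when generators of the ideal at the
  origin of the chart are used away from it.\<close>

locale surface_chart = frame +
 fixes S :: "5 cproj set" and F G u :: "chart => complex"
 assumes closed_S: "zariski_closed S"
  and F: "F : polys Xc" and G: "G : polys Xc" and u: "u : polys Xc"
  and FG_vanish: "abs_cproj (Lc x) : S ==> F x = 0 & G x = 0"
  and in_S: "F x = 0 ==> G x = 0 ==> u x ~= 0 ==> abs_cproj (Lc x) : S"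
begin

definition J :: "chart => complex" where
 "J x = fd F x (1, 0, 0, 0) * fd G x (0, 1, 0, 0) - fd F x (0, 1, 0, 0) * fd G x (1, 0, 0, 0)"

definition good :: "chart => bool" where "good x \<longleftrightarrow> F x = 0 & G x = 0 & u x ~= 0 & J x ~= 0"

text \<open>\<open>V v\<close> is \<open>J\<close> times the lift of the vector \<open>v\<close> in the last two coordinates to the tangent space of \<open>F = G = 0\<close>.\<close>
definition V :: "complex * complex => chart => chart" where
 "V v x = (fd F x (0, 1, 0, 0) * fd G x (0, 0, v) - fd F x (0, 0, v) * fd G x (0, 1, 0, 0),
   fd F x (0, 0, v) * fd G x (1, 0, 0, 0) - fd F x (1, 0, 0, 0) * fd G x (0, 0, v), J x *\<^sub>C v)"

lemma J_polys: "J : polys Xc"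
 unfolding J_def[abs_def] by (intro polys_diff polys.mult polys_Xc_fd F G)

lemma V_kernel: "fd F x (V v x) = 0" "fd G x (V v x) = 0"
proof -
 have e: "fd f x (a, b, c) = a * fd f x (1, 0, 0, 0) + b * fd f x (0, 1, 0, 0) + fd f x (0, 0, c)"
  if "cdiff f x" for f :: "chart => complex" and a b c
  using fd_chart_expand[OF that, of a b "fst c" "snd c"] fd_chart_expand[OF that, of 0 0 "fst c" "snd c"] by simp
 have l: "fd f x (0, 0, c *\<^sub>C v) = c * fd f x (0, 0, v)" if "cdiff f x" for f :: "chart => complex" and c v
  using fd_clin[OF that, of c "(0, 0, v)"] by simp
 show "fd F x (V v x) = 0" "fd G x (V v x) = 0"
  unfolding V_def
   by (subst e, rule cdiff_polys_Xc, rule F G, subst l, rule cdiff_polys_Xc, rule F G, simp add: J_def algebra_simps)+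
qed

text \<open>Cramer's rule for the first two components, with the last two prescribed.\<close>

lemma kernel_V:
 assumes "J x ~= 0" "fd F x (a, b, c) = 0" "fd G x (a, b, c) = 0"
 shows "(a, b, c) = inverse (J x) *\<^sub>C V c x"
proof -
 have e: "fd f x (a, b, c) = a * fd f x (1, 0, 0, 0) + b * fd f x (0, 1, 0, 0) + fd f x (0, 0, c)"
  if "cdiff f x" for f :: "chart => complex"
  using fd_chart_expand[OF that, of a b "fst c" "snd c"] fd_chart_expand[OF that, of 0 0 "fst c" "snd c"] by simp
 have 1: "fd F x (0, 0, c) = - (a * fd F x (1, 0, 0, 0) + b * fd F x (0, 1, 0, 0))"
  using assms(2) e[OF cdiff_polys_Xc[OF F]] by (simp only: eq_neg_iff_add_eq_0 add.commute)
 have 2: "fd G x (0, 0, c) = - (a * fd G x (1, 0, 0, 0) + b * fd G x (0, 1, 0, 0))"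
  using assms(3) e[OF cdiff_polys_Xc[OF G]] by (simp only: eq_neg_iff_add_eq_0 add.commute)
 have "V c x = (J x * a, J x * b, J x *\<^sub>C c)" unfolding V_def 1 2 J_def by (simp add: algebra_simps)
 then show ?thesis using assms(1) by (simp add: cscale_assoc)
qed

text \<open>Tangent vectors of the graph lie in the kernel of both differentials and are thus the
  vectors \<open>V\<close> divided by \<open>J\<close>, by \<open>kernel_V\<close>. So derivatives
  along the surface are rational functions of the point.\<close>

lemma implicit_chart:
 assumes "good (s0, t0, w0)"
 obtains y where "hol_at y w0" "y w0 = (s0, t0)"
  "near (s0, t0, w0) (%x. F x = 0 & G x = 0 \<longleftrightarrow> (fst x, fst (snd x)) = y (snd (snd x)))"
  "near w0 (%w. ALL v. fd (%w. (fst (y w), snd (y w), w)) w v =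
    inverse (J (fst (y w), snd (y w), w)) *\<^sub>C V v (fst (y w), snd (y w), w))"
  "near w0 (%w. good (fst (y w), snd (y w), w))"
proof -
 define Ph where "Ph = (%p::(complex * complex) \<times> (complex * complex).
   (F (fst (snd p), snd (snd p), fst p), G (fst (snd p), snd (snd p), fst p)))"
 have hr: "hol_at (%p::(complex * complex) \<times> (complex * complex). (fst (snd p), snd (snd p), fst p)) p" for p
  by (intro hols)
 have hc: "hol_at (%p. f (fst (snd p), snd (snd p), fst p)) p" if "f : polys Xc" for f :: "chart => complex" and p
  by (rule hol_at_compose[OF hol_at_polys_Xc[OF that] hr])
 have fdr: "fd (%p::(complex * complex) \<times> (complex * complex). (fst (snd p), snd (snd p), fst p)) p v =
   (fst (snd v), snd (snd v), fst v)" for p v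
  by (rule fd_eq) (auto intro!: derivative_eq_intros)
 have fdc: "fd (%p. f (fst (snd p), snd (snd p), fst p)) p v = fd f (fst (snd p), snd (snd p), fst p) (fst (snd v), snd (snd v), fst v)"
  if "f : polys Xc" for f :: "chart => complex" and p v
  using cdiff_compose(2)[OF cdiff_polys_Xc[OF that] hol_at_cdiff[OF hr]] fdr by simp
 have hPh: "hol_at Ph p" for p unfolding Ph_def by (intro hol_at_Pair hc F G)
 have fdPh: "fd Ph (w0, s0, t0) (0, v) = (fd F (s0, t0, w0) (fst v, snd v, 0), fd G (s0, t0, w0) (fst v, snd v, 0))" for v
  unfolding Ph_def by (simp add: cdiff_Pair(2) hol_at_cdiff hc F G fdc)
 have gd: "F (s0, t0, w0) = 0" "G (s0, t0, w0) = 0" "J (s0, t0, w0) ~= 0" using assms by (auto simp: good_def)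
 have lin: "linear (%v. fd Ph (w0, s0, t0) (0, v))"
 proof (rule linearI)
  have c: "cdiff Ph (w0, s0, t0)" by (rule hol_at_cdiff[OF hPh])
  show "fd Ph (w0, s0, t0) (0, u + v) = fd Ph (w0, s0, t0) (0, u) + fd Ph (w0, s0, t0) (0, v)" for u v
   using fd_add[OF c, of "(0, u)" "(0, v)"] by simp
  show "fd Ph (w0, s0, t0) (0, r *\<^sub>R v) = r *\<^sub>R fd Ph (w0, s0, t0) (0, v)" for r v
   using linear_scale[OF fd_linear[OF c], of r "(0, v)"] by simp
 qed
 have "bij (%v. fd Ph (w0, s0, t0) (0, v))"
 proof -
  have "inj (%v. fd Ph (w0, s0, t0) (0, v))"
  proof (rule linear_injective_0[OF lin, THEN iffD2], intro allI impI)
   fix v assume "fd Ph (w0, s0, t0) (0, v) = 0"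
   then have "fd F (s0, t0, w0) (fst v, snd v, 0) = 0" "fd G (s0, t0, w0) (fst v, snd v, 0) = 0"
    by (auto simp: fdPh prod_eq_iff)
   from kernel_V[OF gd(3) this] have "(fst v, snd v, 0) = inverse (J (s0, t0, w0)) *\<^sub>C V 0 (s0, t0, w0)" .
   moreover have "V 0 (s0, t0, w0) = 0"
    using linear_0[OF fd_linear[OF cdiff_polys_Xc[OF F]]] linear_0[OF fd_linear[OF cdiff_polys_Xc[OF G]]]
    by (simp add: V_def zero_prod_def)
   ultimately show "v = 0" by (simp add: prod_eq_iff)
  qed
  then show ?thesis using linear_injective_imp_surjective[OF lin] by (simp add: bij_def)
 qed
 moreover have "Ph (w0, s0, t0) = 0" using gd by (simp add: Ph_def zero_prod_def)
 ultimately obtain y where y: "hol_at y w0" "y w0 = (s0, t0)"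
  "near (w0, s0, t0) (%p. Ph p = 0 \<longleftrightarrow> snd p = y (fst p))"
  "near w0 (%w. Ph (w, y w) = 0)"
  by - (rule hol_implicit_function[OF hPh], blast+)
 define gm where "gm = (%w. (fst (y w), snd (y w), w))"
 have hgm: "hol_at gm w0" "gm w0 = (s0, t0, w0)" unfolding gm_def by (auto intro!: hols y simp: y)
 have FG: "near w0 (%w. F (gm w) = 0 & G (gm w) = 0)"
  using y(4) by (rule eventually_mono) (auto simp: Ph_def gm_def prod_eq_iff)
 have hJ: "hol_at J x" "hol_at u x" for x by (intro hol_at_polys_Xc J_polys u)+
 have "near w0 (%w. J (gm w) ~= 0)"
  by (rule eventually_hol[OF hgm hol_at_nonzero[OF hJ(1)]]) (use gd in auto)
 moreover have "near w0 (%w. u (gm w) ~= 0)"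
  by (rule eventually_hol[OF hgm hol_at_nonzero[OF hJ(2)]]) (use assms in "auto simp: good_def")
 ultimately have gev: "near w0 (%w. good (gm w))"
  using FG by eventually_elim (auto simp: good_def)
 have "near w0 (%w. ALL v. fd gm w v = inverse (J (gm w)) *\<^sub>C V v (gm w))"
 proof -
  have d0: "near w0 (%w. fd (%w. f (gm w)) w = fd (%_. 0) w)"
   if "f : polys Xc" "near w0 (%w. f (gm w) = 0)" for f
   by (rule fd_eventually_eq[OF that(2)])
    (rule hol_at_compose[where f = gm], use hol_at_polys_Xc[OF that(1)] hgm in auto)
  have z: "near w0 (%w. F (gm w) = 0)" "near w0 (%w. G (gm w) = 0)"
   using FG by (auto elim: eventually_mono)
  have "near w0 (cdiff y)" using y(1) by (simp add: hol_at_def)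
  then show ?thesis using d0[OF F z(1)] d0[OF G z(2)] gev
  proof eventually_elim
   case (elim w)
   have cgm: "cdiff gm w" unfolding gm_def by (intro hols elim)
   have fdgm: "fd gm w v = (fst (fd y w v), snd (fd y w v), v)" for v
    unfolding gm_def by (simp add: cdiff_Pair(2) hols elim fd_fst fd_snd fd_eq[OF has_derivative_ident])
   have "fd F (gm w) (fd gm w v) = 0" "fd G (gm w) (fd gm w v) = 0" for v
    using elim(2,3) cdiff_compose(2)[OF cdiff_polys_Xc[OF F] cgm, of v] cdiff_compose(2)[OF cdiff_polys_Xc[OF G] cgm, of v]
    by (simp_all add: fd_const)
   then show ?case using kernel_V[of "gm w" "fst (fd y w v)" "snd (fd y w v)" v for v] elim(4)
    by (simp add: fdgm good_def)
  qed
 qed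
 moreover have "near (s0, t0, w0) (%x. F x = 0 & G x = 0 \<longleftrightarrow> (fst x, fst (snd x)) = y (snd (snd x)))"
 proof -
  have "hol_at (%x::chart. (snd (snd x), fst x, fst (snd x))) (s0, t0, w0)" by (intro hols)
  from eventually_hol[OF this _ y(3)] show ?thesis by (simp add: Ph_def zero_prod_def)
 qed
 ultimately show ?thesis using that[of y] y(1,2) gev unfolding gm_def by blast
qed

end

section \<open>Tangent spaces and incidence conditions\<close>

lemma cdiff_polys_coords: "P : polys (range coords) ==> cdiff P v"
 by (induction rule: polys.induct) (auto intro: hols simp: coords_def[abs_def])

lemma fd_coords: "fd (coords i) v w = w $ i"
 unfolding coords_def[abs_def] using cdiff_bounded_linear(2)[OF bounded_linear_vec_nth clin_nth] by blast

lemma polys_coords_fd: "P : polys (range coords) ==> (%v. fd P v w) : polys (range coords)"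
proof (induction rule: polys.induct)
 case (gen f)
 then show ?case by (auto simp: fd_coords polys.const)
next
 case (add f g)
 then show ?case by (simp add: cdiff_add(2) cdiff_polys_coords polys.add)
next
 case (mult f g)
 then show ?case by (simp add: cdiff_mult(2) cdiff_polys_coords polys.add polys.mult)
qed (simp add: fd_const polys.const)

lemma cdiff_smult: "cdiff (%v::complex ^ 'n::finite. c *s v) v" "fd (%v. c *s v) v w = c *s w"
 using cdiff_cscale[OF cdiff_const cdiff_ident, of c v] fd_eq[OF has_derivative_ident, of v w]
 by (simp_all add: cscale_eq_smult fd_const)

lemma form_fd:
 assumes P: "form d P" and c: "c ~= 0"
 shows "fd P (c *s v) w = c ^ (d - 1) * fd P v w"
proof -
 have cd: "cdiff P v" for v using P by (auto simp: form_def cdiff_polys_coords)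
 have "fd (%v. P (c *s v)) v w = fd P (c *s v) (c *s w)"
  using cdiff_compose(2)[where g = P and f = "%v. c *s v", OF cd cdiff_smult(1)] by (simp add: cdiff_smult(2))
 moreover have "(%v. P (c *s v)) = (%v. c ^ d * P v)" using P by (simp add: form_def)
 moreover have "fd (%v. c ^ d * P v) v w = c ^ d * fd P v w"
  using cdiff_mult(2)[OF cdiff_const cd] by (simp add: fd_const)
 moreover have "fd P (c *s v) (c *s w) = c * fd P (c *s v) w"
  using fd_clin[OF cd, of "c *s v" c w] by (simp add: cscale_eq_smult)
 ultimately have e: "c * fd P (c *s v) w = c ^ d * fd P v w" by simp
 show ?thesis
 proof (cases d)
  \<comment> \<open>Here \<open>d - 1\<close> is 0 in the natural numbers; a form of degree 0 is
    constant, and both sides vanish.\<close>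
  case 0
  have "P v = P 0" for v using P[unfolded form_def 0, THEN conjunct2, rule_format, of 0 v] by simp
  then have "P = (%_. P 0)" by blast
  then have "fd P v w = 0" for v using fd_const[of "P 0" v w] by metis
  then show ?thesis by simp
 next
  case (Suc m)
  then show ?thesis using e c by simp
 qed
qed

definition iform :: "'n::finite cproj set => nat => (complex ^ 'n => complex) => bool" where
 "iform S d P \<longleftrightarrow> form d P & (ALL v. v ~= 0 --> abs_cproj v : S --> P v = 0)"

lemma iform_cdiff: "iform S d P ==> cdiff P v"
 by (auto simp: iform_def form_def cdiff_polys_coords)

lemma iform_linear:
 assumes "iform S d P"
 shows "fd P v (a + b) = fd P v a + fd P v b" "fd P v (a - b) = fd P v a - fd P v b" "fd P v (c *s a) = c * fd P v a"
 using fd_add[OF iform_cdiff[OF assms]] linear_diff[OF fd_linear[OF iform_cdiff[OF assms]]]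
  fd_clin[OF iform_cdiff[OF assms], of v c a] by (simp_all add: cscale_eq_smult)

lemma deriv_line:
 fixes P :: "complex ^ 'n::finite => complex"
 assumes "cdiff P v" shows "deriv (%t. P (v + t *s w)) 0 = fd P v w"
proof -
 have bl: "bounded_linear (%t. t *\<^sub>C w)" "clin (%t. t *\<^sub>C w)"
  using bounded_bilinear.bounded_linear_left[OF bounded_bilinear_cscale] by (auto simp: clin_def cscale_assoc)
 have "((%t. v + t *\<^sub>C w) has_derivative (%t. t *\<^sub>C w)) (at 0)"
  using has_derivative_add[OF has_derivative_const bounded_linear_imp_has_derivative[OF bl(1)], of v] by simp
 then have l: "cdiff (%t. v + t *\<^sub>C w) 0" "fd (%t. v + t *\<^sub>C w) 0 1 = w"
  using cdiffI bl(2) fd_eq[of "%t. v + t *\<^sub>C w" "%t. t *\<^sub>C w" 0 1] by (blast, metis cscale_one)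
 have d: "cdiff (%t. P (v + t *\<^sub>C w)) 0" "fd (%t. P (v + t *\<^sub>C w)) 0 1 = fd P v w"
  using cdiff_compose[where g = P and f = "%t. v + t *\<^sub>C w" and x = 0, OF _ l(1)] assms l(2) by simp_all
 show ?thesis using DERIV_imp_deriv[OF fd_complex[OF d(1)]] d(2) unfolding cscale_eq_smult by simp
qed

lemma cone_tangent_iff:
 assumes "v ~= 0"
 shows "w : cone_tangent S (abs_cproj v) \<longleftrightarrow> (ALL d P. iform S d P --> fd P v w = 0)"
proof -
 obtain c where c: "c ~= 0" "rep_cproj (abs_cproj v) = c *s v" using rep_abs_cproj[OF assms] .
 have scale: "fd P (c *s v) w = 0 \<longleftrightarrow> fd P v w = 0" if "iform S d P" for d P
  using form_fd[of d P c v w] that c(1) by (simp add: iform_def)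
 have rep: "(ALL q:S. P (rep_cproj q) = 0) \<longleftrightarrow> (ALL v. v ~= 0 --> abs_cproj v : S --> P v = 0)" if "form d P" for d P
 proof safe
  fix v assume "ALL q:S. P (rep_cproj q) = 0" "v ~= 0" "abs_cproj v : S"
  then show "P v = 0" using form_abs_cproj[OF that] by blast
 next
  fix q assume "ALL v. v ~= 0 --> abs_cproj v : S --> P v = 0" "q : S"
  then show "P (rep_cproj q) = 0" using rep_cproj_nonzero[of q] by simp
 qed
 show ?thesis
 proof
  assume w: "w : cone_tangent S (abs_cproj v)"
  show "ALL d P. iform S d P --> fd P v w = 0"
  proof (intro allI impI)
   fix d P assume P: "iform S d P"
   then have f: "form d P" by (simp add: iform_def)
   from form_cpoly[OF f] obtain E where E: "homogeneous E" "!!v. poly_eval E (($) v) = P v" by blast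
   have "deriv (%t. P (c *s v + t *s w)) 0 = 0"
    using w P rep[OF f] unfolding cone_tangent_def c(2) by (auto simp: iform_def E dest!: spec[of _ E] intro: E)
   then show "fd P v w = 0" using deriv_line[OF iform_cdiff[OF P]] scale[OF P] by metis
  qed
 next
  assume w: "ALL d P. iform S d P --> fd P v w = 0"
  show "w : cone_tangent S (abs_cproj v)"
   unfolding cone_tangent_def mem_Collect_eq
  proof (intro allI impI, elim conjE)
   fix E :: "'a cpoly"
   assume E: "homogeneous E" "ALL q:S. poly_eval E (($) (rep_cproj q)) = 0"
   obtain d where f: "form d (%v. poly_eval E (($) v))" using form_poly_eval[OF E(1)] .
   have i: "iform S d (%v. poly_eval E (($) v))" using f E(2) rep[OF f] by (simp add: iform_def)
   show "deriv (%t. poly_eval E (($) (rep_cproj (abs_cproj v) + t *s w))) 0 = 0"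
    unfolding c(2) deriv_line[OF iform_cdiff[OF i]] using w i scale[OF i] by blast
  qed
 qed
qed

lemma subspace_cone_tangent: "vec.subspace (cone_tangent S p)"
proof -
 have iff: "w : cone_tangent S p \<longleftrightarrow> (ALL d P. iform S d P --> fd P (rep_cproj p) w = 0)" for w
  using cone_tangent_iff[OF rep_cproj_nonzero[of p]] by simp
 show ?thesis
  unfolding vec.subspace_def iff
  by (auto simp: iff iform_linear linear_0[OF fd_linear[OF iform_cdiff]])
qed

lemma euler_tangent:
 assumes "v ~= 0" "abs_cproj v : S"
 shows "v : cone_tangent S (abs_cproj v)"
 unfolding cone_tangent_iff[OF assms(1)]
proof (intro allI impI)
 fix d P assume P: "iform S d P"
 have "P (v + t *s v) = 0" for t
 proof -
  have e: "v + t *s v = (1 + t) *s v" by (simp add: vec_eq_iff algebra_simps)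
  have "P ((1 + t) *s v) = (1 + t) ^ d * P v" using P unfolding iform_def form_def by blast
  moreover have "P v = 0" using P assms by (simp add: iform_def)
  ultimately show ?thesis unfolding e by simp
 qed
 then show "fd P v v = 0" using deriv_line[OF iform_cdiff[OF P], of v v] by simp
qed

lemma tangent_plane_hyperplane:
 assumes "k ~= 0"
 shows "tangent_plane S p <= hyperplane (abs_cproj k) \<longleftrightarrow> (ALL w:cone_tangent S p. pairing k w = 0)"
proof -
 obtain c where c: "c ~= 0" "rep_cproj (abs_cproj k) = c *s k" using rep_abs_cproj[OF assms] .
 show ?thesis
 proof
  assume l: "tangent_plane S p <= hyperplane (abs_cproj k)"
  show "ALL w:cone_tangent S p. pairing k w = 0"
  proof
   fix w assume w: "w : cone_tangent S p"
   show "pairing k w = 0"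
   proof (cases "w = 0")
    case False
    then obtain e where e: "e ~= 0" "rep_cproj (abs_cproj w) = e *s w" using rep_abs_cproj by blast
    then have "abs_cproj w : tangent_plane S p"
     using w subspace_cone_tangent[of S p] by (simp add: tangent_plane_def vec.subspace_scale)
    then have "abs_cproj w : hyperplane (abs_cproj k)" using l by blast
    then show ?thesis using c e by (simp add: hyperplane_def pairing_linear)
   qed (simp add: pairing_linear)
  qed
 qed (auto simp: tangent_plane_def hyperplane_def c pairing_linear)
qed

lemma complement_plane:
 fixes T :: "(complex ^ 5) set"
 assumes T: "vec.subspace T" "vec.dim T = 3"
 obtains x y where "!!w. EX a b. w - a *s x - b *s y : T" "!!a b. a *s x + b *s y : T ==> a = 0 & b = 0"
proof -
 obtain B where B: "B <= T" "vec.independent B" "T <= vec.span B" "card B = 3"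
  using vec.basis_exists[of T] T(2) by metis
 have sB: "vec.span B = T" using B vec.span_minimal[OF B(1) T(1)] by blast
 obtain C where C: "B <= C" "vec.independent C" "UNIV <= vec.span C"
  using vec.maximal_independent_subset_extend[OF subset_UNIV B(2)] by metis
 have "card C = 5" using vec.basis_card_eq_dim[OF subset_UNIV C(3,2)] by (simp add: card_cart_basis)
 moreover have "finite C" using vec.finiteI_independent[OF C(2)] .
 ultimately have "card (C - B) = 2" using B(4) C(1) by (simp add: card_Diff_subset finite_subset)
 then obtain x y where xy: "C - B = {x, y}" "x ~= y" by (auto simp: card_2_iff)
 have Ceq: "C = insert x (insert y B)" "x ~: insert y B" "y ~: B" using xy C(1) by auto
 have ind: "x ~: vec.span (insert y B)" "y ~: vec.span B"
  using C(2) Ceq by (simp_all add: vec.independent_insert)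
 show ?thesis
 proof (rule that)
  show "EX a b. w - a *s x - b *s y : T" for w
   using C(3) unfolding Ceq(1) sB[symmetric] by (metis UNIV_I subsetD vec.span_breakdown_eq)
 next
  fix a b assume ab: "a *s x + b *s y : T"
  have a: "a = 0"
  proof (rule ccontr)
   assume a: "a ~= 0"
   have "a *s x - (- b) *s y : vec.span B" using ab by (simp add: sB)
   then have "a *s x : vec.span (insert y B)" unfolding vec.span_breakdown_eq by blast
   then have "inverse a *s (a *s x) : vec.span (insert y B)" by (rule vec.span_scale)
   then show False using a ind(1) by simp
  qed
  moreover have "b = 0"
  proof (rule ccontr)
   assume b: "b ~= 0"
   have "b *s y : vec.span B" using ab a by (simp add: sB)
   then have "inverse b *s (b *s y) : vec.span B" by (rule vec.span_scale)
   then show False using b ind(2) by simp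
  qed
  ultimately show "a = 0 & b = 0" ..
 qed
qed

text \<open>Some form \<open>P1\<close> has nonzero derivative along \<open>x\<close>. The
  combination of \<open>x\<close> and \<open>y\<close> killed by its differential is again not
  tangent, so a second form \<open>Q\<close> detects it.\<close>

lemma two_forms:
 assumes v: "v ~= 0" and xy: "!!a b. a *s x + b *s y : cone_tangent S (abs_cproj v) ==> a = 0 & b = 0"
 obtains d P e Q where "iform S d P" "iform S e Q" "fd P v x * fd Q v y - fd P v y * fd Q v x ~= 0"
proof -
 have "1 *s x + 0 *s y ~: cone_tangent S (abs_cproj v)" using xy[of 1 0] by auto
 then obtain d1 P1 where P1: "iform S d1 P1" "fd P1 v x ~= 0"
  unfolding cone_tangent_iff[OF v] by auto
 have "(- fd P1 v y) *s x + fd P1 v x *s y ~: cone_tangent S (abs_cproj v)" using xy[of "- fd P1 v y" "fd P1 v x"] P1(2) by auto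
 then obtain e Q where "iform S e Q" "fd Q v ((- fd P1 v y) *s x + fd P1 v x *s y) ~= 0"
  unfolding cone_tangent_iff[OF v] by auto
 then show ?thesis using that[OF P1(1), of e Q] by (auto simp: iform_linear algebra_simps)
qed

text \<open>The 3 by 3 determinant of \<open>fd P\<close>, \<open>fd Q\<close> and the hyperplane on
  the vectors \<open>x\<close>, \<open>y\<close>, \<open>z\<close>. Its vanishing expresses linear
  dependence of the three functionals on these vectors, polynomially in the point and the
  hyperplane.\<close>

definition dt3 :: "(complex ^ 'n::finite => complex) => (complex ^ 'n => complex) => complex ^ 'n => complex ^ 'n => complex ^ 'n
  => (complex ^ 'n) \<times> (complex ^ 'n) => complex" where
 "dt3 P Q x y z vk = (let f = fd P (fst vk); g = fd Q (fst vk); h = pairing (snd vk) in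
   (f x * g y - f y * g x) * h z + (f y * g z - f z * g y) * h x + (f z * g x - f x * g z) * h y)"

text \<open>The three functionals vanish on a subspace of codimension 2 and are therefore linearly
  dependent.\<close>

lemma dt3_zero:
 fixes S :: "5 cproj set"
 assumes v: "v ~= 0" and dim: "vec.dim (cone_tangent S (abs_cproj v)) = 3"
  and k: "!!w. w : cone_tangent S (abs_cproj v) ==> pairing k w = 0"
  and P: "iform S d P" and Q: "iform S e Q"
 shows "dt3 P Q x y z (v, k) = 0"
proof -
 let ?T = "cone_tangent S (abs_cproj v)"
 obtain x0 y0 where xy0: "!!w. EX a b. w - a *s x0 - b *s y0 : ?T"
  by (rule complement_plane[OF subspace_cone_tangent dim]) blast
 have "EX a b. ALL f:{fd P v, fd Q v, pairing k}. f w = a * f x0 + b * f y0" for w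
 proof -
  obtain a b where ab: "w - a *s x0 - b *s y0 : ?T" using xy0[of w] by blast
  then have "fd P v (w - a *s x0 - b *s y0) = 0" "fd Q v (w - a *s x0 - b *s y0) = 0" "pairing k (w - a *s x0 - b *s y0) = 0"
   using P Q k unfolding cone_tangent_iff[OF v] by blast+
  then show ?thesis
   by (intro exI[of _ a] exI[of _ b]) (simp add: iform_linear[OF P] iform_linear[OF Q] pairing_linear algebra_simps)
 qed
 then obtain a b where ab: "!!w f. f : {fd P v, fd Q v, pairing k} ==> f w = a w * f x0 + b w * f y0" by metis
 show ?thesis
  unfolding dt3_def Let_def fst_conv snd_conv
   ab[of "fd P v" x, simplified] ab[of "fd P v" y, simplified] ab[of "fd P v" z, simplified]
   ab[of "fd Q v" x, simplified] ab[of "fd Q v" y, simplified] ab[of "fd Q v" z, simplified]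
   ab[of "pairing k" x, simplified] ab[of "pairing k" y, simplified] ab[of "pairing k" z, simplified]
  by (simp add: algebra_simps)
qed

text \<open>For a point \<open>v\<close> of the cone over \<open>S\<close> at which \<open>S\<close> is smooth, these equations say that \<open>k\<close> vanishes on
 the tangent space; they are closed conditions on \<open>(v, k)\<close>.\<close>
definition incidence_eqs :: "5 cproj set => ((complex ^ 5) \<times> (complex ^ 5) => complex) set" where
 "incidence_eqs S = {%z. P (fst z) | P. EX d. iform S d P} Un {%z. pairing (snd z) (fst z)} \<union>
   {dt3 P Q x y w | P Q x y w. (EX d. iform S d P) & (EX e. iform S e Q)}"

lemma joint_fst: "P : polys (range coords) ==> (%z. P (fst z)) : joint"
 unfolding joint_def by (rule polys_compose) (auto simp: coords_fst intro: polys.gen)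

lemma joint_pairing_snd: "(%z :: (complex ^ 'n::finite) \<times> (complex ^ 'm::finite). pairing (snd z) x) : joint"
proof -
 have "(%z :: (complex ^ 'n) \<times> (complex ^ 'm). pairing (snd z) x) = (%z. \<Sum>i\<in>UNIV. jk i z * x $ i)" by (simp add: pairing_def jk_def)
 moreover have "\<dots> : polys (range jv Un range jk)"
  by (intro polys_sum polys.mult polys.const polys.gen) auto
 ultimately show ?thesis by (simp add: joint_def)
qed

lemma joint_pairing: "(%z :: (complex ^ 'n::finite) \<times> (complex ^ 'n). pairing (snd z) (fst z)) : joint"
proof -
 have "(%z :: (complex ^ 'n) \<times> (complex ^ 'n). pairing (snd z) (fst z)) = (%z. \<Sum>i\<in>UNIV. jk i z * jv i z)" by (simp add: pairing_def jk_def jv_def)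
 moreover have "\<dots> : polys (range jv Un range jk)"
  by (intro polys_sum polys.mult polys.gen) auto
 ultimately show ?thesis by (simp add: joint_def)
qed

lemma incidence_eqs_joint: "C : incidence_eqs S ==> C : joint"
proof -
 have dt: "dt3 P Q x y w : joint" if P: "iform S d P" and Q: "iform S e Q" for P Q x y w d e
 proof -
  have "(%z. fd P (fst z) a) : joint" "(%z. fd Q (fst z) a) : joint" for a
   using P Q by (auto simp: iform_def form_def intro!: joint_fst[OF polys_coords_fd])
  then show ?thesis unfolding dt3_def[abs_def] Let_def by (intro joint_intros joint_pairing_snd)
 qed
 have "(%z. P (fst z)) : joint" if "iform S d P" for P d
  using that by (auto simp: iform_def form_def intro!: joint_fst)
 then show "C : incidence_eqs S ==> C : joint"
  unfolding incidence_eqs_def using joint_pairing dt by blast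
qed

lemma incidence_eqs_bihom: "C : incidence_eqs S ==> EX d e. bihom C d e"
proof -
 assume "C : incidence_eqs S"
 then consider d P where "iform S d P" "C = (%z. P (fst z))" | "C = (%z. pairing (snd z) (fst z))"
  | P Q x y w d e where "iform S d P" "iform S e Q" "C = dt3 P Q x y w"
  unfolding incidence_eqs_def by auto
 then show ?thesis
 proof cases
  case 1
  then show ?thesis by (intro exI[of _ d] exI[of _ 0]) (auto simp: bihom_def iform_def form_def)
 next
  case 2
  then show ?thesis by (intro exI[of _ 1] exI[of _ 1]) (auto simp: bihom_def pairing_linear)
 next
  case 3
  then have "bihom C ((d - 1) + (e - 1)) 1"
   by (auto simp: bihom_def dt3_def Let_def iform_def form_fd pairing_linear power_add algebra_simps)
  then show ?thesis by blast
 qed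
qed

text \<open>The equations hold at the pairs over smooth points and, being bihomogeneous, pass to the
  closure.\<close>

lemma incidence_variety_eqs:
 assumes "(abs_cproj v, abs_cproj k) : incidence_variety S" "v ~= 0" "k ~= 0" "C : incidence_eqs S"
 shows "C (v, k) = 0"
proof -
 obtain d e where de: "bihom C d e" using incidence_eqs_bihom[OF assms(4)] by blast
 show ?thesis
 proof (rule closure_bihom[OF incidence_eqs_joint[OF assms(4)] de])
  fix v k :: "complex ^ 5"
  assume nz: "v ~= 0" "k ~= 0"
   and "(abs_cproj v, abs_cproj k) : {(p, H). p : smooth_locus S & tangent_plane S p <= hyperplane H}"
  then have s: "abs_cproj v : S" "vec.dim (cone_tangent S (abs_cproj v)) = 3"
   "!!w. w : cone_tangent S (abs_cproj v) ==> pairing k w = 0"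
   by (auto simp: smooth_locus_def tangent_plane_hyperplane)
  show "C (v, k) = 0"
   using assms(4) s nz dt3_zero[OF nz(1) s(2,3)] euler_tangent[OF nz(1) s(1)]
   unfolding incidence_eqs_def by (auto simp: iform_def)
 qed (use assms in "auto simp: incidence_variety_def")
qed

lemma incidence_eqs_in:
 assumes S: "zariski_closed S" and v: "v ~= 0" and C: "!!C. C : incidence_eqs S ==> C (v, k) = 0"
 shows "abs_cproj v : S"
proof -
 obtain \<P> where P: "!!P. P : \<P> ==> EX d. form d P" "!!p. p : S \<longleftrightarrow> (ALL P:\<P>. P (rep_cproj p) = 0)"
  using zariski_closedE[OF S] by blast
 show ?thesis unfolding P(2)
 proof
  fix E assume E: "E : \<P>"
  then obtain d where d: "form d E" using P(1) by blast
  then have "iform S d E" using E P(2) form_abs_cproj[OF d] by (auto simp: iform_def)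
  then have "(%z. E (fst z)) : incidence_eqs S" unfolding incidence_eqs_def by blast
  from C[OF this] show "E (rep_cproj (abs_cproj v)) = 0" using form_abs_cproj[OF d v] by simp
 qed
qed

text \<open>At a smooth point two forms have independent differentials on a complement of the
  tangent space; with a tangent vector \<open>w\<close> as third argument, \<open>dt3\<close> is a
  nonzero multiple of \<open>pairing k w\<close>.\<close>

lemma incidence_eqs_tangent:
 assumes v: "v ~= 0" and dim: "vec.dim (cone_tangent S (abs_cproj v)) = 3"
  and C: "!!C. C : incidence_eqs S ==> C (v, k) = 0" and w: "w : cone_tangent S (abs_cproj v)"
 shows "pairing k w = 0"
proof -
 obtain x y where "!!a b. a *s x + b *s y : cone_tangent S (abs_cproj v) ==> a = 0 & b = 0"
  by (rule complement_plane[OF subspace_cone_tangent dim]) blast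
 from two_forms[OF v this] obtain d P e Q where PQ: "iform S d P" "iform S e Q"
  "fd P v x * fd Q v y - fd P v y * fd Q v x ~= 0" by blast
 have "fd P v w = 0" "fd Q v w = 0" using w PQ unfolding cone_tangent_iff[OF v] by blast+
 moreover have "dt3 P Q x y w (v, k) = 0" by (rule C) (use PQ in \<open>unfold incidence_eqs_def, blast\<close>)
 ultimately show ?thesis using PQ(3) by (simp add: dt3_def Let_def)
qed

lemma independent_triple:
 fixes x y z :: "complex ^ 'n::finite"
 assumes "!!a b c. a *s x + b *s y + c *s z = 0 ==> a = 0 & b = 0 & c = 0"
 shows "vec.dim (vec.span {x, y, z}) = 3"
proof -
 have z: "z ~= 0" using assms[of 0 0 1] by auto
 have y: "y ~: vec.span {z}"
 proof
  assume "y : vec.span {z}"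
  then obtain k where "y = k *s z" by (auto simp: vec.span_singleton)
  then show False using assms[of 0 1 "- k"] by simp
 qed
 have x: "x ~: vec.span {y, z}"
 proof
  assume "x : vec.span {y, z}"
  then obtain k where "x - k *s y : vec.span {z}" unfolding vec.span_breakdown_eq by blast
  then obtain l where "x - k *s y = l *s z" by (auto simp: vec.span_singleton)
  then have "x = k *s y + l *s z" by (simp add: algebra_simps)
  then show False using assms[of 1 "- k" "- l"] by (simp add: algebra_simps)
 qed
 have "vec.independent {x, y, z}" using x y z by (auto simp: vec.independent_insert vec.span_base)
 moreover have "x ~= y" "x ~= z" "y ~= z" using x y by (auto intro: vec.span_base)
 ultimately show ?thesis by (simp add: vec.dim_span vec.dim_eq_card_independent)
qed

section \<open>The surface in a chart\<close>

lemma independent_pair_shift: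
 fixes L :: "complex ^ 2 => complex ^ 'n::finite"
 assumes "!!v. L v = v $ 1 *s L (axis 1 1) + v $ 2 *s L (axis 2 1)"
  and "!!a v. a *s x + L v = 0 ==> a = 0 & v = 0"
 shows "vec.dim (insert x (range L)) = 3"
proof -
 let ?T = "{x, L (axis 1 1), L (axis 2 1)}"
 have "vec.dim (vec.span ?T) = 3"
 proof (rule independent_triple)
  fix a b c assume z: "a *s x + b *s L (axis 1 1) + c *s L (axis 2 1) = 0"
  have "L (vector [b, c]) = b *s L (axis 1 1) + c *s L (axis 2 1)" using assms(1)[of "vector [b, c]"] by simp
  then have "a *s x + L (vector [b, c]) = 0" using z by (simp add: add.assoc)
  from assms(2)[OF this] have "a = 0" "vector [b, c] = (0 :: complex ^ 2)" by auto
  then show "a = 0 & b = 0 & c = 0" by (metis vector_2 zero_index)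
 qed
 moreover have "vec.span (insert x (range L)) = vec.span ?T"
 proof (rule vec.span_eq[THEN iffD2], intro conjI subsetI)
  fix y assume "y : insert x (range L)"
  then consider "y = x" | v where "y = L v" by auto
  then show "y : vec.span ?T"
  proof cases
   case 2
   show ?thesis unfolding 2 assms(1)[of v] by (intro vec.span_add vec.span_scale vec.span_base) auto
  qed (auto intro: vec.span_base)
 qed (auto intro: vec.span_base)
 ultimately show ?thesis by (metis vec.dim_span)
qed

definition pr :: "complex ^ 2 => complex * complex" where "pr z = (z $ 1, z $ 2)"

lemma pr_vector [simp]: "pr (vector [a, b]) = (a, b)" by (simp add: pr_def)
lemma vector_pr [simp]: "vector [fst (pr z), snd (pr z)] = z" by (simp add: pr_def vec_eq_iff forall_2)
lemma pr_inject: "pr z = pr w \<longleftrightarrow> z = w" by (simp add: pr_def vec_eq_iff forall_2)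
lemma pr_zero [simp]: "pr 0 = 0" by (simp add: pr_def zero_prod_def)

lemma hol_at_pr: "hol_at pr z" unfolding pr_def[abs_def] by (intro hols)
lemma fd_pr: "fd pr z v = pr v"
 using fd_eq[OF bounded_linear_imp_has_derivative[OF bounded_linear_Pair[OF bounded_linear_vec_nth bounded_linear_vec_nth]]]
 by (simp add: pr_def[abs_def])

lemma continuous_vector2: "continuous_on A (%w::complex * complex. vector [fst w, snd w] :: complex ^ 2)"
proof -
 have e: "(%w. vector [fst w, snd w] :: complex ^ 2) = (%w::complex * complex. \<chi> i. if i = 1 then fst w else snd w)"
  by (auto simp: vec_eq_iff forall_2)
 show ?thesis unfolding e
 proof (rule continuous_on_vec_lambda)
  show "continuous_on A (%w. if i = 1 then fst w else snd w)" for i :: 2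
   by (cases "i = 1") (auto intro!: continuous_intros)
 qed
qed

text \<open>The left-hand side is what the derivative rules return for \<open>P / J^n\<close> in the
  direction \<open>V / J\<close>. One power of \<open>J\<close> comes from the direction and one
  from the quotient rule, hence the exponent \<open>n + 2\<close>.\<close>

lemma quotient_rule_algebra:
 assumes "(j::complex) ~= 0"
 shows "- p * (inverse (j ^ n) * (of_nat n * (inverse j * b) * j ^ (n - 1)) * inverse (j ^ n)) + inverse j * a / j ^ n =
  (j * a - of_nat n * p * b) / j ^ (n + 2)"
proof (cases n)
 case 0
 then show ?thesis using assms by (simp add: field_simps power2_eq_square)
next
 case (Suc m)
 have "- p * (inverse (j * q) * (N * (inverse j * b) * q) * inverse (j * q)) + inverse j * a / (j * q) =
  (j * a - N * p * b) / (j * (q * (j * j)))" if "q ~= 0" for q N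
  using assms that by (simp add: field_simps)
 from this[of "j ^ m" "of_nat n"] show ?thesis using assms Suc by (simp add: power_add power2_eq_square)
qed

lemma cdiff_cholomorphic:
 "open W ==> (!!w. w : W ==> cdiff ph w) ==> cholomorphic_on ph W"
 unfolding cholomorphic_on_def cdiff_def clin_def by (auto simp: cscale_eq_smult)

context surface_chart
begin

lemma V_expand: "V v x = fst v *\<^sub>C V (1, 0) x + snd v *\<^sub>C V (0, 1) x"
proof -
 have e: "fd f x (0, 0, v) = fst v * fd f x (0, 0, 1, 0) + snd v * fd f x (0, 0, 0, 1)" if "cdiff f x" for f :: "chart => complex"
  using fd_chart_expand[OF that, of 0 0 "fst v" "snd v"] by simp
 show ?thesis
  unfolding V_def e[OF cdiff_polys_Xc[OF F]] e[OF cdiff_polys_Xc[OF G]]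
  by (simp add: prod_eq_iff algebra_simps)
qed

lemma V_zero: "V (0, 0) x = 0"
 using V_expand[of "(0, 0)" x] by (simp add: prod_eq_iff)

lemma tang_zero: "tang 0 = 0" by (simp add: tang_def)

lemma iform_chart:
 assumes f: "f : polys Xc" and van: "!!x. abs_cproj (Lc x) : S ==> f x = 0"
 obtains d P where "iform S d P" "!!x. P (Lc x) = f x"
proof -
 obtain Q d where Q: "Q : (joint :: ((complex ^ 5) \<times> (complex ^ 5) => complex) set)"
  "!!c v k. Q (c *s v, k) = c ^ d * Q (v, k)" "!!x k. Q (Lc x, k) = f x"
  by (rule homogenize[OF XK_fst[OF f]]) auto
 \<comment> \<open>The extra factor makes \<open>P\<close> vanish also at the points of
   \<open>S\<close> at infinity, so that it belongs to the ideal of \<open>S\<close>.\<close>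
 define P where "P = (%v. Q (v, 0) * pairing kl v)"
 have "(%v. Q (v, 0)) : polys (range coords)"
 proof (rule polys_compose[OF Q(1)[unfolded joint_def]])
  fix g :: "(complex ^ 5) \<times> (complex ^ 5) => complex"
  assume "g : range jv Un range jk"
  then consider i where "g = jv i" | i where "g = jk i" by blast
  then show "(%z. g (z, 0)) : polys (range coords)"
  proof cases
   case (1 i)
   then have "(%z. g (z, 0)) = coords i" by (auto simp: jv_def coords_def)
   then show ?thesis by (auto intro: polys.gen)
  next
   case 2
   then show ?thesis by (simp add: jk_def polys.const)
  qed
 qed
 then have P: "P : polys (range coords)" unfolding P_def by (rule polys.mult[OF _ pairing_polys])
 have PL: "P (Lc x) = f x" for x by (simp add: P_def Q(3))
 have "form (Suc d) P" using P by (simp add: form_def) (simp add: P_def Q(2) pairing_linear)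
 moreover have "P v = 0" if "v ~= 0" "abs_cproj v : S" for v
 proof (cases "pairing kl v = 0")
  case False
  have v: "v = pairing kl v *s Lc (chi v)" by (rule Lc_chi[OF False])
  have "abs_cproj (Lc (chi v)) = abs_cproj v" using abs_cproj_scale[OF Lc_nonzero False] v by metis
  then have "P (Lc (chi v)) = 0" using van that PL by simp
  moreover have "P v = pairing kl v ^ Suc d * P (Lc (chi v))"
   using \<open>form (Suc d) P\<close> v unfolding form_def by metis
  ultimately show ?thesis by simp
 qed (simp add: P_def)
 ultimately have "iform S (Suc d) P" by (simp add: iform_def)
 then show ?thesis using that PL by blast
qed

lemma tang_add: "tang (x + y) = tang x + tang y" by (simp add: tang_def vec_eq_iff algebra_simps)

lemma tang_V: "tang (V v x) = fst v *s tang (V (1, 0) x) + snd v *s tang (V (0, 1) x)"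
 using arg_cong[OF V_expand[of v x], of tang] by (simp only: tang_add tang_cscale)

lemma good_in: "good x ==> abs_cproj (Lc x) : S" using in_S by (simp add: good_def)

text \<open>\<open>F\<close> and \<open>G\<close> homogenize to forms of the ideal, so tangent
  vectors are killed by their differentials and come from \<open>V\<close>. Conversely all forms of
  the ideal vanish along the implicit parametrization, and differentiation shows that
  \<open>V\<close> is tangent.\<close>

lemma good_tangent:
 assumes "good x"
 shows "cone_tangent S (abs_cproj (Lc x)) = {c *s Lc x + tang (V v x) | c v. True}"
proof (intro set_eqI iffI)
 fix w assume w: "w : cone_tangent S (abs_cproj (Lc x))"
 define c y where "c = pairing kl w" and "y = co (w - c *s Lc x)"
 have wy: "w = c *s Lc x + tang y"
  unfolding y_def tang_co by (simp add: pairing_linear c_def)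
 have ty: "tang y : cone_tangent S (abs_cproj (Lc x))"
 proof -
  have "w - c *s Lc x : cone_tangent S (abs_cproj (Lc x))"
   by (intro vec.subspace_diff[OF subspace_cone_tangent] w vec.subspace_scale[OF subspace_cone_tangent]
    euler_tangent Lc_nonzero good_in assms)
  then show ?thesis using wy by simp
 qed
 have z: "fd f x y = 0" if f: "f : polys Xc" "!!x. abs_cproj (Lc x) : S ==> f x = 0" for f
 proof -
  obtain d P where P: "iform S d P" "!!x. P (Lc x) = f x" using iform_chart[OF f] by blast
  have "fd (%x. P (Lc x)) x y = fd P (Lc x) (tang y)"
   using cdiff_compose(2)[where g = P and f = Lc, OF iform_cdiff[OF P(1)] cdiff_Lc] by (simp add: fd_Lc)
  then show ?thesis using ty P by (simp add: cone_tangent_iff)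
 qed
 have "y = inverse (J x) *\<^sub>C V (snd (snd y)) x"
  using kernel_V[of x "fst y" "fst (snd y)" "snd (snd y)"] z[OF F] z[OF G] FG_vanish assms by (simp add: good_def)
 also have "\<dots> = V (inverse (J x) *\<^sub>C snd (snd y)) x"
  by (subst (1 2) V_expand) (simp add: cscale_add_right cscale_assoc)
 finally obtain u where "y = V u x" by blast
 then show "w : {c *s Lc x + tang (V v x) | c v. True}" using wy by blast
next
 fix w assume "w : {c *s Lc x + tang (V v x) | c v. True}"
 then obtain c v where w: "w = c *s Lc x + tang (V v x)" by blast
 obtain s0 t0 w0 where x: "x = (s0, t0, w0)" by (cases x) auto
 obtain y where y: "hol_at y w0" "y w0 = (s0, t0)"
  "near w0 (%w. ALL v. fd (%w. (fst (y w), snd (y w), w)) w v =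
    inverse (J (fst (y w), snd (y w), w)) *\<^sub>C V v (fst (y w), snd (y w), w))"
  "near w0 (%w. good (fst (y w), snd (y w), w))"
  by (rule implicit_chart[OF assms[unfolded x]]) blast
 define gm where "gm = (%w. (fst (y w), snd (y w), w))"
 have gm: "cdiff gm w0" "gm w0 = x" "fd gm w0 v = inverse (J x) *\<^sub>C V v x"
  using spec[OF near_imp[OF y(3)], of v] y(1,2) unfolding gm_def by (auto intro!: hols hol_at_cdiff simp: x)
 have "tang (V v x) : cone_tangent S (abs_cproj (Lc x))"
  unfolding cone_tangent_iff[OF Lc_nonzero]
 proof (intro allI impI)
  fix d P assume P: "iform S d P"
  have c1: "cdiff (%w. Lc (gm w)) w0" "fd (%w. Lc (gm w)) w0 v = tang (inverse (J x) *\<^sub>C V v x)"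
   using cdiff_compose[where g = Lc and f = gm, OF cdiff_Lc gm(1)] gm by (simp_all add: fd_Lc)
  have c2: "cdiff (%w. P (Lc (gm w))) w0" "fd (%w. P (Lc (gm w))) w0 v = fd P (Lc x) (tang (inverse (J x) *\<^sub>C V v x))"
   using cdiff_compose[where g = P and f = "%w. Lc (gm w)", OF iform_cdiff[OF P] c1(1)] c1(2) gm(2) by simp_all
  have "near w0 (%w. P (Lc (gm w)) = 0)"
   using y(4) by (rule eventually_mono) (use P good_in in "auto simp: iform_def gm_def")
  then have "fd (%w. P (Lc (gm w))) w0 = fd (%_. 0) w0" by (rule cdiff_transform(2)[OF c2(1), symmetric])
  then have "inverse (J x) * fd P (Lc x) (tang (V v x)) = 0"
   using c2(2) by (simp add: fd_const tang_cscale iform_linear[OF P])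
  then show "fd P (Lc x) (tang (V v x)) = 0" using assms by (simp add: good_def)
 qed
 then show "w : cone_tangent S (abs_cproj (Lc x))"
  unfolding w by (intro vec.subspace_add[OF subspace_cone_tangent] vec.subspace_scale[OF subspace_cone_tangent]
   euler_tangent Lc_nonzero good_in assms)
qed

lemma good_smooth:
 assumes "good x" shows "abs_cproj (Lc x) : smooth_locus S"
proof -
 have "cone_tangent S (abs_cproj (Lc x)) = vec.span {Lc x, tang (V (1, 0) x), tang (V (0, 1) x)}"
  (is "_ = vec.span ?B")
 proof (rule antisym)
  show "cone_tangent S (abs_cproj (Lc x)) <= vec.span ?B"
  proof
   fix w assume "w : cone_tangent S (abs_cproj (Lc x))"
   then obtain c v where w: "w = c *s Lc x + tang (V v x)" unfolding good_tangent[OF assms] by blast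
   show "w : vec.span ?B"
    unfolding w tang_V[of v] by (intro vec.span_add vec.span_scale vec.span_base) auto
  qed
  have "Lc x = 1 *s Lc x + tang (V (0, 0) x)" "tang (V v x) = 0 *s Lc x + tang (V v x)" for v
   by (simp_all add: V_zero tang_zero)
  then have "?B <= cone_tangent S (abs_cproj (Lc x))" unfolding good_tangent[OF assms] by blast
  then show "vec.span ?B <= cone_tangent S (abs_cproj (Lc x))"
   by (rule vec.span_minimal[OF _ subspace_cone_tangent])
 qed
 moreover have "vec.dim (vec.span ?B) = 3"
 proof (rule independent_triple)
  fix a b c assume z: "a *s Lc x + b *s tang (V (1, 0) x) + c *s tang (V (0, 1) x) = 0"
  have p: "pairing k (a *s Lc x + b *s tang (V (1, 0) x) + c *s tang (V (0, 1) x)) = 0" for k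
   unfolding z by (simp add: pairing_linear)
  have a: "a = 0" using p[of kl] by (simp add: pairing_linear)
  show "a = 0 & b = 0 & c = 0"
   using p[of k1] p[of k2] a assms by (simp add: pairing_linear good_def V_def)
 qed
 ultimately show ?thesis using good_in[OF assms] by (simp add: smooth_locus_def)
qed

text \<open>At good points this is \<open>J\<close> times the derivative of the section
  \<open>k\<close> along the surface in direction \<open>v\<close>.\<close>

definition N1 :: "complex * complex => chart \<times> (complex ^ 5) => complex" where
 "N1 v z = pairing (snd z) (tang (V v (fst z)))"

definition crit :: "chart => complex ^ 5 => bool" where
 "crit x k \<longleftrightarrow> pairing k (Lc x) = 0 & N1 (1, 0) (x, k) = 0 & N1 (0, 1) (x, k) = 0"

lemma good_crit:
 assumes "good x"
 shows "(ALL w:cone_tangent S (abs_cproj (Lc x)). pairing k w = 0) \<longleftrightarrow> crit x k"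
proof
 assume l: "ALL w:cone_tangent S (abs_cproj (Lc x)). pairing k w = 0"
 have "1 *s Lc x + tang (V (0, 0) x) : cone_tangent S (abs_cproj (Lc x))"
  "0 *s Lc x + tang (V v x) : cone_tangent S (abs_cproj (Lc x))" for v
  unfolding good_tangent[OF assms] by blast+
 from l[rule_format, OF this(1)] l[rule_format, OF this(2)] show "crit x k"
  by (simp add: crit_def N1_def V_zero tang_zero pairing_linear)
next
 assume c: "crit x k"
 show "ALL w:cone_tangent S (abs_cproj (Lc x)). pairing k w = 0"
 proof
  fix w assume "w : cone_tangent S (abs_cproj (Lc x))"
  then obtain b v where w: "w = b *s Lc x + tang (V v x)" unfolding good_tangent[OF assms] by blast
  show "pairing k w = 0"
   unfolding w tang_V[of v] using c by (simp add: crit_def N1_def pairing_linear)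
 qed
qed

text \<open>Numerator of the derivative of \<open>P / J^n\<close> along the surface, over the
  denominator \<open>J^(n + 2)\<close>; see \<open>fd_quotient\<close>.\<close>

definition dl :: "nat => complex * complex => (chart \<times> (complex ^ 5) => complex) => chart \<times> (complex ^ 5) => complex" where
 "dl n v P z = J (fst z) * fd (%x. P (x, snd z)) (fst z) (V v (fst z)) - of_nat n * P z * fd J (fst z) (V v (fst z))"

definition khom :: "nat => (chart \<times> (complex ^ 5) => complex) => bool" where
 "khom e P \<longleftrightarrow> P : polys XK & (ALL c x k. P (x, c *s k) = c ^ e * P (x, k))"

lemma V_polys: "(%x. fst (V v x)) : polys Xc" "(%x. fst (snd (V v x))) : polys Xc"
 "(%x. fst (snd (snd (V v x)))) : polys Xc" "(%x. snd (snd (snd (V v x)))) : polys Xc"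
 by (simp_all add: V_def, (intro polys_diff polys.mult polys_Xc_fd F G J_polys polys.const)+)

lemma khom_mult: "khom e P ==> khom f Q ==> khom (e + f) (%z. P z * Q z)"
 by (auto simp: khom_def power_add intro: polys.mult)

lemma khom_diff: "khom e P ==> khom e Q ==> khom e (%z. P z - Q z)"
 by (auto simp: khom_def algebra_simps intro: polys_diff)

lemma khom_Xc: "f : polys Xc ==> khom 0 (%z. f (fst z))"
 by (auto simp: khom_def intro: XK_fst)

lemma khom_N1: "khom 1 (N1 v)"
proof -
 have "(%z. tang (V v (fst z)) $ i) : polys XK" for i :: 5
  unfolding tang_def vector_add_component vector_smult_component
  by (intro polys.add polys.mult polys.const XK_fst V_polys)
 moreover have "(%z. snd z $ i) : (polys XK :: (chart \<times> (complex ^ 5) => complex) set)" for i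
  by (rule polys.gen) (auto simp: XK_def)
 ultimately have "N1 v : polys XK" unfolding N1_def[abs_def] pairing_def by (intro polys_sum polys.mult)
 then show ?thesis by (simp add: khom_def N1_def pairing_linear)
qed

lemma khom_dl:
 assumes P: "khom e P" shows "khom e (dl n v P)"
proof -
 have PX: "P : polys XK" using P by (simp add: khom_def)
 have cd: "cdiff (%x. P (x, k)) x" for x k by (rule cdiff_polys_Xc[OF XK_slice[OF PX]])
 have "(%x. P (x, c *s k)) = (%x. c ^ e * P (x, k))" for c k using P unfolding khom_def by blast
 then have "fd (%x. P (x, c *s k)) x w = c ^ e * fd (%x. P (x, k)) x w" for c x k w
  using cdiff_mult(2)[OF cdiff_const cd] by (simp add: fd_const)
 moreover have "P (x, c *s k) = c ^ e * P (x, k)" for c x k using P unfolding khom_def by blast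
 ultimately have "dl n v P (x, c *s k) = c ^ e * dl n v P (x, k)" for c x k
  by (simp add: dl_def algebra_simps)
 moreover have "dl n v P : polys XK"
 proof -
  have e: "dl n v P z = J (fst z) * (fst (V v (fst z)) * fd (%x. P (x, snd z)) (fst z) (1, 0, 0, 0) +
    fst (snd (V v (fst z))) * fd (%x. P (x, snd z)) (fst z) (0, 1, 0, 0) +
    fst (snd (snd (V v (fst z)))) * fd (%x. P (x, snd z)) (fst z) (0, 0, 1, 0) +
    snd (snd (snd (V v (fst z)))) * fd (%x. P (x, snd z)) (fst z) (0, 0, 0, 1)) -
   of_nat n * P z * (fst (V v (fst z)) * fd J (fst z) (1, 0, 0, 0) +
    fst (snd (V v (fst z))) * fd J (fst z) (0, 1, 0, 0) +
    fst (snd (snd (V v (fst z)))) * fd J (fst z) (0, 0, 1, 0) +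
    snd (snd (snd (V v (fst z)))) * fd J (fst z) (0, 0, 0, 1))" for z
   unfolding dl_def
    fd_chart_expand[OF cd, of "snd z" "fst z" "fst (V v (fst z))" "fst (snd (V v (fst z)))"
     "fst (snd (snd (V v (fst z))))" "snd (snd (snd (V v (fst z))))", simplified, symmetric]
    fd_chart_expand[OF cdiff_polys_Xc[OF J_polys], of "fst z" "fst (V v (fst z))" "fst (snd (V v (fst z)))"
     "fst (snd (snd (V v (fst z))))" "snd (snd (snd (V v (fst z))))", simplified, symmetric] ..
  show ?thesis
   unfolding e[abs_def]
   by (intro polys_diff polys.mult polys.add polys.const PX XK_fd XK_fst[OF J_polys] XK_fst[OF V_polys(1)]
     XK_fst[OF V_polys(2)] XK_fst[OF V_polys(3)] XK_fst[OF V_polys(4)] XK_fst[OF polys_Xc_fd[OF J_polys]])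
 qed
 ultimately show ?thesis by (simp add: khom_def)
qed

text \<open>Numerators of the second derivatives, of \<open>hess\<close> and of \<open>cub\<close> of a section; the denominators are the
 powers \<open>J^3\<close>, \<open>J^6\<close> and \<open>J^11\<close>.\<close>
definition "N2 v w = dl 1 w (N1 v)"
definition "NH z = N2 (1, 0) (1, 0) z * N2 (0, 1) (0, 1) z - N2 (1, 0) (0, 1) z * N2 (0, 1) (1, 0) z"
definition "NC z = N2 (0, 1) (0, 1) z * dl 6 (1, 0) NH z - N2 (0, 1) (1, 0) z * dl 6 (0, 1) NH z"

lemma khom_N2: "khom 1 (N2 v w)" unfolding N2_def by (intro khom_dl khom_N1)

lemma khom_NH: "khom 2 NH"
 using khom_diff[OF khom_mult[OF khom_N2 khom_N2] khom_mult[OF khom_N2 khom_N2]] unfolding NH_def[abs_def]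
 by (simp add: numeral_2_eq_2)

lemma khom_NC: "khom 3 NC"
 using khom_diff[OF khom_mult[OF khom_N2 khom_dl[OF khom_NH]] khom_mult[OF khom_N2 khom_dl[OF khom_NH]]]
 unfolding NC_def[abs_def] by (simp add: numeral_3_eq_3 numeral_2_eq_2)

lemma khom_lift:
 assumes "khom e P"
 obtains Q d where "Q : joint" "bihom Q (Suc d) e" "!!v k. Q (v, k) = pairing kl v ^ Suc d * P (chi v, k)"
proof -
 obtain Q d where Q: "Q : (joint :: ((complex ^ 5) \<times> (complex ^ 5) => complex) set)"
  "!!c v k. Q (c *s v, k) = c ^ d * Q (v, k)" "!!x k. Q (Lc x, k) = P (x, k)"
  using homogenize[of P] assms unfolding khom_def by metis
 \<comment> \<open>The additional factor settles the case \<open>pairing kl v = 0\<close>: both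
   sides are then zero, whatever \<open>chi v\<close> is.\<close>
 define R where "R = (%z. Q z * pairing kl (fst z))"
 have R: "R (v, k) = pairing kl v ^ Suc d * P (chi v, k)" for v k
 proof (cases "pairing kl v = 0")
  case False
  have "Q (v, k) = pairing kl v ^ d * Q (Lc (chi v), k)" using Lc_chi[OF False] Q(2) by metis
  then show ?thesis by (simp add: R_def Q(3))
 qed (simp add: R_def)
 have "P (chi v, c *s k) = c ^ e * P (chi v, k)" for c v k using assms unfolding khom_def by blast
 then have b: "bihom R (Suc d) e"
  unfolding bihom_def R by (auto simp: chi_smult pairing_linear power_mult_distrib)
 have "R : joint" unfolding R_def by (intro joint_intros Q joint_fst pairing_polys)
 from that[OF this b R] show ?thesis .
qed

end

section \<open>Sections along a local parametrization of the surface\<close>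

locale good_point = surface_chart +
 fixes s0 t0 :: complex and w0 :: "complex * complex" and y :: "complex * complex => complex * complex"
 assumes good0: "good (s0, t0, w0)"
  and y: "hol_at y w0" "y w0 = (s0, t0)"
  and ynear: "near (s0, t0, w0) (%x. F x = 0 & G x = 0 \<longleftrightarrow> (fst x, fst (snd x)) = y (snd (snd x)))"
  and ytangent: "near w0 (%w. ALL v. fd (%w. (fst (y w), snd (y w), w)) w v =
    inverse (J (fst (y w), snd (y w), w)) *\<^sub>C V v (fst (y w), snd (y w), w))"
  and ygood: "near w0 (%w. good (fst (y w), snd (y w), w))"
begin

definition gm :: "complex * complex => chart" where "gm = (%w. (fst (y w), snd (y w), w))"

lemma gm0: "gm w0 = (s0, t0, w0)" by (simp add: gm_def y)

lemma hol_gm: "hol_at gm w0" unfolding gm_def by (intro hols y)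

lemma fd_quotient:
 assumes P: "P : polys XK"
 shows "hol_at (%w. P (gm w, k) / J (gm w) ^ n) w0"
  "near w0 (%w. fd (%w. P (gm w, k) / J (gm w) ^ n) w v = dl n v P (gm w, k) / J (gm w) ^ (n + 2))"
proof -
 have cP: "cdiff (%x. P (x, k)) x" "cdiff J x" for x by (intro cdiff_polys_Xc XK_slice P J_polys)+
 have "hol_at (%w. P (gm w, k)) w0" "hol_at (%w. J (gm w)) w0"
  by (rule hol_at_compose[where g = "%x. P (x, k)", OF hol_at_polys_Xc[OF XK_slice[OF P]] hol_gm],
   rule hol_at_compose[where g = J, OF hol_at_polys_Xc[OF J_polys] hol_gm])
 then show "hol_at (%w. P (gm w, k) / J (gm w) ^ n) w0"
  by (intro hols) (use good0 in "auto simp: gm0 good_def")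
 show "near w0 (%w. fd (%w. P (gm w, k) / J (gm w) ^ n) w v = dl n v P (gm w, k) / J (gm w) ^ (n + 2))"
  using ytangent ygood hol_gm[unfolded hol_at_def]
 proof eventually_elim
  case (elim w)
  have Jn: "J (gm w) ~= 0" using elim(2) by (simp add: good_def gm_def)
  have g: "fd gm w v = inverse (J (gm w)) *\<^sub>C V v (gm w)" using elim(1)[rule_format, of v] by (simp add: gm_def)
  have d: "fd (%w. f (gm w)) w v = inverse (J (gm w)) * fd f (gm w) (V v (gm w))"
   "((%w. f (gm w)) has_derivative fd (%w. f (gm w)) w) (at w)" if f: "!!x. cdiff f x" for f :: "chart => complex"
   using cdiff_compose[where g = f and f = gm, OF f elim(3)] cdiff_has_derivative
   by (auto simp: g fd_clin[OF f])
  note dP = d[of "%x. P (x, k)", OF cP(1)] and dJ = d[of J, OF cP(2)]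
  have "((%w. P (gm w, k) / J (gm w) ^ n) has_derivative
    (%h. - P (gm w, k) * (inverse (J (gm w) ^ n) * (of_nat n * fd (%w. J (gm w)) w h * J (gm w) ^ (n - 1)) * inverse (J (gm w) ^ n))
     + fd (%w. P (gm w, k)) w h / J (gm w) ^ n)) (at w)"
   by (rule derivative_eq_intros dP(2) dJ(2) refl | simp add: Jn fun_eq_iff divide_inverse)+
  from fd_eq[OF this, of v] show ?case
   unfolding dP(1) dJ(1) quotient_rule_algebra[OF Jn] by (simp add: dl_def)
 qed
qed

definition sec :: "complex ^ 5 => complex * complex => complex" where "sec k w = pairing k (Lc (gm w))"

lemma hol_sec: "hol_at (sec k) w0"
 unfolding sec_def by (rule hol_at_pairing, rule hol_at_compose[where g = Lc, OF hol_at_Lc hol_gm])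

lemma fd_sec: "near w0 (%w. fd (sec k) w v = N1 v (gm w, k) / J (gm w) ^ 1)"
 using ytangent hol_gm[unfolded hol_at_def]
proof eventually_elim
 case (elim w)
 have "fd (%w. Lc (gm w)) w v = tang (inverse (J (gm w)) *\<^sub>C V v (gm w))"
  using cdiff_compose(2)[where g = Lc and f = gm, OF cdiff_Lc elim(2)] elim(1)[rule_format, of v] by (simp add: fd_Lc gm_def)
 then show ?case
  unfolding sec_def fd_pairing[OF cdiff_compose(1)[where g = Lc and f = gm, OF cdiff_Lc elim(2)]]
  by (simp add: N1_def tang_cscale pairing_linear divide_inverse)
qed

lemma fd2_sec: "near w0 (%w. fd (%q. fd (sec k) q v) w v' = N2 v v' (gm w, k) / J (gm w) ^ 3)"
 using fd_eventually_eq[OF fd_sec[of k v] hol_at_fd[OF hol_sec]]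
  fd_quotient(2)[of "N1 v" k 1 v', OF khom_N1[unfolded khom_def, THEN conjunct1]]
 by eventually_elim (simp add: N2_def power3_eq_cube)

lemma hess_sec: "near w0 (%w. hess (sec k) (1, 0) (0, 1) w = NH (gm w, k) / J (gm w) ^ 6)"
 using fd2_sec[of k "(1, 0)" "(1, 0)"] fd2_sec[of k "(0, 1)" "(0, 1)"] fd2_sec[of k "(1, 0)" "(0, 1)"] fd2_sec[of k "(0, 1)" "(1, 0)"]
proof eventually_elim
 case (elim w)
 have e: "J (gm w) ^ 6 = J (gm w) ^ 3 * J (gm w) ^ 3" by (simp flip: power_add)
 show ?case unfolding hess_def elim NH_def e by (simp add: diff_divide_distrib)
qed

lemma cub_sec: "cub (sec k) (1, 0) (0, 1) w0 = NC (gm w0, k) / J (gm w0) ^ 11"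
proof -
 have h: "fd (hess (sec k) (1, 0) (0, 1)) w0 v = dl 6 v NH (gm w0, k) / J (gm w0) ^ 8" for v
 proof -
  have "fd (hess (sec k) (1, 0) (0, 1)) w0 = fd (%w. NH (gm w, k) / J (gm w) ^ 6) w0"
   using near_imp[OF fd_eventually_eq[OF hess_sec hol_at_hess[OF hol_sec]]] .
  then show ?thesis
   using near_imp[OF fd_quotient(2)[of NH k 6 v, OF khom_NH[unfolded khom_def, THEN conjunct1]]] by simp
 qed
 have e: "J (gm w0) ^ 11 = J (gm w0) ^ 3 * J (gm w0) ^ 8" by (simp flip: power_add)
 show ?thesis
  unfolding cub_def h near_imp[OF fd2_sec] NC_def e by (simp add: diff_divide_distrib)
qed

end

lemma fd_expand2:
 fixes f :: "complex ^ 2 => complex ^ 'n::finite"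
 assumes "cdiff f z"
 shows "fd f z v = v $ 1 *s fd f z (axis 1 1) + v $ 2 *s fd f z (axis 2 1)"
proof -
 have "v = v $ 1 *\<^sub>C axis 1 1 + v $ 2 *\<^sub>C axis 2 1" by (simp add: vec_eq_iff forall_2 axis_def)
 then have "fd f z v = fd f z (v $ 1 *\<^sub>C axis 1 1 + v $ 2 *\<^sub>C axis 2 1)" by simp
 then show ?thesis unfolding fd_add[OF assms] fd_clin[OF assms] by (simp only: cscale_eq_smult)
qed

lemma (in frame) continuous_on_chi: "continuous_on {v. pairing kl v ~= 0} chi"
proof -
 have c: "continuous_on A (pairing k)" for A and k :: "complex ^ 5"
  by (rule linear_continuous_on[OF bounded_linear_pairing])
 show ?thesis
  unfolding chi_def[abs_def] co_def cscale_Pair cscale_complex by (intro continuous_intros c) auto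
qed

lemma eventually_openE:
 assumes "near x P"
 obtains U where "open U" "x : U" "!!y. y : U ==> P y"
 using assms unfolding eventually_nhds by blast

context good_point
begin

text \<open>The map \<open>ka\<close>, which brings the local equation to normal form, is inverted
  and followed by the graph \<open>gm\<close>. Most of the proof shows that this is a homeomorphism
  onto an open subset of \<open>S\<close>.\<close>

lemma parametrization:
 assumes ka: "hol_at ka (0, 0)" "ka (0, 0) = (0, 0)" "bij (fd ka (0, 0))"
  and eq: "near (0, 0) (%w. sec (rep_cproj K) (w0 + w) = f (ka w))"
 shows "section_equation S K (abs_cproj (Lc (s0, t0, w0))) (%z. f (pr z))"
proof -
 obtain sg where sg: "hol_at sg (0, 0)" "sg (0, 0) = (0, 0)"
  "near (0, 0) (%w. sg (ka w) = w)" "near (0, 0) (%p. ka (sg p) = p)"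
  using hol_inverse_function[OF ka(1,3)] unfolding ka(2) by blast
 define sgp where "sgp = (%z. sg (pr z))"
 have sgp: "hol_at sgp 0" "sgp 0 = (0, 0)"
  unfolding sgp_def by (rule hol_at_compose[where g = sg and f = pr]) (auto simp: hol_at_pr zero_prod_def[symmetric] sg[folded zero_prod_def])
 define th where "th = (%z. gm (w0 + sgp z))"
 have th: "hol_at th 0" "th 0 = (s0, t0, w0)"
 proof -
  have "hol_at (%z. w0 + sgp z) 0" "w0 + sgp 0 = w0" using sgp by (auto intro: hols simp: zero_prod_def[symmetric])
  then show "hol_at th 0" "th 0 = (s0, t0, w0)"
   unfolding th_def using hol_at_compose[where g = gm and f = "%z. w0 + sgp z" and x = 0] hol_gm gm0 by simp_all
 qed
 obtain A where A: "open A" "(0, 0) : A" "!!w. w : A ==> sg (ka w) = w & hol_at ka w"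
  using eventually_openE[OF eventually_conj[OF sg(3) hol_at_eventually[OF ka(1)]]] by blast
 obtain B0 where B0: "open B0" "(s0, t0, w0) : B0"
  "!!x. x : B0 ==> F x = 0 & G x = 0 \<longleftrightarrow> (fst x, fst (snd x)) = y (snd (snd x))"
  using eventually_openE[OF ynear] by blast
 \<comment> \<open>On \<open>B\<close> the equations \<open>F = G = 0\<close> describe exactly the
   graph, and the last two coordinates stay where \<open>sg\<close> inverts
   \<open>ka\<close>.\<close>
 define B where "B = B0 Int (%x. snd (snd x) - w0) -` A"
 have oB: "open B" unfolding B_def by (intro open_Int B0 open_vimage A continuous_intros)
 have B: "(s0, t0, w0) : B" using B0 A by (simp add: B_def zero_prod_def)
 have pr0: "pr 0 = (0, 0)" by (simp add: zero_prod_def)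
 have w00: "w0 + sgp 0 = w0" using sgp(2) by (simp add: zero_prod_def[symmetric])
 have "near 0 (%z. (ka (sgp z) = pr z & sec (rep_cproj K) (w0 + sgp z) = f (ka (sgp z))) & (good (th z) & th z : B) &
   cdiff sgp z & cdiff th z)"
 proof (intro eventually_conj)
  show "near 0 (%z. ka (sgp z) = pr z)"
   unfolding sgp_def by (rule eventually_hol[OF hol_at_pr pr0 sg(4)])
  show "near 0 (%z. sec (rep_cproj K) (w0 + sgp z) = f (ka (sgp z)))"
   by (rule eventually_hol[OF sgp eq])
  have "hol_at (%z. w0 + sgp z) 0" by (intro hols sgp)
  from eventually_hol[OF this w00 ygood] show "near 0 (%z. good (th z))" by (simp add: th_def gm_def)
  show "near 0 (%z. th z : B)"
   by (rule eventually_hol[OF th]) (use oB B in "auto intro: eventually_nhds_in_open")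
 qed (use sgp(1) th(1) in "simp_all add: hol_at_def")
 then obtain W where W: "open W" "0 : W"
  "!!z. z : W ==> ka (sgp z) = pr z & sec (rep_cproj K) (w0 + sgp z) = f (ka (sgp z))"
  "!!z. z : W ==> good (th z) & th z : B" "!!z. z : W ==> cdiff sgp z" "!!z. z : W ==> cdiff th z"
  by (rule eventually_openE) blast
 have ss: "snd (snd (th z)) = w0 + sgp z" for z by (simp add: th_def gm_def)
 have sgA: "sgp z : A" if "z : W" for z using W(4)[OF that] by (simp add: B_def ss)
 define ph where "ph = (%z. Lc (th z))"
 have cph: "cdiff ph z" "fd ph z v = tang (fd th z v)" if "z : W" for z v
  using cdiff_compose[where g = Lc and f = th, OF cdiff_Lc W(6)[OF that]] by (simp_all add: ph_def fd_Lc)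
 have inj: "v = 0" if z: "z : W" and "fd th z v = 0" for z v
 proof -
  have "fd (%z. snd (snd (th z))) z v = snd (snd (fd th z v))"
   by (simp add: fd_snd cdiff_snd W(6)[OF z])
  moreover have "fd (%z. w0 + sgp z) z v = fd sgp z v"
   using cdiff_add(2)[OF cdiff_const W(5)[OF z]] by (simp add: fd_const)
  ultimately have f0: "fd sgp z v = 0" using that(2) by (simp add: ss)
  have ck: "cdiff ka (sgp z)" using A(3)[OF sgA[OF z]] hol_at_cdiff by blast
  have "fd (%z. ka (sgp z)) z = fd pr z"
  proof (rule cdiff_transform(2)[symmetric])
   show "cdiff (%z. ka (sgp z)) z" by (rule cdiff_compose(1)[where g = ka and f = sgp, OF ck W(5)[OF z]])
   show "near z (%z. ka (sgp z) = pr z)"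
    using eventually_nhds_in_open[OF W(1) z] by (rule eventually_mono) (use W(3) in auto)
  qed
  then have "pr v = fd ka (sgp z) (fd sgp z v)"
   using cdiff_compose(2)[where g = ka and f = sgp, OF ck W(5)[OF z]] by (simp add: fd_pr)
  then have "pr v = pr 0" using f0 linear_0[OF fd_linear[OF ck]] by (simp add: zero_prod_def)
  then show ?thesis by (simp only: pr_inject)
 qed
 have dim: "vec.dim (insert (ph z) (range (fd ph z))) = 3" if z: "z : W" for z
 proof (rule independent_pair_shift)
  show "fd ph z v = v $ 1 *s fd ph z (axis 1 1) + v $ 2 *s fd ph z (axis 2 1)" for v
   by (rule fd_expand2[OF cph(1)[OF z]])
 next
  fix a v assume e: "a *s ph z + fd ph z v = 0"
  have "pairing kl (a *s ph z + fd ph z v) = a" unfolding cph(2)[OF z] by (simp add: ph_def pairing_linear)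
  then have a: "a = 0" unfolding e by (simp add: pairing_linear)
  then have "co (tang (fd th z v)) = co 0" using e cph(2)[OF z] by simp
  then have "fd th z v = 0" by (simp add: co_def pairing_linear zero_prod_def)
  then show "a = 0 & v = 0" using a inj[OF z] by blast
 qed
 \<comment> \<open>Left inverse of \<open>th\<close>: it applies \<open>ka\<close> to the last two
   coordinates. As it is continuous on an open set of the chart and not only on the surface, so is
   the inverse of the parametrization.\<close>
 define eta where "eta = (%x::chart. vector [fst (ka (snd (snd x) - w0)), snd (ka (snd (snd x) - w0))] :: complex ^ 2)"
 have etath: "eta (th z) = z" if "z : W" for z using W(3)[OF that] by (simp add: eta_def ss)
 have ceta: "continuous_on B eta"
 proof -
  have k: "continuous_on A ka" using A(3) hol_at_isCont continuous_at_imp_continuous_on by blast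
  have "continuous_on B (%x. ka (snd (snd x) - w0))"
   by (rule continuous_on_compose2[OF k]) (auto simp: B_def intro!: continuous_intros)
  then show ?thesis unfolding eta_def by (rule continuous_on_compose2[OF continuous_vector2[of UNIV]]) auto
 qed
 define B' where "B' = B Int eta -` W"
 have oB': "open B'" unfolding B'_def by (rule continuous_open_preimage[OF ceta oB W(1)])
 define Om where "Om = {v. pairing kl v ~= 0} Int chi -` B'"
 have o: "open {v. pairing kl v ~= 0}"
  by (rule open_Collect_neq) (auto intro: linear_continuous_on[OF bounded_linear_pairing])
 have oOm: "open Om" unfolding Om_def by (rule continuous_open_preimage[OF continuous_on_chi o oB'])
 have zOm: "0 ~: Om" by (simp add: Om_def pairing_linear)
 define M where "M = abs_cproj ` Om"
 have oM: "open M" unfolding M_def by (rule open_abs_cproj_image[OF oOm zOm])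
 have MOm: "{v. v ~= 0 & abs_cproj v : M} = Om"
 proof (intro set_eqI iffI)
  fix v assume "v : {v. v ~= 0 & abs_cproj v : M}"
  then obtain u where u: "u : Om" "abs_cproj u = abs_cproj v" "v ~= 0" by (auto simp: M_def)
  then have "u ~= 0" using zOm by auto
  then obtain c where "c ~= 0" "v = c *s u" using u abs_cproj_eq_iff by blast
  then show "v : Om" using u(1) by (auto simp: Om_def pairing_linear chi_smult)
 qed (use zOm in "auto simp: M_def")
 define h where "h = (%q. eta (chi (rep_cproj q)))"
 have h: "h (abs_cproj v) = eta (chi v)" if v: "v ~= 0" for v
 proof -
  obtain c where "c ~= 0" "rep_cproj (abs_cproj v) = c *s v" using rep_abs_cproj[OF v] .
  then show ?thesis by (simp add: h_def chi_smult)
 qed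
 have ch: "continuous_on M h"
 proof (rule continuous_on_cproj[OF oM], unfold MOm)
  have "continuous_on Om (%v. eta (chi v))"
   by (rule continuous_on_compose2[OF ceta continuous_on_subset[OF continuous_on_chi]]) (auto simp: Om_def B'_def)
  moreover have "h (abs_cproj v) = eta (chi v)" if "v : Om" for v
   by (rule h) (use that zOm in auto)
  ultimately show "continuous_on Om (%v. h (abs_cproj v))" by simp
 qed
 have hph: "h (abs_cproj (ph z)) = z" if "z : W" for z
  using that by (simp add: ph_def h etath)
 have img: "(%z. abs_cproj (ph z)) ` W = S Int M"
 proof (intro equalityI subsetI)
  fix q assume "q : (%z. abs_cproj (ph z)) ` W"
  then obtain z where z: "z : W" "q = abs_cproj (Lc (th z))" by (auto simp: ph_def)
  then have "Lc (th z) : Om" using W(4)[OF z(1)] by (simp add: Om_def B'_def etath)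
  then show "q : S Int M" using z W(4)[OF z(1)] good_in by (auto simp: M_def)
 next
  fix q assume q: "q : S Int M"
  then obtain v where v: "v : Om" "q = abs_cproj v" by (auto simp: M_def)
  define x where "x = chi v"
  have x: "x : B" "eta x : W" "pairing kl v ~= 0" using v by (auto simp: Om_def B'_def x_def)
  have qx: "q = abs_cproj (Lc x)" using Lc_chi[OF x(3)] abs_cproj_scale[OF Lc_nonzero x(3)] unfolding v x_def by metis
  have "(fst x, fst (snd x)) = y (snd (snd x))" using B0(3)[of x] x(1) FG_vanish[of x] q qx by (simp add: B_def)
  then have xgm: "x = gm (snd (snd x))" by (metis gm_def fst_conv prod.collapse snd_conv)
  define w where "w = snd (snd x) - w0"
  have "w : A" using x(1) by (simp add: B_def w_def)
  moreover have "pr (eta x) = ka w" by (simp add: eta_def w_def)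
  ultimately have "sgp (eta x) = w" using A(3) by (simp add: sgp_def)
  then have "th (eta x) = x" using xgm by (simp add: th_def w_def)
  then show "q : (%z. abs_cproj (ph z)) ` W" using x(2) qx by (auto simp: ph_def intro!: image_eqI[of _ _ "eta x"])
 qed
 have "local_parametrization S (abs_cproj (Lc (s0, t0, w0))) W ph"
  unfolding local_parametrization_def
 proof (intro conjI)
  show "0 : W" by (rule W)
  show "cholomorphic_on ph W" by (rule cdiff_cholomorphic[OF W(1) cph(1)])
  show "ALL w:W. ph w ~= 0" by (simp add: ph_def)
  show "abs_cproj (ph 0) = abs_cproj (Lc (s0, t0, w0))" by (simp add: ph_def th)
  show "ALL w:W. EX D. (ph has_derivative D) (at w) & vec.dim (insert (ph w) (range D)) = 3"
   using cdiff_has_derivative[OF cph(1)] dim by blast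
  show "openin (top_of_set S) ((%w. abs_cproj (ph w)) ` W)" unfolding img using oM by blast
  have "continuous_on W ph" using cph(1) cdiff_continuous continuous_at_imp_continuous_on by blast
  then have "continuous_on W (%w. abs_cproj (ph w))"
   using continuous_on_compose2[OF continuous_on_abs_cproj[of "- {0}"], of W ph]
   by (metis (no_types, lifting) ComplD ComplI Lc_nonzero ph_def image_subset_iff singletonD singletonI)
  then show "EX g. homeomorphism W ((%w. abs_cproj (ph w)) ` W) (%w. abs_cproj (ph w)) g"
   using continuous_on_subset[OF ch, of "S Int M"] img[symmetric] hph
   by (intro exI[of _ h]) (auto simp: homeomorphism_def image_image)
 qed
 moreover have "ALL w:W. pairing (rep_cproj K) (ph w) = f (pr w)"
  using W(3) by (auto simp: ph_def th_def sec_def)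
 ultimately show ?thesis unfolding section_equation_def by blast
qed

lemma section_normal_forms:
 assumes c: "crit (s0, t0, w0) (rep_cproj K)" and n: "N2 (0, 1) (0, 1) ((s0, t0, w0), rep_cproj K) ~= 0"
 shows "NH ((s0, t0, w0), rep_cproj K) ~= 0 ==> node_at S K (abs_cproj (Lc (s0, t0, w0)))"
  "NH ((s0, t0, w0), rep_cproj K) = 0 ==> NC ((s0, t0, w0), rep_cproj K) ~= 0 ==> cusp_at S K (abs_cproj (Lc (s0, t0, w0)))"
proof -
 define g where "g = (%w. sec (rep_cproj K) (w0 + w))"
 have z: "w0 + (0, 0) = w0" by (simp add: zero_prod_def[symmetric])
 have T: "cdiff (%w. w0 + w) p" "fd (%w. w0 + w) p v = v" for p v
  using cdiff_add[OF cdiff_const cdiff_ident] fd_eq[OF has_derivative_ident] by (auto simp: fd_const)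
 have hg: "hol_at g (0, 0)"
  unfolding g_def by (rule hol_at_compose[where g = "sec (rep_cproj K)" and f = "%w. w0 + w"])
   (auto simp: z hol_sec intro!: hols)
 have Jn: "J (s0, t0, w0) ~= 0" using good0 by (simp add: good_def)
 note pull = fd_pull[where T = "%w. w0 + w" and g = "sec (rep_cproj K)" and L = "%v. v" and p = "(0, 0)", OF T,
  unfolded z, OF hol_sec, folded g_def]
 have g0: "g (0, 0) = 0" using c by (simp add: g_def z sec_def gm0 crit_def)
 have g1: "fd g (0, 0) (1, 0) = 0" "fd g (0, 0) (0, 1) = 0"
  using pull(1) near_imp[OF fd_sec] c by (auto simp: gm0 crit_def)
 have g2: "fd (%p. fd g p (0, 1)) (0, 0) (0, 1) ~= 0"
  using pull(2) near_imp[OF fd2_sec] n Jn by (auto simp: gm0)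
 have gh: "hess g (1, 0) (0, 1) (0, 0) = NH ((s0, t0, w0), rep_cproj K) / J (s0, t0, w0) ^ 6"
  using pull(3) near_imp[OF hess_sec] by (simp add: gm0)
 have gc: "cub g (1, 0) (0, 1) (0, 0) = NC ((s0, t0, w0), rep_cproj K) / J (s0, t0, w0) ^ 11"
  using pull(4) cub_sec by (simp add: gm0)
 show "node_at S K (abs_cproj (Lc (s0, t0, w0)))" if "NH ((s0, t0, w0), rep_cproj K) ~= 0"
 proof -
  have "hess g (1, 0) (0, 1) (0, 0) ~= 0" using that Jn by (simp add: gh)
  then obtain ka where "hol_at ka (0, 0)" "ka (0, 0) = (0, 0)" "bij (fd ka (0, 0))"
   "near (0, 0) (%w. g w = fst (ka w) * snd (ka w))"
   by (rule node_normal_form[OF hg g0 g1 g2]) blast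
  from parametrization[where f = "%p. fst p * snd p", OF this[unfolded g_def]]
  show ?thesis by (simp add: node_at_def pr_def)
 qed
 show "cusp_at S K (abs_cproj (Lc (s0, t0, w0)))"
  if "NH ((s0, t0, w0), rep_cproj K) = 0" "NC ((s0, t0, w0), rep_cproj K) ~= 0"
 proof -
  have "hess g (1, 0) (0, 1) (0, 0) = 0" "cub g (1, 0) (0, 1) (0, 0) ~= 0" using that Jn by (simp_all add: gh gc)
  then obtain ka where "hol_at ka (0, 0)" "ka (0, 0) = (0, 0)" "bij (fd ka (0, 0))"
   "near (0, 0) (%w. g w = snd (ka w) ^ 2 - fst (ka w) ^ 3)"
   by (rule cusp_normal_form[OF hg g0 g1 g2]) blast
  from parametrization[where f = "%p. snd p ^ 2 - fst p ^ 3", OF this[unfolded g_def]]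
  show ?thesis by (simp add: cusp_at_def pr_def)
 qed
qed

end

context surface_chart
begin

lemma crit_scale: "c ~= 0 ==> crit x (c *s k) \<longleftrightarrow> crit x k"
 by (simp add: crit_def N1_def pairing_linear)

text \<open>Recentring \<open>good_point\<close> at \<open>x\<close>. The conditions are homogeneous
  in \<open>k\<close>, so the chosen representative can be replaced by any lift.\<close>

lemma good_section:
 assumes x: "good x" and k: "k ~= 0" "crit x k" "N2 (0, 1) (0, 1) (x, k) ~= 0"
 shows "NH (x, k) ~= 0 ==> node_at S (abs_cproj k) (abs_cproj (Lc x))"
  "NH (x, k) = 0 ==> NC (x, k) ~= 0 ==> cusp_at S (abs_cproj k) (abs_cproj (Lc x))"
proof -
 obtain s0 t0 w0 where xe: "x = (s0, t0, w0)" by (cases x) auto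
 obtain y where "hol_at y w0" "y w0 = (s0, t0)"
  "near (s0, t0, w0) (%x. F x = 0 & G x = 0 \<longleftrightarrow> (fst x, fst (snd x)) = y (snd (snd x)))"
  "near w0 (%w. ALL v. fd (%w. (fst (y w), snd (y w), w)) w v =
    inverse (J (fst (y w), snd (y w), w)) *\<^sub>C V v (fst (y w), snd (y w), w))"
  "near w0 (%w. good (fst (y w), snd (y w), w))"
  by (rule implicit_chart[OF x[unfolded xe]]) blast
 then interpret p: good_point es et el e1 e2 ks kt kl k1 k2 S F G u s0 t0 w0 y
  using x by unfold_locales (auto simp: xe)
 obtain c where c: "c ~= 0" "rep_cproj (abs_cproj k) = c *s k" using rep_abs_cproj[OF k(1)] .
 have h: "P (x, rep_cproj (abs_cproj k)) = 0 \<longleftrightarrow> P (x, k) = 0" if "khom e P" for P e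
  using that c unfolding khom_def by (metis mult_eq_0_iff power_not_zero)
 have cr: "crit x (rep_cproj (abs_cproj k))" using k c by (simp add: crit_scale)
 show "NH (x, k) ~= 0 ==> node_at S (abs_cproj k) (abs_cproj (Lc x))"
  "NH (x, k) = 0 ==> NC (x, k) ~= 0 ==> cusp_at S (abs_cproj k) (abs_cproj (Lc x))"
  using p.section_normal_forms[OF cr[unfolded xe]] k(3) h[OF khom_N2] h[OF khom_NH] h[OF khom_NC] unfolding xe by blast+
qed

end

section \<open>Nodes are not cusps\<close>

text \<open>Both images are open in \<open>S\<close>, and parametrizations are homeomorphisms onto
  them; a continuous transition is what the topological comparison of node and cusp works
  with.\<close>

lemma parametrization_transition:
 assumes "local_parametrization S p W ph" "local_parametrization S p W' ph'"
 obtains O' ta where "open O'" "0 : O'" "O' <= W" "continuous_on O' ta" "ta 0 = 0"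
  "!!w. w : O' ==> ta w : W' & abs_cproj (ph' (ta w)) = abs_cproj (ph w)"
proof -
 let ?f = "%w. abs_cproj (ph w)" and ?f' = "%w. abs_cproj (ph' w)"
 obtain g where g: "homeomorphism W (?f ` W) ?f g" using assms(1) by (auto simp: local_parametrization_def)
 obtain g' where g': "homeomorphism W' (?f' ` W') ?f' g'" using assms(2) by (auto simp: local_parametrization_def)
 have a: "open W" "0 : W" "0 : W'" "?f 0 = p" "?f' 0 = p" "openin (top_of_set S) (?f ` W)"
  using assms by (auto simp: local_parametrization_def cholomorphic_on_def)
 obtain T where T: "open T" "?f' ` W' = S Int T"
  using assms(2) unfolding local_parametrization_def openin_open by blast
 define O' where "O' = W Int ?f -` T"
 have f: "?f w : ?f' ` W'" if "w : O'" for w using that openin_imp_subset[OF a(6)] unfolding T(2) O'_def by blast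
 show ?thesis
 proof (rule that)
  show "open O'" unfolding O'_def by (rule continuous_open_preimage[OF homeomorphism_cont1[OF g] a(1) T(1)])
  have "p : ?f' ` W'" using a by force
  then show "0 : O'" using a T by (auto simp: O'_def)
  show "O' <= W" by (auto simp: O'_def)
  show "continuous_on O' (%w. g' (?f w))"
   by (rule continuous_on_compose2[OF homeomorphism_cont2[OF g'] continuous_on_subset[OF homeomorphism_cont1[OF g]]])
    (use f in "auto simp: O'_def")
  show "g' (?f 0) = 0" using homeomorphism_apply1[OF g' a(3)] a by simp
  show "g' (?f w) : W' & ?f' (g' (?f w)) = ?f w" if "w : O'" for w
   using f[OF that] homeomorphism_image2[OF g'] homeomorphism_apply2[OF g'] by blast
 qed
qed

lemma pairing_same_point:
 assumes "abs_cproj v = abs_cproj w" "v ~= 0" "w ~= 0"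
 shows "pairing k v = 0 \<longleftrightarrow> pairing k w = 0"
 using abs_cproj_eq_iff[OF assms(2,3)] assms(1) by (auto simp: pairing_linear)

text \<open>The cusp minus its singular point is connected, whereas the node minus its singular point is not.\<close>
lemma node_not_cusp:
 assumes "node_at S K p" "cusp_at S K p"
 shows False
proof -
 obtain W1 ph1 where 1: "local_parametrization S p W1 ph1" "!!w. w : W1 ==> pairing (rep_cproj K) (ph1 w) = w $ 1 * w $ 2"
  using assms(1) by (auto simp: node_at_def section_equation_def)
 obtain W2 ph2 where 2: "local_parametrization S p W2 ph2" "!!w. w : W2 ==> pairing (rep_cproj K) (ph2 w) = (w $ 2)\<^sup>2 - (w $ 1) ^ 3"
  using assms(2) by (auto simp: cusp_at_def section_equation_def)
 have nz: "ph1 w ~= 0" if "w : W1" for w using 1(1) that by (auto simp: local_parametrization_def)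
 have nz2: "ph2 w ~= 0" if "w : W2" for w using 2(1) that by (auto simp: local_parametrization_def)
 have inj: "inj_on (%w. abs_cproj (ph1 w)) W1" "inj_on (%w. abs_cproj (ph2 w)) W2" "0 : W1" "0 : W2"
  using 1(1) 2(1) unfolding local_parametrization_def by (auto simp: inj_on_def) (metis homeomorphism_apply1)+
 obtain O1 om where O1: "open O1" "0 : O1" "O1 <= W1" "continuous_on O1 om" "om 0 = 0"
  "!!w. w : O1 ==> om w : W2 & abs_cproj (ph2 (om w)) = abs_cproj (ph1 w)"
  by (rule parametrization_transition[OF 1(1) 2(1)]) blast
 obtain O2 ta where O2: "open O2" "0 : O2" "O2 <= W2" "continuous_on O2 ta" "ta 0 = 0"
  "!!w. w : O2 ==> ta w : W1 & abs_cproj (ph1 (ta w)) = abs_cproj (ph2 w)"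
  by (rule parametrization_transition[OF 2(1) 1(1)]) blast
 \<comment> \<open>The punctured cusp is the image of a punctured disc under
   \<open>t \<mapsto> (t^2, t^3)\<close> and hence connected.\<close>
 define c where "c = (%t::complex. vector [fst (t\<^sup>2, t ^ 3), snd (t\<^sup>2, t ^ 3)] :: complex ^ 2)"
 have cc: "continuous_on UNIV c"
  unfolding c_def by (rule continuous_on_compose2[OF continuous_vector2[of UNIV]]) (auto intro!: continuous_intros)
 have "open (c -` O2)" "0 : c -` O2"
  using open_vimage[OF O2(1) cc] O2(2) by (auto simp: c_def vec_eq_iff forall_2 elim!: back_subst[of "%x. x : O2"])
 then obtain e where e: "e > 0" "ball 0 e <= c -` O2" unfolding open_contains_ball by blast
 define D where "D = ball 0 e - {0::complex}"
 have cO: "c t : O2" if "t : ball 0 e" for t using e that by auto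
 have conn: "connected ((%t. ta (c t)) ` D)"
 proof (rule connected_continuous_image)
  show "connected D" unfolding D_def by (rule connected_punctured_ball) simp
  show "continuous_on D (%t. ta (c t))"
   by (rule continuous_on_compose2[OF O2(4) continuous_on_subset[OF cc]]) (auto simp: D_def cO)
 qed
 have cover: "ta (c t) $ 1 * ta (c t) $ 2 = 0 & ta (c t) ~= 0" if "t : D" for t
 proof -
  have t: "c t : O2" "c t : W2" "t ~= 0" using that cO O2(3) by (auto simp: D_def)
  have "pairing (rep_cproj K) (ph2 (c t)) = 0" using 2(2)[OF t(2)] by (simp add: c_def)
  then have "pairing (rep_cproj K) (ph1 (ta (c t))) = 0"
   using pairing_same_point O2(6)[OF t(1)] nz nz2 t(2) by metis
  moreover have "ta (c t) ~= 0"
  proof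
   assume "ta (c t) = 0"
   then have "abs_cproj (ph2 (c t)) = abs_cproj (ph2 0)" using O2(5,6) t(1) O2(2) by metis
   then have "c t = 0" using inj(2,4) t(2) by (auto simp: inj_on_def)
   then show False using t(3) by (auto simp: c_def vec_eq_iff forall_2)
  qed
  ultimately show ?thesis using 1(2) O2(6)[OF t(1)] by simp
 qed
 \<comment> \<open>Both branches of the node are reached: a small multiple of \<open>b\<close> is
   carried to a point \<open>w\<close> of the cusp, whose parameter is
   \<open>w $ 2 / w $ 1\<close>.\<close>
 have reach: "EX t:D. EX a. a ~= 0 & ta (c t) = a *s b" if b: "b ~= 0" "!!a. (a *s b) $ 1 * (a *s b) $ 2 = 0" for b
 proof -
  have com: "isCont om 0" using O1(1,2,4) by (simp add: continuous_on_eq_continuous_at)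
  have cb: "isCont (%a. a *s b) (0::complex)"
   unfolding cscale_eq_smult[symmetric]
   by (intro bounded_linear.isCont[OF bounded_bilinear.bounded_linear_left[OF bounded_bilinear_cscale]] continuous_ident)
  have comb: "isCont (%a. om (a *s b)) (0::complex)"
   by (rule isCont_o2[OF cb]) (use com in simp)
  have ev: "near 0 (%y. P (f y))" if "isCont f 0" "near (f 0) P"
   for f :: "complex => complex ^ 2" and P
  proof -
   have "filterlim f (nhds (f 0)) (nhds 0)" using that(1) by (simp only: continuous_at tendsto_at_iff_tendsto_nhds)
   then show ?thesis using that(2) by (simp add: filterlim_iff)
  qed
  have e1: "near (om (0 *s b)) (%w. w : ball 0 (e\<^sup>2) Int O2)"
   using O2(1,2) e(1) O1(5) by (intro eventually_nhds_in_open) auto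
  have e2: "near 0 (%a. a *s b : O1)"
   by (rule ev[OF cb]) (use O1(1,2) in "auto intro: eventually_nhds_in_open")
  have "near 0 (%a. om (a *s b) : ball 0 (e\<^sup>2) Int O2 & a *s b : O1)"
   using eventually_conj[OF ev[OF comb e1] e2] by simp
  then have "eventually (%a. om (a *s b) : ball 0 (e\<^sup>2) Int O2 & a *s b : O1) (at 0)"
   by (simp add: eventually_at_filter eventually_mono)
  then obtain a where a: "a ~= 0" "om (a *s b) : ball 0 (e\<^sup>2)" "om (a *s b) : O2" "a *s b : O1"
   using eventually_happens[of "%a. a ~= 0 & om (a *s b) : ball 0 (e\<^sup>2) Int O2 & a *s b : O1" "at (0::complex)"]
   by (auto simp: eventually_conj_iff eventually_neq_at_within)
  define w z where "w = om (a *s b)" and "z = a *s b"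
  have zW: "z : W1" "z ~= 0" using a O1(3) b(1) by (auto simp: z_def vector_mul_eq_0)
  have wW: "w : W2" "abs_cproj (ph2 w) = abs_cproj (ph1 z)" using O1(6)[OF a(4)] by (auto simp: w_def z_def)
  have "pairing (rep_cproj K) (ph1 z) = 0" using 1(2)[OF zW(1)] b(2) by (simp add: z_def)
  then have "pairing (rep_cproj K) (ph2 w) = 0" using pairing_same_point wW nz[OF zW(1)] nz2[OF wW(1)] by metis
  then have cusp: "(w $ 2)\<^sup>2 = (w $ 1) ^ 3" using 2(2)[OF wW(1)] by simp
  have "w ~= 0"
  proof
   assume "w = 0"
   then have "abs_cproj (ph1 z) = abs_cproj (ph1 0)" using wW(2) O1(2,5,6) by metis
   then show False using inj(1,3) zW by (auto simp: inj_on_def)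
  qed
  then have w1: "w $ 1 ~= 0" using cusp by (auto simp: vec_eq_iff forall_2)
  define t where "t = w $ 2 / w $ 1"
  have t2: "t\<^sup>2 = w $ 1" using cusp w1 by (simp add: t_def field_simps power2_eq_square power3_eq_cube)
  have t3: "t ^ 3 = w $ 2"
  proof -
   have "t ^ 3 = t\<^sup>2 * t" by (simp add: power2_eq_square power3_eq_cube)
   then show ?thesis unfolding t2 using w1 by (simp add: t_def)
  qed
  have ct: "c t = w" using t2 t3 by (simp add: c_def vec_eq_iff forall_2)
  have "t ~= 0" using t2 w1 by auto
  moreover have "norm t < e"
  proof -
   have "(norm t)\<^sup>2 = norm (w $ 1)" using t2 by (metis norm_power)
   also have "\<dots> <= norm w" by (rule Finite_Cartesian_Product.norm_nth_le)
   also have "\<dots> < e\<^sup>2" using a(2) by (simp add: w_def)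
   finally show ?thesis using e(1) by (simp add: power_less_imp_less_base)
  qed
  ultimately have "t : D" by (simp add: D_def)
  moreover have "ta (c t) = a *s b"
  proof -
   have "w : O2" using a(3) by (simp add: w_def)
   then have "ta w : W1" "abs_cproj (ph1 (ta w)) = abs_cproj (ph1 z)" using O2(6) wW(2) by auto
   then have "ta w = z" using inj(1) zW(1) by (auto simp: inj_on_def)
   then show ?thesis by (simp add: ct z_def)
  qed
  ultimately show ?thesis using a(1) by blast
 qed
 \<comment> \<open>A connected subset of the two axes without the origin cannot meet both of
   them.\<close>
 let ?U = "%i. {z :: complex ^ 2. z $ i ~= 0}"
 have oU: "open (?U i)" for i :: 2
  by (rule open_Collect_neq) (auto intro!: continuous_intros)
 have r: "EX t:D. EX a. a ~= 0 & ta (c t) = a *s axis i 1" for i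
  by (rule reach) (auto simp: axis_eq_0_iff, auto simp: axis_def split: if_splits)
 obtain t a where t: "t : D" "a ~= 0" "ta (c t) = a *s axis 1 1" using r by blast
 obtain t' a' where t': "t' : D" "a' ~= 0" "ta (c t') = a' *s axis 2 1" using r by blast
 have "ta (c t) $ 1 ~= 0" "ta (c t') $ 2 ~= 0" using t t' by (simp_all add: axis_def)
 then have "ta (c t) : ?U 1 Int (%t. ta (c t)) ` D" "ta (c t') : ?U 2 Int (%t. ta (c t)) ` D"
  using t(1) t'(1) by blast+
 moreover have "?U 1 Int ?U 2 Int (%t. ta (c t)) ` D = {}" using cover by auto
 moreover have "(%t. ta (c t)) ` D <= ?U 1 Un ?U 2" using cover by (auto simp: vec_eq_iff forall_2)
 ultimately show False using connectedD[OF conn oU[of 1] oU[of 2]] by blast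
qed

section \<open>A frame adapted to a cusp\<close>

lemma linear_functional:
 fixes f :: "complex ^ 'n::finite => complex"
 assumes "!!v w. f (v + w) = f v + f w" "!!c v. f (c *s v) = c * f v"
 obtains k where "!!v. f v = pairing k v"
proof -
 have s: "f (sum g A) = (\<Sum>i\<in>A. f (g i))" for g :: "'n => complex ^ 'n" and A
  using assms(2)[of 0 0] by (induction A rule: infinite_finite_induct) (simp_all add: assms(1))
 have "f v = pairing (\<chi> i. f (axis i 1)) v" for v
 proof -
  have "f v = f (\<Sum>i\<in>UNIV. v $ i *s axis i 1)" by (simp add: basis_expansion)
  then show ?thesis by (simp add: s assms(2) pairing_def mult.commute)
 qed
 then show ?thesis using that by blast
qed

lemma pairing_axis: "pairing k (axis i 1) = k $ i"
 by (simp add: pairing_def axis_def if_distrib[of "%x. _ * x"] cong: if_cong)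

lemma pairing_eqI: "(!!v. pairing k v = pairing l v) ==> k = l"
 by (metis pairing_axis vec_eq_iff)

lemma dual_basis:
 fixes es et el e1 e2 :: "complex ^ 5"
 assumes ex: "!!w. EX a b c d e. w = a *s es + b *s et + c *s el + d *s e1 + e *s e2"
  and uniq: "!!a b c d e. a *s es + b *s et + c *s el + d *s e1 + e *s e2 = 0 ==> a = 0 & b = 0 & c = 0 & d = 0 & e = 0"
 obtains ks kt kl k1 k2 where "frame es et el e1 e2 ks kt kl k1 k2"
proof -
 define cb where "cb = (%p::complex * complex * complex * complex * complex.
  fst p *s es + fst (snd p) *s et + fst (snd (snd p)) *s el + fst (snd (snd (snd p))) *s e1 + snd (snd (snd (snd p))) *s e2)"
 have "EX p. w = cb p" for w
 proof -
  obtain a b c d e where "w = a *s es + b *s et + c *s el + d *s e1 + e *s e2" using ex[of w] by blast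
  then show ?thesis by (intro exI[of _ "(a, b, c, d, e)"]) (simp add: cb_def)
 qed
 then have "ALL w. EX p. w = cb p" by blast
 from choice[OF this] obtain q where q: "!!w. w = cb (q w)" by blast
 have diff: "cb (p - p') = cb p - cb p'" "cb (p + p') = cb p + cb p'" "cb (c *\<^sub>C p) = c *s cb p" for p p' c
  by (simp_all add: cb_def vec_eq_iff algebra_simps)
 have z: "p = 0" if "cb p = 0" for p
  using uniq[of "fst p" "fst (snd p)" "fst (snd (snd p))" "fst (snd (snd (snd p)))" "snd (snd (snd (snd p)))"] that
  by (simp add: cb_def prod_eq_iff)
 have inj: "p = p'" if "cb p = cb p'" for p p' using z[of "p - p'"] that by (simp add: diff)
 have qa: "q (v + w) = q v + q w" for v w by (rule inj) (simp add: diff q[symmetric])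
 have qs: "q (c *s v) = c *\<^sub>C q v" for c v by (rule inj) (simp add: diff q[symmetric])
 obtain ks where ks: "!!v. fst (q v) = pairing ks v"
  by (rule linear_functional[of "%v. fst (q v)"]) (auto simp: qa qs)
 obtain kt where kt: "!!v. fst (snd (q v)) = pairing kt v"
  by (rule linear_functional[of "%v. fst (snd (q v))"]) (auto simp: qa qs)
 obtain kl where kl: "!!v. fst (snd (snd (q v))) = pairing kl v"
  by (rule linear_functional[of "%v. fst (snd (snd (q v)))"]) (auto simp: qa qs)
 obtain k1 where k1: "!!v. fst (snd (snd (snd (q v)))) = pairing k1 v"
  by (rule linear_functional[of "%v. fst (snd (snd (snd (q v))))"]) (auto simp: qa qs)
 obtain k2 where k2: "!!v. snd (snd (snd (snd (q v)))) = pairing k2 v"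
  by (rule linear_functional[of "%v. snd (snd (snd (snd (q v))))"]) (auto simp: qa qs)
 have b: "q es = (1, 0, 0, 0, 0)" "q et = (0, 1, 0, 0, 0)" "q el = (0, 0, 1, 0, 0)" "q e1 = (0, 0, 0, 1, 0)" "q e2 = (0, 0, 0, 0, 1)"
  by (rule inj, simp add: q[symmetric], simp add: cb_def)+
 have expand: "v = pairing ks v *s es + pairing kt v *s et + pairing kl v *s el + pairing k1 v *s e1 + pairing k2 v *s e2" for v
  using q[of v] by (simp add: cb_def ks kt kl k1 k2)
 have "frame es et el e1 e2 ks kt kl k1 k2"
 proof (rule frame.intro)
  show "v = pairing ks v *s es + pairing kt v *s et + pairing kl v *s el + pairing k1 v *s e1 + pairing k2 v *s e2" for v
   by (rule expand)
  show "k = pairing k es *s ks + pairing k et *s kt + pairing k el *s kl + pairing k e1 *s k1 + pairing k e2 *s k2" for k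
  proof (rule pairing_eqI)
   fix v show "pairing k v = pairing (pairing k es *s ks + pairing k et *s kt + pairing k el *s kl + pairing k e1 *s k1 + pairing k e2 *s k2) v"
    by (subst expand[of v]) (simp add: pairing_linear mult.commute)
  qed
 qed (simp_all add: ks[symmetric] kt[symmetric] kl[symmetric] k1[symmetric] k2[symmetric] b)
 then show ?thesis using that by blast
qed

lemma dim3_coeff:
 fixes x y z :: "complex ^ 'n::finite"
 assumes "vec.dim (vec.span {x, y, z}) = 3" "a *s x + b *s y + c *s z = 0"
 shows "a = 0"
proof (rule ccontr)
 assume a: "a ~= 0"
 have "a *s x = - (b *s y + c *s z)" using assms(2) by (simp only: eq_neg_iff_add_eq_0 add.assoc)
 then have "a *s x = (- b) *s y + (- c) *s z" by (simp add: vec_eq_iff)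
 then have "inverse a *s (a *s x) = inverse a *s ((- b) *s y + (- c) *s z)" by simp
 moreover have "inverse a *s ((- b) *s y + (- c) *s z) : vec.span {y, z}"
  by (intro vec.span_scale vec.span_add vec.span_base) auto
 ultimately have "x : vec.span {y, z}" using a by simp
 then have "vec.span {x, y, z} = vec.span {y, z}" by (simp add: vec.span_redundant)
 then have "vec.dim (vec.span {x, y, z}) <= card {y, z}" by (metis finite.emptyI finite_insert order_refl vec.dim_le_card)
 also have "\<dots> <= 2" by (simp add: card_insert_if)
 finally show False using assms(1) by simp
qed

lemma cholomorphic_cdiff: "cholomorphic_on ph W ==> w : W ==> cdiff ph w"
 unfolding cholomorphic_on_def cdiff_def clin_def by (auto simp: cscale_eq_smult)

text \<open>The span of \<open>ph 0\<close> and its two partial derivatives is contained in the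
  tangent space and has the same dimension 3.\<close>

lemma parametrization_tangent:
 fixes S :: "5 cproj set"
 assumes par: "local_parametrization S p W ph" and p: "p : smooth_locus S"
 shows "w : cone_tangent S p ==> EX a b c. w = a *s ph 0 + b *s fd ph 0 (axis 1 1) + c *s fd ph 0 (axis 2 1)"
  "ph 0 : cone_tangent S p" "fd ph 0 v : cone_tangent S p"
  "a *s ph 0 + b *s fd ph 0 (axis 1 1) + c *s fd ph 0 (axis 2 1) = 0 ==> a = 0 & b = 0 & c = 0"
proof -
 have W: "0 : W" "open W" "cholomorphic_on ph W" "!!w. w : W ==> ph w ~= 0" "abs_cproj (ph 0) = p"
  "openin (top_of_set S) ((%w. abs_cproj (ph w)) ` W)"
  using par by (auto simp: local_parametrization_def cholomorphic_on_def)
 have cd: "cdiff ph w" if "w : W" for w by (rule cholomorphic_cdiff[OF W(3) that])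
 obtain D where D: "(ph has_derivative D) (at 0)" "vec.dim (insert (ph 0) (range D)) = 3"
  using par W(1) unfolding local_parametrization_def by blast
 have "D = fd ph 0" using fd_eq[OF D(1)] by auto
 then have d3: "vec.dim (insert (ph 0) (range (fd ph 0))) = 3" using D(2) by simp
 note ex = fd_expand2[OF cd[OF W(1)]]
 let ?B = "{ph 0, fd ph 0 (axis 1 1), fd ph 0 (axis 2 1)}"
 have sp: "vec.span (insert (ph 0) (range (fd ph 0))) = vec.span ?B"
 proof (rule vec.span_eq[THEN iffD2], intro conjI subsetI)
  fix y assume "y : insert (ph 0) (range (fd ph 0))"
  then consider "y = ph 0" | v where "y = fd ph 0 v" by auto
  then show "y : vec.span ?B"
  proof cases
   case 2
   show ?thesis unfolding 2 ex[of v] by (intro vec.span_add vec.span_scale vec.span_base) auto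
  qed (auto intro: vec.span_base)
 qed (auto intro: vec.span_base)
 have dB: "vec.dim (vec.span ?B) = 3" unfolding sp[symmetric] vec.dim_span by (rule d3)
 show t0: "ph 0 : cone_tangent S p"
  using euler_tangent[of "ph 0" S] W p by (simp add: smooth_locus_def)
 show t1: "fd ph 0 v : cone_tangent S p" for v
  unfolding W(5)[symmetric] cone_tangent_iff[OF W(4)[OF W(1)]]
 proof (intro allI impI)
  fix d P assume P: "iform S d P"
  have "P (ph w) = 0" if "w : W" for w
   using P W(4)[OF that] openin_imp_subset[OF W(6)] that by (auto simp: iform_def)
  then have "near 0 (%w. P (ph w) = 0)"
   using eventually_nhds_in_open[OF W(2,1)] by (auto elim: eventually_mono)
  then have "fd (%w. P (ph w)) 0 = fd (%_. 0) 0"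
   by (intro cdiff_transform(2)[symmetric] cdiff_compose(1)[where g = P and f = ph] iform_cdiff[OF P] cd W(1))
  then show "fd P (ph 0) (fd ph 0 v) = 0"
   using cdiff_compose(2)[where g = P and f = ph, OF iform_cdiff[OF P] cd[OF W(1)]] by (simp add: fd_const)
 qed
 have "vec.span ?B = cone_tangent S p"
 proof (rule vec.subspace_dim_equal)
  show "vec.span ?B <= cone_tangent S p"
   by (rule vec.span_minimal[OF _ subspace_cone_tangent]) (use t0 t1 in auto)
  show "vec.dim (cone_tangent S p) <= vec.dim (vec.span ?B)" using dB p by (simp add: smooth_locus_def)
 qed (auto intro: subspace_cone_tangent)
 then show "w : cone_tangent S p ==> EX a b c. w = a *s ph 0 + b *s fd ph 0 (axis 1 1) + c *s fd ph 0 (axis 2 1)"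
 proof -
  assume "w : cone_tangent S p"
  then have "w : vec.span ?B" using \<open>vec.span ?B = cone_tangent S p\<close> by simp
  then obtain a b where "w - a *s ph 0 - b *s fd ph 0 (axis 1 1) : vec.span {fd ph 0 (axis 2 1)}"
   unfolding vec.span_breakdown_eq by blast
  then obtain c where "w - a *s ph 0 - b *s fd ph 0 (axis 1 1) = c *s fd ph 0 (axis 2 1)"
   by (auto simp: vec.span_singleton)
  then show ?thesis by (intro exI[of _ a] exI[of _ b] exI[of _ c]) (simp add: algebra_simps)
 qed
 show "a = 0 & b = 0 & c = 0" if z: "a *s ph 0 + b *s fd ph 0 (axis 1 1) + c *s fd ph 0 (axis 2 1) = 0"
  using dim3_coeff[OF dB z] dim3_coeff[of "fd ph 0 (axis 1 1)" "ph 0" "fd ph 0 (axis 2 1)" b a c]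
   dim3_coeff[of "fd ph 0 (axis 2 1)" "ph 0" "fd ph 0 (axis 1 1)" c a b] dB z
  by (auto simp: insert_commute algebra_simps)
qed

text \<open>Since \<open>h\<close> vanishes on the tangent space, it is the differential of a
  combination \<open>F0\<close> of two forms of the ideal; \<open>G0\<close> is one of these forms,
  with differential independent of \<open>h\<close>. The two degrees may differ, so
  \<open>F0\<close> is just a polynomial vanishing on the cone.\<close>

lemma adapted_frame:
 fixes S :: "5 cproj set"
 assumes par: "local_parametrization S p W ph" and p: "p : smooth_locus S"
  and h: "h ~= 0" "!!w. w : cone_tangent S p ==> pairing h w = 0"
 obtains es et kt kl k1 k2 F0 G0 where
  "frame es et (ph 0) (fd ph 0 (axis 1 1)) (fd ph 0 (axis 2 1)) h kt kl k1 k2"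
  "F0 : polys (range coords)" "G0 : polys (range coords)"
  "!!v. v ~= 0 ==> abs_cproj v : S ==> F0 v = 0 & G0 v = 0"
  "!!w. fd F0 (ph 0) w = pairing h w" "!!w. fd G0 (ph 0) w = pairing kt w"
proof -
 note pt = parametrization_tangent[OF par p]
 have p0: "ph 0 ~= 0" "abs_cproj (ph 0) = p" using par by (auto simp: local_parametrization_def)
 obtain x y where xy: "!!w. EX a b. w - a *s x - b *s y : cone_tangent S p"
  "!!a b. a *s x + b *s y : cone_tangent S p ==> a = 0 & b = 0"
  by (rule complement_plane[OF subspace_cone_tangent]) (use p in "auto simp: smooth_locus_def")
 obtain dP P dQ Q where PQ: "iform S dP P" "iform S dQ Q"
  "fd P (ph 0) x * fd Q (ph 0) y - fd P (ph 0) y * fd Q (ph 0) x ~= 0"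
  by (rule two_forms[of "ph 0" x y S]) (use p0 xy(2) in auto)
 define Px Py Qx Qy hx hy where "Px = fd P (ph 0) x" and "Py = fd P (ph 0) y" and "Qx = fd Q (ph 0) x"
  and "Qy = fd Q (ph 0) y" and "hx = pairing h x" and "hy = pairing h y"
 define Dl where "Dl = Px * Qy - Py * Qx"
 have Dl: "Dl ~= 0" using PQ(3) by (simp add: Dl_def Px_def Py_def Qx_def Qy_def)
 \<comment> \<open>Cramer's rule for \<open>al * fd P + bex * fd Q = pairing h\<close> on the
   complement spanned by \<open>x\<close> and \<open>y\<close>.\<close>
 define al bex where "al = (hx * Qy - hy * Qx) / Dl" and "bex = (Px * hy - Py * hx) / Dl"
 have "al * Px + bex * Qx = hx * (Px * Qy - Py * Qx) / Dl" "al * Py + bex * Qy = hy * (Px * Qy - Py * Qx) / Dl"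
  by (simp_all add: al_def bex_def add_divide_distrib[symmetric] algebra_simps)
 then have ab: "al * Px + bex * Qx = hx" "al * Py + bex * Qy = hy" using Dl by (simp_all add: Dl_def)
 have tan: "fd P (ph 0) w = 0 & fd Q (ph 0) w = 0" if "w : cone_tangent S p" for w
  using that PQ(1,2) cone_tangent_iff[OF p0(1)] p0(2) by blast
 have "hx ~= 0 | hy ~= 0"
 proof (rule ccontr)
  assume z: "\<not> ?thesis"
  have "pairing h w = pairing 0 w" for w
  proof -
   obtain a b where "w - a *s x - b *s y : cone_tangent S p" using xy(1) by blast
   from h(2)[OF this] show ?thesis using z by (simp add: pairing_linear hx_def hy_def)
  qed
  then show False using h(1) pairing_eqI by blast
 qed
 then have "al ~= 0 | bex ~= 0" using ab by auto
 \<comment> \<open>If \<open>P\<close> enters \<open>F0\<close>, the differential of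
   \<open>Q\<close> is independent of that of \<open>F0\<close>, and vice versa.\<close>
 then obtain d G0 where G0: "iform S d G0" "hx * fd G0 (ph 0) y - hy * fd G0 (ph 0) x ~= 0"
  "!!w. w : cone_tangent S p ==> fd G0 (ph 0) w = 0"
 proof (elim disjE)
  assume "al ~= 0"
  moreover have "hx * Qy - hy * Qx = al * Dl" using Dl by (simp add: al_def)
  ultimately show ?thesis using that[of dQ Q] PQ Dl tan by (simp add: Qx_def Qy_def)
 next
  assume "bex ~= 0"
  moreover have "hx * Py - hy * Px = - bex * Dl" using Dl by (simp add: bex_def)
  ultimately show ?thesis using that[of dP P] PQ Dl tan by (simp add: Px_def Py_def)
 qed
 define Gx Gy ep where "Gx = fd G0 (ph 0) x" and "Gy = fd G0 (ph 0) y" and "ep = hx * fd G0 (ph 0) y - hy * fd G0 (ph 0) x"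
 have ep: "ep ~= 0" "ep = hx * Gy - hy * Gx" using G0(2) by (simp_all add: ep_def Gx_def Gy_def)
 note Gl = iform_linear[OF G0(1)]
 define es et where "es = inverse ep *s (Gy *s x - Gx *s y)" and "et = inverse ep *s (hx *s y - hy *s x)"
 have hes: "pairing h es = 1" "pairing h et = 0" "fd G0 (ph 0) es = 0" "fd G0 (ph 0) et = 1"
 proof -
  have e: "Gy * hx - Gx * hy = ep" "hx * Gy - hy * Gx = ep" "hx * hy - hy * hx = 0" "Gy * Gx - Gx * Gy = 0"
   by (simp_all add: ep(2) mult.commute)
  show "pairing h es = 1" "pairing h et = 0" "fd G0 (ph 0) es = 0" "fd G0 (ph 0) et = 1"
   unfolding es_def et_def pairing_linear Gl hx_def[symmetric] hy_def[symmetric] Gx_def[symmetric] Gy_def[symmetric]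
   by (simp_all only: e left_inverse[OF ep(1)] mult_zero_right)
 qed
 define F0 where "F0 = (%v. al * P v + bex * Q v)"
 have fdF: "fd F0 v w = al * fd P v w + bex * fd Q v w" for v w
 proof -
  have a: "cdiff (%v. al * P v) v" "cdiff (%v. bex * Q v) v" by (intro hols iform_cdiff[OF PQ(1)] iform_cdiff[OF PQ(2)])+
  show ?thesis
   unfolding F0_def cdiff_add(2)[OF a] cdiff_mult(2)[OF cdiff_const iform_cdiff[OF PQ(1)]]
    cdiff_mult(2)[OF cdiff_const iform_cdiff[OF PQ(2)]] by (simp add: fd_const)
 qed
 have dF: "fd F0 (ph 0) w = pairing h w" for w
 proof -
  obtain a b where "w - a *s x - b *s y : cone_tangent S p" using xy(1) by blast
  from h(2)[OF this] tan[OF this]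
  have e: "pairing h w = a * hx + b * hy" "fd P (ph 0) w = a * Px + b * Py" "fd Q (ph 0) w = a * Qx + b * Qy"
   by (simp_all add: pairing_linear iform_linear[OF PQ(1)] iform_linear[OF PQ(2)] Px_def Py_def Qx_def Qy_def hx_def hy_def algebra_simps)
  show ?thesis unfolding fdF e ab[symmetric] by (simp add: algebra_simps)
 qed
 have dual: "EX a b c d e. w = a *s es + b *s et + c *s ph 0 + d *s fd ph 0 (axis 1 1) + e *s fd ph 0 (axis 2 1)" for w
 proof -
  define w' where "w' = w - pairing h w *s es - fd G0 (ph 0) w *s et"
  have w': "pairing h w' = 0" "fd G0 (ph 0) w' = 0" by (simp_all add: w'_def pairing_linear Gl hes)
  obtain a b where t: "w' - a *s x - b *s y : cone_tangent S p" using xy(1) by blast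
  have "pairing h w' - a * hx - b * hy = 0" using h(2)[OF t] by (simp only: pairing_linear hx_def hy_def)
  then have e1: "a * hx + b * hy = 0" using w'(1) by algebra
  have "fd G0 (ph 0) w' - a * Gx - b * Gy = 0" using G0(3)[OF t] by (simp only: Gl Gx_def Gy_def)
  then have e2: "a * Gx + b * Gy = 0" using w'(2) by algebra
  have "a * ep = (a * hx + b * hy) * Gy - (a * Gx + b * Gy) * hy" "b * ep = (a * Gx + b * Gy) * hx - (a * hx + b * hy) * Gx"
   by (simp_all add: ep(2) algebra_simps)
  then have "a * ep = 0" "b * ep = 0" unfolding e1 e2 by simp_all
  then have "a = 0" "b = 0" using ep(1) by simp_all
  then obtain c d e where "w' = c *s ph 0 + d *s fd ph 0 (axis 1 1) + e *s fd ph 0 (axis 2 1)" using pt(1) t by fastforce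
  then have "w = pairing h w *s es + fd G0 (ph 0) w *s et + c *s ph 0 + d *s fd ph 0 (axis 1 1) + e *s fd ph 0 (axis 2 1)"
   by (simp add: w'_def algebra_simps)
  then show ?thesis by blast
 qed
 have uniq: "a = 0 & b = 0 & c = 0 & d = 0 & e = 0"
  if z: "a *s es + b *s et + c *s ph 0 + d *s fd ph 0 (axis 1 1) + e *s fd ph 0 (axis 2 1) = 0" for a b c d e
 proof -
  have "pairing h (a *s es + b *s et + c *s ph 0 + d *s fd ph 0 (axis 1 1) + e *s fd ph 0 (axis 2 1)) = a"
   by (simp add: pairing_linear hes h(2) pt(2,3))
  then have a: "a = 0" unfolding z by (simp add: pairing_linear)
  have "fd G0 (ph 0) (a *s es + b *s et + c *s ph 0 + d *s fd ph 0 (axis 1 1) + e *s fd ph 0 (axis 2 1)) = b"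
   by (simp add: Gl hes G0(3) pt(2,3))
  then have b: "b = 0" unfolding z using Gl(3)[of "ph 0" 0 0] by simp
  show ?thesis using pt(4)[of c d e] z a b by simp
 qed
 obtain ks kt kl k1 k2 where fr: "frame es et (ph 0) (fd ph 0 (axis 1 1)) (fd ph 0 (axis 2 1)) ks kt kl k1 k2"
  by (rule dual_basis[OF dual uniq])
 interpret frame es et "ph 0" "fd ph 0 (axis 1 1)" "fd ph 0 (axis 2 1)" ks kt kl k1 k2 by (rule fr)
 have "h = ks"
 proof (rule pairing_eqI)
  show "pairing h v = pairing ks v" for v
   by (subst expand[of v]) (simp only: pairing_linear hes h(2)[OF pt(2)] h(2)[OF pt(3)] mult_zero_right mult_1_right add_0_right)
 qed
 moreover have "fd G0 (ph 0) v = pairing kt v" for v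
  by (subst expand[of v]) (simp only: Gl hes G0(3)[OF pt(2)] G0(3)[OF pt(3)] mult_zero_right mult_1_right add_0_right add_0_left)
 moreover have "F0 : polys (range coords)" "G0 : polys (range coords)"
  using PQ G0(1) unfolding F0_def by (auto simp: iform_def form_def intro!: polys.add polys.mult polys.const)
 moreover have "F0 v = 0 & G0 v = 0" if "v ~= 0" "abs_cproj v : S" for v
  using that PQ G0(1) by (auto simp: F0_def iform_def)
 ultimately show ?thesis using that[OF fr[folded \<open>h = ks\<close>], of F0 G0] dF by blast
qed

section \<open>Local generators of the ideal\<close>

lemma finite_Xc: "finite Xc" by (simp add: Xc_def)

lemma Xc_zero: "x : Xc ==> x 0 = 0" by (auto simp: Xc_def)

lemma mpow_polys: "f : mpow X k ==> f : polys X" using fidealD(1)[OF mpow_fideal] .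

lemmas mpow_add = fidealD(3)[OF mpow_fideal] and mpow_smult = fidealD(4)[OF mpow_fideal]
 and mpow_zero = fidealD(2)[OF mpow_fideal] and mpow_diff = fideal_diff[OF mpow_fideal]

lemma Xc_mpow: "x : Xc ==> x : mpow Xc (Suc 0)"
 using mpow_SucI[of x Xc "%_. 1" 0] by (simp add: polys.const)

lemma polys_value: "f : polys Xc ==> (%x. f x - f 0) : mpow Xc (Suc 0)"
proof (induction rule: polys.induct)
 case (gen f)
 then show ?case using Xc_mpow[of f] by (simp add: Xc_zero)
next
 case (add f g)
 then show ?case using mpow_add[OF add.IH] by (simp add: algebra_simps)
next
 case (mult f g)
 have "(%x. f x * g x - f 0 * g 0) = (%x. f x * (g x - g 0) + g 0 * (f x - f 0))" by (simp add: algebra_simps)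
 then show ?case using mpow_add[OF mpow_smult[OF mult.hyps(1) mult.IH(2)] mpow_smult[OF polys.const mult.IH(1)]] by simp
qed (simp add: mpow_zero)

lemma polys_linear_part: "f : polys Xc ==> (%x. f x - f 0 - fd f 0 x) : mpow Xc (Suc (Suc 0))"
proof (induction rule: polys.induct)
 case (const c)
 then show ?case using mpow_zero[of Xc "Suc (Suc 0)"] by (simp add: fd_const del: mpow.simps)
next
 case (gen f)
 then show ?case using mpow_zero[of Xc "Suc (Suc 0)"] by (simp add: Xc_zero fd_Xc del: mpow.simps)
next
 case (add f g)
 have "fd (%x. f x + g x) 0 v = fd f 0 v + fd g 0 v" for v by (intro cdiff_add cdiff_polys_Xc add)
 then show ?case using mpow_add[OF add.IH] by (simp add: algebra_simps del: mpow.simps)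
next
 case (mult f g)
 have e: "fd (%x. f x * g x) 0 v = f 0 * fd g 0 v + fd f 0 v * g 0" for v by (intro cdiff_mult cdiff_polys_Xc mult)
 have "(%x. f x * g x - f 0 * g 0 - fd (%x. f x * g x) 0 x) =
  (%x. (f 0 * (g x - g 0 - fd g 0 x) + g 0 * (f x - f 0 - fd f 0 x)) + (f x - f 0) * (g x - g 0))"
  unfolding e by (simp add: algebra_simps)
 moreover have "(%x. (f x - f 0) * (g x - g 0)) : mpow Xc (Suc (Suc 0))"
  using mpow_mult[OF polys_value[OF mult.hyps(1)] polys_value[OF mult.hyps(2)]] by (simp del: mpow.simps)
 ultimately show ?case
  using mpow_add[OF mpow_add[OF mpow_smult[OF polys.const mult.IH(2)] mpow_smult[OF polys.const mult.IH(1)]]] by simp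
qed

abbreviation (input) Xs :: "chart => complex" where "Xs \<equiv> fst"
abbreviation (input) Xt :: "chart => complex" where "Xt \<equiv> %x. fst (snd x)"

definition leading :: "nat => (complex * complex => complex) => bool" where
 "leading k h \<longleftrightarrow> (%x. h (snd (snd x))) : mpow Xc k & (ALL c w. h (c *\<^sub>C w) = c ^ k * h w) & continuous_on UNIV h"

text \<open>Order at least \<open>k - 1\<close> at the origin, phrased through multiplication by
  functions of order 2 so that \<open>k = 0\<close> is covered.\<close>

definition low :: "nat => (chart => complex) => bool" where
 "low k f \<longleftrightarrow> f : polys Xc & (ALL m:mpow Xc 2. (%x. m x * f x) : mpow Xc (Suc k))"

definition decomposes :: "nat => (chart => complex) => bool" where
 "decomposes k f \<longleftrightarrow> (EX h f1 f2. leading k h & low k f1 & low k f2 &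
   (%x. f x - h (snd (snd x)) - fst x * f1 x - fst (snd x) * f2 x) : mpow Xc (Suc k))"

lemma low_add: "low k f ==> low k g ==> low k (%x. f x + g x)"
 unfolding low_def using mpow_add[of _ Xc "Suc k"] by (auto simp: distrib_left polys.add simp del: mpow.simps)

lemma low_zero: "low k (%_. 0)"
 unfolding low_def using mpow_zero[of Xc "Suc k"] by (simp add: polys.const del: mpow.simps)

lemma low_mpow: "f : mpow Xc k ==> low (Suc k) f"
 unfolding low_def using mpow_mult[of _ Xc 2 f k] mpow_polys by (auto simp: numeral_2_eq_2 simp del: mpow.simps)

lemma low_mult:
 assumes "low k f" "x : Xc" "r : polys Xc"
 shows "low (Suc k) (%z. r z * (x z * f z))"
 unfolding low_def
proof (intro conjI ballI)
 show "(%z. r z * (x z * f z)) : polys Xc" using assms by (intro polys.mult) (auto simp: low_def intro: polys.gen)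
 fix m assume "m : mpow Xc 2"
 then have "(%z. m z * f z) : mpow Xc (Suc k)" using assms(1) unfolding low_def by blast
 then have "(%z. r z * (x z * (m z * f z))) : mpow Xc (Suc (Suc k))"
  by (intro mpow_smult[OF assms(3)] mpow_SucI[OF assms(2)])
 then show "(%z. m z * (r z * (x z * f z))) : mpow Xc (Suc (Suc k))" by (simp add: mult_ac)
qed

lemma leading_add: "leading k h ==> leading k h' ==> leading k (%w. h w + h' w)"
 unfolding leading_def using mpow_add[of "%x. h (snd (snd x))" Xc k "%x. h' (snd (snd x))"]
 by (auto simp: distrib_left intro!: continuous_intros)

lemma leading_zero: "leading k (%_. 0)"
 unfolding leading_def using mpow_zero[of Xc k] by auto

lemma leading_mult:
 assumes h: "leading k h" and x: "x : {fst, snd}"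
 shows "leading (Suc k) (%w. c * (x w * h w))"
proof -
 have "(%z. x (snd (snd z)) * h (snd (snd z))) : mpow Xc (Suc k)"
  by (rule mpow_SucI) (use x h in "auto simp: Xc_def leading_def")
 then have "(%z. c * (x (snd (snd z)) * h (snd (snd z)))) : mpow Xc (Suc k)" by (rule mpow_smult[OF polys.const])
 then show ?thesis using h x unfolding leading_def by (auto intro!: continuous_intros)
qed

lemma decomposes_add:
 assumes "decomposes k f" "decomposes k g" shows "decomposes k (%x. f x + g x)"
proof -
 obtain h f1 f2 h' g1 g2 where 1: "leading k h" "low k f1" "low k f2"
   "(%x. f x - h (snd (snd x)) - fst x * f1 x - fst (snd x) * f2 x) : mpow Xc (Suc k)"
  and 2: "leading k h'" "low k g1" "low k g2"
   "(%x. g x - h' (snd (snd x)) - fst x * g1 x - fst (snd x) * g2 x) : mpow Xc (Suc k)"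
  using assms unfolding decomposes_def by blast
 show ?thesis
  unfolding decomposes_def
 proof (intro exI conjI)
  show "(%x. f x + g x - (h (snd (snd x)) + h' (snd (snd x))) - fst x * (f1 x + g1 x) - fst (snd x) * (f2 x + g2 x)) : mpow Xc (Suc k)"
   using mpow_add[OF 1(4) 2(4)] by (simp add: algebra_simps del: mpow.simps)
 qed (use leading_add[OF 1(1) 2(1)] low_add[OF 1(2) 2(2)] low_add[OF 1(3) 2(3)] in auto)
qed

lemma decomposes_mult:
 assumes g: "decomposes k g" "g : mpow Xc k" and x: "x : Xc" and r: "r : polys Xc"
 shows "decomposes (Suc k) (%z. r z * (x z * g z))"
proof -
 have rg: "low (Suc k) (%z. r z * g z)" by (rule low_mpow[OF mpow_smult[OF r g(2)]])
 have z: "(%_. 0) : mpow Xc (Suc (Suc k))" by (rule mpow_zero)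
 consider "x = fst" | "x = (%z. fst (snd z))" | x' where "x' : {fst, snd}" "x = (%z. x' (snd (snd z)))"
  using x by (auto simp: Xc_def)
 then show ?thesis
 proof cases
  case 1
  show ?thesis unfolding decomposes_def 1
   by (intro exI[of _ "%_. 0"] exI[of _ "%z. r z * g z"] conjI leading_zero rg low_zero)
    (use z in "simp add: algebra_simps del: mpow.simps")
 next
  case 2
  show ?thesis unfolding decomposes_def 2
   by (rule exI[of _ "%_. 0"], rule exI[of _ "%_. 0"], rule exI[of _ "%z. r z * g z"], intro conjI leading_zero rg low_zero)
    (use z in "simp add: algebra_simps del: mpow.simps")
 next
  case 3
  obtain h g1 g2 where h: "leading k h" "low k g1" "low k g2"
   "(%x. g x - h (snd (snd x)) - fst x * g1 x - fst (snd x) * g2 x) : mpow Xc (Suc k)"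
   using g(1) unfolding decomposes_def by blast
  have m1: "(%z. r z * (x z * (g z - h (snd (snd z)) - fst z * g1 z - fst (snd z) * g2 z))) : mpow Xc (Suc (Suc k))"
   by (intro mpow_smult r mpow_SucI x h)
  have "(%z. (r z - r 0) * (x z * h (snd (snd z)))) : mpow Xc (Suc 0 + Suc k)"
   by (intro mpow_mult polys_value r mpow_SucI x) (use h in "simp add: leading_def")
  then have m2: "(%z. (r z - r 0) * (x z * h (snd (snd z)))) : mpow Xc (Suc (Suc k))" by (simp del: mpow.simps)
  show ?thesis unfolding decomposes_def
  proof (intro exI conjI)
   show "leading (Suc k) (%w. r 0 * (x' w * h w))" by (rule leading_mult[OF h(1) 3(1)])
   show "low (Suc k) (%z. r z * (x z * g1 z))" "low (Suc k) (%z. r z * (x z * g2 z))" by (intro low_mult h x r)+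
   show "(%z. r z * (x z * g z) - r 0 * (x' (snd (snd z)) * h (snd (snd z))) - fst z * (r z * (x z * g1 z)) -
     fst (snd z) * (r z * (x z * g2 z))) : mpow Xc (Suc (Suc k))"
    using mpow_add[OF m1 m2] unfolding 3(2) by (simp add: algebra_simps del: mpow.simps)
  qed
 qed
qed

text \<open>A monomial of degree \<open>k\<close> either involves only the last two coordinates, and
  contributes to the leading form, or is divisible by a normal coordinate.\<close>

lemma mpow_decomposes: "f : mpow Xc k ==> decomposes k f"
proof (induction k arbitrary: f)
 case 0
 then have "f : polys Xc" by simp
 from polys_value[OF this] show ?case
  unfolding decomposes_def
  by (intro exI[of _ "%_. f 0"] exI[of _ "%_. 0"] conjI low_zero) (auto simp: leading_def polys.const)
next
 case (Suc k)
 from Suc.prems show ?case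
 proof (induction rule: mpow_Suc_induct)
  case zero
  show ?case unfolding decomposes_def
   using leading_zero low_zero mpow_zero[of Xc "Suc (Suc k)"]
   by (intro exI[of _ "%_. 0"] conjI) (auto simp del: mpow.simps)
 next
  case (step r x g f)
  show ?case by (rule decomposes_add[OF decomposes_mult[OF Suc.IH] step.IH]) (use step in auto)
 qed
qed

text \<open>Each of the \<open>k\<close> factors from \<open>Xc\<close> vanishes at
  \<open>xx 0\<close> and contributes a difference quotient in \<open>c\<close>.\<close>

lemma mpow_limit:
 assumes xx: "cdiff xx (0::complex)" "xx 0 = (0 :: chart)" and f: "f : mpow Xc k"
 shows "EX L. ((%c. f (xx c) / c ^ k) \<longlongrightarrow> L) (at 0)"
 using f
proof (induction k arbitrary: f)
 case 0
 then have "cdiff (%c. f (xx c)) 0"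
  by (intro cdiff_compose(1)[where g = f and f = xx] cdiff_polys_Xc xx) simp
 then show ?case using cdiff_continuous[of "%c. f (xx c)" 0] by (auto simp: isCont_def)
next
 case (Suc k)
 from Suc.prems show ?case
 proof (induction rule: mpow_Suc_induct)
  case zero
  then show ?case by (auto intro: tendsto_const)
 next
  case (step r x g f)
  obtain L1 L2 where L: "((%c. g (xx c) / c ^ k) \<longlongrightarrow> L1) (at 0)" "((%c. f (xx c) / c ^ Suc k) \<longlongrightarrow> L2) (at 0)"
   using Suc.IH[OF step(3)] step.IH by blast
  have cx: "cdiff (%c. p (xx c)) 0" if "p : polys Xc" for p
   by (intro cdiff_compose(1)[where g = p and f = xx] cdiff_polys_Xc xx that)
  have "((%c. r (xx c)) \<longlongrightarrow> r (xx 0)) (at 0)" using cdiff_continuous[OF cx[OF step(1)]] by (simp add: isCont_def)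
  moreover have "((%c. x (xx c) / c) \<longlongrightarrow> fd (%c. x (xx c)) 0 1) (at 0)"
   using fd_complex[OF cx[OF polys.gen[OF step(2)]]] Xc_zero[OF step(2)] by (simp add: has_field_derivative_iff xx)
  ultimately have "((%c. r (xx c) * (x (xx c) / c * (g (xx c) / c ^ k)) + f (xx c) / c ^ Suc k) \<longlongrightarrow>
    r (xx 0) * (fd (%c. x (xx c)) 0 1 * L1) + L2) (at 0)"
   by (intro tendsto_intros L)
  then show ?case by (auto simp: add_divide_distrib)
 qed
qed

lemma ideal_gen_vanish:
 assumes "f : ideal_gen R B" "!!b. b : B ==> b x = 0" shows "f x = 0"
 using assms(1) by induction (auto simp: assms(2))

lemma mpow_Suc_vanish: "f : mpow Xc (Suc k) ==> f 0 = 0"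
 by (induction rule: mpow_Suc_induct) (auto simp: Xc_zero)

text \<open>If \<open>F = s + \<dots>\<close> and \<open>G = t + \<dots>\<close> vanish along a germ of a surface which is parametrized by the last
 two coordinates, the leading term of a polynomial which vanishes there is a combination of \<open>s\<close> and \<open>t\<close>.\<close>
lemma local_ideal:
 assumes F: "F : polys Xc" "F 0 = 0" "!!v. fd F 0 v = fst v" and G: "G : polys Xc" "G 0 = 0" "!!v. fd G 0 v = fst (snd v)"
  and th: "cdiff th (0 :: complex * complex)" "th 0 = (0 :: chart)" "!!v. snd (snd (fd th 0 v)) = v"
  and van: "near 0 (%w. F (th w) = 0 & G (th w) = 0)"
  and E: "E : polys Xc" "near 0 (%w. E (th w) = 0)"
 shows "EX v:polys Xc. v 0 ~= 0 & (%x. v x * E x) : ideal_gen (polys Xc) {F, G}"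
proof -
 let ?J = "ideal_gen (polys Xc) {F, G}"
 have J: "fideal (polys Xc) ?J" by (rule ideal_gen_fideal) (use F G in auto)
 have "EX j:?J. (%z. E z - j z) : mpow Xc k" for k
 proof (induction k)
  case 0
  show ?case by (rule bexI[OF _ fidealD(2)[OF J]]) (use E in simp)
 next
  case (Suc k)
  then obtain j where j: "j : ?J" "(%z. E z - j z) : mpow Xc k" by blast
  obtain h f1 f2 where d: "leading k h" "low k f1" "low k f2"
   "(%x. E x - j x - h (snd (snd x)) - fst x * f1 x - fst (snd x) * f2 x) : mpow Xc (Suc k)"
   using mpow_decomposes[OF j(2)] unfolding decomposes_def by blast
  \<comment> \<open>Replacing \<open>s\<close> by \<open>F\<close> and \<open>t\<close> by
    \<open>G\<close> costs terms of order 2, which the factors \<open>f1\<close> and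
    \<open>f2\<close> raise to order \<open>k + 1\<close>.\<close>
  have "(%x. - (F x - F 0 - fd F 0 x)) : mpow Xc 2" "(%x. - (G x - G 0 - fd G 0 x)) : mpow Xc 2"
   using mpow_smult[OF polys.const polys_linear_part[OF F(1)], of "-1"] mpow_smult[OF polys.const polys_linear_part[OF G(1)], of "-1"]
   by (simp_all add: numeral_2_eq_2 del: mpow.simps)
  then have "(%x. fst x - F x) : mpow Xc 2" "(%x. fst (snd x) - G x) : mpow Xc 2" by (simp_all add: F G)
  then have m: "(%x. (fst x - F x) * f1 x) : mpow Xc (Suc k)" "(%x. (fst (snd x) - G x) * f2 x) : mpow Xc (Suc k)"
   using bspec[OF conjunct2[OF d(2)[unfolded low_def]]] bspec[OF conjunct2[OF d(3)[unfolded low_def]]] by simp_all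
  from mpow_add[OF d(4) mpow_add[OF m]]
  have rest: "(%x. E x - (F x * f1 x + (G x * f2 x + j x)) - h (snd (snd x))) : mpow Xc (Suc k)" (is "?R : _")
   by (simp add: algebra_simps del: mpow.simps)
  \<comment> \<open>Along the curve \<open>th (c *\<^sub>C w)\<close> the functions
    \<open>E\<close>, \<open>F\<close>, \<open>G\<close> and \<open>j\<close> vanish, so there
    \<open>h\<close> equals minus a term of order \<open>k + 1\<close>; divided by
    \<open>c^k\<close>, however, it tends to \<open>h w\<close>.\<close>
  have "h w = 0" for w
  proof -
   define xx where "xx = (%c::complex. th (c *\<^sub>C w))"
   have bl: "bounded_linear (%t. t *\<^sub>C w)" "clin (%t. t *\<^sub>C w)"
    using bounded_bilinear.bounded_linear_left[OF bounded_bilinear_cscale] by (auto simp: clin_def cscale_assoc)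
   have z: "0 *\<^sub>C w = 0" by (simp add: prod_eq_iff)
   have l: "cdiff (%t. t *\<^sub>C w) 0" "fd (%t. t *\<^sub>C w) 0 1 = w"
    using cdiff_bounded_linear[OF bl] by simp_all
   have cxx: "cdiff xx 0" "fd xx 0 1 = fd th 0 w" "xx 0 = 0"
    using cdiff_compose[where g = th and f = "%t. t *\<^sub>C w" and x = 0] l th by (simp_all add: xx_def z)
   have ev: "near 0 (%c. P (c *\<^sub>C w))" if "near 0 P" for P
   proof -
    have "hol_at (%t. t *\<^sub>C w) (0::complex)" by (intro hols)
    from eventually_hol[OF this z that] show ?thesis .
   qed
   have EV: "eventually (%c. - (?R (xx c) / c ^ Suc k) * c = h (snd (snd (xx c))) / c ^ k) (at 0)"
    unfolding eventually_at_filter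
    using ev[OF van] ev[OF E(2)]
   proof eventually_elim
    case (elim c)
    then have z0: "F (xx c) = 0" "G (xx c) = 0" "E (xx c) = 0" by (simp_all add: xx_def)
    moreover have "j (xx c) = 0" by (rule ideal_gen_vanish[OF j(1)]) (use z0 in auto)
    ultimately show ?case by simp
   qed
   obtain L where "((%c. ?R (xx c) / c ^ Suc k) \<longlongrightarrow> L) (at 0)"
    using mpow_limit[OF cxx(1,3) rest] by blast
   then have "((%c. - (?R (xx c) / c ^ Suc k) * c) \<longlongrightarrow> - L * 0) (at 0)" by (intro tendsto_intros)
   from Lim_transform_eventually[OF this EV]
   have "((%c. h (snd (snd (xx c))) / c ^ k) \<longlongrightarrow> 0) (at 0)" by simp
   moreover have "((%c. h (snd (snd (xx c))) / c ^ k) \<longlongrightarrow> h w) (at 0)"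
   proof -
    have hom: "h (snd (snd (xx c))) / c ^ k = h (inverse c *\<^sub>C snd (snd (xx c)))" if "c ~= 0" for c
    proof -
     have "h (inverse c *\<^sub>C snd (snd (xx c))) = inverse c ^ k * h (snd (snd (xx c)))"
      using d(1) unfolding leading_def by blast
     then show ?thesis by (simp add: power_inverse divide_inverse mult.commute)
    qed
    have dv: "((%c. p (xx c) / c) \<longlongrightarrow> p (fd th 0 w)) (at 0)" if "p : Xc" for p
     using fd_complex[OF cdiff_compose(1)[where g = p and f = xx, OF cdiff_Xc[OF that] cxx(1)]]
      cdiff_compose(2)[where g = p and f = xx, OF cdiff_Xc[OF that] cxx(1), of 1] Xc_zero[OF that]
     by (simp add: has_field_derivative_iff cxx fd_Xc[OF that])
    have "((%c. (fst (snd (snd (xx c))) / c, snd (snd (snd (xx c))) / c)) \<longlongrightarrow> (fst (snd (snd (fd th 0 w))), snd (snd (snd (fd th 0 w))))) (at 0)"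
     using dv[of "%x. fst (snd (snd x))"] dv[of "%x. snd (snd (snd x))"] by (intro tendsto_Pair) (auto simp: Xc_def)
    then have "((%c. inverse c *\<^sub>C snd (snd (xx c))) \<longlongrightarrow> w) (at 0)"
     using th(3)[of w] by (simp add: cscale_prod_def divide_inverse mult.commute)
    then have "((%c. h (inverse c *\<^sub>C snd (snd (xx c)))) \<longlongrightarrow> h w) (at 0)"
     by (rule isCont_tendsto_compose[rotated]) (use d(1) in "auto simp only: leading_def continuous_on_eq_continuous_at[OF open_UNIV]")
    moreover have "eventually (%c. h (inverse c *\<^sub>C snd (snd (xx c))) = h (snd (snd (xx c))) / c ^ k) (at 0)"
     using hom by (auto simp: eventually_at_filter)
    ultimately show ?thesis by (rule Lim_transform_eventually)
   qed
   ultimately show ?thesis using tendsto_unique[OF trivial_limit_at] by metis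
  qed
  then have "(%x. E x - (F x * f1 x + (G x * f2 x + j x))) : mpow Xc (Suc k)" using rest by simp
  moreover have "(%x. F x * f1 x + (G x * f2 x + j x)) : ?J"
  proof -
   have "(%x. f1 x * F x) : ?J" "(%x. f2 x * G x) : ?J"
    using fidealD(4)[OF J _ ideal_gen_base, of f1 F] fidealD(4)[OF J _ ideal_gen_base, of f2 G] d(2,3) by (simp_all add: low_def)
   from fidealD(3)[OF J this(1) fidealD(3)[OF J this(2) j(1)]] show ?thesis by (simp add: mult.commute)
  qed
  ultimately show ?case by (intro bexI[of _ "%x. F x * f1 x + (G x * f2 x + j x)"])
 qed
 \<comment> \<open>\<open>E\<close> lies in \<open>?J + mpow Xc k\<close> for every
   \<open>k\<close>; the intersection theorem yields a factor \<open>1 - e\<close> with value 1 at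
   the origin.\<close>
 then obtain e where e: "e : mpow Xc 1" "(%z. (1 - e z) * E z) : ?J"
  by (rule krull_intersection[OF finite_Xc J E(1)]) blast
 have "e 0 = 0" using mpow_Suc_vanish[of e 0] e(1) by (simp del: mpow.simps)
 then show ?thesis
  using e by (intro bexI[of _ "%z. 1 - e z"]) (auto intro: polys_diff polys.const mpow_polys)
qed

lemma ideal_chart:
 fixes Lc :: "chart => complex ^ 5"
 shows "fideal (polys Xc) {f : polys Xc. ALL x. abs_cproj (Lc x) : S --> f x = 0}"
 unfolding fideal_def by (auto intro: polys.const polys.add polys.mult)

section \<open>The parametrization at the cusp in the coordinates of the chart\<close>

definition vec2 :: "complex * complex => complex ^ 2" where "vec2 w = vector [fst w, snd w]"

lemma vec2_simps [simp]: "vec2 w $ 1 = fst w" "vec2 w $ 2 = snd w" by (simp_all add: vec2_def)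

lemma vec2_zero: "vec2 0 = 0" by (simp add: vec_eq_iff forall_2)

lemma cdiff_vec2: "cdiff vec2 w" "fd vec2 w v = vec2 v"
proof -
 have e: "vec2 = (%w. \<chi> i. if i = 1 then fst w else snd w)" by (auto simp: vec_eq_iff forall_2)
 have "linear vec2" by (rule linearI) (auto simp: vec_eq_iff forall_2)
 then have b: "bounded_linear vec2" by (simp add: linear_conv_bounded_linear)
 have c: "clin vec2" by (simp add: clin_def vec_eq_iff forall_2)
 show "cdiff vec2 w" "fd vec2 w v = vec2 v" using cdiff_bounded_linear[OF b c] by auto
qed

lemma hol_at_vec2: "hol_at vec2 w"
 unfolding hol_at_def using cdiff_vec2(1) by (simp add: always_eventually)

locale frame_param = frame +
 fixes S :: "5 cproj set" and W :: "(complex ^ 2) set" and ph :: "complex ^ 2 => complex ^ 5"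
 assumes par: "local_parametrization S (abs_cproj el) W ph"
  and ph0: "ph 0 = el" "fd ph 0 (axis 1 1) = e1" "fd ph 0 (axis 2 1) = e2"
begin

definition th :: "complex * complex => chart" where "th w = chi (ph (vec2 w))"

lemma W: "open W" "0 : W" "w : W ==> cdiff ph w" "w : W ==> ph w ~= 0" "w : W ==> abs_cproj (ph w) : S"
proof -
 have "openin (top_of_set S) ((%w. abs_cproj (ph w)) ` W)" using par by (simp add: local_parametrization_def)
 from openin_imp_subset[OF this] show "w : W ==> abs_cproj (ph w) : S" by blast
 have "cholomorphic_on ph W" using par by (simp add: local_parametrization_def)
 then show "open W" "w : W ==> cdiff ph w" using cholomorphic_cdiff by (auto simp: cholomorphic_on_def)
 show "0 : W" "w : W ==> ph w ~= 0" using par by (auto simp: local_parametrization_def)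
qed

lemma cdiff_ph: "vec2 w : W ==> cdiff (%w. ph (vec2 w)) w"
 "vec2 w : W ==> fd (%w. ph (vec2 w)) w v = fd ph (vec2 w) (vec2 v)"
 using cdiff_compose[where g = ph and f = vec2, OF W(3) cdiff_vec2(1)] by (simp_all add: cdiff_vec2(2))

lemma cdiff_chi:
 assumes "cdiff f x" "pairing kl (f x) ~= 0"
 shows "cdiff (%x. chi (f x)) x"
 unfolding chi_def co_def by (intro hols cdiff_pairing assms)

lemma eventually_W: "near 0 (%w. vec2 w : W & pairing kl (ph (vec2 w)) ~= 0)"
proof -
 have 1: "near 0 (%w. vec2 w : W)"
  by (rule eventually_hol[of vec2 0 0]) (use W(1,2) hol_at_vec2 in "auto simp: vec2_zero intro: eventually_nhds_in_open")
 then have h: "hol_at (%w. pairing kl (ph (vec2 w))) 0"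
  unfolding hol_at_def by (rule eventually_mono) (rule cdiff_pairing[OF cdiff_ph(1)])
 have "near 0 (%w. pairing kl (ph (vec2 w)) ~= 0)"
  by (rule hol_at_nonzero[OF h]) (simp add: vec2_zero ph0)
 then show ?thesis using 1 by (rule eventually_conj[rotated])
qed

lemma th_lift: "pairing kl (ph (vec2 w)) ~= 0 ==> ph (vec2 w) = pairing kl (ph (vec2 w)) *s Lc (th w)"
 unfolding th_def by (rule Lc_chi)

lemma eventually_th: "near 0 (%w. abs_cproj (Lc (th w)) : S)"
 using eventually_W
proof eventually_elim
 case (elim w)
 then have "abs_cproj (Lc (th w)) = abs_cproj (ph (vec2 w))"
  using abs_cproj_scale[OF Lc_nonzero, of "pairing kl (ph (vec2 w))" "th w"] th_lift[of w] by simp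
 then show ?case using W(5) elim by simp
qed

lemma hol_th: "hol_at th 0"
 unfolding hol_at_def using eventually_W
 by (rule eventually_mono) (auto simp: th_def[abs_def] intro: cdiff_chi cdiff_ph)

lemma th0: "th 0 = 0" by (simp add: th_def vec2_zero ph0 chi_def co_def prod_eq_iff)

lemma fd_th: "snd (snd (fd th 0 v)) = v"
proof -
 have c: "cdiff (%w. ph (vec2 w)) 0" "vec2 0 : W" by (simp_all add: cdiff_ph(1) vec2_zero W)
 have f: "fd (%w. ph (vec2 w)) 0 v = fst v *s e1 + snd v *s e2"
  using cdiff_ph(2)[OF c(2), of v] fd_expand2[OF W(3)[OF W(2)], of "vec2 v"] by (simp add: vec2_zero ph0)
 have cl: "cdiff (%w. inverse (pairing kl (ph (vec2 w)))) 0"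
  by (intro hols cdiff_pairing c) (simp add: vec2_zero ph0)
 have ck: "cdiff (%w. inverse (pairing kl (ph (vec2 w))) * pairing k (ph (vec2 w))) 0" for k
  by (intro cdiff_mult cl cdiff_pairing c)
 have d: "fd (%w. inverse (pairing kl (ph (vec2 w))) * pairing k (ph (vec2 w))) 0 v = pairing k (fst v *s e1 + snd v *s e2)"
  if "pairing k el = 0" for k
  using cdiff_mult(2)[OF cl cdiff_pairing[OF c(1)], of k v] that f by (simp add: fd_pairing[OF c(1)] vec2_zero ph0)
 have "th = (%w. (inverse (pairing kl (ph (vec2 w))) * pairing ks (ph (vec2 w)), inverse (pairing kl (ph (vec2 w))) * pairing kt (ph (vec2 w)),
  inverse (pairing kl (ph (vec2 w))) * pairing k1 (ph (vec2 w)), inverse (pairing kl (ph (vec2 w))) * pairing k2 (ph (vec2 w))))"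
  by (simp add: th_def[abs_def] chi_def co_def)
 then have "snd (snd (fd th 0 v)) = (pairing k1 (fst v *s e1 + snd v *s e2), pairing k2 (fst v *s e1 + snd v *s e2))"
  by (simp add: cdiff_Pair ck d)
 then show ?thesis by (simp add: pairing_linear)
qed

end

locale cusp_chart = surface_chart es et el e1 e2 ks kt kl k1 k2 S F G u + frame_param es et el e1 e2 ks kt kl k1 k2 S W ph
 for es et el e1 e2 ks kt kl k1 k2 :: "complex ^ 5" and S F G u W ph +
 assumes F0: "F 0 = 0" "!!v. fd F 0 v = fst v" and G0: "G 0 = 0" "!!v. fd G 0 v = fst (snd v)"
  and u0: "u 0 ~= 0" and cusp: "w : W ==> pairing ks (ph w) = (w $ 2)\<^sup>2 - (w $ 1) ^ 3"

text \<open>\<open>u\<close> is the product of the denominators that \<open>local_ideal\<close>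
  yields for finitely many generators of the ideal of \<open>S\<close> in the chart. Where
  \<open>F = G = 0\<close> and \<open>u\<close> is nonzero all generators vanish, and with them the
  forms defining \<open>S\<close>.\<close>

lemma cusp_chart_exists:
 assumes S: "zariski_closed S" and p: "p : smooth_locus S" "tangent_plane S p <= hyperplane H" and c: "cusp_at S H p"
 obtains es et el e1 e2 ks kt kl k1 k2 F G u W ph where
  "cusp_chart es et el e1 e2 ks kt kl k1 k2 S F G u W ph" "abs_cproj el = p" "abs_cproj ks = H"
proof -
 obtain W ph where parph: "local_parametrization S p W ph" "!!w. w : W ==> pairing (rep_cproj H) (ph w) = (w $ 2)\<^sup>2 - (w $ 1) ^ 3"
  using c by (auto simp: cusp_at_def section_equation_def)
 have p0: "abs_cproj (ph 0) = p" using parph(1) by (simp add: local_parametrization_def)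
 have h: "pairing (rep_cproj H) w = 0" if "w : cone_tangent S p" for w
  using tangent_plane_hyperplane[OF rep_cproj_nonzero, of S p H] p(2) that by simp
 obtain es et kt kl k1 k2 F0 G0 where fr: "frame es et (ph 0) (fd ph 0 (axis 1 1)) (fd ph 0 (axis 2 1)) (rep_cproj H) kt kl k1 k2"
  "F0 : polys (range coords)" "G0 : polys (range coords)"
  "!!v. v ~= 0 ==> abs_cproj v : S ==> F0 v = 0 & G0 v = 0"
  "!!w. fd F0 (ph 0) w = pairing (rep_cproj H) w" "!!w. fd G0 (ph 0) w = pairing kt w"
  by (rule adapted_frame[OF parph(1) p(1) rep_cproj_nonzero h]) (assumption, rule that, assumption+)
 interpret frame_param es et "ph 0" "fd ph 0 (axis 1 1)" "fd ph 0 (axis 2 1)" "rep_cproj H" kt kl k1 k2 S W ph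
  using fr(1) parph(1) by (intro frame_param.intro frame_param_axioms.intro) (simp_all add: p0)
 define F G where "F = (%x. F0 (Lc x))" and "G = (%x. G0 (Lc x))"
 have FG: "F : polys Xc" "G : polys Xc" unfolding F_def G_def by (intro polys_Lc fr)+
 have L0: "Lc 0 = ph 0" by (simp add: Lc_def tang_def)
 have fdF: "fd F 0 v = fst v" "fd G 0 v = fst (snd v)" for v
  unfolding F_def G_def cdiff_compose(2)[where g = F0 and f = Lc, OF cdiff_polys_coords[OF fr(2)] cdiff_Lc]
   cdiff_compose(2)[where g = G0 and f = Lc, OF cdiff_polys_coords[OF fr(3)] cdiff_Lc] fd_Lc L0 fr(5,6)
  by (rule pairing_tang)+
 have FGz: "F x = 0 & G x = 0" if "abs_cproj (Lc x) : S" for x using fr(4)[OF Lc_nonzero that] by (simp add: F_def G_def)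
 have z: "F 0 = 0" "G 0 = 0" using FGz[of 0] p(1) by (simp_all add: L0 p0 smooth_locus_def)
 have van: "near 0 (%w. f (th w) = 0)" if "!!x. abs_cproj (Lc x) : S ==> f x = 0" for f :: "chart => complex"
  using eventually_th by (rule eventually_mono) (rule that)
 define I where "I = {f : polys Xc. ALL x. abs_cproj (Lc x) : S --> f x = 0}"
 have fI: "fideal (polys Xc) I" unfolding I_def by (rule ideal_chart)
 have "EX B. finite B & B <= I & I <= ideal_gen (polys Xc) B"
  by (rule noeth_polys[OF finite_Xc, unfolded noeth_def, THEN spec, THEN mp, OF fI])
 then obtain B where B: "finite B" "B <= I" "I <= ideal_gen (polys Xc) B" by (elim exE conjE) (rule that)
 have "EX v:polys Xc. v 0 ~= 0 & (%x. v x * b x) : ideal_gen (polys Xc) {F, G}" if "b : B" for b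
  using that B(2)
  by (intro local_ideal[OF FG(1) z(1) fdF(1) FG(2) z(2) fdF(2) hol_at_cdiff[OF hol_th] th0 fd_th] eventually_conj van)
   (use FGz in "auto simp: I_def")
 then have "ALL b:B. EX v. v : polys Xc & v 0 ~= 0 & (%x. v x * b x) : ideal_gen (polys Xc) {F, G}" by blast
 from bchoice[OF this] obtain v where v: "!!b. b : B ==> v b : polys Xc" "!!b. b : B ==> v b 0 ~= 0"
  "!!b. b : B ==> (%x. v b x * b x) : ideal_gen (polys Xc) {F, G}" by blast
 define u where "u = (%x. \<Prod>b\<in>B. v b x)"
 have u: "u : polys Xc" "u 0 ~= 0" unfolding u_def using v B(1) by (auto intro: polys_prod)
 obtain \<P> where P: "!!P. P : \<P> ==> EX d. form d P" "!!p. p : S \<longleftrightarrow> (ALL P:\<P>. P (rep_cproj p) = 0)"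
  using zariski_closedE[OF S] by blast
 have inS: "abs_cproj (Lc x) : S" if x: "F x = 0" "G x = 0" "u x ~= 0" for x
 proof -
  have b: "b x = 0" if "b : B" for b
  proof -
   have "v b x * b x = 0" by (rule ideal_gen_vanish[OF v(3)[OF that]]) (use x in auto)
   moreover have "v b x ~= 0" using x(3) that B(1) by (auto simp: u_def)
   ultimately show ?thesis by simp
  qed
  have "P (rep_cproj (abs_cproj (Lc x))) = 0" if "P : \<P>" for P
  proof -
   obtain d where d: "form d P" using P(1) \<open>P : \<P>\<close> by blast
   have "P (Lc x') = 0" if "abs_cproj (Lc x') : S" for x'
    using P(2) that \<open>P : \<P>\<close> form_abs_cproj[OF d Lc_nonzero] by blast
   then have "(%x. P (Lc x)) : I" using polys_Lc[of P] d by (simp add: I_def form_def)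
   then have "P (Lc x) = 0" using ideal_gen_vanish[of "%x. P (Lc x)" "polys Xc" B x] B(3) b by blast
   then show ?thesis using form_abs_cproj[OF d Lc_nonzero] by blast
  qed
  then show ?thesis unfolding P(2) by blast
 qed
 have "cusp_chart es et (ph 0) (fd ph 0 (axis 1 1)) (fd ph 0 (axis 2 1)) (rep_cproj H) kt kl k1 k2 S F G u W ph"
 proof unfold_locales
  show "abs_cproj (Lc x) : S ==> F x = 0 & G x = 0" for x by (rule FGz)
  show "F x = 0 ==> G x = 0 ==> u x ~= 0 ==> abs_cproj (Lc x) : S" for x by (rule inS)
  show "w : W ==> pairing (rep_cproj H) (ph w) = (w $ 2)\<^sup>2 - (w $ 1) ^ 3" for w by (rule parph(2))
 qed (fact S FG u z fdF)+
 then show ?thesis by (rule that) (simp_all add: p0)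
qed

text \<open>The derivatives are computed outright by the product rule. The values at 0 are those of
  \<open>y^2 - x^3\<close>: second derivative 2 in \<open>y\<close>, third derivative -6 in
  \<open>x\<close>, and hence -24 for \<open>cub\<close>.\<close>

lemma cusp_jets:
 fixes m A B g :: "complex * complex => complex"
 assumes hol: "hol_at m 0" "hol_at A 0" "hol_at B 0" "hol_at g 0"
  and AB: "A 0 = 0" "B 0 = 0" "!!v. fd A 0 v = snd v" "!!v. fd B 0 v = fst v" and m: "m 0 = 1"
  and g: "near 0 (%w. g w = m w * (A w ^ 2 - B w ^ 3))"
 shows "g 0 = 0" "fd g 0 v = 0" "fd (%q. fd g q (0, 1)) 0 (0, 1) ~= 0" "hess g (1, 0) (0, 1) 0 = 0"
  "cub g (1, 0) (0, 1) 0 ~= 0"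
proof -
 have D: "(f has_derivative fd f q) (at q)" if "cdiff f q" for f :: "complex * complex => complex" and q
  using cdiff_has_derivative[OF that] .
 have D': "near 0 (%q. (f has_derivative fd f q) (at q))" if "hol_at f 0" for f :: "complex * complex => complex"
  using that unfolding hol_at_def by (rule eventually_mono) (rule D)
 have hv: "hol_at (%q. fd f q v) 0" if "hol_at f 0" for f :: "complex * complex => complex" and v
  by (rule hol_at_fd[OF that])
 define E1 where "E1 v q = m q * (2 * (A q * fd A q v) - 3 * (B q ^ 2 * fd B q v)) + fd m q v * (A q ^ 2 - B q ^ 3)" for v q
 have c: "((%x. c * f x) has_derivative (%h. c * f' h)) (at q)" if "(f has_derivative f') (at q)" for c q
  and f f' :: "complex * complex => complex"
  using has_derivative_mult[OF has_derivative_const that, of c] by simp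
 have e1: "near 0 (%q. fd g q v = E1 v q)" for v
 proof -
  have "near 0 (%q. fd g q = fd (%w. m w * (A w ^ 2 - B w ^ 3)) q)" by (rule fd_eventually_eq[OF g hol(4)])
  then show ?thesis using D'[OF hol(1)] D'[OF hol(2)] D'[OF hol(3)]
  proof eventually_elim
   case (elim q)
   show ?case
    unfolding elim(1) fd_eq[OF has_derivative_mult[OF elim(2) has_derivative_diff[OF has_derivative_power[OF elim(3), of 2] has_derivative_power[OF elim(4), of 3]]]]
    by (simp add: E1_def algebra_simps)
  qed
 qed
 define E2 where "E2 v w q = m q * (2 * (A q * fd (%q. fd A q v) q w + fd A q w * fd A q v) - 3 * (B q ^ 2 * fd (%q. fd B q v) q w + 2 * fd B q w * B q * fd B q v))
   + fd m q w * (2 * (A q * fd A q v) - 3 * (B q ^ 2 * fd B q v))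
   + (fd m q v * (2 * fd A q w * A q - 3 * fd B q w * B q ^ 2) + fd (%q. fd m q v) q w * (A q ^ 2 - B q ^ 3))" for v w q
 have e2: "near 0 (%q. fd (%q. fd g q v) q w = E2 v w q)" for v w
 proof -
  have "near 0 (%q. fd (%q. fd g q v) q = fd (E1 v) q)" by (rule fd_eventually_eq[OF e1 hv[OF hol(4)]])
  then show ?thesis
   using D'[OF hol(1)] D'[OF hol(2)] D'[OF hol(3)] D'[OF hv[OF hol(1), of v]] D'[OF hv[OF hol(2), of v]] D'[OF hv[OF hol(3), of v]]
  proof eventually_elim
   case (elim q)
   show ?case
    unfolding elim(1) E1_def[abs_def]
     fd_eq[OF has_derivative_add[OF has_derivative_mult[OF elim(2) has_derivative_diff[OF c[OF has_derivative_mult[OF elim(3) elim(6)], of 2]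
      c[OF has_derivative_mult[OF has_derivative_power[OF elim(4), of 2] elim(7)], of 3]]]
      has_derivative_mult[OF elim(5) has_derivative_diff[OF has_derivative_power[OF elim(3), of 2] has_derivative_power[OF elim(4), of 3]]]]]
    by (simp add: E2_def algebra_simps)
  qed
 qed
 show "g 0 = 0" using near_imp[OF g] AB by simp
 show "fd g 0 v = 0" using near_imp[OF e1[of v]] AB by (simp add: E1_def)
 have g2: "fd (%q. fd g q v) 0 w = 2 * (snd v * snd w)" for v w
  using near_imp[OF e2[of v w]] AB m by (simp add: E2_def mult.commute)
 show "fd (%q. fd g q (0, 1)) 0 (0, 1) ~= 0" by (simp add: g2)
 have g3: "fd (%q. fd (%q. fd g q (1, 0)) q (1, 0)) 0 (1, 0) = - 6"
 proof -
  let ?v = "(1, 0) :: complex * complex"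
  have "fd (%q. fd (%q. fd g q ?v) q ?v) 0 = fd (E2 ?v ?v) 0"
   using near_imp[OF fd_eventually_eq[OF e2[of ?v ?v] hv[OF hv[OF hol(4)]]]] .
  note m0 = D[OF hol_at_cdiff[OF hol(1)]] and A0 = D[OF hol_at_cdiff[OF hol(2)]] and B0 = D[OF hol_at_cdiff[OF hol(3)]]
   and m1 = D[OF hol_at_cdiff[OF hv[OF hol(1), of ?v]]] and A1 = D[OF hol_at_cdiff[OF hv[OF hol(2), of ?v]]]
   and B1 = D[OF hol_at_cdiff[OF hv[OF hol(3), of ?v]]]
   and m2 = D[OF hol_at_cdiff[OF hv[OF hv[OF hol(1), of ?v], of ?v]]]
   and A2 = D[OF hol_at_cdiff[OF hv[OF hv[OF hol(2), of ?v], of ?v]]]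
   and B2 = D[OF hol_at_cdiff[OF hv[OF hv[OF hol(3), of ?v], of ?v]]]
  have p: "((%q. 2 * fd A q ?v * A q) has_derivative (%h. 2 * fd A 0 ?v * fd A 0 h + 2 * fd (%q. fd A q ?v) 0 h * A 0)) (at 0)"
   by (rule has_derivative_mult[OF c[OF A1] A0])
  have q: "((%q. 2 * fd B q ?v * B q * fd B q ?v) has_derivative
    (%h. 2 * fd B 0 ?v * B 0 * fd (%q. fd B q ?v) 0 h + (2 * fd B 0 ?v * fd B 0 h + 2 * fd (%q. fd B q ?v) 0 h * B 0) * fd B 0 ?v)) (at 0)"
   by (rule has_derivative_mult[OF has_derivative_mult[OF c[OF B1] B0] B1])
  note t1 = has_derivative_mult[OF m0 has_derivative_diff[OF c[OF has_derivative_add[OF has_derivative_mult[OF A0 A2] has_derivative_mult[OF A1 A1]], of 2]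
    c[OF has_derivative_add[OF has_derivative_mult[OF has_derivative_power[OF B0, of 2] B2] q], of 3]]]
  note t2 = has_derivative_mult[OF m1 has_derivative_diff[OF c[OF has_derivative_mult[OF A0 A1], of 2]
    c[OF has_derivative_mult[OF has_derivative_power[OF B0, of 2] B1], of 3]]]
  note t3 = has_derivative_add[OF has_derivative_mult[OF m1 has_derivative_diff[OF p has_derivative_mult[OF c[OF B1, of 3] has_derivative_power[OF B0, of 2]]]]
    has_derivative_mult[OF m2 has_derivative_diff[OF has_derivative_power[OF A0, of 2] has_derivative_power[OF B0, of 3]]]]
  have "fd (E2 ?v ?v) 0 ?v = - 6"
   unfolding E2_def[abs_def] fd_eq[OF has_derivative_add[OF has_derivative_add[OF t1 t2] t3], of ?v]
   by (simp add: AB m)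
  then show ?thesis using \<open>fd (%q. fd (%q. fd g q ?v) q ?v) 0 = fd (E2 ?v ?v) 0\<close> by simp
 qed
 show "hess g (1, 0) (0, 1) 0 = 0" by (simp add: hess_def g2)
 have h2: "cdiff (%q. fd (%q. fd g q v) q w) 0" for v w by (rule hol_at_cdiff[OF hv[OF hv[OF hol(4)]]])
 have "fd (hess g (1, 0) (0, 1)) 0 (1, 0) = - 12"
  unfolding hess_def[abs_def] cdiff_diff(2)[OF cdiff_mult(1)[OF h2 h2] cdiff_mult(1)[OF h2 h2]] cdiff_mult(2)[OF h2 h2] g2 g3
  by simp
 then show "cub g (1, 0) (0, 1) 0 ~= 0" by (simp add: cub_def g2)
qed

context cusp_chart
begin

lemma good_0: "good 0" "J 0 = 1"
proof -
 show "J 0 = 1" by (simp add: J_def F0 G0)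
 then show "good 0" by (simp add: good_def F0 G0 u0)
qed

text \<open>The cusp is given in the coordinates of \<open>ph\<close>, whereas \<open>crit\<close>,
  \<open>N2\<close>, \<open>NH\<close> and \<open>NC\<close> refer to the graph \<open>gm\<close>.
  The coordinate change \<open>sg\<close> between them has identity derivative at 0, so its
  components can serve as \<open>A\<close> and \<open>B\<close> in \<open>cusp_jets\<close>.\<close>

lemma central_point:
 obtains y where "good_point es et el e1 e2 ks kt kl k1 k2 S F G u 0 0 0 y"
  "crit 0 ks" "N2 (0, 1) (0, 1) (0, ks) ~= 0" "NH (0, ks) = 0" "NC (0, ks) ~= 0"
proof -
 have z: "(0, 0, 0) = (0 :: chart)" by (simp add: zero_prod_def)
 obtain y where y: "hol_at y 0" "y 0 = (0, 0)"
  "near (0, 0, 0) (%x. F x = 0 & G x = 0 \<longleftrightarrow> (fst x, fst (snd x)) = y (snd (snd x)))"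
  "near 0 (%w. ALL v. fd (%w. (fst (y w), snd (y w), w)) w v =
    inverse (J (fst (y w), snd (y w), w)) *\<^sub>C V v (fst (y w), snd (y w), w))"
  "near 0 (%w. good (fst (y w), snd (y w), w))"
  by (rule implicit_chart[of 0 0 0]) (auto simp: z good_0)
 then interpret p: good_point es et el e1 e2 ks kt kl k1 k2 S F G u 0 0 0 y
  using good_0 by unfold_locales (auto simp: z)
 have gm0: "p.gm 0 = 0" using p.gm0 by (simp add: z)
 define ta where "ta = (%w. snd (snd (th w)))"
 have hta: "hol_at ta 0" unfolding ta_def by (intro hols hol_th)
 have ta0: "ta 0 = 0" by (simp add: ta_def th0)
 have fdta: "fd ta 0 v = v" for v
  unfolding ta_def using hol_at_cdiff[OF hol_th] by (simp add: fd_snd cdiff_snd fd_th)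
 have bta: "bij (fd ta 0)" unfolding bij_def inj_def surj_def by (auto simp: fdta)
 obtain sg where sg: "hol_at sg 0" "sg 0 = 0" "near 0 (%z. ta (sg z) = z)"
  using hol_inverse_function[OF hta bta] unfolding ta0 by metis
 have fdsg: "fd sg 0 v = v" for v
 proof -
  have c: "cdiff ta (sg 0)" "cdiff sg 0" using hta sg by (simp_all add: hol_at_cdiff)
  have "fd (%z. z) 0 = fd (%z. ta (sg z)) 0"
   by (rule cdiff_transform(2)[OF cdiff_compose(1)[where g = ta and f = sg, OF c] sg(3)])
  then have "v = fd (%z. ta (sg z)) 0 v" using fd_eq[OF has_derivative_ident, of 0 v] by (simp only:)
  also have "\<dots> = fd ta (sg 0) (fd sg 0 v)" by (rule cdiff_compose(2)[where g = ta and f = sg, OF c])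
  also have "\<dots> = fd sg 0 v" by (simp only: sg(2) fdta)
  finally show ?thesis by (rule sym)
 qed
 \<comment> \<open>Unit factor between the lift \<open>ph\<close> and the lift normalized by
   \<open>kl = 1\<close>.\<close>
 define m where "m = (%z. 1 / pairing kl (ph (vec2 (sg z))))"
 have hl: "hol_at (%w. pairing kl (ph (vec2 w))) 0"
  unfolding hol_at_def using eventually_W by (rule eventually_mono) (auto intro: cdiff_pairing cdiff_ph)
 have "hol_at (%z. pairing kl (ph (vec2 (sg z)))) 0"
  by (rule hol_at_compose[where g = "%w. pairing kl (ph (vec2 w))" and f = sg]) (simp_all add: sg hl)
 then have hm: "hol_at m 0" unfolding m_def by (intro hols) (simp_all add: sg vec2_zero ph0)
 have m0: "m 0 = 1" by (simp add: m_def sg vec2_zero ph0)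
 have "near 0 (%z. p.sec ks z = m z * (snd (sg z) ^ 2 - fst (sg z) ^ 3))"
 proof -
  have near: "near 0 (%w. F (th w) = 0 & G (th w) = 0 \<longleftrightarrow> (fst (th w), fst (snd (th w))) = y (snd (snd (th w))))"
   by (rule eventually_hol[OF hol_th th0]) (use y(3) in "simp add: z")
  have "near 0 (%w. p.sec ks (ta w) = 1 / pairing kl (ph (vec2 w)) * (snd w ^ 2 - fst w ^ 3))"
   using near eventually_th eventually_W
  proof eventually_elim
   case (elim w)
   have yt: "y (ta w) = (fst (th w), fst (snd (th w)))" using elim(1) FG_vanish[OF elim(2)] by (simp add: ta_def)
   have "th w = p.gm (ta w)" by (simp only: p.gm_def yt fst_conv snd_conv) (simp add: ta_def)
   then have "p.sec ks (ta w) = pairing ks (Lc (th w))" by (simp add: p.sec_def)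
   moreover have "pairing ks (ph (vec2 w)) = pairing kl (ph (vec2 w)) * pairing ks (Lc (th w))"
    using arg_cong[OF th_lift[of w], of "pairing ks"] elim(3) by (simp add: pairing_linear)
   ultimately show ?case using elim(3) cusp[of "vec2 w"] by (simp add: field_simps)
  qed
  from eventually_hol[OF sg(1,2) this] sg(3) show ?thesis
   by eventually_elim (simp add: m_def)
 qed
 note sec_eq = this
 have hAB: "hol_at (%z. snd (sg z)) 0" "hol_at (%z. fst (sg z)) 0" by (intro hols sg)+
 have AB: "snd (sg 0) = 0" "fst (sg 0) = 0" "fd (%z. snd (sg z)) 0 v = snd v" "fd (%z. fst (sg z)) 0 v = fst v" for v
  by (simp_all add: sg(2) fd_snd fd_fst hol_at_cdiff[OF sg(1)] fdsg)
 note j = cusp_jets[where m = m and A = "%z. snd (sg z)" and B = "%z. fst (sg z)" and g = "p.sec ks",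
  OF hm hAB p.hol_sec AB m0 sec_eq]
 have "crit 0 ks"
  using j(1) j(2) near_imp[OF p.fd_sec[of ks "(1, 0)"]] near_imp[OF p.fd_sec[of ks "(0, 1)"]]
  by (simp add: crit_def p.sec_def gm0 good_0)
 moreover have "N2 (0, 1) (0, 1) (0, ks) ~= 0"
  using j(3) near_imp[OF p.fd2_sec[of ks "(0, 1)" "(0, 1)"]] by (auto simp: gm0 good_0)
 moreover have "NH (0, ks) = 0" using j(4) near_imp[OF p.hess_sec[of ks]] by (simp add: gm0 good_0)
 moreover have "NC (0, ks) ~= 0" using j(5) p.cub_sec[of ks] by (auto simp: gm0 good_0)
 ultimately show ?thesis using that p.good_point_axioms by blast
qed

end

section \<open>Coordinates on the dual space\<close>

text \<open>The first two entries are exchanged, so that a pair \<open>(chx1, chx2)\<close> with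
  \<open>chx1^2 = chx2^3\<close> becomes a point of the curve
  \<open>(w $ 2)^2 = (w $ 1)^3\<close>.\<close>

definition v4 :: "chart => complex ^ 4" where
 "v4 p = (\<chi> i. if i = 1 then fst (snd p) else if i = 2 then fst p else if i = 3 then fst (snd (snd p)) else snd (snd (snd p)))"

definition w4 :: "complex ^ 4 => chart" where "w4 w = (w $ 2, w $ 1, w $ 3, w $ 4)"

lemma v4_nth [simp]: "v4 p $ 1 = fst (snd p)" "v4 p $ 2 = fst p" "v4 p $ 3 = fst (snd (snd p))" "v4 p $ 4 = snd (snd (snd p))"
 by (simp_all add: v4_def)

lemma w4_v4 [simp]: "w4 (v4 p) = p" and v4_w4 [simp]: "v4 (w4 w) = w"
 by (simp_all add: w4_def vec_eq_iff forall_4)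

lemma cdiff_v4: "cdiff v4 p"
proof -
 have "linear v4" by (rule linearI) (auto simp: vec_eq_iff forall_4)
 then have "bounded_linear v4" by (simp add: linear_conv_bounded_linear)
 moreover have "clin v4" by (simp add: clin_def vec_eq_iff forall_4)
 ultimately show ?thesis by (rule cdiff_bounded_linear)
qed

lemma cdiff_w4: "cdiff w4 w" unfolding w4_def[abs_def] by (intro hols)

lemma cdiff_continuous_on: "(!!x. x : A ==> cdiff f x) ==> continuous_on A f"
 using cdiff_continuous continuous_at_imp_continuous_on by blast

context frame
begin

lemma ks_nonzero: "ks ~= 0"
proof
 assume "ks = 0"
 then have "pairing ks es = 0" by (simp only: pairing_linear(7))
 then show False by simp
qed

lemma chart_open:
 assumes "open B"
 defines "M \<equiv> abs_cproj ` ({v. pairing kl v ~= 0} Int chi -` B)"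
 shows "open M" "{v. v ~= 0 & abs_cproj v : M} = {v. pairing kl v ~= 0} Int chi -` B"
  "K : M ==> EX x. x : B & K = abs_cproj (Lc x)" "x : B ==> abs_cproj (Lc x) : M" "open ({v. pairing kl v ~= 0} Int chi -` B)"
proof -
 let ?Om = "{v. pairing kl v ~= 0} Int chi -` B"
 have o: "open {v. pairing kl v ~= 0}"
  by (rule open_Collect_neq) (auto intro: linear_continuous_on[OF bounded_linear_pairing])
 show oOm: "open ?Om" by (rule continuous_open_preimage[OF continuous_on_chi o assms(1)])
 have z: "0 ~: ?Om" by (simp add: pairing_linear)
 show "open M" unfolding M_def by (rule open_abs_cproj_image[OF oOm z])
 show "{v. v ~= 0 & abs_cproj v : M} = ?Om"
 proof (intro set_eqI iffI)
  fix v assume "v : {v. v ~= 0 & abs_cproj v : M}"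
  then obtain w where w: "w : ?Om" "abs_cproj w = abs_cproj v" "v ~= 0" unfolding M_def by fastforce
  then have "w ~= 0" using z by blast
  then obtain c where "c ~= 0" "v = c *s w" using w abs_cproj_eq_iff by blast
  then show "v : ?Om" using w(1) by (auto simp: pairing_linear chi_smult)
 qed (use z in "auto simp: M_def")
 show "EX x. x : B & K = abs_cproj (Lc x)" if KM: "K : M"
 proof -
  obtain v where v: "pairing kl v ~= 0" "chi v : B" "K = abs_cproj v" using KM by (auto simp: M_def)
  then show ?thesis using Lc_chi[OF v(1)] abs_cproj_scale[OF Lc_nonzero v(1)] by metis
 qed
 show "abs_cproj (Lc x) : M" if "x : B" unfolding M_def by (rule imageI) (use that in simp)
qed

lemma cdiff_chi_id: "pairing kl v ~= 0 ==> cdiff chi v"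
proof -
 assume n: "pairing kl v ~= 0"
 have p: "cdiff (pairing k) v" for k :: "complex ^ 5" using cdiff_pairing[OF cdiff_ident] .
 show "cdiff chi v" unfolding chi_def[abs_def] co_def by (intro hols p n)
qed

text \<open>Coordinates at the origin of the affine chart induce coordinates on an open set of
  projective space. The germ property \<open>P\<close> is carried along, to be read off on all of
  \<open>N\<close>.\<close>

lemma chart_coordinates:
 assumes Ps: "hol_at Ps 0" "Ps 0 = 0" "bij (fd Ps 0)" and P: "near (0 :: chart) P"
 obtains N z where "abs_cproj el : N" "holomorphic_coordinates N z" "z (abs_cproj el) = 0"
  "!!K. K : N ==> EX x. K = abs_cproj (Lc x) & z K = v4 (Ps x) & P x"
proof -
 obtain Xx where Xx: "hol_at Xx 0" "Xx 0 = 0" "near 0 (%x. Xx (Ps x) = x)" "near 0 (%y. Ps (Xx y) = y)"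
  using hol_inverse_function[OF Ps(1,3)] unfolding Ps(2) by blast
 have "near 0 (%x. Xx (Ps x) = x & cdiff Ps x & P x)"
  using Xx(3) Ps(1)[unfolded hol_at_def] P by eventually_elim auto
 then obtain A where A: "open A" "0 : A" "!!x. x : A ==> Xx (Ps x) = x & cdiff Ps x & P x" by (rule eventually_openE) (rule that, assumption+)
 have "near 0 (%y. Xx y : A)" by (rule eventually_hol[OF Xx(1,2)]) (use A in "auto intro: eventually_nhds_in_open")
 with Xx(4) Xx(1)[unfolded hol_at_def] have "near 0 (%y. Ps (Xx y) = y & cdiff Xx y & Xx y : A)"
  by eventually_elim auto
 then obtain B where B: "open B" "0 : B" "!!y. y : B ==> Ps (Xx y) = y & cdiff Xx y & Xx y : A" by (rule eventually_openE) (rule that, assumption+)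
 define A' where "A' = A Int Ps -` B"
 have A': "open A'" unfolding A'_def by (rule continuous_open_preimage[OF cdiff_continuous_on A(1) B(1)]) (use A in auto)
 define N where "N = abs_cproj ` ({v. pairing kl v ~= 0} Int chi -` A')"
 note N = chart_open[OF A', folded N_def]
 define z where "z = (%K. v4 (Ps (chi (rep_cproj K))))"
 have zL: "z (abs_cproj v) = v4 (Ps (chi v))" if v: "v ~= 0" for v
 proof -
  obtain c where "c ~= 0" "rep_cproj (abs_cproj v) = c *s v" using rep_abs_cproj[OF v] .
  then show ?thesis by (simp add: z_def chi_smult)
 qed
 have zLc: "z (abs_cproj (Lc x)) = v4 (Ps x)" for x by (simp add: zL)
 have zN: "z ` N = w4 -` B"
 proof (intro equalityI subsetI)
  fix w assume "w : z ` N"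
  then obtain x where "x : A'" "w = z (abs_cproj (Lc x))" using N(3) by blast
  then show "w : w4 -` B" by (simp add: zLc A'_def)
 next
  fix w assume w: "w : w4 -` B"
  then have "Xx (w4 w) : A'" "w = z (abs_cproj (Lc (Xx (w4 w))))" using B(3)[of "w4 w"] by (simp_all add: A'_def zLc)
  then show "w : z ` N" using N(4) by blast
 qed
 have oz: "open (z ` N)"
  unfolding zN by (rule open_vimage[OF B(1)]) (rule cdiff_continuous_on, rule cdiff_w4)
 have "holomorphic_coordinates N z"
  unfolding holomorphic_coordinates_def
 proof (intro conjI ballI)
  show "open N" by (rule N)
  show "open (z ` N)" by (rule oz)
  show "inj_on z N"
  proof (rule inj_onI)
   fix K K' assume K: "K : N" "K' : N" "z K = z K'"
   obtain x x' where x: "x : A'" "K = abs_cproj (Lc x)" "x' : A'" "K' = abs_cproj (Lc x')" using N(3) K(1,2) by blast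
   then have "w4 (v4 (Ps x)) = w4 (v4 (Ps x'))" using K(3) by (simp add: zLc)
   then have "Xx (Ps x) = Xx (Ps x')" by simp
   then show "K = K'" using x A(3) by (simp add: A'_def)
  qed
  show "cholomorphic_on (%v. z (abs_cproj v)) {v. v ~= 0 & abs_cproj v : N}"
   unfolding N(2)
  proof (rule cdiff_cholomorphic[OF N(5)])
   fix v assume v: "v : {v. pairing kl v ~= 0} Int chi -` A'"
   then have c: "cdiff chi v" "cdiff Ps (chi v)" using A(3) by (auto simp: A'_def intro: cdiff_chi_id)
   have "cdiff (%v. v4 (Ps (chi v))) v"
    by (rule cdiff_compose(1)[where g = v4 and f = "%v. Ps (chi v)", OF cdiff_v4])
     (rule cdiff_compose(1)[where g = Ps and f = chi, OF c(2,1)])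
   moreover have "near v (%v. v4 (Ps (chi v)) = z (abs_cproj v))"
    using eventually_nhds_in_open[OF N(5) v]
   proof eventually_elim
    case (elim v)
    then have "v ~= 0" by (auto simp: pairing_linear)
    then show ?case by (simp add: zL)
   qed
   ultimately show "cdiff (%v. z (abs_cproj v)) v" by (rule cdiff_transform(1))
  qed
  fix K assume K: "K : N"
  have "cholomorphic_on (%w. Lc (Xx (w4 w))) (z ` N)"
  proof (rule cdiff_cholomorphic[OF oz])
   fix w assume "w : z ` N"
   then have "cdiff Xx (w4 w)" using B(3) unfolding zN by simp
   then show "cdiff (%w. Lc (Xx (w4 w))) w"
    by (intro cdiff_compose(1)[where g = Lc and f = "%w. Xx (w4 w)", OF cdiff_Lc] cdiff_compose(1)[where g = Xx and f = w4] cdiff_w4)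
  qed
  moreover have "Lc (Xx (w4 w)) ~= 0 & abs_cproj (Lc (Xx (w4 w))) : N & z (abs_cproj (Lc (Xx (w4 w)))) = w" if "w : z ` N" for w
   using that B(3)[of "w4 w"] unfolding zN by (auto simp: zLc A'_def intro!: N(4))
  ultimately show "EX W psx. z K : W & W <= z ` N & cholomorphic_on psx W & (ALL w:W. psx w ~= 0 & abs_cproj (psx w) : N & z (abs_cproj (psx w)) = w)"
   using K by (intro exI[of _ "z ` N"] exI[of _ "%w. Lc (Xx (w4 w))"]) auto
 qed
 moreover have L0: "Lc 0 = el" by (simp add: Lc_def tang_def)
 have "abs_cproj el : N" using N(4)[of 0] A(2) B(2) by (simp add: L0 A'_def Ps(2))
 moreover have "z (abs_cproj el) = 0" using zLc[of 0] by (simp add: L0 Ps(2) vec_eq_iff forall_4)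
 moreover have "EX x. K = abs_cproj (Lc x) & z K = v4 (Ps x) & P x" if KN: "K : N" for K
 proof -
  obtain x where x: "x : A'" "K = abs_cproj (Lc x)" using N(3)[OF KN] by blast
  have "P x" using A(3)[of x] x(1) by (simp add: A'_def)
  then show ?thesis using x(2) zLc[of x] by blast
 qed
 ultimately show ?thesis using that by blast
qed

end

lemma pairing_commute: "pairing k v = pairing v k" by (simp add: pairing_def mult.commute)

text \<open>Hyperplanes near \<open>ks\<close> get a chart of their own. With this order of the dual
  vectors the coordinates \<open>(k0, k1, (a, b))\<close> are the coefficients with which
  \<open>1\<close>, \<open>x\<close>, \<open>y\<close> and the normal coordinate \<open>t\<close>
  enter a section, in accordance with \<open>unf_crit\<close>.\<close>

lemma frame_dual:
 assumes "frame es et el e1 e2 ks kt kl k1 k2" shows "frame kl k1 ks k2 kt el e1 es e2 et"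
proof -
 interpret frame es et el e1 e2 ks kt kl k1 k2 by (rule assms)
 show ?thesis
 proof (rule frame.intro)
  show "v = pairing el v *s kl + pairing e1 v *s k1 + pairing es v *s ks + pairing e2 v *s k2 + pairing et v *s kt" for v
   by (subst expand_dual[of v]) (simp only: pairing_commute[of _ v] add_ac)
  show "k = pairing k kl *s el + pairing k k1 *s e1 + pairing k ks *s es + pairing k k2 *s e2 + pairing k kt *s et" for k
   by (subst expand[of k]) (simp only: pairing_commute[of k] add_ac)
 qed (simp_all add: pairing_commute[of el] pairing_commute[of e1] pairing_commute[of es] pairing_commute[of e2] pairing_commute[of et])
qed

section \<open>Incidence conditions in the chart and their limits\<close>

context surface_chart
begin

lemma crit_incidence:
 assumes "good x" "k ~= 0" "crit x k"
 shows "(abs_cproj (Lc x), abs_cproj k) : incidence_variety S"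
 unfolding incidence_variety_def
 by (rule subsetD[OF closure_subset])
  (use good_smooth[OF assms(1)] good_crit[OF assms(1)] assms(2,3) in "auto simp: tangent_plane_hyperplane")

lemma incidence_crit:
 assumes x: "good x" and v: "v ~= 0" "abs_cproj v = abs_cproj (Lc x)" and C: "!!C. C : incidence_eqs S ==> C (v, k) = 0"
 shows "crit x k"
proof -
 have dim: "vec.dim (cone_tangent S (abs_cproj v)) = 3" using good_smooth[OF x] by (simp add: v(2) smooth_locus_def)
 have "pairing k w = 0" if w: "w : cone_tangent S (abs_cproj v)" for w
  by (rule incidence_eqs_tangent[OF v(1) dim _ w]) (rule C)
 then show ?thesis using good_crit[OF x] v(2) by auto
qed

text \<open>Where \<open>u\<close>, \<open>J\<close>, \<open>N2\<close> and \<open>NH\<close> are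
  all nonzero, an incidence point is a node. So the product vanishes at the pairs without a node
  and, lifted to a bihomogeneous form, on their closure.\<close>

lemma closure_nodes:
 assumes c: "(abs_cproj (Lc x), abs_cproj k) : closure {(p, H) : incidence_variety S. p : smooth_locus S & \<not> node_at S H p}"
  and k: "k ~= 0"
 shows "u x * J x * (N2 (0, 1) (0, 1) (x, k) * NH (x, k)) = 0"
proof -
 have "khom (0 + 0 + (1 + 2)) (%z. u (fst z) * J (fst z) * (N2 (0, 1) (0, 1) z * NH z))"
  by (intro khom_mult khom_Xc u J_polys khom_N2 khom_NH)
 then obtain Q d where Q: "Q : joint" "bihom Q (Suc d) (0 + 0 + (1 + 2))"
  "!!v k. Q (v, k) = pairing kl v ^ Suc d * (u (chi v) * J (chi v) * (N2 (0, 1) (0, 1) (chi v, k) * NH (chi v, k)))"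
  by (rule khom_lift) (rule that, assumption, assumption, simp)
 have "Q (Lc x, k) = 0"
 proof (rule closure_bihom[OF Q(1,2) _ c Lc_nonzero k])
  fix v k :: "complex ^ 5"
  assume vk: "v ~= 0" "k ~= 0" "(abs_cproj v, abs_cproj k) : {(p, H) : incidence_variety S. p : smooth_locus S & \<not> node_at S H p}"
  show "Q (v, k) = 0"
  proof (rule ccontr)
   assume nz: "Q (v, k) ~= 0"
   then have kl: "pairing kl v ~= 0" and n: "u (chi v) ~= 0" "J (chi v) ~= 0" "N2 (0, 1) (0, 1) (chi v, k) ~= 0" "NH (chi v, k) ~= 0"
    by (auto simp: Q(3))
   have e: "abs_cproj v = abs_cproj (Lc (chi v))" using Lc_chi[OF kl] abs_cproj_scale[OF Lc_nonzero kl] by metis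
   then have g: "good (chi v)" using vk(3) FG_vanish[of "chi v"] n by (auto simp: good_def smooth_locus_def)
   have "crit (chi v) k"
    by (rule incidence_crit[OF g vk(1) e]) (use incidence_variety_eqs[OF _ vk(1,2)] vk(3) in auto)
   from good_section(1)[OF g vk(2) this n(3,4)] show False using vk(3) by (simp add: e)
  qed
 qed
 then show ?thesis by (simp add: Q(3))
qed

end

context good_point
begin

text \<open>The conditions of the locale are open along the graph. Hence facts known at the base
  point hold at each nearby \<open>w\<close>, on a neighbourhood that is the same for all
  \<open>k\<close>.\<close>

lemma eventually_good_point:
 "near w0 (%w. good_point es et el e1 e2 ks kt kl k1 k2 S F G u (fst (y w)) (snd (y w)) w y)"
proof -
 have "near (s0, t0, w0) (%x. near x (%x. F x = 0 & G x = 0 \<longleftrightarrow> (fst x, fst (snd x)) = y (snd (snd x))))"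
  using ynear by (simp only: eventually_eventually)
 from eventually_hol[OF hol_gm gm0 this] hol_at_eventually[OF y(1)]
  eventually_eventually[THEN iffD2, OF ytangent] eventually_eventually[THEN iffD2, OF ygood]
 show ?thesis
 proof eventually_elim
  case (elim w)
  show ?case
   using elim near_imp[OF elim(4)]
   by (intro good_point.intro surface_chart_axioms good_point_axioms.intro) (simp_all add: gm_def)
 qed
qed

lemma sec_facts:
 "near w0 (%w. good (gm w) & hol_at y w & (ALL k. (crit (gm w) k \<longleftrightarrow> sec k w = 0 & fd (sec k) w (1, 0) = 0 & fd (sec k) w (0, 1) = 0) &
   (hess (sec k) (1, 0) (0, 1) w = 0 \<longleftrightarrow> NH (gm w, k) = 0)))"
 using eventually_good_point
proof eventually_elim
 case (elim w)
 interpret q: good_point es et el e1 e2 ks kt kl k1 k2 S F G u "fst (y w)" "snd (y w)" w y by (rule elim)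
 have g: "good (gm w)" using q.good0 by (simp add: gm_def)
 then have "J (gm w) ~= 0" by (simp add: good_def)
 then show ?case
  using g q.y(1) near_imp[OF q.fd_sec] near_imp[OF q.hess_sec]
  by (simp add: crit_def sec_def)
qed

end

section \<open>The dual variety near the hyperplane\<close>

locale central = cusp_chart + good_point es et el e1 e2 ks kt kl k1 k2 S F G u 0 0 0 y for y +
 assumes center: "crit 0 ks" "N2 (0, 1) (0, 1) (0, ks) ~= 0" "NH (0, ks) = 0" "NC (0, ks) ~= 0"
  and single: "!!v. v ~= 0 ==> (!!C. C : incidence_eqs S ==> C (v, ks) = 0) ==> abs_cproj v = abs_cproj el"
begin

interpretation D: frame kl k1 ks k2 kt el e1 es e2 et by (rule frame_dual[OF frame_axioms])

lemma L0: "Lc 0 = el" "D.Lc 0 = ks" by (simp_all add: Lc_def tang_def D.Lc_def D.tang_def)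

lemma gm_0: "gm 0 = 0" using gm0 by (simp add: zero_prod_def)

text \<open>Compactness: the lifts of norm 1 outside the open cone \<open>Om\<close> over a piece of
  the chart form a compact set, so the hyperplanes incident to one of them form a closed set, which
  misses \<open>ks\<close> by \<open>single\<close>. Hyperplanes close to \<open>ks\<close> are
  incident only at points of the graph.\<close>

lemma eventually_crit:
 assumes Q: "near 0 Q"
 shows "near 0 (%k. ALL v. v ~= 0 --> (ALL C:incidence_eqs S. C (v, D.Lc k) = 0) -->
  (EX w. Q w & abs_cproj v = abs_cproj (Lc (gm w)) & good (gm w) & crit (gm w) (D.Lc k)))"
proof -
 obtain U where U: "open U" "0 : U" "!!w. w : U ==> Q w & good (gm w)"
  using eventually_openE[OF eventually_conj[OF Q ygood]] unfolding gm_def by blast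
 obtain B where B: "open B" "(0, 0, 0) : B" "!!x. x : B ==> F x = 0 & G x = 0 \<longleftrightarrow> (fst x, fst (snd x)) = y (snd (snd x))"
  using eventually_openE[OF ynear] by blast
 define B' where "B' = B Int (%x. snd (snd x)) -` U"
 have oB': "open B'" unfolding B'_def by (intro open_Int B open_vimage U continuous_intros)
 have zB': "0 : B'" using B(2) U(2) by (simp add: B'_def zero_prod_def)
 define Om where "Om = {v. pairing kl v ~= 0} Int chi -` B'"
 have oOm: "open Om" unfolding Om_def by (rule chart_open(5)[OF oB'])
 define Z where "Z = {p. ALL C:incidence_eqs S. C (fst p, D.Lc (snd p)) = 0}"
 have "closed Z"
 proof -
  have c: "continuous_on UNIV D.Lc" by (rule cdiff_continuous_on, rule D.cdiff_Lc)
  have cp: "continuous_on UNIV (%p :: (complex ^ 5) \<times> chart. (fst p, D.Lc (snd p)))"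
   by (intro continuous_intros continuous_on_compose2[OF c]) auto
  have "closed {p. C (fst p, D.Lc (snd p)) = 0}" if "C : incidence_eqs S" for C
   by (rule closed_Collect_eq)
    (use continuous_on_compose2[OF joint_continuous[OF incidence_eqs_joint[OF that]] cp] in "auto intro: continuous_intros")
  then have "closed (\<Inter>C\<in>incidence_eqs S. {p. C (fst p, D.Lc (snd p)) = 0})" by blast
  moreover have "Z = (\<Inter>C\<in>incidence_eqs S. {p. C (fst p, D.Lc (snd p)) = 0})" by (auto simp: Z_def)
  ultimately show ?thesis by simp
 qed
 moreover have "compact (sphere 0 1 Int - Om)" by (rule compact_Int_closed) (use oOm in auto)
 ultimately have cl: "closed {k. EX v. v : sphere 0 1 Int - Om & (v, k) : Z}" by (intro closed_compact_projection)
 have "0 ~: {k. EX v. v : sphere 0 1 Int - Om & (v, k) : Z}"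
 proof
  assume "0 : {k. EX v. v : sphere 0 1 Int - Om & (v, k) : Z}"
  then obtain v where v: "norm v = 1" "v ~: Om" "(v, 0) : Z" by auto
  then have v0: "v ~= 0" by auto
  have "abs_cproj v = abs_cproj (Lc 0)" using single[OF v0] v(3) by (simp add: Z_def L0)
  then obtain c where "c ~= 0" "v = c *s Lc 0" using abs_cproj_eq_iff[OF Lc_nonzero v0] by metis
  then have "v : Om" using zB' by (simp add: Om_def pairing_linear chi_smult)
  then show False using v by simp
 qed
 then have "near 0 (%k. k : - {k. EX v. v : sphere 0 1 Int - Om & (v, k) : Z})"
  using cl by (intro eventually_nhds_in_open) auto
 then show ?thesis
 proof eventually_elim
  case (elim k)
  show ?case
  proof (intro allI impI)
   fix v :: "complex ^ 5" assume v: "v ~= 0" and C: "ALL C:incidence_eqs S. C (v, D.Lc k) = 0"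
   define r where "r = complex_of_real (inverse (norm v))"
   have r: "r ~= 0" using v by (simp add: r_def)
   have "r *s v = inverse (norm v) *\<^sub>R v" unfolding r_def by (simp only: cscale_eq_smult[symmetric] cscale_of_real)
   then have "norm (r *s v) = 1" using v by simp
   moreover have "C (r *s v, D.Lc k) = 0" if CI: "C : incidence_eqs S" for C
   proof -
    obtain d e where "bihom C d e" using incidence_eqs_bihom[OF CI] by blast
    then have "C (r *s v, D.Lc k) = r ^ d * C (v, D.Lc k)" using r by (simp add: bihom_def)
    then show ?thesis using CI C by simp
   qed
   ultimately have rv: "r *s v : Om" using elim by (auto simp: Z_def)
   define x where "x = chi v"
   have x: "pairing kl v ~= 0" "x : B'" using rv r by (auto simp: Om_def x_def pairing_linear chi_smult)
   have vx: "abs_cproj v = abs_cproj (Lc x)" using Lc_chi[OF x(1)] abs_cproj_scale[OF Lc_nonzero x(1)] unfolding x_def by metis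
   have "abs_cproj (Lc x) : S" unfolding vx[symmetric] by (rule incidence_eqs_in[OF closed_S v]) (use C in blast)
   then have "(fst x, fst (snd x)) = y (snd (snd x))" using B(3)[of x] x(2) FG_vanish[of x] by (simp add: B'_def)
   then have xg: "x = gm (snd (snd x))" by (metis gm_def fst_conv prod.collapse snd_conv)
   have Qg: "Q (snd (snd x))" "good (gm (snd (snd x)))" using U(3) x(2) by (simp_all add: B'_def)
   have "crit x (D.Lc k)" by (rule incidence_crit[OF _ v vx]) (use Qg xg C in auto)
   then show "EX w. Q w & abs_cproj v = abs_cproj (Lc (gm w)) & good (gm w) & crit (gm w) (D.Lc k)"
    using Qg xg vx by (intro exI[of _ "snd (snd x)"]) simp
  qed
 qed
qed

text \<open>What remains of a section in the dual coordinates after removal of the constant and of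
  the linear term in \<open>x\<close>; see \<open>sec_Gu\<close>.\<close>

definition Gu :: "(complex * complex) \<times> complex * complex => complex" where
 "Gu p = fst (fst p) * snd (snd p) + fst (y (snd p)) + snd (fst p) * snd (y (snd p))"

lemma sec_Gu: "sec (D.Lc k) w = fst k + fst (snd k) * fst w + Gu (snd (snd k), w)"
 by (simp add: sec_def D.Lc_def D.tang_def Lc_def tang_def gm_def Gu_def pairing_linear algebra_simps)

lemma Gu_facts:
 assumes w: "hol_at y w"
 shows "hol_at Gu (c, w)" "fd (sec (D.Lc k)) w v = fst (snd k) * fst v + fd Gu (snd (snd k), w) (0, v)"
  "hess (sec (D.Lc k)) (1, 0) (0, 1) w = hess Gu ex ey (snd (snd k), w)"
  "fd (%q. fd (sec (D.Lc k)) q v) w v' = fd (%q. fd Gu q (0, v)) (snd (snd k), w) (0, v')"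
  "k = 0 ==> cub (sec (D.Lc k)) (1, 0) (0, 1) w = cub Gu ex ey (0, w)"
proof -
 have hG: "hol_at Gu (c, w)" for c
 proof -
  have "hol_at (%p :: (complex * complex) \<times> complex * complex. y (snd p)) (c, w)"
   by (rule hol_at_compose[where g = y and f = snd]) (use w in "auto intro: hols")
  then show ?thesis unfolding Gu_def[abs_def] by (intro hols)
 qed
 show "hol_at Gu (c, w)" by (rule hG)
 define c where "c = snd (snd k)"
 have T: "cdiff (%w. (c, w)) p" "fd (%w. (c, w)) p v = (0, v)" for p v :: "complex * complex"
  using cdiff_Pair[OF cdiff_const cdiff_ident] fd_eq[OF has_derivative_ident, of p v] by (simp_all add: fd_const)
 note pull = fd_pull[where T = "%w. (c, w)" and g = Gu and L = "%v. (0, v)" and p = w, OF T hG]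
 have hh: "hol_at (%w. Gu (c, w)) w"
  by (rule hol_at_compose[where g = Gu and f = "%w. (c, w)", OF hG]) (intro hols)
 have lin: "cdiff (%w. fst k + fst (snd k) * fst w) q" "fd (%w. fst k + fst (snd k) * fst w) q v = fst (snd k) * fst v"
  for q v :: "complex * complex"
 proof -
  have a: "cdiff (%w :: complex * complex. fst (snd k) * fst w) q" by (intro hols)
  show "cdiff (%w. fst k + fst (snd k) * fst w) q" by (intro hols)
  show "fd (%w. fst k + fst (snd k) * fst w) q v = fst (snd k) * fst v"
   unfolding cdiff_add(2)[OF cdiff_const a] cdiff_mult(2)[OF cdiff_const cdiff_fst_id] by (simp add: fd_const fd_fst_id)
 qed
 have s: "sec (D.Lc k) = (%w. fst k + fst (snd k) * fst w + Gu (c, w))" by (simp add: sec_Gu fun_eq_iff c_def)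
 have f1: "fd (sec (D.Lc k)) q v = fst (snd k) * fst v + fd (%w. Gu (c, w)) q v" if "cdiff (%w. Gu (c, w)) q" for q v
  unfolding s cdiff_add(2)[OF lin(1) that] lin(2) ..
 show f: "fd (sec (D.Lc k)) w v = fst (snd k) * fst v + fd Gu (snd (snd k), w) (0, v)" for v
  unfolding f1[OF hol_at_cdiff[OF hh]] pull(1) by (simp only: c_def)
 have f2: "fd (%q. fd (sec (D.Lc k)) q v) w v' = fd (%q. fd (%w. Gu (c, w)) q v) w v'" for v v'
 proof -
  have hv: "hol_at (%q. fd (%w. Gu (c, w)) q v) w" by (rule hol_at_fd[OF hh])
  have a: "cdiff (%q. fst (snd k) * fst v + fd (%w. Gu (c, w)) q v) w" by (intro hols hol_at_cdiff[OF hv])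
  have "near w (%q. fst (snd k) * fst v + fd (%w. Gu (c, w)) q v = fd (sec (D.Lc k)) q v)"
   using hh[unfolded hol_at_def] by (rule eventually_mono) (simp add: f1)
  from cdiff_transform(2)[OF a this] show ?thesis
   unfolding cdiff_add(2)[OF cdiff_const hol_at_cdiff[OF hv]] by (simp add: cdiff_add(2)[OF cdiff_const hol_at_cdiff[OF hv]] fd_const)
 qed
 show "fd (%q. fd (sec (D.Lc k)) q v) w v' = fd (%q. fd Gu q (0, v)) (snd (snd k), w) (0, v')"
  unfolding f2 pull(2) by (simp only: c_def)
 have "hess (sec (D.Lc k)) (1, 0) (0, 1) w = hess (%w. Gu (c, w)) (1, 0) (0, 1) w" unfolding hess_def f2 ..
 then show "hess (sec (D.Lc k)) (1, 0) (0, 1) w = hess Gu ex ey (snd (snd k), w)" using pull(3) by (simp add: c_def)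
 show "cub (sec (D.Lc k)) (1, 0) (0, 1) w = cub Gu ex ey (0, w)" if "k = 0"
 proof -
  have e: "sec (D.Lc k) = (%w. Gu (c, w))" unfolding s using that by simp
  have "c = 0" using that by (simp add: c_def)
  then show ?thesis unfolding e pull(4) by simp
 qed
qed

lemma eventually_XK_nonzero:
 assumes P: "P : polys XK" "P (0, ks) ~= 0"
 shows "near (0, 0) (%p. P (gm (snd p), D.Lc (fst p)) ~= 0)"
proof -
 have c: "continuous_on UNIV P"
  by (rule continuous_on_polys[OF P(1)]) (auto simp: XK_def Xc_def intro!: continuous_intros)
 have e: "near (0, ks) (%z. P z ~= 0)"
  using eventually_nhds_in_open[OF open_Collect_neq[OF c continuous_on_const], of "(0, ks)" 0] P(2) by simp
 have "hol_at (%p :: chart \<times> complex * complex. gm (snd p)) (0, 0)"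
  by (rule hol_at_compose[where g = gm and f = snd]) (auto intro: hols simp: hol_gm)
 moreover have "hol_at (%p :: chart \<times> complex * complex. D.Lc (fst p)) (0, 0)"
  by (rule hol_at_compose[where g = D.Lc and f = fst]) (auto intro: hols simp: D.hol_at_Lc)
 ultimately have h: "hol_at (%p. (gm (snd p), D.Lc (fst p))) (0 :: chart, 0)" by (rule hol_at_Pair)
 show ?thesis by (rule eventually_hol[OF h _ e]) (simp add: gm_0 L0)
qed

lemma dual_cusp_subset: "dual_cusp S <= dual_variety S"
 unfolding dual_cusp_def dual_variety_def
 by (intro image_mono closure_minimal) (auto simp: incidence_variety_def)

lemma cuspidal_subset: "cuspidal_locus S <= dual_cusp S"
 unfolding cuspidal_locus_def irreducible_component_def by blast

text \<open>The points of a component of \<open>dual_cusp S\<close> through \<open>K\<close> at which the form \<open>A\<close> does not vanish are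
 hyperplanes with a cusp at a smooth point: all limits of incidence points over them stay in the chart.\<close>
lemma eventually_cuspidal: "near 0 (%k. abs_cproj (D.Lc k) : dual_cusp S --> abs_cproj (D.Lc k) : cuspidal_locus S)"
proof -
 \<comment> \<open>This function is adjoined to the incidence equations before elimination. Over
   hyperplanes with \<open>A\<close> nonzero there is no common zero, so the function is nonzero at
   all incidence points, which therefore lie in the chart and are cusps as soon as \<open>NH\<close>
   vanishes.\<close>
 have kh: "khom (0 + 0 + (1 + 3)) (%z. u (fst z) * J (fst z) * (N2 (0, 1) (0, 1) z * NC z))"
  by (intro khom_mult khom_Xc u J_polys khom_N2 khom_NC)
 obtain T d where T: "T : joint" "bihom T (Suc d) (0 + 0 + (1 + 3))"
  "!!v k. T (v, k) = pairing kl v ^ Suc d * (u (chi v) * J (chi v) * (N2 (0, 1) (0, 1) (chi v, k) * NC (chi v, k)))"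
  by (rule khom_lift[OF kh]) (rule that, assumption, assumption, simp)
 note ks = ks_nonzero
 have j: "insert T (incidence_eqs S) <= joint" using T(1) incidence_eqs_joint by blast
 have b: "EX d e. bihom P d e" if "P : insert T (incidence_eqs S)" for P using that T(2) incidence_eqs_bihom by blast
 have nz: "EX P:insert T (incidence_eqs S). P (v, ks) ~= 0" if v: "v ~= 0" for v
 proof (rule ccontr)
  assume z: "\<not> ?thesis"
  then have "abs_cproj v = abs_cproj (Lc 0)" using single[OF v] by (simp add: L0)
  then obtain c where c: "c ~= 0" "v = c *s Lc 0" using abs_cproj_eq_iff[OF Lc_nonzero v] by metis
  then have "T (v, ks) ~= 0" using u0 good_0(2) center by (simp add: T(3) pairing_linear chi_smult)
  then show False using z by blast
 qed
 obtain A e where A: "A : polys (range coords)" "!!t K. A (t *s K) = t ^ e * A K" "A ks ~= 0"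
  "!!K v. A K ~= 0 ==> v ~= 0 ==> EX P:insert T (incidence_eqs S). P (v, K) ~= 0"
  by (rule elimination[OF j b ks nz]) (assumption, assumption, rule that, assumption+)
 have fA: "form e A" using A(1,2) by (simp add: form_def)
 have "hol_at (%k. A (D.Lc k)) 0"
  unfolding hol_at_def using cdiff_compose(1)[where g = A and f = D.Lc, OF cdiff_polys_coords[OF A(1)] D.cdiff_Lc]
  by (intro always_eventually allI)
 from hol_at_nonzero[OF this] have "near 0 (%k. A (D.Lc k) ~= 0)" using A(3) by (simp add: L0)
 then show ?thesis
 proof (rule eventually_mono, intro impI)
  fix k assume elim: "A (D.Lc k) ~= 0" "abs_cproj (D.Lc k) : dual_cusp S"
  obtain Z where Z: "irreducible_component Z (dual_cusp S)" "abs_cproj (D.Lc k) : Z"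
   using irreducible_component_exists[OF elim(2)] by blast
  \<comment> \<open>The exceptional set for genericity; it is proper because the given hyperplane of
    \<open>Z\<close> lies off \<open>A = 0\<close>.\<close>
  define Y where "Y = Z Int {K. A (rep_cproj K) = 0}"
  have "zariski_closed Y"
   unfolding Y_def using Z(1)
   by (intro zariski_closed_Int zariski_closed_hypersurface[OF fA]) (simp add: irreducible_component_def irreducible_variety_def)
  moreover have "A (rep_cproj (abs_cproj (D.Lc k))) ~= 0" using form_abs_cproj[OF fA D.Lc_nonzero] elim(1) by blast
  then have "Y \<subset> Z" using Z(2) unfolding Y_def by blast
  moreover have "EX p:smooth_locus S. cusp_at S K p" if K: "K : Z - Y" for K
  proof -
   have Kd: "K : dual_cusp S" using K Z(1) by (auto simp: irreducible_component_def)
   define ka where "ka = rep_cproj K"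
   have ka: "ka ~= 0" "abs_cproj ka = K" "A ka ~= 0" using K by (auto simp: ka_def rep_cproj_nonzero Y_def)
   obtain q where q: "(q, K) : closure {(p, H) : incidence_variety S. p : smooth_locus S & \<not> node_at S H p}"
    using Kd by (auto simp: dual_cusp_def)
   have "closure {(p, H) : incidence_variety S. p : smooth_locus S & \<not> node_at S H p} <= incidence_variety S"
    by (rule closure_minimal) (auto simp: incidence_variety_def)
   then have qi: "(q, K) : incidence_variety S" using q by blast
   define v where "v = rep_cproj q"
   have v: "v ~= 0" "abs_cproj v = q" by (simp_all add: v_def rep_cproj_nonzero)
   have C: "C (v, ka) = 0" if "C : incidence_eqs S" for C
    by (rule incidence_variety_eqs[OF _ v(1) ka(1) that]) (simp add: v ka qi)
   then have "T (v, ka) ~= 0" using A(4)[OF ka(3) v(1)] by blast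
   then have kl: "pairing kl v ~= 0" and n: "u (chi v) ~= 0" "J (chi v) ~= 0" "N2 (0, 1) (0, 1) (chi v, ka) ~= 0" "NC (chi v, ka) ~= 0"
    by (auto simp: T(3))
   have e: "abs_cproj v = abs_cproj (Lc (chi v))" using Lc_chi[OF kl] abs_cproj_scale[OF Lc_nonzero kl] by metis
   have "abs_cproj (Lc (chi v)) : S" unfolding e[symmetric] by (rule incidence_eqs_in[OF closed_S v(1)]) (rule C)
   then have g: "good (chi v)" using FG_vanish[of "chi v"] n by (simp add: good_def)
   have cr: "crit (chi v) ka" by (rule incidence_crit[OF g v(1) e]) (rule C)
   have "u (chi v) * J (chi v) * (N2 (0, 1) (0, 1) (chi v, ka) * NH (chi v, ka)) = 0"
    by (rule closure_nodes[OF _ ka(1)]) (use q e v ka in simp)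
   then have "NH (chi v, ka) = 0" using n by simp
   from good_section(2)[OF g ka(1) cr n(3) this n(4)] show ?thesis using good_smooth[OF g] by (auto simp: ka)
  qed
  ultimately show "abs_cproj (D.Lc k) : cuspidal_locus S" unfolding cuspidal_locus_def using Z by blast
 qed
qed

lemma ordinary_cusps: "ordinary_cusps_along (dual_variety S) (cuspidal_locus S) (abs_cproj ks)"
proof -
 have z: "((0, 0, 0) :: (complex * complex) \<times> complex * complex) = (0, 0)" by (simp add: zero_prod_def)
 have sf0: "sec ks 0 = 0" "fd (sec ks) 0 (1, 0) = 0" "fd (sec ks) 0 (0, 1) = 0" "hess (sec ks) (1, 0) (0, 1) 0 = 0"
  using near_imp[OF sec_facts] center by (auto simp: gm_0)
 note Gf = Gu_facts[OF y(1)]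
 have G1: "hol_at Gu (0, 0, 0)" "Gu (0, 0, 0) = 0" "fd Gu (0, 0, 0) ex = 0" "fd Gu (0, 0, 0) ey = 0"
  unfolding z using Gf(1)[of 0] sec_Gu[of 0 0] Gf(2)[of 0 "(1, 0)"] Gf(2)[of 0 "(0, 1)"] sf0 by (simp_all add: L0)
 have G2: "fd (%p. fd Gu p ey) (0, 0, 0) ey ~= 0"
  unfolding z using Gf(4)[of 0 "(0, 1)" "(0, 1)"] near_imp[OF fd2_sec[of ks "(0, 1)" "(0, 1)"]] center(2)
  by (simp add: L0 gm_0 good_0)
 have G3: "hess Gu ex ey (0, 0, 0) = 0" "cub Gu ex ey (0, 0, 0) ~= 0"
  unfolding z using Gf(3)[of 0] Gf(5)[of 0] sf0(4) cub_sec[of ks] center(4) by (simp_all add: L0 gm_0 good_0)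
 obtain chx1 chx2 :: "complex * complex * complex * complex => complex" where
  \<chi>: "hol_at chx1 0" "hol_at chx2 0" "chx1 0 = 0" "chx2 0 = 0" "bij (fd (%k. (chx1 k, chx2 k, snd (snd k))) 0)"
  "near (0, 0) (%(k, w). unf_crit Gu k w --> chx1 k ^ 2 = chx2 k ^ 3 &
    (hess Gu ex ey (snd (snd k), w) = 0 \<longleftrightarrow> chx1 k = 0 & chx2 k = 0))"
  "!!P. near (0, 0) P ==>
    near 0 (%k. chx1 k ^ 2 = chx2 k ^ 3 --> (EX w. P w & unf_crit Gu k w))"
  by (rule unfolding_discriminant[OF G1 G2 G3]) (rule that, assumption+)
 have pN: "N2 (0, 1) (0, 1) : polys XK" "NC : polys XK" using khom_N2 khom_NC by (simp_all add: khom_def)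
 \<comment> \<open>The neighbourhood is split into a product, since \<open>eventually_crit\<close>
   takes a condition on \<open>w\<close> alone, uniform in \<open>k\<close>.\<close>
 have "eventually (%p. (case p of (k, w) => unf_crit Gu k w --> chx1 k ^ 2 = chx2 k ^ 3 &
    (hess Gu ex ey (snd (snd k), w) = 0 \<longleftrightarrow> chx1 k = 0 & chx2 k = 0)) &
   N2 (0, 1) (0, 1) (gm (snd p), D.Lc (fst p)) ~= 0 & NC (gm (snd p), D.Lc (fst p)) ~= 0) (nhds 0 \<times>\<^sub>F nhds 0)"
  using eventually_conj[OF \<chi>(6) eventually_conj[OF eventually_XK_nonzero[OF pN(1) center(2)] eventually_XK_nonzero[OF pN(2) center(4)]]]
  by (simp add: nhds_prod zero_prod_def)
 then obtain P1 P2 where P: "near 0 P1" "near 0 P2"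
  "!!k w. P1 k ==> P2 w ==> (unf_crit Gu k w --> chx1 k ^ 2 = chx2 k ^ 3 &
    (hess Gu ex ey (snd (snd k), w) = 0 \<longleftrightarrow> chx1 k = 0 & chx2 k = 0)) &
   N2 (0, 1) (0, 1) (gm w, D.Lc k) ~= 0 & NC (gm w, D.Lc k) ~= 0"
  unfolding eventually_prod_filter by auto
 define Q where "Q w \<longleftrightarrow> P2 w & good (gm w) & hol_at y w &
  (ALL k. (crit (gm w) k \<longleftrightarrow> sec k w = 0 & fd (sec k) w (1, 0) = 0 & fd (sec k) w (0, 1) = 0) &
   (hess (sec k) (1, 0) (0, 1) w = 0 \<longleftrightarrow> NH (gm w, k) = 0))" for w
 have Q: "near 0 Q" unfolding Q_def using P(2) sec_facts by (rule eventually_conj)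
 have crit: "crit (gm w) (D.Lc k) \<longleftrightarrow> unf_crit Gu k w" if "Q w" for k w
 proof -
  have hy: "hol_at y w" using that by (simp only: Q_def)
  have "crit (gm w) (D.Lc k) \<longleftrightarrow> sec (D.Lc k) w = 0 & fd (sec (D.Lc k)) w (1, 0) = 0 & fd (sec (D.Lc k)) w (0, 1) = 0"
   using that unfolding Q_def by blast
  then show ?thesis unfolding Gu_facts(2)[OF hy] by (simp add: unf_crit_def sec_Gu)
 qed
 have hess: "NH (gm w, D.Lc k) = 0 \<longleftrightarrow> hess Gu ex ey (snd (snd k), w) = 0" if "Q w" for k w
 proof -
  have hy: "hol_at y w" using that by (simp only: Q_def)
  have "hess (sec (D.Lc k)) (1, 0) (0, 1) w = 0 \<longleftrightarrow> NH (gm w, D.Lc k) = 0"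
   using that unfolding Q_def by blast
  then show ?thesis unfolding Gu_facts(3)[OF hy] by (rule sym)
 qed
 let ?A = "{(p, H) : incidence_variety S. p : smooth_locus S & \<not> node_at S H p}"
 have clA: "closure ?A <= incidence_variety S" by (rule closure_minimal) (auto simp: incidence_variety_def)
 have "near 0 (%k. (abs_cproj (D.Lc k) : dual_variety S \<longleftrightarrow> chx1 k ^ 2 = chx2 k ^ 3) &
  (abs_cproj (D.Lc k) : cuspidal_locus S \<longleftrightarrow> chx1 k = 0 & chx2 k = 0))"
  using P(1) eventually_crit[OF Q] eventually_cuspidal \<chi>(7)[OF Q[unfolded zero_prod_def]]
 proof eventually_elim
  case (elim k)
  have loc: "EX w. Q w & q = abs_cproj (Lc (gm w)) & good (gm w) & crit (gm w) (D.Lc k)"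
   if q: "(q, abs_cproj (D.Lc k)) : incidence_variety S" for q
  proof -
   have "ALL C:incidence_eqs S. C (rep_cproj q, D.Lc k) = 0"
    by (intro ballI incidence_variety_eqs) (use q rep_cproj_nonzero in auto)
   with elim(2) rep_cproj_nonzero[of q] have "EX w. Q w & abs_cproj (rep_cproj q) = abs_cproj (Lc (gm w)) & good (gm w) & crit (gm w) (D.Lc k)"
    by blast
   then show ?thesis by simp
  qed
  have ex: "EX w. Q w & crit (gm w) (D.Lc k)" if "chx1 k ^ 2 = chx2 k ^ 3" using elim(4) that crit by blast
  have fwd: "chx1 k ^ 2 = chx2 k ^ 3 & (NH (gm w, D.Lc k) = 0 \<longleftrightarrow> chx1 k = 0 & chx2 k = 0) &
   N2 (0, 1) (0, 1) (gm w, D.Lc k) ~= 0 & NC (gm w, D.Lc k) ~= 0" if "Q w" "crit (gm w) (D.Lc k)" for w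
   using P(3)[OF elim(1), of w] that crit[OF that(1)] hess[OF that(1)] by (auto simp: Q_def)
  have "abs_cproj (D.Lc k) : dual_variety S \<longleftrightarrow> chx1 k ^ 2 = chx2 k ^ 3"
  proof
   assume "abs_cproj (D.Lc k) : dual_variety S"
   then obtain q where "(q, abs_cproj (D.Lc k)) : incidence_variety S" by (auto simp: dual_variety_def)
   then show "chx1 k ^ 2 = chx2 k ^ 3" using loc fwd by blast
  next
   assume "chx1 k ^ 2 = chx2 k ^ 3"
   then obtain w where w: "Q w" "crit (gm w) (D.Lc k)" using ex by blast
   then have "good (gm w)" by (simp add: Q_def)
   from imageI[OF crit_incidence[OF this D.Lc_nonzero w(2)], of snd] show "abs_cproj (D.Lc k) : dual_variety S"
    by (simp only: dual_variety_def snd_conv)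
  qed
  \<comment> \<open>A limit of pairs without nodes stays on the graph, where
    \<open>closure_nodes\<close> forces \<open>NH\<close> to vanish.\<close>
  moreover have "chx1 k = 0 & chx2 k = 0" if dc: "abs_cproj (D.Lc k) : dual_cusp S"
  proof -
   obtain q where q: "(q, abs_cproj (D.Lc k)) : closure ?A" using dc by (auto simp: dual_cusp_def)
   then obtain w where w: "Q w" "q = abs_cproj (Lc (gm w))" "good (gm w)" "crit (gm w) (D.Lc k)" using loc clA by blast
   have "u (gm w) * J (gm w) * (N2 (0, 1) (0, 1) (gm w, D.Lc k) * NH (gm w, D.Lc k)) = 0"
    by (rule closure_nodes[OF _ D.Lc_nonzero]) (use q w in simp)
   then show ?thesis using fwd[OF w(1,4)] w(3) by (simp add: good_def)
  qed
  moreover have "abs_cproj (D.Lc k) : dual_cusp S" if c: "chx1 k = 0 & chx2 k = 0"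
  proof -
   have "chx1 k ^ 2 = chx2 k ^ 3" using c by simp
   then obtain w where w: "Q w" "crit (gm w) (D.Lc k)" using ex by blast
   have g: "good (gm w)" using w by (simp add: Q_def)
   have "cusp_at S (abs_cproj (D.Lc k)) (abs_cproj (Lc (gm w)))"
    by (rule good_section(2)[OF g D.Lc_nonzero w(2)]) (use fwd[OF w] c in auto)
   then have "\<not> node_at S (abs_cproj (D.Lc k)) (abs_cproj (Lc (gm w)))" using node_not_cusp by blast
   then have "(abs_cproj (Lc (gm w)), abs_cproj (D.Lc k)) : ?A"
    using crit_incidence[OF g D.Lc_nonzero w(2)] good_smooth[OF g] by simp
   then have "(abs_cproj (Lc (gm w)), abs_cproj (D.Lc k)) : closure ?A" by (rule subsetD[OF closure_subset])
   from imageI[OF this, of snd] show ?thesis by (simp only: dual_cusp_def snd_conv)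
  qed
  ultimately show ?case using elim(3) cuspidal_subset by blast
 qed
 note ev = this
 define Ps where "Ps = (%k. (chx1 k, chx2 k, snd (snd k)))"
 have Ps: "hol_at Ps 0" "Ps 0 = 0" "bij (fd Ps 0)"
 proof -
  show "hol_at Ps 0" unfolding Ps_def by (intro hols \<chi>)
  show "Ps 0 = 0" by (simp add: Ps_def \<chi>(3,4) prod_eq_iff)
  show "bij (fd Ps 0)" unfolding Ps_def by (rule \<chi>(5))
 qed
 obtain N z where N: "abs_cproj ks : N" "holomorphic_coordinates N z" "z (abs_cproj ks) = 0"
  "!!K. K : N ==> EX k. K = abs_cproj (D.Lc k) & z K = v4 (Ps k) &
   ((abs_cproj (D.Lc k) : dual_variety S \<longleftrightarrow> chx1 k ^ 2 = chx2 k ^ 3) &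
    (abs_cproj (D.Lc k) : cuspidal_locus S \<longleftrightarrow> chx1 k = 0 & chx2 k = 0))"
  by (rule D.chart_coordinates[OF Ps ev]) (rule that, assumption+)
 define Gm :: "(complex ^ 2) set" where "Gm = {w. (w $ 2)\<^sup>2 = (w $ 1) ^ 3}"
 have "plane_curve_cusp Gm"
 proof -
  have "cholomorphic_on (id :: complex ^ 2 => complex ^ 2) UNIV" unfolding id_def by (rule cdiff_cholomorphic) (auto intro: hols)
  moreover have "inv_into UNIV id = (id :: complex ^ 2 => complex ^ 2)" by (simp add: fun_eq_iff inv_id[unfolded id_def] id_def)
  ultimately have "biholomorphic_between UNIV UNIV (id :: complex ^ 2 => complex ^ 2)"
   by (simp add: biholomorphic_between_def bij_betw_def)
  then show ?thesis unfolding plane_curve_cusp_def Gm_def by (intro exI[of _ UNIV] exI[of _ id]) auto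
 qed
 moreover have "K : cuspidal_locus S \<longleftrightarrow> z K $ 1 = 0 & z K $ 2 = 0"
  "K : dual_variety S \<longleftrightarrow> vector [z K $ 1, z K $ 2] : Gm" if "K : N" for K
  using N(4)[OF that] by (auto simp: Ps_def Gm_def)
 ultimately show ?thesis
  unfolding ordinary_cusps_along_def using cuspidal_subset dual_cusp_subset N(1-3)
  by (intro conjI exI[of _ N] exI[of _ z] exI[of _ Gm]) auto
qed

end

theorem theorem2p3:
 fixes S :: "5 cproj set" and H :: "5 cproj"
 assumes "segre_surface S"
  and "hyperplane H \<inter> (S - smooth_locus S) = {}"
  and "H \<in> cuspidal_locus S"
  and "\<exists>p. section_singularities S H = {p} \<and> cusp_at S H p"
 shows "ordinary_cusps_along (dual_variety S) (cuspidal_locus S) H"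
proof -
 have S: "zariski_closed S"
  using assms(1) by (simp add: segre_surface_def variety_of_def irreducible_variety_def)
 obtain p where p: "section_singularities S H = {p}" "cusp_at S H p" using assms(4) by blast
 then have ps: "p : smooth_locus S" "tangent_plane S p <= hyperplane H" by (auto simp: section_singularities_def)
 obtain es et el e1 e2 ks kt kl k1 k2 F G u W ph where
  c: "cusp_chart es et el e1 e2 ks kt kl k1 k2 S F G u W ph" "abs_cproj el = p" "abs_cproj ks = H"
  by (rule cusp_chart_exists[OF S ps p(2)]) blast
 interpret cusp_chart es et el e1 e2 ks kt kl k1 k2 S F G u W ph by (rule c)
 obtain y where y: "good_point es et el e1 e2 ks kt kl k1 k2 S F G u 0 0 0 y"
  "crit 0 ks" "N2 (0, 1) (0, 1) (0, ks) ~= 0" "NH (0, ks) = 0" "NC (0, ks) ~= 0"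
  by (rule central_point) blast
 note ks = ks_nonzero
 \<comment> \<open>As \<open>H\<close> avoids the singular points of \<open>S\<close>, the incidence
   equations over \<open>H\<close> hold only at smooth points where \<open>H\<close> is tangent,
   that is, at the cusp \<open>p\<close>.\<close>
 have single: "abs_cproj v = abs_cproj el" if v: "v ~= 0" and C: "!!C. C : incidence_eqs S ==> C (v, ks) = 0" for v
 proof -
  have vS: "abs_cproj v : S" by (rule incidence_eqs_in[OF S v]) (rule C)
  have "pairing ks v = 0" using C[of "%z. pairing (snd z) (fst z)"] by (simp add: incidence_eqs_def)
  moreover obtain a b where "rep_cproj (abs_cproj ks) = a *s ks" "rep_cproj (abs_cproj v) = b *s v"
   using rep_abs_cproj[OF ks] rep_abs_cproj[OF v] by metis
  ultimately have vH: "abs_cproj v : hyperplane H" unfolding c(3)[symmetric] by (simp add: hyperplane_def pairing_linear)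
  then have sm: "abs_cproj v : smooth_locus S" using assms(2) vS by blast
  then have dim: "vec.dim (cone_tangent S (abs_cproj v)) = 3" by (simp add: smooth_locus_def)
  have "pairing ks w = 0" if w: "w : cone_tangent S (abs_cproj v)" for w
   by (rule incidence_eqs_tangent[OF v dim _ w]) (rule C)
  then have "tangent_plane S (abs_cproj v) <= hyperplane H"
   unfolding c(3)[symmetric] tangent_plane_hyperplane[OF ks] by blast
  then have "abs_cproj v : section_singularities S H" using sm vH by (simp add: section_singularities_def)
  then show ?thesis using p(1) c(2) by simp
 qed
 interpret central es et el e1 e2 ks kt kl k1 k2 S F G u W ph y
  by (intro central.intro cusp_chart_axioms central_axioms.intro y single)
 show ?thesis using ordinary_cusps unfolding c(3) .
qed

end
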